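(* There exist universal constants $\kappa,\xi>0$ and a deterministic polynomial-time algorithm with the following property. Let $G$ be an instance of $\mathrm{DkSExpReg}(n,k,d,\delta,d',\lambda)$ (defined in the context) with planted set $S$, such that \[\nu' := \frac{5}{\sqrt{1+\frac{dk}{4\xi^2\delta n}\left(1-\frac{\lambda}{d}-\frac{d'k}{(n-k)d}-6\delta\right)^2}}\] satisfies $\nu'\in(0,1)$, and $\frac{\delta d}{k}\in\left[\kappa\frac{\log n}{n},1\right)$. Then, given $G$, with high probability (over the random choices in Step 1 of the instance), the algorithm outputs a vertex set $\mathcal Q$ with $|\mathcal Q|=k$ such that (a) $\rho(\mathcal Q)\ge(1-\nu')\frac{kd}{2}$ and (b) $|\mathcal Q\cap S|\ge\left(1-\frac{\nu'}{6}\right)k$.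
   Context: All graphs are weighted undirected graphs $G=(V,E,w)$ with $V=[n]$ and non-negative weights; a non-edge is treated as an edge of weight $0$. For $V'\subseteq V$, $\rho(V'):=\frac12\sum_{i,j\in V'}w(\{i,j\})$. A graph is a $(d',\lambda)$-expander if it is $d'$-regular (every vertex has weighted degree $d'$) and every eigenvalue of its weighted adjacency matrix other than the largest has absolute value at most $\lambda$. An instance of $\mathrm{DkSExpReg}(n,k,d,\delta,d',\lambda)$ (with $k<n$, $d>0$, $0<\delta<1$) is generated as follows: (1) $V$ is partitioned into $S$ and $V\setminus S$ with $|S|=k$; each pair in $S\times(V\setminus S)$ independently becomes an edge of weight $1$ with probability $p:=\delta d/k$. (2) Edges of non-negative weights are added inside $S$ so that the graph induced on $S$ is an arbitrary $d$-regular (weighted degree $d$) graph. (3) Edges of arbitrary non-negative weights are added inside $V\setminus S$ so that the graph induced on $V\setminus S$ is a $(d',\lambda)$-expander. (4) (Monotone adversary) Any of the edges added in steps (1) and (3) may be arbitrarily deleted. (5) The resulting graph is output; $S$ is not revealed.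
   Formalization: The formal theorem additionally assumes that 1−λ/d−d'k/((n−k)d)−6δ is positive (the claim fails when it is negative, e.g. two disjoint equal cliques), that λ≥0, and that the weights of the graph given to the algorithm, which also receives k, are rational. *)

theory Defs
  imports
    "HOL-Probability.Product_PMF"
    "Jordan_Normal_Form.Char_Poly"
    "HOL-Library.Log_Nat"
begin

section \<open>Weighted graphs\<close>

text \<open>
  A graph on the vertex set \<open>{..<n}\<close> is given by its weight function on unordered pairs
  \<open>{i, j}\<close>; non-edges, in particular the loops \<open>{i, i} = {i}\<close>, have weight 0. Values of the
  weight function elsewhere are irrelevant.
\<close>

definition weighted_graph :: "nat \<Rightarrow> (nat set \<Rightarrow> real) \<Rightarrow> bool" where
  "weighted_graph n w \<longleftrightarrow> (\<forall>i<n. \<forall>j<n. 0 \<le> w {i, j}) \<and> (\<forall>i<n. w {i} = 0)"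

definition rho :: "(nat set \<Rightarrow> real) \<Rightarrow> nat set \<Rightarrow> real" where
  "rho w U = 1 / 2 * (\<Sum>i\<in>U. \<Sum>j\<in>U. w {i, j})"

definition regular_on :: "nat set \<Rightarrow> (nat set \<Rightarrow> real) \<Rightarrow> real \<Rightarrow> bool" where
  "regular_on U w d \<longleftrightarrow> (\<forall>i\<in>U. (\<Sum>j\<in>U. w {i, j}) = d)"

definition adjacency_mat_on :: "nat set \<Rightarrow> (nat set \<Rightarrow> real) \<Rightarrow> real mat" where
  "adjacency_mat_on U w =
     (let vs = sorted_list_of_set U
      in mat (card U) (card U) (\<lambda>(a, b). w {vs ! a, vs ! b}))"

text \<open>
  Eigenvalues counted with multiplicity. The adjacency matrix is symmetric, so its characteristic
  polynomial splits over the reals and no eigenvalue is missed.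
\<close>

definition spectrum_on :: "nat set \<Rightarrow> (nat set \<Rightarrow> real) \<Rightarrow> real multiset" where
  "spectrum_on U w = proots (char_poly (adjacency_mat_on U w))"

text \<open>
  Exactly one copy of the largest eigenvalue is exempt from the bound. The condition
  \<open>0 \<le> lam\<close> matters only for a graph with a single vertex; otherwise it follows.
\<close>

definition expander_on :: "nat set \<Rightarrow> (nat set \<Rightarrow> real) \<Rightarrow> real \<Rightarrow> real \<Rightarrow> bool" where
  "expander_on U w d' lam \<longleftrightarrow>
     regular_on U w d' \<and> 0 \<le> lam \<and>
     (\<forall>x \<in># spectrum_on U w - {#Max (set_mset (spectrum_on U w))#}. \<bar>x\<bar> \<le> lam)"


section \<open>The planted model\<close>

text \<open>The random choices: one independent coin for each pair in \<open>S \<times> ({..<n} - S)\<close>.\<close>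

definition cross_edges_pmf ::
    "nat \<Rightarrow> nat \<Rightarrow> real \<Rightarrow> real \<Rightarrow> nat set \<Rightarrow> (nat \<times> nat \<Rightarrow> bool) pmf" where
  "cross_edges_pmf n k d \<delta> S =
     Pi_pmf (S \<times> ({..<n} - S)) False (\<lambda>_. bernoulli_pmf (\<delta> * d / real k))"

definition completion ::
    "nat \<Rightarrow> real \<Rightarrow> real \<Rightarrow> real \<Rightarrow> nat set \<Rightarrow> (nat \<times> nat \<Rightarrow> bool) \<Rightarrow> (nat set \<Rightarrow> real) \<Rightarrow> bool" where
  "completion n d d' lam S \<omega> w \<longleftrightarrow>
     weighted_graph n w \<and>
     (\<forall>i\<in>S. \<forall>j\<in>{..<n} - S. w {i, j} = of_bool (\<omega> (i, j))) \<and>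
     regular_on S w d \<and>
     expander_on ({..<n} - S) w d' lam"

definition monotone_deletion ::
    "nat \<Rightarrow> nat set \<Rightarrow> (nat set \<Rightarrow> real) \<Rightarrow> (nat set \<Rightarrow> real) \<Rightarrow> bool" where
  "monotone_deletion n S w0 w \<longleftrightarrow>
     (\<forall>i<n. \<forall>j<n. if i \<in> S \<and> j \<in> S then w {i, j} = w0 {i, j} else w {i, j} \<in> {0, w0 {i, j}})"

text \<open>
  \<open>w\<close> is a possible output of the model when the planted set is \<open>S\<close> and the random choices
  came out as \<open>\<omega>\<close>.
\<close>

definition dks_exp_reg_instance ::
    "nat \<Rightarrow> real \<Rightarrow> real \<Rightarrow> real \<Rightarrow> nat set \<Rightarrow> (nat \<times> nat \<Rightarrow> bool) \<Rightarrow> (nat set \<Rightarrow> real) \<Rightarrow> bool" where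
  "dks_exp_reg_instance n d d' lam S \<omega> w \<longleftrightarrow>
     (\<exists>w0. completion n d d' lam S \<omega> w0 \<and> monotone_deletion n S w0 w)"

definition spectral_gap :: "nat \<Rightarrow> nat \<Rightarrow> real \<Rightarrow> real \<Rightarrow> real \<Rightarrow> real \<Rightarrow> real" where
  "spectral_gap n k d \<delta> d' lam =
     1 - lam / d - d' * real k / ((real n - real k) * d) - 6 * \<delta>"

text \<open>
  Only the square of the gap enters below, so \<open>nu' < 1\<close> is meaningful only together with
  positivity of the gap: for a negative gap the planted set need not be identifiable (two disjoint
  copies of the same regular graph).
\<close>

definition nu' :: "real \<Rightarrow> nat \<Rightarrow> nat \<Rightarrow> real \<Rightarrow> real \<Rightarrow> real \<Rightarrow> real \<Rightarrow> real" where
  "nu' \<xi> n k d \<delta> d' lam =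
     5 / sqrt (1 + d * real k / (4 * \<xi>\<^sup>2 * \<delta> * real n) * (spectral_gap n k d \<delta> d' lam)\<^sup>2)"


section \<open>Deterministic polynomial-time algorithms\<close>

text \<open>
  Algorithms are programs for a random access machine with integer cells, indirect addressing
  and structured control flow, under the logarithmic cost criterion: every operation costs the
  bit lengths of all addresses and operands involved. Polynomial time on this machine coincides
  with polynomial time on Turing machines.
\<close>

type_synonym store = "nat \<Rightarrow> int"

datatype aexp =
    Const int
  | Cell aexp
  | Plus aexp aexp
  | Minus aexp aexp
  | Times aexp aexp
  | Div aexp aexp

datatype com =
    Skip
  | Store aexp aexp
  | Seq com com
  | If aexp com com
  | While aexp com

definition bit_length :: "int \<Rightarrow> nat" where
  "bit_length x = 1 + floorlog 2 (nat \<bar>x\<bar>)"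

fun aval :: "aexp \<Rightarrow> store \<Rightarrow> int" where
  "aval (Const c) s = c"
| "aval (Cell a) s = s (nat (aval a s))"
| "aval (Plus a b) s = aval a s + aval b s"
| "aval (Minus a b) s = aval a s - aval b s"
| "aval (Times a b) s = aval a s * aval b s"
| "aval (Div a b) s = aval a s div aval b s"

fun acost :: "aexp \<Rightarrow> store \<Rightarrow> nat" where
  "acost (Const c) s = bit_length c"
| "acost (Cell a) s = acost a s + bit_length (aval a s) + bit_length (aval (Cell a) s)"
| "acost (Plus a b) s = acost a s + acost b s + bit_length (aval a s) + bit_length (aval b s)"
| "acost (Minus a b) s = acost a s + acost b s + bit_length (aval a s) + bit_length (aval b s)"
| "acost (Times a b) s = acost a s + acost b s + bit_length (aval a s) + bit_length (aval b s)"
| "acost (Div a b) s = acost a s + acost b s + bit_length (aval a s) + bit_length (aval b s)"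

text \<open>\<open>exec c s t s'\<close>: started in \<open>s\<close>, program \<open>c\<close> halts in \<open>s'\<close> at total cost \<open>t\<close>.\<close>

inductive exec :: "com \<Rightarrow> store \<Rightarrow> nat \<Rightarrow> store \<Rightarrow> bool" where
  Skip: "exec Skip s 1 s"
| Store: "exec (Store a b) s
      (1 + acost a s + acost b s + bit_length (aval a s) + bit_length (aval b s))
      (s(nat (aval a s) := aval b s))"
| Seq: "exec c1 s t1 s1 \<Longrightarrow> exec c2 s1 t2 s2 \<Longrightarrow> exec (Seq c1 c2) s (1 + t1 + t2) s2"
| IfTrue: "aval b s > 0 \<Longrightarrow> exec c1 s t s1 \<Longrightarrow> exec (If b c1 c2) s (1 + acost b s + t) s1"
| IfFalse: "\<not> aval b s > 0 \<Longrightarrow> exec c2 s t s1 \<Longrightarrow> exec (If b c1 c2) s (1 + acost b s + t) s1"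
| WhileFalse: "\<not> aval b s > 0 \<Longrightarrow> exec (While b c) s (1 + acost b s) s"
| WhileTrue: "aval b s > 0 \<Longrightarrow> exec c s t1 s1 \<Longrightarrow> exec (While b c) s1 t2 s2 \<Longrightarrow>
      exec (While b c) s (1 + acost b s + t1 + t2) s2"

inductive_cases exec_SkipE: "exec Skip s t s'"
inductive_cases exec_StoreE: "exec (Store a b) s t s'"
inductive_cases exec_SeqE: "exec (Seq c1 c2) s t s'"
inductive_cases exec_IfE: "exec (If b c1 c2) s t s'"
inductive_cases exec_WhileE: "exec (While b c) s t s'"

lemma exec_deterministic:
  "exec c s t s1 \<Longrightarrow> exec c s t' s2 \<Longrightarrow> t' = t \<and> s2 = s1"
proof (induction arbitrary: t' s2 rule: exec.induct)
  case (Skip s)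
  then show ?case by (auto elim: exec_SkipE)
next
  case (Store a b s)
  then show ?case by (auto elim: exec_StoreE)
next
  case (Seq c1 s t1 s1 c2 t2 s2')
  from Seq.prems obtain u1 r1 u2 where "exec c1 s u1 r1" "exec c2 r1 u2 s2" "t' = 1 + u1 + u2"
    by (rule exec_SeqE) simp
  then show ?case using Seq.IH(1)[of u1 r1] Seq.IH(2)[of u2 s2] by simp
next
  case (IfTrue b s c1 t s1 c2)
  from IfTrue.prems obtain u where "exec c1 s u s2" "t' = 1 + acost b s + u"
    by (rule exec_IfE) (use IfTrue.hyps in simp_all)
  then show ?case using IfTrue.IH[of u s2] by simp
next
  case (IfFalse b s c2 t s1 c1)
  from IfFalse.prems obtain u where "exec c2 s u s2" "t' = 1 + acost b s + u"
    by (rule exec_IfE) (use IfFalse.hyps in simp_all)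
  then show ?case using IfFalse.IH[of u s2] by simp
next
  case (WhileFalse b s c)
  from WhileFalse.prems show ?case
    by (rule exec_WhileE) (use WhileFalse.hyps in simp_all)
next
  case (WhileTrue b s c t1 s1 t2 s2')
  from WhileTrue.prems obtain u1 r1 u2
    where "exec c s u1 r1" "exec (While b c) r1 u2 s2" "t' = 1 + acost b s + u1 + u2"
    by (rule exec_WhileE) (use WhileTrue.hyps in simp_all)
  then show ?case using WhileTrue.IH(1)[of u1 r1] WhileTrue.IH(2)[of u2 s2] by simp
qed

text \<open>
  The input consists of \<open>n\<close>, \<open>k\<close> and the rational weight matrix in row-major order, each weight
  given by numerator and denominator in lowest terms.
\<close>

definition dks_input :: "nat \<Rightarrow> nat \<Rightarrow> (nat set \<Rightarrow> rat) \<Rightarrow> int list" where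
  "dks_input n k q =
     int n # int k #
     concat (map (\<lambda>(i, j). [fst (quotient_of (q {i, j})), snd (quotient_of (q {i, j}))])
       (List.product [0..<n] [0..<n]))"

definition input_size :: "int list \<Rightarrow> nat" where
  "input_size xs = sum_list (map bit_length xs)"

definition init_store :: "int list \<Rightarrow> store" where
  "init_store xs a = (if a < length xs then xs ! a else 0)"

definition real_weights :: "(nat set \<Rightarrow> rat) \<Rightarrow> nat set \<Rightarrow> real" where
  "real_weights q e = of_rat (q e)"

definition dks_poly_time :: "com \<Rightarrow> bool" where
  "dks_poly_time c \<longleftrightarrow>
     (\<exists>p :: nat poly. \<forall>n k q. k \<le> n \<longrightarrow> weighted_graph n (real_weights q) \<longrightarrow>
        (\<exists>t s. exec c (init_store (dks_input n k q)) t s \<and>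
               t \<le> poly p (input_size (dks_input n k q))))"

text \<open>The output is the vertex set whose indicator vector is left in the first \<open>n\<close> cells.\<close>

definition dks_outputs :: "com \<Rightarrow> nat \<Rightarrow> nat \<Rightarrow> (nat set \<Rightarrow> rat) \<Rightarrow> nat set \<Rightarrow> bool" where
  "dks_outputs c n k q Q \<longleftrightarrow>
     (\<exists>t s. exec c (init_store (dks_input n k q)) t s \<and> Q = {i. i < n \<and> s i \<noteq> 0})"

end

theory Submission
  imports Defs "Jordan_Normal_Form.Schur_Decomposition" "HOL-Real_Asymp.Real_Asymp"
begin

text \<open>
  The planted set is recovered from the relaxation that maximises \<open>\<langle>W, X\<rangle>\<close> over positive semidefinite \<open>X\<close> of
  trace \<open>k\<close> with \<open>0 \<le> X\<^sub>i\<^sub>j \<le> X\<^sub>i\<^sub>i \<le> 1\<close> and \<open>\<Sum>\<^sub>j X\<^sub>i\<^sub>j \<le> k X\<^sub>i\<^sub>i\<close>, by taking the \<open>k\<close> largest diagonal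
  entries. Let \<open>z\<close> be the diagonal mass outside \<open>S\<close> and \<open>p = \<delta> d / k\<close>. The block \<open>S \<times> S\<close> contributes at
  most \<open>d (k - z)\<close> and the outer block at most \<open>(\<lambda> + d' k / (n - k)) z\<close>, by the spectral bound on the
  complement of the constant vectors. In the cross blocks \<open>X\<^sub>i\<^sub>j \<le> X\<^sub>j\<^sub>j\<close> leaves only the column degrees of the
  random graph, so by Cauchy-Schwarz the noise is controlled by the sum of their squared deviations from
  \<open>p k\<close>, to which Chebyshev's inequality applies; no spectral norm of a random matrix is needed. Comparison
  with the planted solution, of value \<open>k d\<close>, yields \<open>gap\<^sup>2 d\<^sup>2 z = O(n p k)\<close>, and at most \<open>3 z\<close> planted vertices are missed.

  The relaxation is solved in integer arithmetic by a drift-plus-penalty iteration: each step adds an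
  approximate maximiser, over the matrices of unit trace, of the objective plus the constraints weighted by their
  accumulated violations. A large normalised matrix power is such a maximiser, because the moments of a
  positive semidefinite matrix are log-convex. Inverse polynomial precision suffices, since the slack in the constant
  \<open>6 \<delta>\<close> keeps the margin of the analysis above \<open>d / (8 n\<^sup>2)\<close>. The iteration is written in an array
  language whose compilation to the random access machine costs only a polynomial factor.
\<close>

section \<open>Programs over arrays and their compilation\<close>

text \<open>The completion and the adversary may depend on the coins. Randomness therefore enters
  through a single event about the coins alone, and everything after it is deterministic and uniform
  over all compatible graphs. Deletions do no harm because weights off \<open>S\<close> are only
  ever bounded from above. The weights inside \<open>S\<close> are not bounded in terms of
  \<open>n\<close>, so for given \<open>n\<close> the gap relative to \<open>d\<close> may be
  arbitrarily small and cannot dictate a numerical precision. The margin is bounded below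
  independently of it: cross edges use up only \<open>2 * \<delta> * d\<close> of the
  \<open>6 * \<delta> * d\<close> in the gap, and if neither the gap nor \<open>\<delta>\<close> is
  large, then \<open>lam\<close> is, because the absence of loops bounds \<open>d'\<close> by
  \<open>lam\<close> times the size of the complement of \<open>S\<close>. The part of the
  certificate for the outer block that this leaves over is again slack. Additive errors cannot be
  compared with a small \<open>z\<close>. They only matter when \<open>z \<le> 1 / 8\<close>, and
  there the number of missed vertices, being an integer below 1, is 0. The program knows only
  \<open>n\<close>, \<open>k\<close> and the weights; all other parameters occur in the analysis
  alone.\<close>

lemma bit_length_le_iff: "bit_length x \<le> Suc b \<longleftrightarrow> \<bar>x\<bar> < 2 ^ b"
proof -
  have "nat \<bar>x\<bar> < 2 ^ b \<longleftrightarrow> \<bar>x\<bar> < 2 ^ b"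
    by (simp add: nat_less_iff)
  then show ?thesis by (simp add: bit_length_def floorlog_le_iff)
qed

lemma bit_length_pos: "1 \<le> bit_length x"
  by (simp add: bit_length_def)

lemma abs_less_two_power_bit_length: "\<bar>x\<bar> < 2 ^ (bit_length x - 1)"
  using bit_length_le_iff[of x "bit_length x - 1"] bit_length_pos[of x] by simp

lemma bit_length_mono: "\<bar>x\<bar> \<le> \<bar>y\<bar> \<Longrightarrow> bit_length x \<le> bit_length y"
  using bit_length_le_iff[of x "bit_length y - 1"] abs_less_two_power_bit_length[of y]
    bit_length_pos[of y] by simp

lemma bit_length_add_le: "bit_length (x + y) \<le> bit_length x + bit_length y"
proof -
  obtain a b where ab: "bit_length x = Suc a" "bit_length y = Suc b"
    by (metis bit_length_def plus_1_eq_Suc)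
  have "\<bar>x\<bar> < 2 ^ a" "\<bar>y\<bar> < 2 ^ b" using bit_length_le_iff ab by (metis le_refl)+
  moreover have "(2::int) ^ a \<le> 2 ^ (a + b)" "(2::int) ^ b \<le> 2 ^ (a + b)" by simp_all
  ultimately have "\<bar>x + y\<bar> < 2 ^ (Suc (a + b))" unfolding power_Suc by linarith
  then show ?thesis using bit_length_le_iff ab by (metis add_Suc add_Suc_right)
qed

lemma bit_length_uminus [simp]: "bit_length (- x) = bit_length x"
  by (simp add: bit_length_def)

lemma bit_length_diff_le: "bit_length (x - y) \<le> bit_length x + bit_length y"
  using bit_length_add_le[of x "- y"] by simp

lemma bit_length_mult_le: "bit_length (x * y) \<le> bit_length x + bit_length y"
proof -
  obtain a b where ab: "bit_length x = Suc a" "bit_length y = Suc b"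
    by (metis bit_length_def plus_1_eq_Suc)
  have "\<bar>x\<bar> < 2 ^ a" "\<bar>y\<bar> < 2 ^ b" using bit_length_le_iff ab by (metis le_refl)+
  then have "\<bar>x * y\<bar> < 2 ^ (a + b)" by (simp add: abs_mult power_add mult_strict_mono)
  then have "bit_length (x * y) \<le> Suc (a + b)" by (simp only: bit_length_le_iff)
  then show ?thesis using ab by simp
qed

text \<open>Flooring moves a negative quotient away from zero, but never beyond \<open>x\<close>. A
  negative divisor is reduced to a positive one by negating both numbers, and division by zero gives
  0.\<close>

lemma abs_div_le: "\<bar>x div y\<bar> \<le> \<bar>x\<bar>" for x y :: int
proof -
  have *: "\<bar>x div y\<bar> \<le> \<bar>x\<bar>" if "y > 0" for x y :: int
  proof (cases "0 \<le> x")
    case True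
    then show ?thesis using that zdiv_mono2[of x 1 y] by (simp add: pos_imp_zdiv_nonneg_iff)
  next
    case False
    then have "x * y \<le> x" using that mult_left_mono_neg[of 1 y x] by simp
    then have "x * y div y \<le> x div y" using that by (rule zdiv_mono1)
    moreover have "x div y < 0" using that False by (simp add: neg_imp_zdiv_neg_iff pos_imp_zdiv_neg_iff)
    ultimately show ?thesis using that by simp
  qed
  show ?thesis
    using *[of y x] *[of "- y" "- x"] by (cases y "0::int" rule: linorder_cases) simp_all
qed

lemma bit_length_div_le: "bit_length (x div y) \<le> bit_length x"
  by (rule bit_length_mono[OF abs_div_le])

text \<open>A factor depending on the syntax only: times the largest bit length in the store it
  bounds both the length of the value and the cost. The doubling pays once for the costs of the
  operands and once for their lengths.\<close>

fun aexp_weight :: "aexp \<Rightarrow> nat" where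
  "aexp_weight (Const c) = bit_length c"
| "aexp_weight (Cell a) = 2 * aexp_weight a + 1"
| "aexp_weight (Plus a b) = 2 * (aexp_weight a + aexp_weight b)"
| "aexp_weight (Minus a b) = 2 * (aexp_weight a + aexp_weight b)"
| "aexp_weight (Times a b) = 2 * (aexp_weight a + aexp_weight b)"
| "aexp_weight (Div a b) = 2 * (aexp_weight a + aexp_weight b)"

lemma aexp_weight_bounds:
  assumes "\<forall>a. bit_length (s a) \<le> \<beta>" "1 \<le> \<beta>"
  shows "bit_length (aval e s) \<le> aexp_weight e * \<beta> \<and> acost e s \<le> aexp_weight e * \<beta>"
proof (induction e)
  case (Const c)
  then show ?case using assms(2) mult_le_mono2[of 1 \<beta> "bit_length c"] by simp
next
  case (Cell a)
  have "bit_length (s (nat (aval a s))) \<le> \<beta>" using assms(1) by blast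
  then show ?case using Cell by (simp add: algebra_simps)
next
  case (Plus a b)
  then show ?case using bit_length_add_le[of "aval a s" "aval b s"] by (simp add: algebra_simps)
next
  case (Minus a b)
  then show ?case using bit_length_diff_le[of "aval a s" "aval b s"] by (simp add: algebra_simps)
next
  case (Times a b)
  then show ?case using bit_length_mult_le[of "aval a s" "aval b s"] by (simp add: algebra_simps)
next
  case (Div a b)
  then show ?case using bit_length_div_le[of "aval a s" "aval b s"] by (simp add: algebra_simps)
qed

text \<open>The guard is evaluated \<open>N + 1\<close> times and the body \<open>N\<close> times;
  charging both \<open>N + 1\<close> times keeps the bound a product.\<close>

lemma exec_while_count:
  assumes I0: "I 0 s0"
    and step: "\<And>i s. i < N \<Longrightarrow> I i s \<Longrightarrow> \<exists>t s'. exec c s t s' \<and> t \<le> tb \<and> I (Suc i) s'"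
    and guard: "\<And>i s. i \<le> N \<Longrightarrow> I i s \<Longrightarrow> (aval b s > 0 \<longleftrightarrow> i < N) \<and> acost b s \<le> cb"
  shows "\<exists>t s'. exec (While b c) s0 t s' \<and> I N s' \<and> t \<le> (N + 1) * (1 + cb + tb)"
proof -
  have "\<exists>t s'. exec (While b c) s t s' \<and> I N s' \<and> t \<le> (m + 1) * (1 + cb + tb)"
    if "I i s" "i + m = N" for m i s
    using that
  proof (induction m arbitrary: i s)
    case 0
    then have "exec (While b c) s (1 + acost b s) s"
      using guard[of i s] by (intro WhileFalse) simp
    then show ?case using guard[of i s] 0 by force
  next
    case (Suc m)
    have g: "aval b s > 0" "acost b s \<le> cb" using guard[of i s] Suc.prems by auto
    obtain t s1 where 1: "exec c s t s1" "t \<le> tb" "I (Suc i) s1"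
      using step[of i s] Suc.prems by auto
    obtain t2 s2 where 2: "exec (While b c) s1 t2 s2" "I N s2" "t2 \<le> (m + 1) * (1 + cb + tb)"
      using Suc.IH[OF 1(3)] Suc.prems by auto
    have "exec (While b c) s (1 + acost b s + t + t2) s2"
      using g(1) 1(1) 2(1) by (rule WhileTrue)
    moreover have "1 + acost b s + t + t2 \<le> (Suc m + 1) * (1 + cb + tb)"
      using g 1(2) 2(3) by simp
    ultimately show ?case using 2(2) by blast
  qed
  from this[OF I0, of N] show ?thesis by simp
qed

lemma exec_store_bounded:
  assumes "\<forall>a. bit_length (s a) \<le> \<beta>" "1 \<le> \<beta>"
    and "aval b s = v" "nat (aval a s) = x"
  shows "\<exists>t. exec (Store a b) s t (s(x := v)) \<and>
    t \<le> (1 + 2 * aexp_weight a + 2 * aexp_weight b) * \<beta>"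
proof -
  have "exec (Store a b) s
      (1 + acost a s + acost b s + bit_length (aval a s) + bit_length (aval b s)) (s(x := v))"
    using exec.Store[of a b s] assms(3,4) by simp
  moreover have "1 + acost a s + acost b s + bit_length (aval a s) + bit_length (aval b s)
      \<le> (1 + 2 * aexp_weight a + 2 * aexp_weight b) * \<beta>"
    using aexp_weight_bounds[OF assms(1,2), of a] aexp_weight_bounds[OF assms(1,2), of b] assms(2)
    by (simp add: algebra_simps)
  ultimately show ?thesis by blast
qed

text \<open>
  A loop language with arrays. \<open>Tab A a b e\<close> sets cell \<open>i < n ^ a\<close> of array \<open>A\<close> to the
  sum of \<open>e\<close> over the summation index \<open>l < n ^ b\<close>; inside \<open>e\<close> the two indices are \<open>VI\<close> and \<open>VS\<close>.
  The cells of the input and of the arrays are addressed modulo \<open>2 n\<^sup>2 + 2\<close>, the length of the input,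
  so that every address is in range.
\<close>

datatype vexp =
    VC int
  | VI
  | VS
  | VIn vexp
  | VA nat vexp
  | VAdd vexp vexp
  | VSub vexp vexp
  | VMul vexp vexp
  | VDiv vexp vexp

datatype prog =
    Tab nat nat nat vexp
  | PSeq prog prog
  | Loop nat nat prog

definition base :: "nat \<Rightarrow> nat" where
  "base n = 2 * (n * n) + 2"

type_synonym arrays = "nat \<Rightarrow> nat \<Rightarrow> int"

fun vev :: "nat \<Rightarrow> store \<Rightarrow> arrays \<Rightarrow> nat \<Rightarrow> nat \<Rightarrow> vexp \<Rightarrow> int" where
  "vev n inp \<sigma> i l (VC c) = c"
| "vev n inp \<sigma> i l VI = int i"
| "vev n inp \<sigma> i l VS = int l"
| "vev n inp \<sigma> i l (VIn e) = inp (nat (vev n inp \<sigma> i l e mod int (base n)))"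
| "vev n inp \<sigma> i l (VA A e) = \<sigma> A (nat (vev n inp \<sigma> i l e mod int (base n)))"
| "vev n inp \<sigma> i l (VAdd e f) = vev n inp \<sigma> i l e + vev n inp \<sigma> i l f"
| "vev n inp \<sigma> i l (VSub e f) = vev n inp \<sigma> i l e - vev n inp \<sigma> i l f"
| "vev n inp \<sigma> i l (VMul e f) = vev n inp \<sigma> i l e * vev n inp \<sigma> i l f"
| "vev n inp \<sigma> i l (VDiv e f) = vev n inp \<sigma> i l e div vev n inp \<sigma> i l f"

fun reads :: "vexp \<Rightarrow> nat set" where
  "reads (VIn e) = reads e"
| "reads (VA A e) = insert A (reads e)"
| "reads (VAdd e f) = reads e \<union> reads f"
| "reads (VSub e f) = reads e \<union> reads f"
| "reads (VMul e f) = reads e \<union> reads f"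
| "reads (VDiv e f) = reads e \<union> reads f"
| "reads _ = {}"

fun writes :: "prog \<Rightarrow> nat set" where
  "writes (Tab A a b e) = {A}"
| "writes (PSeq p q) = writes p \<union> writes q"
| "writes (Loop r a p) = insert r (writes p)"

text \<open>The arrays 0 and 1 are reserved for the loop indices of \<open>Tab\<close>.\<close>

fun wf_prog :: "prog \<Rightarrow> bool" where
  "wf_prog (Tab A a b e) \<longleftrightarrow> A \<in> {2..<32} \<and> reads e \<subseteq> {2..<32} \<and> A \<notin> reads e"
| "wf_prog (PSeq p q) \<longleftrightarrow> wf_prog p \<and> wf_prog q"
| "wf_prog (Loop r a p) \<longleftrightarrow> wf_prog p \<and> r \<in> {2..<32} \<and> r \<notin> writes p"

text \<open>The round number sits in cell 0 of array \<open>r\<close>, where the body can read it;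
  \<open>prep\<close> computes an input address from it.\<close>

fun iterate :: "nat \<Rightarrow> (arrays \<Rightarrow> arrays) \<Rightarrow> arrays \<Rightarrow> nat \<Rightarrow> arrays" where
  "iterate r f \<sigma> 0 = \<sigma>(r := (\<sigma> r)(0 := 0))"
| "iterate r f \<sigma> (Suc t) =
     (let \<sigma>' = f (iterate r f \<sigma> t) in \<sigma>'(r := (\<sigma>' r)(0 := int (Suc t))))"

fun run :: "nat \<Rightarrow> store \<Rightarrow> prog \<Rightarrow> arrays \<Rightarrow> arrays" where
  "run n inp (Tab A a b e) \<sigma> =
     \<sigma>(A := \<lambda>i. if i < n ^ a then \<Sum>l<n ^ b. vev n inp \<sigma> i l e else \<sigma> A i)"
| "run n inp (PSeq p q) \<sigma> = run n inp q (run n inp p \<sigma>)"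
| "run n inp (Loop r a p) \<sigma> = iterate r (run n inp p) \<sigma> (n ^ a)"

text \<open>All partial sums are constrained, not only the complete ones, because the compiled
  \<open>Tab\<close> accumulates them in memory. The powers of \<open>n\<close> bound the loop
  indices.\<close>

fun bounded_run :: "nat \<Rightarrow> nat \<Rightarrow> store \<Rightarrow> prog \<Rightarrow> arrays \<Rightarrow> bool" where
  "bounded_run \<beta> n inp (Tab A a b e) \<sigma> \<longleftrightarrow>
     bit_length (int (n ^ a)) \<le> \<beta> \<and> bit_length (int (n ^ b)) \<le> \<beta> \<and>
     (\<forall>i<n ^ a. \<forall>m\<le>n ^ b. bit_length (\<Sum>l<m. vev n inp \<sigma> i l e) \<le> \<beta>)"
| "bounded_run \<beta> n inp (PSeq p q) \<sigma> \<longleftrightarrow>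
     bounded_run \<beta> n inp p \<sigma> \<and> bounded_run \<beta> n inp q (run n inp p \<sigma>)"
| "bounded_run \<beta> n inp (Loop r a p) \<sigma> \<longleftrightarrow>
     bit_length (int (n ^ a)) \<le> \<beta> \<and>
     (\<forall>t<n ^ a. bounded_run \<beta> n inp p (iterate r (run n inp p) \<sigma> t))"

lemma vev_cong:
  "(\<And>A. A \<in> reads e \<Longrightarrow> \<sigma> A = \<sigma>' A) \<Longrightarrow> vev n inp \<sigma> i l e = vev n inp \<sigma>' i l e"
  by (induction e) auto

lemma run_unchanged: "A \<notin> writes p \<Longrightarrow> run n inp p \<sigma> A = \<sigma> A"
proof (induction p arbitrary: \<sigma>)
  case (Loop r a p)
  have "iterate r (run n inp p) \<sigma> t A = \<sigma> A" for t
    using Loop by (induction t) (auto simp: Let_def)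
  then show ?case by simp
qed auto

lemma iterate_counter: "iterate r f \<sigma> t r 0 = int t"
  by (cases t) (auto simp: Let_def)


section \<open>Compilation to the random access machine\<close>

definition aexp_n :: aexp where "aexp_n = Cell (Const 0)"
definition aexp_base :: aexp where
  "aexp_base = Plus (Times (Const 2) (Times aexp_n aexp_n)) (Const 2)"
text \<open>The 32 arrays are interleaved behind the input, cell \<open>x\<close> of array
  \<open>A\<close> at \<open>base n + A + 32 * x\<close>, so that no array needs a declared length
  and a scalar register is just a cell 0.\<close>

definition aexp_addr :: "nat \<Rightarrow> aexp \<Rightarrow> aexp" where
  "aexp_addr A e = Plus aexp_base (Plus (Const (int A)) (Times (Const 32) e))"
definition aexp_mod :: "aexp \<Rightarrow> aexp" where
  "aexp_mod e = Minus e (Times aexp_base (Div e aexp_base))"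
fun aexp_npow :: "nat \<Rightarrow> aexp" where
  "aexp_npow 0 = Const 1"
| "aexp_npow (Suc a) = Times aexp_n (aexp_npow a)"
definition reg_addr :: "nat \<Rightarrow> aexp" where "reg_addr r = aexp_addr r (Const 0)"
definition reg :: "nat \<Rightarrow> aexp" where "reg r = Cell (reg_addr r)"

fun compile_exp :: "vexp \<Rightarrow> aexp" where
  "compile_exp (VC c) = Const c"
| "compile_exp VI = reg 0"
| "compile_exp VS = reg 1"
| "compile_exp (VIn e) = Cell (aexp_mod (compile_exp e))"
| "compile_exp (VA A e) = Cell (aexp_addr A (aexp_mod (compile_exp e)))"
| "compile_exp (VAdd e f) = Plus (compile_exp e) (compile_exp f)"
| "compile_exp (VSub e f) = Minus (compile_exp e) (compile_exp f)"
| "compile_exp (VMul e f) = Times (compile_exp e) (compile_exp f)"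
| "compile_exp (VDiv e f) = Div (compile_exp e) (compile_exp f)"

definition for_loop :: "nat \<Rightarrow> nat \<Rightarrow> com \<Rightarrow> com" where
  "for_loop r a c = Seq (Store (reg_addr r) (Const 0))
     (While (Minus (aexp_npow a) (reg r)) (Seq c (Store (reg_addr r) (Plus (reg r) (Const 1)))))"

definition accumulate :: "nat \<Rightarrow> vexp \<Rightarrow> com" where
  "accumulate A e = Store (aexp_addr A (reg 0)) (Plus (Cell (aexp_addr A (reg 0))) (compile_exp e))"

fun compile :: "prog \<Rightarrow> com" where
  "compile (Tab A a b e) = for_loop 0 a
     (Seq (Store (aexp_addr A (reg 0)) (Const 0)) (for_loop 1 b (accumulate A e)))"
| "compile (PSeq p q) = Seq (compile p) (compile q)"
| "compile (Loop r a p) = for_loop r a (compile p)"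

text \<open>The contents of arrays 0 and 1 are left open, since they change with the indices of a
  running \<open>Tab\<close>; the bit bound covers every cell, including theirs.\<close>

definition represents :: "nat \<Rightarrow> store \<Rightarrow> nat \<Rightarrow> arrays \<Rightarrow> store \<Rightarrow> bool" where
  "represents n inp \<beta> \<sigma> s \<longleftrightarrow> (\<forall>a<base n. s a = inp a) \<and>
     (\<forall>A\<in>{2..<32}. \<forall>x. s (base n + (A + 32 * x)) = \<sigma> A x) \<and>
     (\<forall>a. bit_length (s a) \<le> \<beta>)"

lemma address_inj:
  assumes "A < 32" "A' < (32::nat)" "b + (A + 32 * x) = b + (A' + 32 * x')"
  shows "A = A' \<and> x = x'"
proof -
  have "A + 32 * x = A' + 32 * x'" using assms(3) by simp
  then have "(A + 32 * x) mod 32 = (A' + 32 * x') mod 32" by simp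
  then have "A = A'" using assms(1,2) by simp
  then show ?thesis using \<open>A + 32 * x = A' + 32 * x'\<close> by simp
qed

lemma represents_update:
  assumes "represents n inp \<beta> \<sigma> s" "A \<in> {2..<32}" "bit_length v \<le> \<beta>"
  shows "represents n inp \<beta> (\<sigma>(A := (\<sigma> A)(x := v))) (s(base n + (A + 32 * x) := v))"
  using assms unfolding represents_def by (auto dest: address_inj[where b = 0, simplified])

lemma represents_register:
  assumes "represents n inp \<beta> \<sigma> s" "r < 2" "bit_length v \<le> \<beta>"
  shows "represents n inp \<beta> \<sigma> (s(base n + r := v))"
proof -
  have "base n + (A + 32 * x) \<noteq> base n + r" if "A \<in> {2..<32}" for A x
    using that assms(2) by auto
  then show ?thesis using assms unfolding represents_def by auto
qed

lemma represents_bit_length: "represents n inp \<beta> \<sigma> s \<Longrightarrow> \<forall>a. bit_length (s a) \<le> \<beta>"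
  by (simp add: represents_def)

definition tab_const :: "nat \<Rightarrow> nat \<Rightarrow> nat \<Rightarrow> vexp \<Rightarrow> nat" where
  "tab_const A a b e = 200 + 100 * (aexp_weight (reg_addr 0) + aexp_weight (reg_addr 1) + aexp_weight (aexp_npow a) +
     aexp_weight (aexp_npow b) + aexp_weight (aexp_addr A (reg 0)) + aexp_weight (compile_exp e))"

context
  fixes n :: nat and inp :: store
  assumes inp0: "inp 0 = int n"
begin

lemma base_pos: "0 < base n" by (simp add: base_def)

lemma aval_n: "represents n inp \<beta> \<sigma> s \<Longrightarrow> aval aexp_n s = int n"
  using inp0 base_pos by (simp add: aexp_n_def represents_def)

lemma aval_base: "represents n inp \<beta> \<sigma> s \<Longrightarrow> aval aexp_base s = int (base n)"
  by (simp add: aexp_base_def aval_n base_def)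

lemma aval_addr:
  "represents n inp \<beta> \<sigma> s \<Longrightarrow> aval e s = int x \<Longrightarrow>
   nat (aval (aexp_addr A e) s) = base n + (A + 32 * x)"
  by (simp add: aexp_addr_def aval_base nat_add_distrib nat_mult_distrib flip: of_nat_add of_nat_mult)

lemma aval_reg_addr:
  "represents n inp \<beta> \<sigma> s \<Longrightarrow> nat (aval (reg_addr r) s) = base n + r"
  using aval_addr[of \<beta> \<sigma> s "Const 0" 0 r] by (simp add: reg_addr_def)

lemma aval_reg: "represents n inp \<beta> \<sigma> s \<Longrightarrow> aval (reg r) s = s (base n + r)"
  by (simp add: reg_def aval_reg_addr)

lemma aval_npow: "represents n inp \<beta> \<sigma> s \<Longrightarrow> aval (aexp_npow a) s = int (n ^ a)"
  by (induction a) (simp_all add: aval_n)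

lemma aval_mod:
  "represents n inp \<beta> \<sigma> s \<Longrightarrow> aval (aexp_mod e) s = aval e s mod int (base n)"
  by (simp add: aexp_mod_def aval_base minus_mult_div_eq_mod)

lemma aval_compile_exp:
  assumes "represents n inp \<beta> \<sigma> s" "s (base n) = int i" "s (base n + 1) = int l"
    and "reads e \<subseteq> {2..<32}"
  shows "aval (compile_exp e) s = vev n inp \<sigma> i l e"
  using assms(4)
proof (induction e)
  case (VIn e)
  have "nat (vev n inp \<sigma> i l e mod int (base n)) < base n"
    using base_pos by (simp add: nat_less_iff)
  then show ?case using VIn assms(1) by (simp add: aval_mod[OF assms(1)] represents_def)
next
  case (VA A e)
  have "aval (aexp_mod (compile_exp e)) s = int (nat (vev n inp \<sigma> i l e mod int (base n)))"
    using VA base_pos by (simp add: aval_mod[OF assms(1)])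
  from aval_addr[OF assms(1) this] show ?case using VA assms(1) by (simp add: represents_def)
qed (use assms aval_reg[OF assms(1)] in auto)

text \<open>The invariant describes stores whose counter has already been written. Hence the body
  has to leave the counter alone and to establish the invariant in the store in which it is then
  advanced.\<close>

lemma exec_for_loop:
  assumes I0: "I 0 (s0(base n + r := 0))" and rep0: "represents n inp \<beta> \<tau> s0"
    and \<beta>: "1 \<le> \<beta>"
    and rep: "\<And>i s. I i s \<Longrightarrow> i \<le> n ^ a \<Longrightarrow> (\<exists>\<sigma>. represents n inp \<beta> \<sigma> s) \<and> s (base n + r) = int i"
    and step: "\<And>i s. i < n ^ a \<Longrightarrow> I i s \<Longrightarrow> \<exists>t s'. exec c s t s' \<and> t \<le> tb \<and>
       (\<exists>\<sigma>. represents n inp \<beta> \<sigma> s') \<and> s' (base n + r) = int i \<and>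
       I (Suc i) (s'(base n + r := int (Suc i)))"
  shows "\<exists>t s'. exec (for_loop r a c) s0 t s' \<and> I (n ^ a) s' \<and>
     t \<le> (n ^ a + 1) * (tb + \<beta> * (30 + 20 * aexp_weight (reg_addr r) + 10 * aexp_weight (aexp_npow a)))"
proof -
  let ?b = "Minus (aexp_npow a) (reg r)"
  let ?st = "Store (reg_addr r) (Plus (reg r) (Const 1))"
  let ?wr = "aexp_weight (reg_addr r)" and ?wn = "aexp_weight (aexp_npow a)"
  have "\<exists>t s'. exec (While ?b (Seq c ?st)) (s0(base n + r := 0)) t s' \<and> I (n ^ a) s' \<and>
     t \<le> (n ^ a + 1) * (1 + aexp_weight ?b * \<beta> + (1 + tb + (1 + 2 * aexp_weight (reg_addr r) +
        2 * aexp_weight (Plus (reg r) (Const 1))) * \<beta>))"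
  proof (rule exec_while_count[where I = I])
    show "I 0 (s0(base n + r := 0))" by fact
  next
    fix i s assume i: "i < n ^ a" and I: "I i s"
    obtain t s' \<sigma> where 1: "exec c s t s'" "t \<le> tb" "represents n inp \<beta> \<sigma> s'"
      "s' (base n + r) = int i" "I (Suc i) (s'(base n + r := int (Suc i)))"
      using step[OF i I] by blast
    have "aval (Plus (reg r) (Const 1)) s' = int (Suc i)"
      using 1(4) by (simp add: aval_reg[OF 1(3)])
    from exec_store_bounded[OF represents_bit_length[OF 1(3)] \<beta> this aval_reg_addr[OF 1(3)]]
    obtain t2 where 2: "exec ?st s' t2 (s'(base n + r := int (Suc i)))"
      "t2 \<le> (1 + 2 * aexp_weight (reg_addr r) + 2 * aexp_weight (Plus (reg r) (Const 1))) * \<beta>"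
      by blast
    have "exec (Seq c ?st) s (1 + t + t2) (s'(base n + r := int (Suc i)))"
      using 1(1) 2(1) by (rule exec.Seq)
    moreover have "1 + t + t2 \<le> 1 + tb + (1 + 2 * aexp_weight (reg_addr r) +
        2 * aexp_weight (Plus (reg r) (Const 1))) * \<beta>"
      using 1(2) 2(2) by linarith
    ultimately show "\<exists>t s'. exec (Seq c ?st) s t s' \<and> t \<le> 1 + tb + (1 + 2 * aexp_weight (reg_addr r) +
        2 * aexp_weight (Plus (reg r) (Const 1))) * \<beta> \<and> I (Suc i) s'"
      using 1(5) by blast
  next
    fix i s assume i: "i \<le> n ^ a" and I: "I i s"
    obtain \<sigma> where r: "represents n inp \<beta> \<sigma> s" "s (base n + r) = int i" using rep[OF I i] by blast
    show "(0 < aval ?b s) = (i < n ^ a) \<and> acost ?b s \<le> aexp_weight ?b * \<beta>"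
      using aexp_weight_bounds[OF represents_bit_length[OF r(1)] \<beta>, of ?b] r(2)
      by (simp add: aval_npow[OF r(1)] aval_reg[OF r(1)] flip: of_nat_power)
  qed
  then obtain t s' where w: "exec (While ?b (Seq c ?st)) (s0(base n + r := 0)) t s'" "I (n ^ a) s'"
     "t \<le> (n ^ a + 1) * (1 + aexp_weight ?b * \<beta> + (1 + tb + (1 + 2 * aexp_weight (reg_addr r) +
        2 * aexp_weight (Plus (reg r) (Const 1))) * \<beta>))" by blast
  have "aval (Const 0) s0 = 0" by simp
  from exec_store_bounded[OF represents_bit_length[OF rep0] \<beta> this aval_reg_addr[OF rep0]]
  obtain t0 where 0: "exec (Store (reg_addr r) (Const 0)) s0 t0 (s0(base n + r := 0))"
    "t0 \<le> (1 + 2 * aexp_weight (reg_addr r) + 2 * aexp_weight (Const 0)) * \<beta>" by blast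
  have e: "exec (for_loop r a c) s0 (1 + t0 + t) s'"
    unfolding for_loop_def using 0(1) w(1) by (rule exec.Seq)
  have b: "bit_length 0 = 1" "bit_length 1 = 2" by (simp_all add: bit_length_def floorlog_def)
  let ?W = "tb + \<beta> * (30 + 20 * ?wr + 10 * ?wn)"
  let ?U = "1 + aexp_weight ?b * \<beta> + (1 + tb + (1 + 2 * aexp_weight (reg_addr r) +
        2 * aexp_weight (Plus (reg r) (Const 1))) * \<beta>)"
  have U: "?U + (1 + t0) \<le> ?W"
    using 0(2) \<beta> by (simp add: b reg_def algebra_simps)
  have "1 + t0 + t \<le> (1 + t0) + (n ^ a + 1) * ?U" using w(3) by simp
  also have "\<dots> \<le> (n ^ a + 1) * (?U + (1 + t0))" by (simp add: algebra_simps)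
  also have "\<dots> \<le> (n ^ a + 1) * ?W" using U by (rule mult_le_mono2)
  finally have "1 + t0 + t \<le> (n ^ a + 1) * ?W" .
  then show ?thesis using e w(2) by blast
qed

lemma exec_tab:
  assumes rep: "represents n inp \<beta> \<sigma> s" and \<beta>: "1 \<le> \<beta>"
    and wf: "wf_prog (Tab A a b e)" and bd: "bounded_run \<beta> n inp (Tab A a b e) \<sigma>"
  shows "\<exists>t s'. exec (compile (Tab A a b e)) s t s' \<and>
    represents n inp \<beta> (run n inp (Tab A a b e) \<sigma>) s' \<and>
    t \<le> (n ^ a + 1) * (n ^ b + 1) * \<beta> * tab_const A a b e"
proof -
  define full where "full i = (\<Sum>l<n ^ b. vev n inp \<sigma> i l e)" for i
  \<comment> \<open>\<open>st i\<close> has the first \<open>i\<close> cells finished,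
    \<open>st' i m\<close> in addition the first \<open>m\<close> terms of cell \<open>i\<close>. As
    \<open>e\<close> does not read \<open>A\<close>, half-written contents of \<open>A\<close> do
    not influence it, and all sums refer to the initial arrays.\<close>
  define st where "st i = \<sigma>(A := \<lambda>x. if x < i then full x else \<sigma> A x)" for i
  define st' where "st' i m = (st i)(A := (st i A)(i := \<Sum>l<m. vev n inp \<sigma> i l e))" for i m
  let ?wA = "aexp_weight (aexp_addr A (reg 0))" and ?we = "aexp_weight (compile_exp e)"
  let ?acc = "(1 + 2 * ?wA + 2 * aexp_weight (Plus (Cell (aexp_addr A (reg 0))) (compile_exp e))) * \<beta>"
  let ?w0 = "30 + 20 * aexp_weight (reg_addr 0) + 10 * aexp_weight (aexp_npow a)"
  let ?w1 = "30 + 20 * aexp_weight (reg_addr 1) + 10 * aexp_weight (aexp_npow b)"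
  let ?in = "(n ^ b + 1) * (?acc + \<beta> * ?w1)"
  let ?body = "Seq (Store (aexp_addr A (reg 0)) (Const 0)) (for_loop 1 b (accumulate A e))"
  let ?tb = "1 + (1 + 2 * ?wA + 2) * \<beta> + ?in"
  have A: "A \<in> {2..<32}" "A \<notin> reads e" "reads e \<subseteq> {2..<32}" using wf by auto
  have ev: "vev n inp (st' i m) i l e = vev n inp \<sigma> i l e" for i m l
    by (rule vev_cong) (use A(2) in \<open>auto simp: st'_def st_def\<close>)
  have bl0: "bit_length 0 = 1" by (simp add: bit_length_def floorlog_def)
  have bitle: "bit_length (int x) \<le> \<beta>" if "x \<le> y" "bit_length (int y) \<le> \<beta>" for x y
    using bit_length_mono[of "int x" "int y"] that by linarith
  have "\<exists>t s'. exec (for_loop 0 a ?body) s t s' \<and>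
     (represents n inp \<beta> (st (n ^ a)) s' \<and> s' (base n + 0) = int (n ^ a)) \<and>
     t \<le> (n ^ a + 1) * (?tb + \<beta> * ?w0)"
  proof (rule exec_for_loop[where I = "\<lambda>i s. represents n inp \<beta> (st i) s \<and> s (base n + 0) = int i"
        and r = 0 and \<tau> = \<sigma>, OF _ rep \<beta>], goal_cases)
    case 1
    have "st 0 = \<sigma>" by (auto simp: st_def)
    then show ?case using represents_register[OF rep, of 0 0] \<beta> by (simp add: bl0)
  next
    case (2 i s)
    then show ?case by blast
  next
    case (3 i s)
    then have s: "represents n inp \<beta> (st i) s" "s (base n) = int i" and i: "i < n ^ a" by auto
    have reg0: "aval (reg 0) s = int i" if "represents n inp \<beta> \<tau> s" "s (base n) = int i" for s \<tau>
      using that by (simp add: aval_reg[OF that(1)])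
    let ?s1 = "s(base n + (A + 32 * i) := 0)"
    have "aval (Const 0) s = 0" by simp
    from exec_store_bounded[OF represents_bit_length[OF s(1)] \<beta> this aval_addr[OF s(1) reg0[OF s]]]
    obtain t1 where t1: "exec (Store (aexp_addr A (reg 0)) (Const 0)) s t1 ?s1"
      "t1 \<le> (1 + 2 * ?wA + 2 * aexp_weight (Const 0)) * \<beta>" by blast
    have "(\<Sum>l<0. vev n inp \<sigma> i l e) = 0" by simp
    then have r1: "represents n inp \<beta> (st' i 0) ?s1"
      unfolding st'_def using represents_update[OF s(1) A(1), of 0 i] \<beta> by (simp add: bl0)
    have s1b: "?s1 (base n) = int i" using s(2) A(1) by auto
    have "\<exists>t s'. exec (for_loop 1 b (accumulate A e)) ?s1 t s' \<and>
       (represents n inp \<beta> (st' i (n ^ b)) s' \<and> s' (base n) = int i \<and> s' (base n + 1) = int (n ^ b)) \<and>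
       t \<le> (n ^ b + 1) * (?acc + \<beta> * ?w1)"
    proof (rule exec_for_loop[where I = "\<lambda>m s. represents n inp \<beta> (st' i m) s \<and> s (base n) = int i \<and>
          s (base n + 1) = int m" and r = 1 and \<tau> = "st' i 0", OF _ r1 \<beta>], goal_cases)
      case 1
      show ?case using represents_register[OF r1, of 1 0] \<beta> s1b by (simp add: bl0)
    next
      case (2 m s)
      then show ?case by blast
    next
      case (3 m s)
      then have m: "m < n ^ b" and r: "represents n inp \<beta> (st' i m) s"
        and b: "s (base n) = int i" "s (base n + 1) = int m" by auto
      let ?v = "\<Sum>l<Suc m. vev n inp \<sigma> i l e"
      have "s (base n + (A + 32 * i)) = st' i m A i" using r A(1) by (simp add: represents_def)
      then have "s (base n + (A + 32 * i)) = (\<Sum>l<m. vev n inp \<sigma> i l e)" by (simp add: st'_def)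
      then have v: "aval (Plus (Cell (aexp_addr A (reg 0))) (compile_exp e)) s = ?v"
        by (simp add: aval_addr[OF r reg0[OF r b(1)]] aval_compile_exp[OF r b A(3)] ev)
      let ?s' = "s(base n + (A + 32 * i) := ?v)"
      from exec_store_bounded[OF represents_bit_length[OF r] \<beta> v aval_addr[OF r reg0[OF r b(1)]]]
      obtain t where t: "exec (accumulate A e) s t ?s'" "t \<le> ?acc"
        unfolding accumulate_def by blast
      have blv: "bit_length ?v \<le> \<beta>" using bd m i by (simp del: sum.lessThan_Suc)
      have "(st' i m)(A := (st' i m A)(i := ?v)) = st' i (Suc m)" by (simp add: st'_def)
      then have r': "represents n inp \<beta> (st' i (Suc m)) ?s'"
        using represents_update[OF r A(1) blv, of i] by simp
      have b': "?s' (base n) = int i" "?s' (base n + 1) = int m" using b A(1) by auto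
      have r'': "represents n inp \<beta> (st' i (Suc m)) (?s'(base n + 1 := int (Suc m)))"
        by (rule represents_register[OF r']) (use bitle[of "Suc m" "n ^ b"] bd m in auto)
      show ?case using t r' r'' b' by (intro exI[of _ t] exI[of _ ?s']) auto
    qed
    then obtain t2 s2 where 2: "exec (for_loop 1 b (accumulate A e)) ?s1 t2 s2"
      "represents n inp \<beta> (st' i (n ^ b)) s2" "s2 (base n) = int i" "t2 \<le> ?in" by blast
    have e: "exec ?body s (1 + t1 + t2) s2" using t1(1) 2(1) by (rule exec.Seq)
    have "st' i (n ^ b) = st (Suc i)"
      unfolding st'_def st_def by (auto simp: fun_eq_iff full_def less_Suc_eq)
    then have r2: "represents n inp \<beta> (st (Suc i)) s2" using 2(2) by simp
    have r3: "represents n inp \<beta> (st (Suc i)) (s2(base n + 0 := int (Suc i)))"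
      by (rule represents_register[OF r2]) (use bitle[of "Suc i" "n ^ a"] bd i in auto)
    have "1 + t1 + t2 \<le> ?tb" using t1(2) 2(4) by (simp add: bl0)
    then show ?case using e r2 r3 2(3) by (intro exI[of _ "1 + t1 + t2"] exI[of _ s2]) auto
  qed
  then obtain t s' where f: "exec (compile (Tab A a b e)) s t s'" "represents n inp \<beta> (st (n ^ a)) s'"
    "t \<le> (n ^ a + 1) * (?tb + \<beta> * ?w0)" by auto
  have st_run: "st (n ^ a) = run n inp (Tab A a b e) \<sigma>" by (simp add: st_def full_def fun_eq_iff)
  let ?G = "tab_const A a b e"
  have "?tb + \<beta> * ?w0 \<le> (n ^ b + 1) * (?acc + \<beta> * ?w1 + (\<beta> * ?w0 + 1 + (1 + 2 * ?wA + 2) * \<beta>))"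
    by (simp add: algebra_simps)
  also have "\<dots> \<le> (n ^ b + 1) * (\<beta> * ?G)"
    by (rule mult_le_mono2) (use \<beta> in \<open>simp add: tab_const_def algebra_simps\<close>)
  finally have "(n ^ a + 1) * (?tb + \<beta> * ?w0) \<le> (n ^ a + 1) * (n ^ b + 1) * \<beta> * ?G"
    unfolding mult.assoc by (rule mult_le_mono2)
  then show ?thesis using f unfolding st_run by (meson le_trans)
qed

end

fun prog_const :: "prog \<Rightarrow> nat" where
  "prog_const (Tab A a b e) = 4 * tab_const A a b e"
| "prog_const (PSeq p q) = 1 + prog_const p + prog_const q"
| "prog_const (Loop r a p) =
     2 * (prog_const p + (30 + 20 * aexp_weight (reg_addr r) + 10 * aexp_weight (aexp_npow a)))"

fun prog_degree :: "prog \<Rightarrow> nat" where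
  "prog_degree (Tab A a b e) = a + b"
| "prog_degree (PSeq p q) = prog_degree p + prog_degree q"
| "prog_degree (Loop r a p) = a + prog_degree p"

lemma power_Suc_le_twice: "n ^ a + 1 \<le> 2 * (n + 1) ^ a" for n :: nat
  using power_mono[of n "n + 1" a] one_le_power[of "n + 1" a] by linarith

text \<open>The number of operations and the size of the operands are separated: the syntax gives a
  polynomial in \<open>n\<close>, while the bit bound \<open>\<beta>\<close> is a fact about the
  values of the run and is established later. Adding degrees in \<open>PSeq\<close> is wasteful but
  harmless.\<close>

lemma exec_compile:
  assumes inp0: "inp 0 = int n" and \<beta>: "1 \<le> \<beta>"
    and "represents n inp \<beta> \<sigma> s" "bounded_run \<beta> n inp p \<sigma>" "wf_prog p"
  shows "\<exists>t s'. exec (compile p) s t s' \<and> represents n inp \<beta> (run n inp p \<sigma>) s' \<and>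
    t \<le> prog_const p * (n + 1) ^ prog_degree p * \<beta>"
  using assms(3-)
proof (induction p arbitrary: \<sigma> s)
  case (Tab A a b e)
  let ?G = "tab_const A a b e"
  obtain t s' where t: "exec (compile (Tab A a b e)) s t s'"
    "represents n inp \<beta> (run n inp (Tab A a b e) \<sigma>) s'"
    "t \<le> (n ^ a + 1) * (n ^ b + 1) * \<beta> * ?G"
    using exec_tab[OF inp0 Tab(1) \<beta> Tab(3,2)] by blast
  have "(n ^ a + 1) * (n ^ b + 1) \<le> (2 * (n + 1) ^ a) * (2 * (n + 1) ^ b)"
    by (intro mult_le_mono power_Suc_le_twice)
  then have "(n ^ a + 1) * (n ^ b + 1) * (\<beta> * ?G) \<le> (2 * (n + 1) ^ a) * (2 * (n + 1) ^ b) * (\<beta> * ?G)"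
    by (rule mult_le_mono1)
  also have "\<dots> = prog_const (Tab A a b e) * (n + 1) ^ prog_degree (Tab A a b e) * \<beta>"
    by (simp add: power_add)
  finally have "t \<le> prog_const (Tab A a b e) * (n + 1) ^ prog_degree (Tab A a b e) * \<beta>"
    using t(3) by (simp only: mult.assoc)
  then show ?case using t(1,2) by blast
next
  case (PSeq p q)
  obtain t1 s1 where 1: "exec (compile p) s t1 s1" "represents n inp \<beta> (run n inp p \<sigma>) s1"
    "t1 \<le> prog_const p * (n + 1) ^ prog_degree p * \<beta>"
    using PSeq.IH(1)[OF PSeq.prems(1)] PSeq.prems by auto
  obtain t2 s2 where 2: "exec (compile q) s1 t2 s2" "represents n inp \<beta> (run n inp (PSeq p q) \<sigma>) s2"
    "t2 \<le> prog_const q * (n + 1) ^ prog_degree q * \<beta>"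
    using PSeq.IH(2)[OF 1(2)] PSeq.prems by auto
  have e: "exec (compile (PSeq p q)) s (1 + t1 + t2) s2"
    using 1(1) 2(1) exec.Seq by simp
  have "(n + 1) ^ prog_degree p * 1 \<le> (n + 1) ^ prog_degree p * (n + 1) ^ prog_degree q"
    "1 * (n + 1) ^ prog_degree q \<le> (n + 1) ^ prog_degree p * (n + 1) ^ prog_degree q"
    "1 * 1 \<le> (n + 1) ^ prog_degree p * (n + 1) ^ prog_degree q"
    by (intro mult_le_mono one_le_power; simp)+
  then have D: "(n + 1) ^ prog_degree p \<le> (n + 1) ^ prog_degree (PSeq p q)"
    "(n + 1) ^ prog_degree q \<le> (n + 1) ^ prog_degree (PSeq p q)"
    "1 \<le> (n + 1) ^ prog_degree (PSeq p q)"
    by (simp_all add: power_add)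
  let ?D = "(n + 1) ^ prog_degree (PSeq p q)"
  have "t1 \<le> prog_const p * ?D * \<beta>" "t2 \<le> prog_const q * ?D * \<beta>" "1 \<le> 1 * ?D * \<beta>"
    using le_trans[OF 1(3) mult_le_mono[OF mult_le_mono[OF le_refl D(1)] le_refl]]
      le_trans[OF 2(3) mult_le_mono[OF mult_le_mono[OF le_refl D(2)] le_refl]]
      mult_le_mono[OF D(3) \<beta>] by simp_all
  then have "1 + t1 + t2 \<le> 1 * ?D * \<beta> + prog_const p * ?D * \<beta> + prog_const q * ?D * \<beta>"
    by (intro add_mono)
  also have "\<dots> = prog_const (PSeq p q) * ?D * \<beta>" by (simp only: prog_const.simps distrib_right)
  finally have "1 + t1 + t2 \<le> prog_const (PSeq p q) * ?D * \<beta>" .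
  then show ?case using e 2(2) by blast
next
  case (Loop r a p)
  let ?it = "iterate r (run n inp p) \<sigma>"
  define w where "w = 30 + 20 * aexp_weight (reg_addr r) + 10 * aexp_weight (aexp_npow a)"
  let ?tb = "prog_const p * (n + 1) ^ prog_degree p * \<beta>"
  have r: "r \<in> {2..<32}" "r \<notin> writes p" "wf_prog p" using Loop.prems by auto
  have bl0: "bit_length 0 = 1" by (simp add: bit_length_def floorlog_def)
  have cell: "s (base n + r) = \<tau> r 0" if "represents n inp \<beta> \<tau> s" for \<tau> s
    using that r(1) unfolding represents_def by (metis add.right_neutral mult_zero_right)
  have upd: "represents n inp \<beta> (\<tau>(r := (\<tau> r)(0 := v))) (s(base n + r := v))"
    if "represents n inp \<beta> \<tau> s" "bit_length v \<le> \<beta>" for \<tau> s v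
    using represents_update[OF that(1) r(1) that(2), of 0] by simp
  have "\<exists>t s'. exec (for_loop r a (compile p)) s t s' \<and> represents n inp \<beta> (?it (n ^ a)) s' \<and>
     t \<le> (n ^ a + 1) * (?tb + \<beta> * w)"
  proof (rule exec_for_loop[where I = "\<lambda>i s. represents n inp \<beta> (?it i) s" and \<tau> = \<sigma> and r = r and a = a,
        OF inp0 _ Loop.prems(1) \<beta>, folded w_def], goal_cases)
    case 1
    show ?case using upd[OF Loop.prems(1), of 0] \<beta> by (simp add: bl0)
  next
    case (2 i s)
    then show ?case using cell[of "?it i" s] iterate_counter by auto
  next
    case (3 i s)
    have "bounded_run \<beta> n inp p (?it i)" using Loop.prems(2) 3(1) by simp
    then obtain t s' where t: "exec (compile p) s t s'" "t \<le> ?tb"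
      "represents n inp \<beta> (run n inp p (?it i)) s'"
      using Loop.IH[OF 3(2) _ r(3)] by auto
    have c: "s' (base n + r) = int i"
      using cell[OF t(3)] by (simp add: run_unchanged[OF r(2)] iterate_counter)
    have "bit_length (int (Suc i)) \<le> \<beta>"
      by (rule le_trans[OF bit_length_mono[of "int (Suc i)" "int (n ^ a)"]])
        (use 3(1) Loop.prems(2) in \<open>simp_all flip: of_nat_power\<close>)
    from upd[OF t(3) this] have "represents n inp \<beta> (?it (Suc i)) (s'(base n + r := int (Suc i)))"
      by (simp add: Let_def)
    then show ?case using t c by blast
  qed
  then obtain t s' where f: "exec (compile (Loop r a p)) s t s'" "represents n inp \<beta> (run n inp (Loop r a p) \<sigma>) s'"
    "t \<le> (n ^ a + 1) * (?tb + \<beta> * w)" by auto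
  have "1 \<le> (n + 1) ^ prog_degree p" by simp
  then have "?tb + \<beta> * w \<le> (prog_const p + w) * (n + 1) ^ prog_degree p * \<beta>"
    using mult_le_mono2[of 1 "(n + 1) ^ prog_degree p" "\<beta> * w"] by (simp add: algebra_simps del: power_Suc)
  then have "(n ^ a + 1) * (?tb + \<beta> * w)
      \<le> (2 * (n + 1) ^ a) * ((prog_const p + w) * (n + 1) ^ prog_degree p * \<beta>)"
    by (intro mult_le_mono power_Suc_le_twice)
  also have "\<dots> = prog_const (Loop r a p) * (n + 1) ^ prog_degree (Loop r a p) * \<beta>"
    by (simp add: power_add w_def)
  finally show ?case using f by (meson le_trans)
qed

section \<open>Concentration of the column degrees\<close>

text \<open>An arbitrary index set in place of the full product, so that moments can be computed by
  inserting one pair at a time.\<close>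

definition coins :: "real \<Rightarrow> 'a set \<Rightarrow> ('a \<Rightarrow> bool) pmf" where
  "coins p F = Pi_pmf F False (\<lambda>_. bernoulli_pmf p)"

lemma finite_set_coins: "finite F \<Longrightarrow> finite (set_pmf (coins p F))"
  unfolding coins_def by (rule finite_subset[OF set_Pi_pmf_subset']) (auto intro: finite_PiE_dflt)

lemma integrable_coins [simp]: "finite F \<Longrightarrow> integrable (measure_pmf (coins p F)) (g :: _ \<Rightarrow> real)"
  by (intro integrable_measure_pmf_finite finite_set_coins)

lemma expectation_coins_insert:
  fixes g :: "('a \<Rightarrow> bool) \<Rightarrow> real"
  assumes "finite F" "x \<notin> F" "0 \<le> p" "p \<le> 1"
  shows "measure_pmf.expectation (coins p (insert x F)) g =
    measure_pmf.expectation (coins p F) (\<lambda>w. p * g (w(x := True)) + (1 - p) * g (w(x := False)))"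
proof -
  have "coins p (insert x F) = bernoulli_pmf p \<bind> (\<lambda>y. map_pmf (\<lambda>w. w(x := y)) (coins p F))"
    using assms by (simp add: coins_def Pi_pmf_insert' map_pmf_def)
  then have "measure_pmf.expectation (coins p (insert x F)) g =
     (\<Sum>a\<in>UNIV. pmf (bernoulli_pmf p) a *\<^sub>R
       measure_pmf.expectation (map_pmf (\<lambda>w. w(x := a)) (coins p F)) g)"
    using finite_set_coins[OF assms(1), of p] by (simp only:) (intro pmf_expectation_bind; simp)
  then show ?thesis using assms by (simp add: UNIV_bool)
qed

definition col_dev :: "real \<Rightarrow> (nat \<times> nat) set \<Rightarrow> (nat \<times> nat \<Rightarrow> bool) \<Rightarrow> nat \<Rightarrow> real" where
  "col_dev p F w j = (\<Sum>e\<in>{e \<in> F. snd e = j}. of_bool (w e) - p)"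

definition sq_dev :: "real \<Rightarrow> nat set \<Rightarrow> (nat \<times> nat) set \<Rightarrow> (nat \<times> nat \<Rightarrow> bool) \<Rightarrow> real" where
  "sq_dev p U F w = (\<Sum>j\<in>U. (col_dev p F w j)\<^sup>2)"

lemma col_dev_insert:
  assumes "finite F" "e \<notin> F"
  shows "col_dev p (insert e F) (w(e := b)) j = col_dev p F w j + (if snd e = j then of_bool b - p else 0)"
proof -
  have "(\<Sum>x\<in>{x \<in> F. snd x = j}. of_bool ((w(e := b)) x) - p) = (\<Sum>x\<in>{x \<in> F. snd x = j}. of_bool (w x) - p)"
    using assms by (intro sum.cong) auto
  moreover have "{x \<in> insert e F. snd x = j} =
      (if snd e = j then insert e {x \<in> F. snd x = j} else {x \<in> F. snd x = j})" by auto
  ultimately show ?thesis using assms by (simp add: col_dev_def)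
qed

lemma sq_dev_insert:
  assumes "finite F" "e \<notin> F" "finite U" "snd e \<in> U"
  shows "sq_dev p U (insert e F) (w(e := b)) =
    sq_dev p U F w + 2 * (of_bool b - p) * col_dev p F w (snd e) + (of_bool b - p)\<^sup>2"
proof -
  have "sq_dev p U (insert e F) (w(e := b)) =
     (\<Sum>j\<in>U. (col_dev p F w j)\<^sup>2 + (if snd e = j then 2 * (of_bool b - p) * col_dev p F w (snd e) + (of_bool b - p)\<^sup>2 else 0))"
    unfolding sq_dev_def by (intro sum.cong refl) (auto simp: col_dev_insert[OF assms(1,2)] power2_eq_square algebra_simps)
  also have "\<dots> = sq_dev p U F w + (2 * (of_bool b - p) * col_dev p F w (snd e) + (of_bool b - p)\<^sup>2)"
    using assms(3,4) by (simp add: sum.distrib sq_dev_def)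
  finally show ?thesis by simp
qed

lemma col_dev_moments:
  assumes "finite F" "0 \<le> p" "p \<le> 1"
  shows "measure_pmf.expectation (coins p F) (\<lambda>w. col_dev p F w j) = 0 \<and>
    measure_pmf.expectation (coins p F) (\<lambda>w. (col_dev p F w j)\<^sup>2) =
      real (card {e \<in> F. snd e = j}) * (p * (1 - p))"
  using assms(1)
proof (induction F rule: finite_induct)
  case empty
  then show ?case by (simp add: col_dev_def)
next
  case (insert e F)
  let ?E = "measure_pmf.expectation (coins p F)"
  have c: "card {x \<in> insert e F. snd x = j} =
      (if snd e = j then Suc (card {x \<in> F. snd x = j}) else card {x \<in> F. snd x = j})"
  proof -
    have "{x \<in> insert e F. snd x = j} =
      (if snd e = j then insert e {x \<in> F. snd x = j} else {x \<in> F. snd x = j})" by auto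
    then show ?thesis using insert.hyps by simp
  qed
  show ?case
  proof (cases "snd e = j")
    case False
    then show ?thesis using insert
      by (simp only: c) (simp add: expectation_coins_insert assms col_dev_insert algebra_simps)
  next
    case True
    have 1: "(\<lambda>w. p * col_dev p (insert e F) (w(e := True)) j + (1 - p) * col_dev p (insert e F) (w(e := False)) j) =
       (\<lambda>w. col_dev p F w j)"
      using insert True by (simp add: col_dev_insert fun_eq_iff algebra_simps)
    have 2: "(\<lambda>w. p * (col_dev p (insert e F) (w(e := True)) j)\<^sup>2 + (1 - p) * (col_dev p (insert e F) (w(e := False)) j)\<^sup>2) =
       (\<lambda>w. (col_dev p F w j)\<^sup>2 + p * (1 - p))"
      using insert True by (simp add: col_dev_insert fun_eq_iff power2_eq_square algebra_simps)
    show ?thesis using insert True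
      unfolding expectation_coins_insert[OF insert.hyps assms(2,3)] 1 2 c
      by (simp add: algebra_simps)
  qed
qed

text \<open>
  When the pair \<open>e\<close> is added, the squared deviation changes by \<open>2 b r + b\<^sup>2\<close>, where \<open>b\<close> is the
  centred coin and \<open>r\<close> the deviation of its column; all odd moments of \<open>r\<close> and \<open>b\<close> that would
  couple the two drop out.
\<close>

lemma sq_dev_moments:
  assumes "finite F" "0 \<le> p" "p \<le> 1" "finite U" "finite S" "F \<subseteq> S \<times> U"
  shows "measure_pmf.expectation (coins p F) (sq_dev p U F) = real (card F) * (p * (1 - p)) \<and>
    measure_pmf.expectation (coins p F) (\<lambda>w. (sq_dev p U F w)\<^sup>2) \<le>
      (real (card F) * (p * (1 - p)))\<^sup>2 + real (card F) * (4 * real (card S) * p\<^sup>2 + p)"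
  using assms(1,6)
proof (induction F rule: finite_induct)
  case empty
  then show ?case by (simp add: sq_dev_def col_dev_def)
next
  case (insert e F)
  let ?E = "measure_pmf.expectation (coins p F)"
  let ?q = "p * (1 - p)" and ?j = "snd e"
  have e: "snd e \<in> U" "F \<subseteq> S \<times> U" using insert.prems by auto
  note ins = sq_dev_insert[OF insert.hyps(1,2) assms(4) e(1)]
  have IH: "?E (sq_dev p U F) = real (card F) * ?q"
    "?E (\<lambda>w. (sq_dev p U F w)\<^sup>2) \<le> (real (card F) * ?q)\<^sup>2 + real (card F) * (4 * real (card S) * p\<^sup>2 + p)"
    using insert.IH[OF e(2)] by auto
  have mom: "?E (\<lambda>w. col_dev p F w ?j) = 0"
    "?E (\<lambda>w. (col_dev p F w ?j)\<^sup>2) = real (card {x \<in> F. snd x = ?j}) * ?q"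
    using col_dev_moments[OF insert.hyps(1) assms(2,3)] by auto
  have "card {x \<in> F. snd x = ?j} \<le> card S"
  proof (rule card_inj_on_le[of fst])
    show "inj_on fst {x \<in> F. snd x = ?j}" by (auto simp: inj_on_def prod_eq_iff)
  qed (use e assms in auto)
  then have cle: "real (card {x \<in> F. snd x = ?j}) \<le> real (card S)" by simp
  have 1: "(\<lambda>w. p * sq_dev p U (insert e F) (w(e := True)) + (1 - p) * sq_dev p U (insert e F) (w(e := False))) =
     (\<lambda>w. sq_dev p U F w + ?q)"
    by (simp add: ins fun_eq_iff power2_eq_square algebra_simps)
  \<comment> \<open>The third and fourth moments of the centred coin. The term with
    \<open>m3\<close> vanishes because it is multiplied by a column deviation, which has mean
    0.\<close>
  define m3 m4 where "m3 = p * (1 - p) ^ 3 - (1 - p) * p ^ 3" and "m4 = p * (1 - p) ^ 4 + (1 - p) * p ^ 4"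
  have 2: "(\<lambda>w. p * (sq_dev p U (insert e F) (w(e := True)))\<^sup>2 + (1 - p) * (sq_dev p U (insert e F) (w(e := False)))\<^sup>2) =
     (\<lambda>w. (sq_dev p U F w)\<^sup>2 + 4 * ?q * (col_dev p F w ?j)\<^sup>2 + 2 * ?q * sq_dev p U F w +
        4 * m3 * col_dev p F w ?j + m4)"
    by (simp add: ins fun_eq_iff m3_def m4_def power2_eq_square power3_eq_cube power4_eq_xxxx algebra_simps)
  have q: "0 \<le> ?q" "?q \<le> p" using assms(2,3) by (simp_all add: mult_left_le)
  have qq: "?q * (real (card {x \<in> F. snd x = ?j}) * ?q) \<le> p * (real (card S) * p)"
    using q cle assms by (intro mult_mono) auto
  have m4: "m4 \<le> p"
  proof -
    have "(1 - p) ^ 4 \<le> (1 - p) ^ 1" "p ^ 4 \<le> p ^ 1" using assms by (intro power_decreasing; simp)+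
    then have "m4 \<le> p * (1 - p) + (1 - p) * p"
      unfolding m4_def using assms by (intro add_mono mult_left_mono) auto
    moreover have "m4 \<le> p * (1 - p) ^ 2 + (1 - p) * p ^ 2"
      unfolding m4_def using assms by (intro add_mono mult_left_mono power_decreasing) auto
    moreover have "p * (1 - p) ^ 2 + (1 - p) * p ^ 2 = ?q" by (simp add: power2_eq_square algebra_simps)
    ultimately show ?thesis using q by linarith
  qed
  have "measure_pmf.expectation (coins p (insert e F)) (\<lambda>w. (sq_dev p U (insert e F) w)\<^sup>2) =
     ?E (\<lambda>w. (sq_dev p U F w)\<^sup>2) + 4 * (?q * (real (card {x \<in> F. snd x = ?j}) * ?q)) + 2 * ?q * (real (card F) * ?q) + m4"
    unfolding expectation_coins_insert[OF insert.hyps assms(2,3)] 2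
    using insert.hyps by (simp add: IH(1) mom)
  also have "\<dots> \<le> (real (card F) * ?q)\<^sup>2 + real (card F) * (4 * real (card S) * p\<^sup>2 + p) +
      4 * (p * (real (card S) * p)) + 2 * ?q * (real (card F) * ?q) + p"
    using IH(2) qq m4 by linarith
  also have "\<dots> \<le> (real (card (insert e F)) * ?q)\<^sup>2 + real (card (insert e F)) * (4 * real (card S) * p\<^sup>2 + p)"
  proof -
    have "(real (card F) * ?q)\<^sup>2 + 2 * ?q * (real (card F) * ?q) + ?q\<^sup>2 = (real (card (insert e F)) * ?q)\<^sup>2"
      using insert.hyps by (simp add: power2_eq_square algebra_simps)
    moreover have "0 \<le> ?q\<^sup>2" by simp
    moreover have "real (card (insert e F)) * (4 * real (card S) * p\<^sup>2 + p) =
      real (card F) * (4 * real (card S) * p\<^sup>2 + p) + 4 * (p * (real (card S) * p)) + p"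
      using insert.hyps by (simp add: power2_eq_square algebra_simps)
    ultimately show ?thesis by linarith
  qed
  finally have "measure_pmf.expectation (coins p (insert e F)) (\<lambda>w. (sq_dev p U (insert e F) w)\<^sup>2) \<le>
    (real (card (insert e F)) * ?q)\<^sup>2 + real (card (insert e F)) * (4 * real (card S) * p\<^sup>2 + p)" .
  moreover have "measure_pmf.expectation (coins p (insert e F)) (sq_dev p U (insert e F)) =
    real (card (insert e F)) * ?q"
    unfolding expectation_coins_insert[OF insert.hyps assms(2,3)] 1
    using insert.hyps by (simp add: IH(1) algebra_simps)
  ultimately show ?case by blast
qed

text \<open>Chebyshev's inequality at distance \<open>n * p * k\<close>, which also bounds the mean.
  The variance is at most \<open>n * k * (4 * k * p\<^sup>2 + p)\<close>, and its two terms yield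
  the two terms of the bound.\<close>

lemma sq_dev_concentration:
  assumes S: "S \<subseteq> {..<n}" "card S = k" "0 < k" "k < n" and p: "0 < p" "p < 1"
  shows "measure_pmf.prob (coins p (S \<times> ({..<n} - S))) {w. sq_dev p ({..<n} - S) (S \<times> ({..<n} - S)) w > 2 * n * p * k}
    \<le> 4 / n + 1 / (n * p * k)"
proof -
  let ?U = "{..<n} - S" let ?F = "S \<times> ?U" let ?P = "coins p ?F" let ?X = "sq_dev p ?U ?F"
  have fin: "finite S" "finite ?U" using S finite_subset by auto
  then have finF: "finite ?F" by simp
  have cU: "card ?U \<le> n" by (metis card_lessThan card_mono Diff_subset finite_lessThan)
  have cF: "real (card ?F) \<le> real n * k" using cU S by (simp add: card_cartesian_product mult_mono mult.commute)
  have "measure_pmf.expectation ?P ?X = real (card ?F) * (p * (1 - p)) \<and>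
    measure_pmf.expectation ?P (\<lambda>w. (?X w)\<^sup>2) \<le>
      (real (card ?F) * (p * (1 - p)))\<^sup>2 + real (card ?F) * (4 * real (card S) * p\<^sup>2 + p)"
    using fin p by (intro sq_dev_moments) auto
  then have m: "measure_pmf.expectation ?P ?X = real (card ?F) * (p * (1 - p))"
    and v: "measure_pmf.variance ?P ?X \<le> real (card ?F) * (4 * real k * p\<^sup>2 + p)"
    using S(2) measure_pmf.variance_eq[of ?P ?X, OF integrable_coins[OF finF] integrable_coins[OF finF]]
    by auto
  have npk: "0 < n * p * k" using S p by simp
  have m': "measure_pmf.expectation ?P ?X \<le> n * p * k"
  proof -
    have "real (card ?F) * (p * (1 - p)) \<le> (real n * k) * p"
      using cF p by (intro mult_mono) (auto simp: mult_left_le)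
    then show ?thesis using m by (simp add: algebra_simps)
  qed
  have "measure_pmf.prob ?P {w. ?X w > 2 * n * p * k}
     \<le> measure_pmf.prob ?P {w \<in> space (measure_pmf ?P). n * p * k \<le> \<bar>?X w - measure_pmf.expectation ?P ?X\<bar>}"
    by (intro measure_pmf.finite_measure_mono) (use m' in auto)
  also have "\<dots> \<le> measure_pmf.variance ?P ?X / (n * p * k)\<^sup>2"
    using npk finF by (intro measure_pmf.Chebyshev_inequality) auto
  also have "\<dots> \<le> ((real n * k) * (4 * real k * p\<^sup>2 + p)) / (n * p * k)\<^sup>2"
    using v cF p by (intro divide_right_mono order.trans[OF v] mult_right_mono) auto
  also have "\<dots> = 4 / n + 1 / (n * p * k)"
    using S p by (simp add: power2_eq_square field_simps)
  finally show ?thesis by simp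
qed

section \<open>Moments and powers of symmetric matrices\<close>

definition inner_on :: "'a set \<Rightarrow> ('a \<Rightarrow> real) \<Rightarrow> ('a \<Rightarrow> real) \<Rightarrow> real" where
  "inner_on I x y = (\<Sum>i\<in>I. x i * y i)"

text \<open>Generic in the scalars: the machine takes powers over the integers, the analysis over
  the reals.\<close>

definition mat_app :: "'a set \<Rightarrow> ('a \<Rightarrow> 'a \<Rightarrow> 'b :: comm_semiring_1) \<Rightarrow> ('a \<Rightarrow> 'b) \<Rightarrow> 'a \<Rightarrow> 'b" where
  "mat_app I M x i = (\<Sum>j\<in>I. M i j * x j)"

definition unit_at :: "'a \<Rightarrow> 'a \<Rightarrow> 'b :: zero_neq_one" where
  "unit_at i j = of_bool (j = i)"

definition sym_on :: "'a set \<Rightarrow> ('a \<Rightarrow> 'a \<Rightarrow> 'b) \<Rightarrow> bool" where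
  "sym_on I M \<longleftrightarrow> (\<forall>i\<in>I. \<forall>j\<in>I. M i j = M j i)"

definition psd_on :: "'a set \<Rightarrow> ('a \<Rightarrow> 'a \<Rightarrow> real) \<Rightarrow> bool" where
  "psd_on I M \<longleftrightarrow> (\<forall>x. 0 \<le> inner_on I x (mat_app I M x))"

lemma inner_on_commute: "inner_on I x y = inner_on I y x"
  by (simp add: inner_on_def mult.commute)

lemma inner_on_self_nonneg: "0 \<le> inner_on I x x"
  by (simp add: inner_on_def sum_nonneg)

lemma inner_on_cong: "(\<And>i. i \<in> I \<Longrightarrow> x i = x' i) \<Longrightarrow> (\<And>i. i \<in> I \<Longrightarrow> y i = y' i) \<Longrightarrow>
  inner_on I x y = inner_on I x' y'"
  by (simp add: inner_on_def)

lemma inner_on_diff_scale: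
  "inner_on I (\<lambda>i. x i - t * y i) z = inner_on I x z - t * inner_on I y z"
  "inner_on I z (\<lambda>i. x i - t * y i) = inner_on I z x - t * inner_on I z y"
  by (simp_all add: inner_on_def algebra_simps sum_subtractf sum_distrib_left)

lemma mat_app_diff_scale:
  "mat_app I M (\<lambda>i. x i - t * y i) = (\<lambda>i. mat_app I M x i - t * mat_app I M y i)"
  for x :: "'a \<Rightarrow> real"
  by (rule ext) (simp add: mat_app_def algebra_simps sum_subtractf sum_distrib_left)

lemma cauchy_schwarz_on: "(inner_on I x y)\<^sup>2 \<le> inner_on I x x * inner_on I y y"
  unfolding inner_on_def using Cauchy_Schwarz_ineq_sum[of x y I] by (simp add: power2_eq_square)

lemma inner_on_mat_app: "inner_on I x (mat_app I M y) = (\<Sum>i\<in>I. \<Sum>j\<in>I. x i * M i j * y j)"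
  by (simp add: inner_on_def mat_app_def sum_distrib_left mult.assoc)

lemma self_adjoint:
  assumes "sym_on I M"
  shows "inner_on I x (mat_app I M y) = inner_on I (mat_app I M x) y"
proof -
  have "inner_on I x (mat_app I M y) = (\<Sum>j\<in>I. \<Sum>i\<in>I. x i * M i j * y j)"
    unfolding inner_on_mat_app by (rule sum.swap)
  also have "\<dots> = (\<Sum>j\<in>I. \<Sum>i\<in>I. M j i * x i * y j)"
    using assms by (intro sum.cong refl) (auto simp: sym_on_def)
  finally show ?thesis by (simp add: inner_on_def mat_app_def sum_distrib_right)
qed

lemma self_adjoint_power:
  assumes "sym_on I M"
  shows "inner_on I ((mat_app I M ^^ a) x) ((mat_app I M ^^ b) y) = inner_on I x ((mat_app I M ^^ (a + b)) y)"
proof (induction a arbitrary: b)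
  case (Suc a)
  have "inner_on I ((mat_app I M ^^ Suc a) x) ((mat_app I M ^^ b) y) =
      inner_on I ((mat_app I M ^^ a) x) ((mat_app I M ^^ Suc b) y)"
    using self_adjoint[OF assms] by simp
  then show ?case using Suc.IH[of "Suc b"] by simp
qed simp

definition moment :: "'a set \<Rightarrow> ('a \<Rightarrow> 'a \<Rightarrow> real) \<Rightarrow> ('a \<Rightarrow> real) \<Rightarrow> nat \<Rightarrow> real" where
  "moment I M x r = inner_on I x ((mat_app I M ^^ r) x)"

text \<open>The trace of \<open>M ^ r\<close>, written as a sum of moments of unit vectors so that
  inequalities for moments carry over by summation.\<close>

definition pow_trace :: "'a set \<Rightarrow> ('a \<Rightarrow> 'a \<Rightarrow> real) \<Rightarrow> nat \<Rightarrow> real" where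
  "pow_trace I M r = (\<Sum>i\<in>I. moment I M (unit_at i) r)"

lemma moment_even: "sym_on I M \<Longrightarrow>
  moment I M x (2 * s) = inner_on I ((mat_app I M ^^ s) x) ((mat_app I M ^^ s) x)"
  by (simp add: moment_def self_adjoint_power mult_2)

text \<open>For the moments of \<open>x\<close> under \<open>M\<close> this is the value of the form
  \<open>M ^ r\<close> at \<open>x - t * M x\<close>. A family of linear inequalities is stable
  under sums, which log-convexity itself does not show directly, and it avoids
  diagonalisation.\<close>

definition moment_seq :: "(nat \<Rightarrow> real) \<Rightarrow> bool" where
  "moment_seq m \<longleftrightarrow> (\<forall>r t. 0 \<le> m r - 2 * t * m (r + 1) + t\<^sup>2 * m (r + 2))"

text \<open>With \<open>y = M ^ s (x - t * M x)\<close>, the even case is the squared norm of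
  \<open>y\<close> and the odd case the form of \<open>M\<close> at \<open>y\<close>; only the
  latter needs semidefiniteness.\<close>

lemma moment_seq_moment:
  assumes "sym_on I M" "psd_on I M"
  shows "moment_seq (moment I M x)"
proof -
  let ?f = "mat_app I M" and ?m = "moment I M x"
  have m: "inner_on I ((?f ^^ a) x) ((?f ^^ b) x) = ?m (a + b)" for a b
    by (simp add: self_adjoint_power[OF assms(1)] moment_def)
  have f: "?f ((?f ^^ a) x) = (?f ^^ Suc a) x" for a by simp
  have ev: "0 \<le> ?m (2 * s) - 2 * t * ?m (2 * s + 1) + t\<^sup>2 * ?m (2 * s + 2)" for s t
  proof -
    let ?y = "\<lambda>i. (?f ^^ s) x i - t * (?f ^^ Suc s) x i"
    have "inner_on I ?y ?y = ?m (s + s) - t * ?m (s + Suc s) - t * (?m (Suc s + s) - t * ?m (Suc s + Suc s))"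
      unfolding inner_on_diff_scale m by simp
    moreover have "s + s = 2 * s" "s + Suc s = 2 * s + 1" "Suc s + s = 2 * s + 1" "Suc s + Suc s = 2 * s + 2"
      by simp_all
    ultimately have "inner_on I ?y ?y = ?m (2 * s) - t * ?m (2 * s + 1) - t * (?m (2 * s + 1) - t * ?m (2 * s + 2))"
      by metis
    then show ?thesis using inner_on_self_nonneg[of I ?y] by (simp add: power2_eq_square algebra_simps)
  qed
  have od: "0 \<le> ?m (2 * s + 1) - 2 * t * ?m (2 * s + 2) + t\<^sup>2 * ?m (2 * s + 3)" for s t
  proof -
    let ?y = "\<lambda>i. (?f ^^ s) x i - t * (?f ^^ Suc s) x i"
    have "inner_on I ?y (?f ?y) = ?m (s + Suc s) - t * ?m (s + Suc (Suc s)) -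
        t * (?m (Suc s + Suc s) - t * ?m (Suc s + Suc (Suc s)))"
      unfolding mat_app_diff_scale f inner_on_diff_scale m by simp
    moreover have "s + Suc (Suc s) = 2 * s + 2" "s + Suc s = 2 * s + 1" "Suc s + Suc (Suc s) = 2 * s + 3"
      "Suc s + Suc s = 2 * s + 2" by simp_all
    ultimately have "inner_on I ?y (?f ?y) = ?m (2 * s + 1) - t * ?m (2 * s + 2) - t * (?m (2 * s + 2) - t * ?m (2 * s + 3))"
      by metis
    moreover have "0 \<le> inner_on I ?y (?f ?y)" using assms(2) by (simp add: psd_on_def)
    ultimately show ?thesis by (simp add: power2_eq_square algebra_simps)
  qed
  have "0 \<le> ?m r - 2 * t * ?m (r + 1) + t\<^sup>2 * ?m (r + 2)" for r t
  proof (cases "even r")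
    case True
    then obtain s where "r = 2 * s" by blast
    then show ?thesis using ev[of s t] by simp
  next
    case False
    then obtain s where "r = 2 * s + 1" using oddE by blast
    then show ?thesis using od[of s t] by (simp add: numeral_3_eq_3)
  qed
  then show ?thesis by (simp add: moment_seq_def)
qed

lemma moment_seq_sum: "(\<And>i. i \<in> J \<Longrightarrow> moment_seq (m i)) \<Longrightarrow> moment_seq (\<lambda>r. \<Sum>i\<in>J. m i r)"
  unfolding moment_seq_def
proof (intro allI, goal_cases)
  case (1 r t)
  then have "0 \<le> (\<Sum>i\<in>J. m i r - 2 * t * m i (r + 1) + t\<^sup>2 * m i (r + 2))" by (intro sum_nonneg) blast
  then show ?case by (simp add: sum.distrib sum_subtractf sum_distrib_left)
qed

lemma moment_seq_pow_trace: "sym_on I M \<Longrightarrow> psd_on I M \<Longrightarrow> moment_seq (pow_trace I M)"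
  unfolding pow_trace_def by (intro moment_seq_sum moment_seq_moment)

lemma moment_seq_nonneg: "moment_seq m \<Longrightarrow> 0 \<le> m r"
  unfolding moment_seq_def by (drule spec[of _ r], drule spec[of _ 0]) simp

text \<open>The discriminant of a nonnegative quadratic polynomial in \<open>t\<close>. If its
  leading coefficient vanishes it is affine, so its slope vanishes too.\<close>

lemma moment_seq_log_convex:
  assumes "moment_seq m"
  shows "(m (Suc r))\<^sup>2 \<le> m r * m (Suc (Suc r))"
proof -
  have q: "0 \<le> m r - 2 * t * m (Suc r) + t\<^sup>2 * m (Suc (Suc r))" for t
    using assms unfolding moment_seq_def by (metis add_2_eq_Suc' Suc_eq_plus1)
  have nn: "0 \<le> m r" "0 \<le> m (Suc (Suc r))" using moment_seq_nonneg[OF assms] by auto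
  show ?thesis
  proof (cases "m (Suc (Suc r)) = 0")
    case True
    have "m (Suc r) = 0"
    proof (rule ccontr)
      assume ne: "m (Suc r) \<noteq> 0"
      have "2 * ((m r + 1) / (2 * m (Suc r))) * m (Suc r) = m r + 1" using ne by simp
      then show False using q[of "(m r + 1) / (2 * m (Suc r))"] True by simp
    qed
    then show ?thesis using True by simp
  next
    case False
    then have pos: "0 < m (Suc (Suc r))" using nn by simp
    have "0 \<le> m r - (m (Suc r))\<^sup>2 / m (Suc (Suc r))"
      using q[of "m (Suc r) / m (Suc (Suc r))"] pos by (simp add: power2_eq_square field_simps)
    then show ?thesis using pos by (simp add: field_simps)
  qed
qed

text \<open>Log-convexity makes the quotients of consecutive moments nondecreasing, so each is at
  least the first one.\<close>

lemma moment_seq_lower: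
  assumes "moment_seq m" "0 < m 0"
  shows "m 0 * (m 1 / m 0) ^ r \<le> m r"
proof -
  define \<rho> where "\<rho> = m 1 / m 0"
  note nn = moment_seq_nonneg[OF assms(1)]
  have \<rho>: "0 \<le> \<rho>" using nn[of 1] assms(2) by (simp add: \<rho>_def)
  have step: "\<rho> * m r \<le> m (Suc r)" for r
  proof (induction r)
    case 0
    then show ?case using assms(2) by (simp add: \<rho>_def)
  next
    case (Suc r)
    show ?case
    proof (cases "m (Suc r) = 0")
      case True
      then show ?thesis using nn by simp
    next
      case False
      then have p: "0 < m (Suc r)" using nn[of "Suc r"] by simp
      have lc: "m (Suc r) * m (Suc r) \<le> m r * m (Suc (Suc r))"
        using moment_seq_log_convex[OF assms(1), of r] by (simp add: power2_eq_square)
      then have r: "0 < m r" using p nn[of r] by (cases "m r = 0") (auto simp: mult_le_0_iff)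
      have "m r * (\<rho> * m (Suc r)) = (\<rho> * m r) * m (Suc r)" by simp
      also have "\<dots> \<le> m (Suc r) * m (Suc r)" using Suc.IH p by (intro mult_right_mono) auto
      also note lc
      finally show ?thesis using r by simp
    qed
  qed
  show ?thesis unfolding \<rho>_def[symmetric]
  proof (induction r)
    case (Suc r)
    have "m 0 * \<rho> ^ Suc r = \<rho> * (m 0 * \<rho> ^ r)" by simp
    also have "\<dots> \<le> \<rho> * m r" using Suc \<rho> by (rule mult_left_mono)
    also have "\<dots> \<le> m (Suc r)" by (rule step)
    finally show ?case .
  qed simp
qed

text \<open>Lyapunov's inequality with the roots cleared: \<open>(m r / m 0)\<close> to the power
  \<open>1 / r\<close> is nondecreasing in \<open>r\<close>.\<close>

lemma moment_seq_upper:
  assumes "moment_seq m"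
  shows "m r ^ Suc r \<le> m 0 * m (Suc r) ^ r"
proof (induction r)
  case (Suc r)
  note nn = moment_seq_nonneg[OF assms]
  show ?case
  proof (cases "m (Suc r) = 0")
    case True
    then show ?thesis using nn by simp
  next
    case False
    then have p: "0 < m (Suc r) ^ r" using nn[of "Suc r"] by simp
    have "m (Suc r) ^ r * m (Suc r) ^ Suc (Suc r) = ((m (Suc r))\<^sup>2) ^ Suc r"
      by (simp add: power2_eq_square power_mult_distrib)
    also have "\<dots> \<le> (m r * m (Suc (Suc r))) ^ Suc r"
      using moment_seq_log_convex[OF assms] by (intro power_mono) auto
    also have "\<dots> = m r ^ Suc r * m (Suc (Suc r)) ^ Suc r" by (rule power_mult_distrib)
    also have "\<dots> \<le> (m 0 * m (Suc r) ^ r) * m (Suc (Suc r)) ^ Suc r"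
      using Suc nn by (intro mult_right_mono) auto
    also have "\<dots> = m (Suc r) ^ r * (m 0 * m (Suc (Suc r)) ^ Suc r)" by simp
    finally show ?thesis using p by simp
  qed
qed simp

lemma mat_app_funpow_Suc: "(mat_app I M ^^ Suc r) x i = (\<Sum>j\<in>I. M i j * (mat_app I M ^^ r) x j)"
  unfolding funpow.simps o_apply by (rule mat_app_def)

lemma mat_app_power_expand:
  fixes x :: "'a \<Rightarrow> 'b :: comm_semiring_1"
  assumes "finite I" "i \<in> I"
  shows "(mat_app I M ^^ r) x i = (\<Sum>j\<in>I. (mat_app I M ^^ r) (unit_at j) i * x j)"
  using assms(2)
proof (induction r arbitrary: i)
  case 0
  have "(\<Sum>j\<in>I. of_bool (i = j) * x j) = (\<Sum>j\<in>I. if i = j then x j else 0)"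
    by (intro sum.cong) auto
  then show ?case using assms(1) 0 by (simp add: unit_at_def)
next
  case (Suc r)
  have "(mat_app I M ^^ Suc r) x i = (\<Sum>l\<in>I. M i l * (\<Sum>j\<in>I. (mat_app I M ^^ r) (unit_at j) l * x j))"
    unfolding mat_app_funpow_Suc using Suc.IH by (intro sum.cong refl) simp
  also have "\<dots> = (\<Sum>j\<in>I. \<Sum>l\<in>I. M i l * (mat_app I M ^^ r) (unit_at j) l * x j)"
    by (simp add: sum_distrib_left mult.assoc) (rule sum.swap)
  finally show ?case unfolding mat_app_funpow_Suc by (simp add: sum_distrib_right)
qed

text \<open>The operator norm is at most the Hilbert-Schmidt norm. The columns \<open>F j\<close>
  are arbitrary because the result is needed for the columns of a power and also for these columns
  with their constant part removed.\<close>

lemma norm_combination_le: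
  fixes c :: "'a \<Rightarrow> real" and F :: "'a \<Rightarrow> 'a \<Rightarrow> real"
  assumes "\<And>i. i \<in> I \<Longrightarrow> y i = (\<Sum>j\<in>I. F j i * c j)"
  shows "inner_on I y y \<le> inner_on I c c * (\<Sum>j\<in>I. inner_on I (F j) (F j))"
proof -
  have "inner_on I y y = (\<Sum>i\<in>I. (\<Sum>j\<in>I. F j i * c j)\<^sup>2)"
    using assms by (simp add: inner_on_def power2_eq_square)
  also have "\<dots> \<le> (\<Sum>i\<in>I. (\<Sum>j\<in>I. (F j i)\<^sup>2) * (\<Sum>j\<in>I. (c j)\<^sup>2))"
    by (intro sum_mono Cauchy_Schwarz_ineq_sum)
  also have "\<dots> = (\<Sum>j\<in>I. \<Sum>i\<in>I. (F j i)\<^sup>2) * (\<Sum>j\<in>I. (c j)\<^sup>2)"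
    by (subst sum.swap) (simp add: sum_distrib_right)
  finally show ?thesis by (simp add: inner_on_def power2_eq_square mult.commute)
qed

lemma moment_le_pow_trace:
  assumes "finite I" "sym_on I M"
  shows "moment I M x (2 * s) \<le> inner_on I x x * pow_trace I M (2 * s)"
  unfolding moment_even[OF assms(2)] pow_trace_def
  by (rule norm_combination_le) (rule mat_app_power_expand[OF assms(1)])

lemma pow_trace_0: "finite I \<Longrightarrow> pow_trace I M 0 = real (card I)"
  by (simp add: pow_trace_def moment_def inner_on_def unit_at_def)

lemma pow_trace_diag:
  assumes "finite I" shows "pow_trace I M r = (\<Sum>i\<in>I. (mat_app I M ^^ r) (unit_at i) i)"
proof -
  have "(\<Sum>j\<in>I. of_bool (j = i) * f j) = f i" if "i \<in> I" for i and f :: "'a \<Rightarrow> real"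
  proof -
    have "(\<Sum>j\<in>I. of_bool (j = i) * f j) = (\<Sum>j\<in>I. if j = i then f j else 0)" by (intro sum.cong) auto
    then show ?thesis using that assms by simp
  qed
  then show ?thesis by (simp add: pow_trace_def moment_def inner_on_def unit_at_def)
qed

text \<open>The normalised power \<open>M ^ (2 s) / tr M ^ (2 s)\<close> is an approximate maximiser of the linear form \<open>M\<close>
  over the spectrahedron, by log-convexity of the moments.\<close>

lemma power_oracle:
  assumes fin: "finite I" and sym: "sym_on I M" and psd: "psd_on I M"
    and x: "inner_on I x x = 1" and s: "0 < s" and pos: "0 < pow_trace I M (2 * s)"
    and card: "card I \<le> 2 * s" "I \<noteq> {}"
  shows "inner_on I x (mat_app I M x) * (1 - card I / (2 * s))
    \<le> pow_trace I M (2 * s + 1) / pow_trace I M (2 * s)"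
proof (rule ccontr)
  define \<rho> where "\<rho> = inner_on I x (mat_app I M x)"
  let ?b = "pow_trace I M" and ?m = "2 * s"
  define \<theta> where "\<theta> = card I / ?m"
  define q where "q = ?b (?m + 1) / ?b ?m"
  assume "\<not> ?thesis"
  then have q: "q < \<rho> * (1 - \<theta>)" by (simp add: q_def \<rho>_def \<theta>_def)
  note mt = moment_seq_pow_trace[OF sym psd] and mm = moment_seq_moment[OF sym psd, of x]
  have q0: "0 \<le> q" using moment_seq_nonneg[OF mt] by (simp add: q_def)
  have m01: "moment I M x 0 = 1" "moment I M x 1 = \<rho>" using x by (simp_all add: moment_def \<rho>_def)
  have \<rho>0: "0 \<le> \<rho>" using moment_seq_nonneg[OF mm, of 1] m01 by simp
  have "\<rho> ^ ?m \<le> moment I M x ?m" using moment_seq_lower[OF mm, of ?m] m01 by simp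
  also have "\<dots> \<le> ?b ?m" using moment_le_pow_trace[OF fin sym, of x s] x by simp
  finally have 1: "\<rho> ^ ?m \<le> ?b ?m" .
  \<comment> \<open>Lyapunov's inequality for the traces. Dividing by a power of the trace gives
    \<open>?b ?m \<le> card I * q ^ ?m\<close>, to be compared with the lower bound
    \<open>\<rho> ^ ?m\<close>.\<close>
  have "?b ?m ^ Suc ?m \<le> card I * ?b (Suc ?m) ^ ?m"
    using moment_seq_upper[OF mt, of ?m] fin by (simp add: pow_trace_0)
  also have "?b (Suc ?m) = q * ?b ?m" using pos by (simp add: q_def)
  finally have "?b ?m * ?b ?m ^ ?m \<le> (card I * q ^ ?m) * ?b ?m ^ ?m"
    by (simp add: power_mult_distrib)
  then have "?b ?m \<le> card I * q ^ ?m" using pos by simp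
  with 1 have 2: "\<rho> ^ ?m \<le> card I * q ^ ?m" by simp
  have \<theta>: "0 \<le> \<theta>" "\<theta> \<le> 1" using card s by (simp_all add: \<theta>_def divide_le_eq)
  have mt: "?m * \<theta> = card I" using s by (simp add: \<theta>_def)
  have cI: "0 < real (card I)" using card(2) fin by (simp add: card_gt_0_iff)
  \<comment> \<open>\<open>\<theta>\<close> is chosen such that
    \<open>?m * \<theta> = card I\<close>: then \<open>(1 - \<theta>) ^ ?m\<close> is at most
    \<open>1 / (1 + card I)\<close>, which outweighs the dimension factor \<open>card I\<close> lost
    above.\<close>
  have "1 + ?m * \<theta> \<le> (1 + \<theta>) ^ ?m" using \<theta> by (intro Bernoulli_inequality) auto
  then have "(1 + card I) * (1 - \<theta>) ^ ?m \<le> (1 + \<theta>) ^ ?m * (1 - \<theta>) ^ ?m"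
    using \<theta> mt by (intro mult_right_mono) auto
  also have "\<dots> = (1 - \<theta>\<^sup>2) ^ ?m" by (simp add: power_mult_distrib[symmetric] power2_eq_square algebra_simps)
  also have "\<dots> \<le> 1" using \<theta> by (intro power_le_one) (auto simp: power2_eq_square mult_le_one)
  finally have 3: "(1 + card I) * (1 - \<theta>) ^ ?m \<le> 1" .
  have "\<rho> * (1 - \<theta>) > 0" using q q0 by linarith
  then have p: "\<rho> > 0" using \<rho>0 by (cases "\<rho> = 0") auto
  have "card I * q ^ ?m < card I * (\<rho> * (1 - \<theta>)) ^ ?m"
    using q q0 cI s by (intro mult_strict_left_mono power_strict_mono) auto
  also have "\<dots> = \<rho> ^ ?m * (card I * (1 - \<theta>) ^ ?m)" by (simp add: power_mult_distrib)
  also have "\<dots> \<le> \<rho> ^ ?m * 1"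
  proof (rule mult_left_mono)
    have "0 \<le> (1 - \<theta>) ^ ?m" using \<theta> by simp
    then show "card I * (1 - \<theta>) ^ ?m \<le> 1" using 3 by (simp add: algebra_simps)
  qed (use p in simp)
  finally show False using 2 by simp
qed

section \<open>Quadratic forms of regular graphs\<close>

definition mtrace :: "'a :: comm_semiring_1 mat \<Rightarrow> 'a" where
  "mtrace A = (\<Sum>i<dim_row A. A $$ (i, i))"

lemma mtrace_mult_commute:
  assumes "A \<in> carrier_mat n n" "B \<in> carrier_mat n n"
  shows "mtrace (A * B) = mtrace (B * A)"
proof -
  have "mtrace (A * B) = (\<Sum>i<n. \<Sum>j<n. A $$ (i, j) * B $$ (j, i))"
    using assms by (simp add: mtrace_def scalar_prod_def lessThan_atLeast0)
  also have "\<dots> = (\<Sum>j<n. \<Sum>i<n. B $$ (j, i) * A $$ (i, j))"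
    by (subst sum.swap) (simp add: mult.commute)
  also have "\<dots> = mtrace (B * A)"
    using assms by (simp add: mtrace_def scalar_prod_def lessThan_atLeast0)
  finally show ?thesis .
qed

lemma mtrace_similar:
  assumes "similar_mat_wit A B P Q" "A \<in> carrier_mat n n"
  shows "mtrace A = mtrace B"
proof -
  from similar_mat_witD2[OF assms(2,1)]
  have w: "P * Q = 1\<^sub>m n" "Q * P = 1\<^sub>m n" "A = P * B * Q" "B \<in> carrier_mat n n" "P \<in> carrier_mat n n" "Q \<in> carrier_mat n n"
    by auto
  have "mtrace A = mtrace (P * (B * Q))" using w by (simp add: assoc_mult_mat)
  also have "\<dots> = mtrace ((B * Q) * P)" using w by (intro mtrace_mult_commute) auto
  also have "(B * Q) * P = B" using w by (simp add: assoc_mult_mat)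
  finally show ?thesis .
qed

lemma upper_triangular_mult:
  assumes "A \<in> carrier_mat n n" "B \<in> carrier_mat n n" "upper_triangular A" "upper_triangular B"
  shows "upper_triangular (A * B) \<and> (\<forall>i<n. (A * B) $$ (i, i) = A $$ (i, i) * B $$ (i, i))"
proof -
  have z: "A $$ (i, j) = 0" if "i < n" "j < i" for i j using assms that by auto
  have z': "B $$ (i, j) = 0" if "i < n" "j < i" for i j using assms that by auto
  have e: "(A * B) $$ (i, j) = (\<Sum>l<n. A $$ (i, l) * B $$ (l, j))" if "i < n" "j < n" for i j
    using assms that by (simp add: scalar_prod_def lessThan_atLeast0)
  have "(A * B) $$ (i, j) = 0" if "i < n" "j < i" for i j
  proof -
    have "A $$ (i, l) * B $$ (l, j) = 0" if "l < n" for l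
      using z[of i l] z'[of l j] that \<open>i < n\<close> \<open>j < i\<close> by (cases "l < i") auto
    then show ?thesis using e[of i j] that by simp
  qed
  moreover have "(A * B) $$ (i, i) = A $$ (i, i) * B $$ (i, i)" if "i < n" for i
  proof -
    have "(\<Sum>l<n. A $$ (i, l) * B $$ (l, i)) = (\<Sum>l<n. if l = i then A $$ (i, i) * B $$ (i, i) else 0)"
    proof (intro sum.cong refl)
      fix l assume "l \<in> {..<n}"
      then show "A $$ (i, l) * B $$ (l, i) = (if l = i then A $$ (i, i) * B $$ (i, i) else 0)"
        using z[of i l] z'[of l i] that by (cases l i rule: linorder_cases) auto
    qed
    then show ?thesis using e[of i i] that by simp
  qed
  ultimately show ?thesis using assms by auto
qed

lemma upper_triangular_pow:
  fixes B :: "'a :: comm_ring_1 mat"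
  assumes "B \<in> carrier_mat n n" "upper_triangular B"
  shows "upper_triangular (B ^\<^sub>m r) \<and> (\<forall>i<n. (B ^\<^sub>m r) $$ (i, i) = (B $$ (i, i)) ^ r)"
proof (induction r)
  case 0
  then show ?case using assms by auto
next
  case (Suc r)
  have "B ^\<^sub>m r \<in> carrier_mat n n" using assms by simp
  from upper_triangular_mult[OF this assms(1) conjunct1[OF Suc] assms(2)] Suc
  show ?case by (simp add: mult.commute)
qed

lemma mtrace_pow_eigenvalues:
  fixes A :: "real mat"
  assumes A: "A \<in> carrier_mat n n" and c: "char_poly A = (\<Prod>e\<leftarrow>es. [:- e, 1:])"
  shows "mtrace (A ^\<^sub>m r) = (\<Sum>e\<leftarrow>es. e ^ r)"
proof -
  obtain B P Q where s: "schur_decomposition A es = (B, P, Q)" by (cases "schur_decomposition A es") auto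
  from schur_decomposition[OF A c s]
  have w: "similar_mat_wit A B P Q" "upper_triangular B" "diag_mat B = es" by auto
  have B: "B \<in> carrier_mat n n" using similar_mat_witD2[OF A w(1)] by auto
  have "mtrace (A ^\<^sub>m r) = mtrace (B ^\<^sub>m r)"
    using A by (intro mtrace_similar[OF similar_mat_wit_pow[OF w(1)]]) auto
  also have "\<dots> = (\<Sum>i<n. (B $$ (i, i)) ^ r)"
    using upper_triangular_pow[OF B w(2), of r] B by (simp add: mtrace_def)
  also have "\<dots> = (\<Sum>e\<leftarrow>diag_mat B. e ^ r)"
    using B by (simp add: diag_mat_def o_def interv_sum_list_conv_sum_set_nat lessThan_atLeast0)
  finally show ?thesis using w(3) by simp
qed

lemma real_symmetric_eigenvalue_real:
  fixes A :: "real mat"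
  assumes A: "A \<in> carrier_mat n n" and sym: "\<And>i j. i < n \<Longrightarrow> j < n \<Longrightarrow> A $$ (i, j) = A $$ (j, i)"
    and ev: "eigenvalue (map_mat complex_of_real A) e"
  shows "e \<in> \<real>"
proof -
  let ?A = "map_mat complex_of_real A"
  obtain v where v: "v \<in> carrier_vec n" "v \<noteq> 0\<^sub>v n" "?A *\<^sub>v v = e \<cdot>\<^sub>v v"
    using ev A by (auto simp: eigenvalue_def eigenvector_def)
  have eq: "(\<Sum>j<n. of_real (A $$ (i, j)) * v $ j) = e * v $ i" if "i < n" for i
  proof -
    have "(?A *\<^sub>v v) $ i = (\<Sum>j<n. of_real (A $$ (i, j)) * v $ j)"
      using that A v(1) by (simp add: scalar_prod_def lessThan_atLeast0)
    then show ?thesis using v that by simp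
  qed
  define N where "N = (\<Sum>i<n. (cmod (v $ i))\<^sup>2)"
  have N0: "N \<noteq> 0"
  proof
    assume "N = 0"
    then have z: "v $ i = 0" if "i < n" for i using that unfolding N_def by (simp add: sum_nonneg_eq_0_iff)
    have "v = 0\<^sub>v n" by (rule eq_vecI) (use z v(1) in auto)
    then show False using v(2) by simp
  qed
  let ?q = "\<Sum>i<n. \<Sum>j<n. cnj (v $ i) * of_real (A $$ (i, j)) * v $ j"
  have "?q = (\<Sum>i<n. cnj (v $ i) * (e * v $ i))"
    by (intro sum.cong refl) (simp add: eq[symmetric] sum_distrib_left mult.assoc)
  also have "\<dots> = (\<Sum>i<n. e * complex_of_real ((cmod (v $ i))\<^sup>2))"
    by (intro sum.cong refl) (simp only: complex_norm_square mult_ac)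
  also have "\<dots> = e * of_real N"
    by (simp add: N_def sum_distrib_left)
  finally have q: "?q = e * of_real N" .
  have "cnj ?q = (\<Sum>i<n. \<Sum>j<n. cnj (v $ j) * of_real (A $$ (i, j)) * v $ i)"
    by (simp add: mult_ac)
  also have "\<dots> = (\<Sum>j<n. \<Sum>i<n. cnj (v $ j) * of_real (A $$ (i, j)) * v $ i)" by (rule sum.swap)
  also have "\<dots> = ?q" using sym by (intro sum.cong refl) auto
  finally have "cnj e * of_real N = e * of_real N" using q by simp
  then have "cnj e = e" using N0 by simp
  then show ?thesis by (simp add: Reals_cnj_iff)
qed

lemma real_symmetric_char_poly_splits:
  fixes A :: "real mat"
  assumes A: "A \<in> carrier_mat n n" and sym: "\<And>i j. i < n \<Longrightarrow> j < n \<Longrightarrow> A $$ (i, j) = A $$ (j, i)"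
  obtains es where "char_poly A = (\<Prod>e\<leftarrow>es. [:- e, 1:])" "length es = n"
proof -
  let ?A = "map_mat complex_of_real A"
  have cA: "?A \<in> carrier_mat n n" using A by simp
  obtain as where as: "char_poly ?A = (\<Prod>a\<leftarrow>as. [:- a, 1:])" "length as = n"
    using char_poly_factorized[OF cA] by auto
  have re: "a = of_real (Re a)" if "a \<in> set as" for a
  proof -
    have "poly (char_poly ?A) a = 0" using that unfolding as(1) poly_prod_list by (force simp: prod_list_zero_iff)
    then have "a \<in> \<real>" using real_symmetric_eigenvalue_real[OF A sym] eigenvalue_root_char_poly[OF cA] by blast
    then show ?thesis by (simp add: of_real_Re)
  qed
  interpret mp: map_poly_inj_comm_ring_hom complex_of_real ..
  have "map_poly complex_of_real (char_poly A) = (\<Prod>a\<leftarrow>as. [:- a, 1:])"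
    unfolding as(1)[symmetric] by (rule of_real_hom.char_poly_hom[OF A, symmetric])
  also have "\<dots> = (\<Prod>a\<leftarrow>as. map_poly complex_of_real [:- Re a, 1:])"
    using re by (intro arg_cong[of _ _ prod_list] map_cong refl) simp
  also have "\<dots> = map_poly complex_of_real (\<Prod>a\<leftarrow>as. [:- Re a, 1:])"
    by (simp add: mp.hom_prod_list o_def)
  finally have "char_poly A = (\<Prod>a\<leftarrow>as. [:- Re a, 1:])" by simp
  then have "char_poly A = (\<Prod>e\<leftarrow>map Re as. [:- e, 1:])" by (simp add: o_def)
  then show ?thesis using that[of "map Re as"] as(2) by simp
qed

lemma mat_app_power_pow_mat:
  fixes A :: "real mat"
  assumes A: "A \<in> carrier_mat n n" and "i < n"
  shows "(mat_app {..<n} (\<lambda>i j. A $$ (i, j)) ^^ r) x i = (\<Sum>j<n. (A ^\<^sub>m r) $$ (i, j) * x j)"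
  using assms(2)
proof (induction r arbitrary: x i)
  case 0
  have "(\<Sum>j<n. (1\<^sub>m n) $$ (i, j) * x j) = (\<Sum>j<n. if j = i then x j else 0)"
    using 0 by (intro sum.cong) auto
  then show ?case using 0 A by simp
next
  case (Suc r)
  let ?f = "mat_app {..<n} (\<lambda>i j. A $$ (i, j))"
  have "(?f ^^ Suc r) x i = (?f ^^ r) (?f x) i" by (simp add: funpow_swap1)
  also have "\<dots> = (\<Sum>j<n. (A ^\<^sub>m r) $$ (i, j) * (\<Sum>l<n. A $$ (j, l) * x l))"
    unfolding Suc.IH[OF Suc.prems] by (simp add: mat_app_def)
  also have "\<dots> = (\<Sum>j<n. \<Sum>l<n. (A ^\<^sub>m r) $$ (i, j) * A $$ (j, l) * x l)"
    by (simp add: sum_distrib_left mult.assoc)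
  also have "\<dots> = (\<Sum>l<n. (\<Sum>j<n. (A ^\<^sub>m r) $$ (i, j) * A $$ (j, l)) * x l)"
    by (subst sum.swap) (simp add: sum_distrib_right)
  also have "\<dots> = (\<Sum>l<n. (A ^\<^sub>m Suc r) $$ (i, l) * x l)"
    using A Suc.prems by (intro sum.cong refl) (simp add: scalar_prod_def lessThan_atLeast0)
  finally show ?case .
qed

lemma pow_trace_eigenvalues:
  fixes A :: "real mat"
  assumes A: "A \<in> carrier_mat n n" and c: "char_poly A = (\<Prod>e\<leftarrow>es. [:- e, 1:])"
  shows "pow_trace {..<n} (\<lambda>i j. A $$ (i, j)) r = (\<Sum>e\<leftarrow>es. e ^ r)"
proof -
  have "pow_trace {..<n} (\<lambda>i j. A $$ (i, j)) r = (\<Sum>i<n. \<Sum>j<n. (A ^\<^sub>m r) $$ (i, j) * unit_at i j)"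
    unfolding pow_trace_diag[OF finite_lessThan] by (intro sum.cong refl mat_app_power_pow_mat[OF A]) simp
  also have "\<dots> = (\<Sum>i<n. \<Sum>j<n. if j = i then (A ^\<^sub>m r) $$ (i, i) else 0)"
    by (intro sum.cong refl) (auto simp: unit_at_def)
  also have "\<dots> = mtrace (A ^\<^sub>m r)" using A by (simp add: mtrace_def)
  finally show ?thesis using mtrace_pow_eigenvalues[OF A c] by simp
qed

text \<open>
  The trace of \<open>A ^ (2 r)\<close> minus the contribution \<open>d ^ (2 r)\<close> of the constant vector dominates the
  quadratic form of \<open>A ^ (2 r)\<close> on the complement of the constant vectors; letting \<open>r\<close> grow
  isolates the second largest modulus of an eigenvalue.
\<close>

lemma regular_quadratic_form_bound:
  fixes A :: "real mat"
  assumes A: "A \<in> carrier_mat n n" and sym: "\<And>i j. i < n \<Longrightarrow> j < n \<Longrightarrow> A $$ (i, j) = A $$ (j, i)"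
    and nn: "\<And>i j. i < n \<Longrightarrow> j < n \<Longrightarrow> 0 \<le> A $$ (i, j)"
    and reg: "\<And>i. i < n \<Longrightarrow> (\<Sum>j<n. A $$ (i, j)) = d" and n: "0 < n"
    and lam: "0 \<le> lam" "\<forall>x \<in># proots (char_poly A) - {#Max (set_mset (proots (char_poly A)))#}. \<bar>x\<bar> \<le> lam"
    and v: "(\<Sum>i<n. v i) = 0"
  shows "\<bar>\<Sum>i<n. \<Sum>j<n. v i * A $$ (i, j) * v j\<bar> \<le> lam * (\<Sum>i<n. (v i)\<^sup>2)"
proof -
  obtain es where es: "char_poly A = (\<Prod>e\<leftarrow>es. [:- e, 1:])" "length es = n"
    using real_symmetric_char_poly_splits[OF A sym] .
  have nz: "(\<Prod>e\<leftarrow>es. [:- e, 1:]) \<noteq> 0" for es :: "real list" by (auto simp: prod_list_zero_iff)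
  have "proots (\<Prod>e\<leftarrow>es. [:- e, 1:]) = mset es" for es :: "real list"
  proof (induction es)
    case (Cons e es)
    have "proots (\<Prod>e\<leftarrow>e # es. [:- e, 1:]) = proots [:- e, 1:] + proots (\<Prod>e\<leftarrow>es. [:- e, 1:])"
      unfolding list.map prod_list.Cons by (rule proots_mult) (use nz[of es] in auto)
    then show ?case using Cons by simp
  qed simp
  then have spec: "proots (char_poly A) = mset es" using es by simp
  let ?M = "\<lambda>i j. A $$ (i, j)" let ?I = "{..<n}" let ?f = "mat_app ?I ?M"
  have symM: "sym_on ?I ?M" using sym by (simp add: sym_on_def)
  have ev_iff: "eigenvalue A e \<longleftrightarrow> e \<in> set es" for e
    unfolding eigenvalue_root_char_poly[OF A] es(1) poly_prod_list by (auto simp: prod_list_zero_iff)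
  have d0: "0 \<le> d" using reg[OF n] nn[OF n] by (metis lessThan_iff sum_nonneg)
  have "eigenvector A (vec n (\<lambda>_. 1)) d"
    unfolding eigenvector_def
  proof (intro conjI)
    show "A *\<^sub>v vec n (\<lambda>_. 1) = d \<cdot>\<^sub>v vec n (\<lambda>_. 1)"
    proof (rule eq_vecI)
      fix i assume "i < dim_vec (d \<cdot>\<^sub>v vec n (\<lambda>_. 1 :: real))"
      then have i: "i < n" by simp
      have "(A *\<^sub>v vec n (\<lambda>_. 1)) $ i = (\<Sum>j<n. A $$ (i, j))"
        using i A by (simp add: scalar_prod_def lessThan_atLeast0)
      then show "(A *\<^sub>v vec n (\<lambda>_. 1)) $ i = (d \<cdot>\<^sub>v vec n (\<lambda>_. 1)) $ i"
        using reg[OF i] i by simp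
    qed (use A in simp)
    have "vec n (\<lambda>_. 1 :: real) $ 0 \<noteq> (0\<^sub>v n :: real vec) $ 0" using n by simp
    then show "vec n (\<lambda>_. 1 :: real) \<noteq> 0\<^sub>v (dim_row A)" using A by auto
  qed (use A in auto)
  then have d_in: "d \<in> set es" using ev_iff unfolding eigenvalue_def by blast
  \<comment> \<open>Compare both sides of the eigenvalue equation at a coordinate of largest
    modulus. This identifies \<open>d\<close> as the largest eigenvalue, the one exempt from the
    bound.\<close>
  have le_d: "\<bar>e\<bar> \<le> d" if e_in: "e \<in> set es" for e
  proof -
    obtain x where x: "x \<in> carrier_vec n" "x \<noteq> 0\<^sub>v n" "A *\<^sub>v x = e \<cdot>\<^sub>v x"
      using e_in ev_iff[of e] A by (auto simp: eigenvalue_def eigenvector_def)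
    obtain i where i: "i < n" "\<And>j. j < n \<Longrightarrow> \<bar>x $ j\<bar> \<le> \<bar>x $ i\<bar>"
    proof -
      have "\<exists>i\<in>{..<n}. \<forall>j\<in>{..<n}. \<bar>x $ j\<bar> \<le> \<bar>x $ i\<bar>"
      proof -
        have f: "finite ((\<lambda>j. \<bar>x $ j\<bar>) ` {..<n})" "(\<lambda>j. \<bar>x $ j\<bar>) ` {..<n} \<noteq> {}" using n by auto
        from Max_in[OF f] obtain i where "i < n" "Max ((\<lambda>j. \<bar>x $ j\<bar>) ` {..<n}) = \<bar>x $ i\<bar>" by auto
        then show ?thesis using f by (metis Max_ge imageI lessThan_iff)
      qed
      then show ?thesis using that by auto
    qed
    have pos: "0 < \<bar>x $ i\<bar>"
    proof (rule ccontr)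
      assume "\<not> ?thesis"
      then have z: "x $ j = 0" if "j < n" for j using i(2)[OF that] by simp
      have "x = 0\<^sub>v n" by (rule eq_vecI) (use z x(1) in auto)
      then show False using x(2) by simp
    qed
    have "e * x $ i = (\<Sum>j<n. A $$ (i, j) * x $ j)"
    proof -
      have "(A *\<^sub>v x) $ i = (\<Sum>j<n. A $$ (i, j) * x $ j)"
        using i(1) A x(1) by (simp add: scalar_prod_def lessThan_atLeast0)
      then show ?thesis using x i(1) by simp
    qed
    then have "\<bar>e\<bar> * \<bar>x $ i\<bar> = \<bar>\<Sum>j<n. A $$ (i, j) * x $ j\<bar>" by (metis abs_mult)
    also have "\<dots> \<le> (\<Sum>j<n. A $$ (i, j) * \<bar>x $ i\<bar>)"
      using i nn by (intro order.trans[OF sum_abs] sum_mono) (auto simp: abs_mult intro!: mult_left_mono)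
    also have "\<dots> = d * \<bar>x $ i\<bar>" using reg[OF i(1)] by (simp flip: sum_distrib_right)
    finally show ?thesis using pos by simp
  qed
  have mx: "Max (set es) = d"
    using d_in le_d by (intro Max_eqI) (auto dest: le_d)
  \<comment> \<open>Only one copy of \<open>d\<close> is removed; further copies, as in a
    disconnected graph, stay in \<open>es'\<close> and are subject to the bound
    \<open>lam\<close>.\<close>
  obtain es' where es': "mset es = add_mset d (mset es')"
    using d_in by (metis ex_mset insert_DiffM set_mset_mset)
  have small: "\<bar>e\<bar> \<le> lam" if "e \<in> set es'" for e
  proof -
    have "proots (char_poly A) - {#Max (set_mset (proots (char_poly A)))#} = mset es'"
      unfolding spec set_mset_mset mx unfolding es' by simp
    then show ?thesis using lam(2) that by simp
  qed
  have len: "length es' \<le> n" using es(2) es' by (metis Suc_n_not_le_n nat_le_linear size_add_mset size_mset)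
  have tr: "pow_trace ?I ?M (2 * r) - d ^ (2 * r) \<le> n * lam ^ (2 * r)" for r
  proof -
    have "pow_trace ?I ?M (2 * r) = (\<Sum>e\<in>#mset es. e ^ (2 * r))"
      using pow_trace_eigenvalues[OF A es(1)] by (simp flip: sum_mset_sum_list)
    also have "\<dots> = d ^ (2 * r) + (\<Sum>e\<leftarrow>es'. e ^ (2 * r))" by (simp add: es' flip: sum_mset_sum_list)
    also have "(\<Sum>e\<leftarrow>es'. e ^ (2 * r)) \<le> (\<Sum>e\<leftarrow>es'. lam ^ (2 * r))"
    proof (rule sum_list_mono)
      fix e assume "e \<in> set es'"
      then show "e ^ (2 * r) \<le> lam ^ (2 * r)"
        using power_mono[OF small[of e], of "2 * r"] by (simp add: power_even_abs)
    qed
    also have "\<dots> = length es' * lam ^ (2 * r)" by (simp add: sum_list_triv)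
    also have "\<dots> \<le> n * lam ^ (2 * r)" using len lam(1) by (intro mult_right_mono) auto
    finally show ?thesis by simp
  qed
  have one_pow: "inner_on ?I (\<lambda>_. 1) ((?f ^^ r) x) = d ^ r * (\<Sum>i<n. x i)" for r x
  proof (induction r)
    case (Suc r)
    have "inner_on ?I (\<lambda>_. 1) (?f y) = d * inner_on ?I (\<lambda>_. 1) y" for y
    proof -
      have "inner_on ?I (\<lambda>_. 1) (?f y) = inner_on ?I (?f (\<lambda>_. 1)) y" by (rule self_adjoint[OF symM])
      also have "\<dots> = inner_on ?I (\<lambda>_. d) y" using reg by (intro inner_on_cong) (auto simp: mat_app_def)
      finally show ?thesis by (simp add: inner_on_def sum_distrib_left)
    qed
    then show ?case using Suc by simp
  qed (simp add: inner_on_def)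
  have quad: "moment ?I ?M v (2 * r) \<le> inner_on ?I v v * (n * lam ^ (2 * r))" for r
  proof -
    \<comment> \<open>The columns of \<open>A ^ r\<close> minus their mean. The entries of
      \<open>v\<close> sum to 0, so this changes nothing in the action on \<open>v\<close>, while it
      lowers the Hilbert-Schmidt norm by exactly the contribution of \<open>d\<close>.\<close>
    define F where "F j = (\<lambda>i. (?f ^^ r) (unit_at j) i - d ^ r / n * 1)" for j
    have FF: "inner_on ?I (F j) (F j) = moment ?I ?M (unit_at j) (2 * r) - d ^ (2 * r) / n" if "j < n" for j
    proof -
      have u: "(\<Sum>i<n. unit_at j i) = (1::real)" using that by (simp add: unit_at_def)
      have 1: "inner_on ?I (\<lambda>_. 1) ((?f ^^ r) (unit_at j)) = d ^ r" using one_pow[of r "unit_at j"] u by simp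
      have 2: "inner_on ?I ((?f ^^ r) (unit_at j)) (\<lambda>_. 1) = d ^ r" using 1 by (simp add: inner_on_commute)
      have 3: "inner_on ?I (\<lambda>_. 1) (\<lambda>_. 1) = n" by (simp add: inner_on_def)
      show ?thesis unfolding F_def inner_on_diff_scale 1 2 3 moment_even[OF symM] using n
        by (simp add: field_simps power2_eq_square flip: power_add mult_2)
    qed
    have "inner_on ?I ((?f ^^ r) v) ((?f ^^ r) v) \<le> inner_on ?I v v * (\<Sum>j\<in>?I. inner_on ?I (F j) (F j))"
    proof (rule norm_combination_le)
      fix i assume "i \<in> ?I"
      then have "(?f ^^ r) v i = (\<Sum>j\<in>?I. (?f ^^ r) (unit_at j) i * v j)"
        by (rule mat_app_power_expand[OF finite_lessThan])
      also have "\<dots> = (\<Sum>j\<in>?I. F j i * v j) + d ^ r / n * (\<Sum>j<n. v j)"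
        by (simp add: F_def left_diff_distrib sum_subtractf sum_distrib_left)
      finally show "(?f ^^ r) v i = (\<Sum>j\<in>?I. F j i * v j)" using v by simp
    qed
    also have "(\<Sum>j\<in>?I. inner_on ?I (F j) (F j)) = pow_trace ?I ?M (2 * r) - d ^ (2 * r)"
      using FF n by (simp add: sum_subtractf pow_trace_def)
    also have "inner_on ?I v v * (pow_trace ?I ?M (2 * r) - d ^ (2 * r)) \<le> inner_on ?I v v * (n * lam ^ (2 * r))"
      by (rule mult_left_mono[OF tr inner_on_self_nonneg])
    finally show ?thesis unfolding moment_even[OF symM] .
  qed
  let ?N = "inner_on ?I v v" let ?q = "inner_on ?I v (?f v)"
  have res: "\<bar>?q\<bar> \<le> lam * ?N"
  proof (cases "?N = 0")
    case True
    then have "?q\<^sup>2 \<le> 0" using cauchy_schwarz_on[of ?I v "?f v"] by simp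
    then show ?thesis using True by simp
  next
    case False
    then have N: "0 < ?N" using inner_on_self_nonneg[of ?I v] by linarith
    \<comment> \<open>\<open>A\<close> need not be positive semidefinite, so only even moments are
      used; they are the moments of its square.\<close>
    let ?M2 = "\<lambda>r. moment ?I ?M v (2 * r)"
    have ms: "moment_seq ?M2"
      unfolding moment_seq_def
    proof (intro allI)
      fix r :: nat and t :: real
      let ?a = "(?f ^^ r) v" let ?b = "(?f ^^ (r + 2)) v"
      have *: "inner_on ?I ((?f ^^ a) v) ((?f ^^ b) v) = moment ?I ?M v (a + b)" for a b
        by (simp add: self_adjoint_power[OF symM] moment_def)
      have "0 \<le> inner_on ?I (\<lambda>i. ?a i - t * ?b i) (\<lambda>i. ?a i - t * ?b i)" by (rule inner_on_self_nonneg)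
      also have "\<dots> = moment ?I ?M v (r + r) - t * moment ?I ?M v (r + (r + 2)) -
          t * (moment ?I ?M v (r + 2 + r) - t * moment ?I ?M v (r + 2 + (r + 2)))"
        unfolding inner_on_diff_scale * by simp
      also have "\<dots> = ?M2 r - 2 * t * ?M2 (r + 1) + t\<^sup>2 * ?M2 (r + 2)"
      proof -
        have "r + r = 2 * r" "r + (r + 2) = 2 * (r + 1)" "r + 2 + r = 2 * (r + 1)" "r + 2 + (r + 2) = 2 * (r + 2)"
          by simp_all
        then show ?thesis by (simp only:) (simp add: power2_eq_square algebra_simps)
      qed
      finally show "0 \<le> ?M2 r - 2 * t * ?M2 (r + 1) + t\<^sup>2 * ?M2 (r + 2)" .
    qed
    define c where "c = ?q / ?N"
    have m0: "?M2 0 = ?N" by (simp add: moment_def)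
    have c2: "c\<^sup>2 \<le> ?M2 1 / ?M2 0"
    proof -
      have "?q\<^sup>2 \<le> ?N * ?M2 1"
        using cauchy_schwarz_on[of ?I v "?f v"] moment_even[OF symM, of v 1] by simp
      then show ?thesis using N m0 by (simp add: c_def field_simps power2_eq_square)
    qed
    have key: "(c\<^sup>2) ^ r \<le> n * (lam\<^sup>2) ^ r" for r
    proof -
      have "?N * (c\<^sup>2) ^ r \<le> ?N * (?M2 1 / ?M2 0) ^ r"
        using c2 N by (intro mult_left_mono power_mono) auto
      also have "\<dots> \<le> ?M2 r" using moment_seq_lower[OF ms, of r] N m0 by simp
      also have "\<dots> \<le> ?N * (n * (lam\<^sup>2) ^ r)" using quad[of r] by (simp add: power_mult)
      finally show ?thesis using N by simp
    qed
    have "c\<^sup>2 \<le> lam\<^sup>2"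
    proof (rule ccontr)
      assume "\<not> ?thesis"
      then have gt: "lam\<^sup>2 < c\<^sup>2" by simp
      show False
      proof (cases "lam = 0")
        case True
        then show False using key[of 1] gt by simp
      next
        case False
        then have l: "0 < lam\<^sup>2" by simp
        have "1 < c\<^sup>2 / lam\<^sup>2" using gt l by simp
        then obtain r where "real n < (c\<^sup>2 / lam\<^sup>2) ^ r" using real_arch_pow by blast
        then show False using key[of r] l by (simp add: power_divide field_simps)
      qed
    qed
    then have "\<bar>c\<bar> \<le> lam" using lam(1) by (metis abs_le_square_iff abs_of_nonneg)
    then show ?thesis using N by (simp add: c_def abs_divide field_simps)
  qed
  have "?q = (\<Sum>i<n. \<Sum>j<n. v i * A $$ (i, j) * v j)" by (rule inner_on_mat_app)
  moreover have "?N = (\<Sum>i<n. (v i)\<^sup>2)" by (simp add: inner_on_def power2_eq_square)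
  ultimately show ?thesis using res by simp
qed

section \<open>The drift-plus-penalty iteration\<close>

definition pos :: "'b :: linordered_idom \<Rightarrow> 'b" where
  "pos x = max 0 x"

lemma pos_nonneg: "0 \<le> pos x" by (simp add: pos_def)
lemma pos_le: "\<bar>x\<bar> \<le> b \<Longrightarrow> pos x \<le> b" for x :: "'b :: linordered_idom"
  using abs_ge_zero[of x] abs_ge_self[of x] by (auto simp: pos_def)
lemma of_int_pos: "of_int (pos x) = pos (of_int x :: 'b :: linordered_idom)" by (simp add: pos_def max_def)

text \<open>As \<open>x \<le> pos x\<close>, the positive part of \<open>x - y\<close> is at most
  \<open>\<bar>pos x - y\<bar>\<close>. With a violation \<open>x\<close> and a slack
  \<open>y\<close> this is the estimate for one step of the potential.\<close>

lemma pos_diff_square: "(pos (x - y))\<^sup>2 \<le> (pos x)\<^sup>2 - 2 * (pos x * y) + y\<^sup>2" for x y :: real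
proof -
  have "(pos (x - y))\<^sup>2 \<le> (pos x - y)\<^sup>2"
  proof (cases "0 \<le> x")
    case True
    then show ?thesis by (auto simp: pos_def max_def)
  next
    case False
    then show ?thesis by (auto simp: pos_def max_def abs_le_square_iff[symmetric])
  qed
  then show ?thesis by (simp add: power2_eq_square algebra_simps)
qed

definition row_excess :: "nat \<Rightarrow> 'b \<Rightarrow> (nat \<Rightarrow> nat \<Rightarrow> 'b :: linordered_idom) \<Rightarrow> nat \<Rightarrow> 'b" where
  "row_excess n k Z i = pos ((\<Sum>l<n. Z i l) - k * Z i i)"

text \<open>For trace \<open>k\<close> this is the constraint that diagonal entries are at most 1.
  In the homogeneous form it applies to an accumulated sum of responses as well as to their
  average.\<close>

definition diag_excess :: "nat \<Rightarrow> 'b \<Rightarrow> (nat \<Rightarrow> nat \<Rightarrow> 'b :: linordered_idom) \<Rightarrow> nat \<Rightarrow> 'b" where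
  "diag_excess n k Z i = pos (k * Z i i - (\<Sum>l<n. Z l l))"

text \<open>
  Twice the objective matrix, with weight \<open>H\<close>, plus the symmetrised constraint matrices weighted by
  their current violations. The constraints are \<open>Z\<^sub>i\<^sub>j \<ge> 0\<close>, \<open>Z\<^sub>i\<^sub>j \<le> Z\<^sub>i\<^sub>i\<close>,
  \<open>\<Sum>\<^sub>j Z\<^sub>i\<^sub>j \<le> k Z\<^sub>i\<^sub>i\<close> and \<open>k Z\<^sub>i\<^sub>i \<le> tr Z\<close>.
\<close>

definition drift :: "nat \<Rightarrow> 'b \<Rightarrow> 'b \<Rightarrow> (nat \<Rightarrow> nat \<Rightarrow> 'b) \<Rightarrow> (nat \<Rightarrow> nat \<Rightarrow> 'b :: linordered_idom) \<Rightarrow> nat \<Rightarrow> nat \<Rightarrow> 'b" where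
  "drift n k H a Z i j = 2 * H * a i j + 2 * pos (- Z i j) - pos (Z i j - Z i i) - pos (Z j i - Z j j)
     - row_excess n k Z i - row_excess n k Z j
     + (if i = j then 2 * (\<Sum>l<n. pos (Z i l - Z i i)) + 2 * k * row_excess n k Z i
          - 2 * k * diag_excess n k Z i + 2 * (\<Sum>l<n. diag_excess n k Z l) else 0)"

lemma of_int_drift:
  "real_of_int (drift n k H a Z i j) =
     drift n (of_int k) (of_int H) (\<lambda>i j. of_int (a i j)) (\<lambda>i j. of_int (Z i j)) i j"
  by (simp add: drift_def row_excess_def diag_excess_def of_int_pos)

text \<open>A quadratic Lyapunov function: \<open>drift\<close> is \<open>2 * H * a\<close> minus
  the symmetrised gradient of this function at \<open>Z\<close>.\<close>

definition potential :: "nat \<Rightarrow> real \<Rightarrow> (nat \<Rightarrow> nat \<Rightarrow> real) \<Rightarrow> real" where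
  "potential n k Z = (\<Sum>i<n. \<Sum>j<n. (pos (- Z i j))\<^sup>2) + (\<Sum>i<n. \<Sum>j<n. (pos (Z i j - Z i i))\<^sup>2) +
     (\<Sum>i<n. (row_excess n k Z i)\<^sup>2) + (\<Sum>i<n. (diag_excess n k Z i)\<^sup>2)"

definition dot :: "nat \<Rightarrow> (nat \<Rightarrow> nat \<Rightarrow> real) \<Rightarrow> (nat \<Rightarrow> nat \<Rightarrow> real) \<Rightarrow> real" where
  "dot n A B = (\<Sum>i<n. \<Sum>j<n. A i j * B i j)"

lemma sum_diagonal: "(\<Sum>i<n. \<Sum>j<n. (if i = j then c i else 0) * V i j) = (\<Sum>i<n. c i * V i i)"
  for c :: "nat \<Rightarrow> real"
proof (intro sum.cong refl)
  fix i assume "i \<in> {..<n}"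
  have "(\<Sum>j<n. (if i = j then c i else 0) * V i j) = (\<Sum>j<n. if i = j then c i * V i j else 0)"
    by (intro sum.cong) auto
  then show "(\<Sum>j<n. (if i = j then c i else 0) * V i j) = c i * V i i"
    using \<open>i \<in> {..<n}\<close> by simp
qed

text \<open>Against a symmetric \<open>V\<close> the symmetrisation in \<open>drift\<close> is
  undone by swapping the indices, and every violation at \<open>Z\<close> ends up multiplied by the
  slack of the same constraint at \<open>V\<close>.\<close>

lemma dot_drift:
  assumes sym: "sym_on {..<n} V"
  shows "dot n (drift n k H a Z) V = 2 * H * dot n a V
    + 2 * (\<Sum>i<n. \<Sum>j<n. pos (- Z i j) * V i j)
    + 2 * (\<Sum>i<n. \<Sum>j<n. pos (Z i j - Z i i) * (V i i - V i j))
    + 2 * (\<Sum>i<n. row_excess n k Z i * (k * V i i - (\<Sum>j<n. V i j)))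
    + 2 * (\<Sum>i<n. diag_excess n k Z i * ((\<Sum>j<n. V j j) - k * V i i))"
proof -
  let ?t = "\<lambda>i j. pos (Z i j - Z i i)" and ?q = "row_excess n k Z" and ?p = "diag_excess n k Z"
  have sw: "(\<Sum>i<n. \<Sum>j<n. f j i * V i j) = (\<Sum>i<n. \<Sum>j<n. f i j * V i j)" for f
  proof -
    have "(\<Sum>i<n. \<Sum>j<n. f j i * V i j) = (\<Sum>i<n. \<Sum>j<n. f i j * V j i)" by (rule sum.swap)
    also have "\<dots> = (\<Sum>i<n. \<Sum>j<n. f i j * V i j)"
      using sym by (intro sum.cong refl) (auto simp: sym_on_def)
    finally show ?thesis .
  qed
  let ?c = "\<lambda>i. 2 * (\<Sum>l<n. ?t i l) + 2 * k * ?q i - 2 * k * ?p i + 2 * (\<Sum>l<n. ?p l)"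
  have "dot n (drift n k H a Z) V = (\<Sum>i<n. \<Sum>j<n. 2 * H * (a i j * V i j) + 2 * (pos (- Z i j) * V i j) - ?t i j * V i j
      - ?t j i * V i j - ?q i * V i j - ?q j * V i j + (if i = j then ?c i else 0) * V i j)"
    unfolding dot_def drift_def by (intro sum.cong refl) (simp add: algebra_simps)
  also have "\<dots> = 2 * H * dot n a V + 2 * (\<Sum>i<n. \<Sum>j<n. pos (- Z i j) * V i j) - (\<Sum>i<n. \<Sum>j<n. ?t i j * V i j)
     - (\<Sum>i<n. \<Sum>j<n. ?t j i * V i j) - (\<Sum>i<n. \<Sum>j<n. ?q i * V i j) - (\<Sum>i<n. \<Sum>j<n. ?q j * V i j)
     + (\<Sum>i<n. \<Sum>j<n. (if i = j then ?c i else 0) * V i j)"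
    unfolding dot_def by (simp only: sum.distrib sum_subtractf sum_distrib_left)
  also have "(\<Sum>i<n. \<Sum>j<n. ?t j i * V i j) = (\<Sum>i<n. \<Sum>j<n. ?t i j * V i j)" by (rule sw)
  also have "(\<Sum>i<n. \<Sum>j<n. ?q j * V i j) = (\<Sum>i<n. \<Sum>j<n. ?q i * V i j)" by (rule sw)
  also have "(\<Sum>i<n. \<Sum>j<n. ?q i * V i j) = (\<Sum>i<n. ?q i * (\<Sum>j<n. V i j))" by (simp add: sum_distrib_left)
  also have "(\<Sum>i<n. \<Sum>j<n. (if i = j then ?c i else 0) * V i j) =
      2 * (\<Sum>i<n. \<Sum>j<n. ?t i j * V i i) + 2 * (\<Sum>i<n. ?q i * (k * V i i)) - 2 * (\<Sum>i<n. ?p i * (k * V i i))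
      + 2 * (\<Sum>i<n. ?p i * (\<Sum>j<n. V j j))"
  proof -
    have "(\<Sum>i<n. (\<Sum>l<n. ?p l) * V i i) = (\<Sum>i<n. ?p i * (\<Sum>j<n. V j j))"
      by (simp flip: sum_distrib_left sum_distrib_right)
    moreover have "(\<Sum>i<n. ?c i * V i i) = 2 * (\<Sum>i<n. \<Sum>j<n. ?t i j * V i i) + 2 * (\<Sum>i<n. ?q i * (k * V i i))
       - 2 * (\<Sum>i<n. ?p i * (k * V i i)) + 2 * (\<Sum>i<n. (\<Sum>l<n. ?p l) * V i i)"
      by (simp add: sum_distrib_left sum_distrib_right sum.distrib sum_subtractf algebra_simps)
    ultimately show ?thesis unfolding sum_diagonal by simp
  qed
  finally show ?thesis
    by (simp only: right_diff_distrib sum_subtractf)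
qed

definition spread :: "nat \<Rightarrow> real \<Rightarrow> (nat \<Rightarrow> nat \<Rightarrow> real) \<Rightarrow> real" where
  "spread n k V = (\<Sum>i<n. \<Sum>j<n. (V i j)\<^sup>2) + (\<Sum>i<n. \<Sum>j<n. (V i i - V i j)\<^sup>2) +
     (\<Sum>i<n. (k * V i i - (\<Sum>j<n. V i j))\<^sup>2) + (\<Sum>i<n. ((\<Sum>j<n. V j j) - k * V i i)\<^sup>2)"

text \<open>\<open>pos_diff_square\<close> for each constraint: the first-order terms add up to the
  constraint part of \<open>dot_drift\<close>, and \<open>spread\<close> collects the squared
  slacks.\<close>

lemma potential_add:
  assumes "sym_on {..<n} V"
  shows "potential n k (\<lambda>i j. Z i j + V i j) \<le>
    potential n k Z - (dot n (drift n k H a Z) V - 2 * H * dot n a V) + spread n k V"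
proof -
  have 1: "(\<Sum>i<n. \<Sum>j<n. (pos (- (Z i j + V i j)))\<^sup>2) \<le>
     (\<Sum>i<n. \<Sum>j<n. (pos (- Z i j))\<^sup>2 - 2 * (pos (- Z i j) * V i j) + (V i j)\<^sup>2)"
    by (intro sum_mono) (use pos_diff_square in \<open>metis diff_conv_add_uminus minus_add_distrib\<close>)
  have 2: "(\<Sum>i<n. \<Sum>j<n. (pos ((Z i j + V i j) - (Z i i + V i i)))\<^sup>2) \<le>
     (\<Sum>i<n. \<Sum>j<n. (pos (Z i j - Z i i))\<^sup>2 - 2 * (pos (Z i j - Z i i) * (V i i - V i j)) + (V i i - V i j)\<^sup>2)"
  proof (intro sum_mono)
    fix i j
    have "(Z i j + V i j) - (Z i i + V i i) = (Z i j - Z i i) - (V i i - V i j)" by simp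
    then show "(pos ((Z i j + V i j) - (Z i i + V i i)))\<^sup>2 \<le>
      (pos (Z i j - Z i i))\<^sup>2 - 2 * (pos (Z i j - Z i i) * (V i i - V i j)) + (V i i - V i j)\<^sup>2"
      using pos_diff_square by metis
  qed
  have 3: "(\<Sum>i<n. (row_excess n k (\<lambda>i j. Z i j + V i j) i)\<^sup>2) \<le> (\<Sum>i<n. (row_excess n k Z i)\<^sup>2 -
     2 * (row_excess n k Z i * (k * V i i - (\<Sum>j<n. V i j))) + (k * V i i - (\<Sum>j<n. V i j))\<^sup>2)"
  proof (intro sum_mono)
    fix i
    have "(\<Sum>l<n. Z i l + V i l) - k * (Z i i + V i i) = ((\<Sum>l<n. Z i l) - k * Z i i) - (k * V i i - (\<Sum>j<n. V i j))"
      by (simp add: sum.distrib algebra_simps)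
    then show "(row_excess n k (\<lambda>i j. Z i j + V i j) i)\<^sup>2 \<le> (row_excess n k Z i)\<^sup>2 -
     2 * (row_excess n k Z i * (k * V i i - (\<Sum>j<n. V i j))) + (k * V i i - (\<Sum>j<n. V i j))\<^sup>2"
      unfolding row_excess_def using pos_diff_square by metis
  qed
  have 4: "(\<Sum>i<n. (diag_excess n k (\<lambda>i j. Z i j + V i j) i)\<^sup>2) \<le> (\<Sum>i<n. (diag_excess n k Z i)\<^sup>2 -
     2 * (diag_excess n k Z i * ((\<Sum>j<n. V j j) - k * V i i)) + ((\<Sum>j<n. V j j) - k * V i i)\<^sup>2)"
  proof (intro sum_mono)
    fix i
    have "k * (Z i i + V i i) - (\<Sum>l<n. Z l l + V l l) = (k * Z i i - (\<Sum>l<n. Z l l)) - ((\<Sum>j<n. V j j) - k * V i i)"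
      by (simp add: sum.distrib algebra_simps)
    then show "(diag_excess n k (\<lambda>i j. Z i j + V i j) i)\<^sup>2 \<le> (diag_excess n k Z i)\<^sup>2 -
     2 * (diag_excess n k Z i * ((\<Sum>j<n. V j j) - k * V i i)) + ((\<Sum>j<n. V j j) - k * V i i)\<^sup>2"
      unfolding diag_excess_def using pos_diff_square by metis
  qed
  show ?thesis
    using 1 2 3 4 unfolding potential_def spread_def dot_drift[OF assms]
    by (simp add: sum.distrib sum_subtractf sum_distrib_left)
qed

lemma potential_nonneg: "0 \<le> potential n k Z"
  unfolding potential_def by (intro add_nonneg_nonneg sum_nonneg) auto

lemma violations_le_potential:
  assumes "i < n" "j < n" "potential n k Z \<le> e\<^sup>2" "0 \<le> e"
  shows "- e \<le> Z i j" "Z i j \<le> Z i i + e" "(\<Sum>l<n. Z i l) \<le> k * Z i i + e" "k * Z i i \<le> (\<Sum>l<n. Z l l) + e"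
proof -
  have single: "f i \<le> (\<Sum>i<n. f i)" if "\<And>i. 0 \<le> f i" "i < n" for f :: "nat \<Rightarrow> real" and i
    using that by (intro member_le_sum) auto
  have dbl: "f i j \<le> (\<Sum>i<n. \<Sum>j<n. f i j)" if "\<And>i j. 0 \<le> f i j" for f :: "nat \<Rightarrow> nat \<Rightarrow> real"
    using single[of "f i" j] single[of "\<lambda>i. \<Sum>j<n. f i j" i] that assms(1,2) by (force intro: sum_nonneg order.trans)
  have nn: "0 \<le> (\<Sum>i<n. \<Sum>j<n. (pos (- Z i j))\<^sup>2)" "0 \<le> (\<Sum>i<n. \<Sum>j<n. (pos (Z i j - Z i i))\<^sup>2)"
    "0 \<le> (\<Sum>i<n. (row_excess n k Z i)\<^sup>2)" "0 \<le> (\<Sum>i<n. (diag_excess n k Z i)\<^sup>2)" by (intro sum_nonneg; simp)+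
  have "(pos (- Z i j))\<^sup>2 \<le> e\<^sup>2" "(pos (Z i j - Z i i))\<^sup>2 \<le> e\<^sup>2" "(row_excess n k Z i)\<^sup>2 \<le> e\<^sup>2" "(diag_excess n k Z i)\<^sup>2 \<le> e\<^sup>2"
    using dbl[of "\<lambda>i j. (pos (- Z i j))\<^sup>2"] dbl[of "\<lambda>i j. (pos (Z i j - Z i i))\<^sup>2"] nn
      single[of "\<lambda>i. (row_excess n k Z i)\<^sup>2" i] single[of "\<lambda>i. (diag_excess n k Z i)\<^sup>2" i] assms
    unfolding potential_def by (auto intro: order.trans)
  then have "pos (- Z i j) \<le> e" "pos (Z i j - Z i i) \<le> e" "row_excess n k Z i \<le> e" "diag_excess n k Z i \<le> e"
    using assms(4) power2_le_imp_le by blast+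
  then show "- e \<le> Z i j" "Z i j \<le> Z i i + e" "(\<Sum>l<n. Z i l) \<le> k * Z i i + e" "k * Z i i \<le> (\<Sum>l<n. Z l l) + e"
    by (auto simp: pos_def row_excess_def diag_excess_def)
qed

section \<open>Approximate best responses by matrix powers\<close>

lemma psd_on_diagonally_dominant:
  assumes fin: "finite I" and sym: "sym_on I M" and row: "\<And>i. i \<in> I \<Longrightarrow> (\<Sum>j\<in>I. \<bar>M i j\<bar>) \<le> c"
  shows "psd_on I (\<lambda>i j. M i j + (if i = j then c else 0))"
  unfolding psd_on_def inner_on_mat_app
proof
  fix x
  have diag: "(\<Sum>i\<in>I. \<Sum>j\<in>I. x i * (if i = j then c else 0) * x j) = (\<Sum>i\<in>I. c * (x i)\<^sup>2)"
  proof (intro sum.cong refl)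
    fix i assume "i \<in> I"
    have "(\<Sum>j\<in>I. x i * (if i = j then c else 0) * x j) = (\<Sum>j\<in>I. if i = j then c * (x i)\<^sup>2 else 0)"
      by (intro sum.cong) (auto simp: power2_eq_square)
    then show "(\<Sum>j\<in>I. x i * (if i = j then c else 0) * x j) = c * (x i)\<^sup>2" using fin \<open>i \<in> I\<close> by simp
  qed
  have "(\<Sum>i\<in>I. \<Sum>j\<in>I. \<bar>M i j\<bar> * (x j)\<^sup>2) = (\<Sum>j\<in>I. \<Sum>i\<in>I. \<bar>M i j\<bar> * (x j)\<^sup>2)" by (rule sum.swap)
  also have "\<dots> = (\<Sum>j\<in>I. \<Sum>i\<in>I. \<bar>M j i\<bar> * (x j)\<^sup>2)" using sym by (intro sum.cong refl) (auto simp: sym_on_def)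
  finally have sw: "(\<Sum>i\<in>I. \<Sum>j\<in>I. \<bar>M i j\<bar> * (x j)\<^sup>2) = (\<Sum>i\<in>I. \<Sum>j\<in>I. \<bar>M i j\<bar> * (x i)\<^sup>2)" .
  have "(\<Sum>i\<in>I. \<Sum>j\<in>I. \<bar>M i j\<bar> * (x i)\<^sup>2) = (\<Sum>i\<in>I. (\<Sum>j\<in>I. \<bar>M i j\<bar>) * (x i)\<^sup>2)" by (simp add: sum_distrib_right)
  also have "\<dots> \<le> (\<Sum>i\<in>I. c * (x i)\<^sup>2)" using row by (intro sum_mono mult_right_mono) auto
  finally have b: "(\<Sum>i\<in>I. \<Sum>j\<in>I. \<bar>M i j\<bar> * (x i)\<^sup>2) \<le> (\<Sum>i\<in>I. c * (x i)\<^sup>2)" .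
  have "(\<Sum>i\<in>I. \<Sum>j\<in>I. - (\<bar>M i j\<bar> * (x i)\<^sup>2 + \<bar>M i j\<bar> * (x j)\<^sup>2) / 2) \<le> (\<Sum>i\<in>I. \<Sum>j\<in>I. x i * M i j * x j)"
  proof (intro sum_mono)
    fix i j
    have "\<bar>x i * M i j * x j\<bar> = \<bar>M i j\<bar> * (\<bar>x i\<bar> * \<bar>x j\<bar>)" by (simp add: abs_mult)
    also have "\<dots> \<le> \<bar>M i j\<bar> * (((x i)\<^sup>2 + (x j)\<^sup>2) / 2)"
      using sum_squares_bound[of "\<bar>x i\<bar>" "\<bar>x j\<bar>"] by (intro mult_left_mono) auto
    finally show "- (\<bar>M i j\<bar> * (x i)\<^sup>2 + \<bar>M i j\<bar> * (x j)\<^sup>2) / 2 \<le> x i * M i j * x j"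
      by (simp add: algebra_simps abs_le_iff)
  qed
  moreover have "(\<Sum>i\<in>I. \<Sum>j\<in>I. - (\<bar>M i j\<bar> * (x i)\<^sup>2 + \<bar>M i j\<bar> * (x j)\<^sup>2) / 2)
     = - (\<Sum>i\<in>I. \<Sum>j\<in>I. \<bar>M i j\<bar> * (x i)\<^sup>2)"
  proof -
    have "(\<Sum>i\<in>I. \<Sum>j\<in>I. - (\<bar>M i j\<bar> * (x i)\<^sup>2 + \<bar>M i j\<bar> * (x j)\<^sup>2) / 2)
      = - ((\<Sum>i\<in>I. \<Sum>j\<in>I. \<bar>M i j\<bar> * (x i)\<^sup>2) + (\<Sum>i\<in>I. \<Sum>j\<in>I. \<bar>M i j\<bar> * (x j)\<^sup>2)) / 2"
      by (simp only: sum.distrib sum_negf flip: sum_divide_distrib)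
    then show ?thesis unfolding sw by simp
  qed
  ultimately show "0 \<le> (\<Sum>i\<in>I. \<Sum>j\<in>I. x i * (M i j + (if i = j then c else 0)) * x j)"
    using b diag by (simp add: algebra_simps sum.distrib)
qed

definition mat_pow :: "nat \<Rightarrow> (nat \<Rightarrow> nat \<Rightarrow> 'b :: comm_semiring_1) \<Rightarrow> nat \<Rightarrow> nat \<Rightarrow> nat \<Rightarrow> 'b" where
  "mat_pow n P r i j = (mat_app {..<n} P ^^ r) (unit_at j) i"

lemma of_int_mat_pow:
  "real_of_int (mat_pow n P r i j) = mat_pow n (\<lambda>i j. of_int (P i j)) r i j"
proof -
  have "(\<lambda>i. real_of_int ((mat_app {..<n} P ^^ r) x i)) =
      (mat_app {..<n} (\<lambda>i j. of_int (P i j)) ^^ r) (\<lambda>i. of_int (x i))" for x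
  proof (induction r)
    case (Suc r)
    show ?case
      by (rule ext, unfold mat_app_funpow_Suc Suc[symmetric]) simp
  qed simp
  from fun_cong[OF this[of "unit_at j"], of i] show ?thesis
    by (simp add: mat_pow_def unit_at_def [abs_def])
qed

text \<open>The normalised even power, scaled to trace \<open>B\<close> and floored: a large
  \<open>B\<close> makes the rounding relatively small.\<close>

definition response :: "nat \<Rightarrow> int \<Rightarrow> (nat \<Rightarrow> nat \<Rightarrow> int) \<Rightarrow> nat \<Rightarrow> nat \<Rightarrow> nat \<Rightarrow> int" where
  "response n B P s i j = B * mat_pow n P (2 * s) i j div (\<Sum>l<n. mat_pow n P (2 * s) l l)"

text \<open>\<open>M\<close> is a drift, \<open>c\<close> a shift that makes it diagonally dominant,
  and \<open>y\<close> the unit vector whose form value the response has to match. That value being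
  nonnegative keeps the power of the shifted matrix from vanishing; \<open>c * n \<le> s\<close>
  reduces the relative error of the power to an absolute error of at most 1.\<close>

locale best_response =
  fixes n s :: nat and M :: "nat \<Rightarrow> nat \<Rightarrow> int" and c B :: int and y :: "nat \<Rightarrow> real"
  assumes n: "0 < n" and symM: "sym_on {..<n} M" and row: "\<And>i. i < n \<Longrightarrow> (\<Sum>j<n. \<bar>M i j\<bar>) \<le> c"
    and c: "0 < c" and s: "c * int n \<le> int s" and B: "0 < B"
    and y0: "0 \<le> (\<Sum>i<n. \<Sum>j<n. y i * real_of_int (M i j) * y j)" and y1: "(\<Sum>i<n. (y i)\<^sup>2) = 1"
begin

definition "P i j = M i j + (if i = j then c else 0)"
definition "PR i j = real_of_int (P i j)"
definition "N i j = mat_pow n PR (2 * s) i j / pow_trace {..<n} PR (2 * s)"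

lemma PR_alt: "PR = (\<lambda>i j. real_of_int (M i j) + (if i = j then real_of_int c else 0))"
  by (auto simp: PR_def P_def fun_eq_iff)

lemma PR_sym: "sym_on {..<n} PR"
  using symM by (auto simp: sym_on_def PR_alt)

lemma PR_psd: "psd_on {..<n} PR"
  unfolding PR_alt
proof (rule psd_on_diagonally_dominant)
  show "sym_on {..<n} (\<lambda>i j. real_of_int (M i j))" using symM by (simp add: sym_on_def)
  fix i assume "i \<in> {..<n}"
  then have "real_of_int (\<Sum>j<n. \<bar>M i j\<bar>) \<le> real_of_int c" using row by (simp only: of_int_le_iff lessThan_iff)
  then show "(\<Sum>j<n. \<bar>real_of_int (M i j)\<bar>) \<le> real_of_int c" by simp
qed simp

lemma quad_PR: "inner_on {..<n} x (mat_app {..<n} PR x) =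
  (\<Sum>i<n. \<Sum>j<n. x i * real_of_int (M i j) * x j) + real_of_int c * (\<Sum>i<n. (x i)\<^sup>2)"
proof -
  have "(\<Sum>i<n. \<Sum>j<n. (if i = j then c * x i else 0) * x j) = (\<Sum>i<n. (c * x i) * x i)"
    using sum_diagonal[of "\<lambda>i. c * x i" "\<lambda>i j. x j" n] by simp
  then have "(\<Sum>i<n. \<Sum>j<n. x i * (if i = j then real_of_int c else 0) * x j) = real_of_int c * (\<Sum>i<n. (x i)\<^sup>2)"
    by (simp add: sum_distrib_left power2_eq_square if_distrib[of "\<lambda>z. z * _"] if_distrib[of "\<lambda>z. _ * z"] mult.assoc mult.commute mult.left_commute cong: if_cong)
  then show ?thesis unfolding inner_on_mat_app PR_alt by (simp add: algebra_simps sum.distrib)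
qed

lemma trace_pos: "0 < pow_trace {..<n} PR (2 * s)"
proof -
  have q: "0 < inner_on {..<n} y (mat_app {..<n} PR y)" unfolding quad_PR using y0 y1 c by simp
  have yy: "inner_on {..<n} y y = 1" using y1 by (simp add: inner_on_def power2_eq_square)
  have "inner_on {..<n} y (mat_app {..<n} PR y) ^ (2 * s) \<le> moment {..<n} PR y (2 * s)"
    using moment_seq_lower[OF moment_seq_moment[OF PR_sym PR_psd], of y "2 * s"] yy by (simp add: moment_def)
  also have "\<dots> \<le> pow_trace {..<n} PR (2 * s)" using moment_le_pow_trace[OF finite_lessThan PR_sym, of y s] yy by simp
  finally show ?thesis using q by (meson less_le_trans zero_less_power)
qed

text \<open>An even power of a symmetric matrix is the Gram matrix of the columns of the half power.
  Semidefiniteness, the sign of the diagonal and the bound on the entries of \<open>N\<close> all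
  come from this.\<close>

lemma mat_pow_inner: "mat_pow n PR (2 * s) i j =
    inner_on {..<n} (\<lambda>l. mat_pow n PR s l i) (\<lambda>l. mat_pow n PR s l j)" if "i < n"
proof -
  have e: "inner_on {..<n} (unit_at i) x = x i" for x
  proof -
    have "inner_on {..<n} (unit_at i) x = (\<Sum>l<n. if l = i then x l else 0)"
      unfolding inner_on_def unit_at_def by (intro sum.cong) auto
    then show ?thesis using that by simp
  qed
  have "inner_on {..<n} ((mat_app {..<n} PR ^^ s) (unit_at i)) ((mat_app {..<n} PR ^^ s) (unit_at j))
     = mat_pow n PR (2 * s) i j"
    unfolding self_adjoint_power[OF PR_sym] e mat_pow_def by (simp add: mult_2)
  then show ?thesis by (simp add: mat_pow_def)
qed

lemma N_trace: "(\<Sum>i<n. N i i) = 1"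
  using trace_pos unfolding N_def mat_pow_def pow_trace_diag[OF finite_lessThan]
  by (simp flip: sum_divide_distrib)

lemma N_psd:
  assumes "U \<subseteq> {..<n}" "\<And>x. 0 \<le> (\<Sum>i\<in>U. \<Sum>j\<in>U. x i * Q i j * x j)"
  shows "0 \<le> (\<Sum>i\<in>U. \<Sum>j\<in>U. Q i j * N i j)"
proof -
  let ?t = "pow_trace {..<n} PR (2 * s)" let ?R = "mat_pow n PR s"
  have "(\<Sum>i\<in>U. \<Sum>j\<in>U. Q i j * N i j) = (\<Sum>i\<in>U. \<Sum>j\<in>U. \<Sum>l<n. ?R l i * Q i j * ?R l j / ?t)"
  proof (intro sum.cong refl)
    fix i j assume "i \<in> U" "j \<in> U"
    then have "i < n" using assms(1) by auto
    then have "N i j = (\<Sum>l<n. ?R l i * ?R l j / ?t)"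
      unfolding N_def by (subst mat_pow_inner) (simp_all add: inner_on_def sum_divide_distrib)
    then show "Q i j * N i j = (\<Sum>l<n. ?R l i * Q i j * ?R l j / ?t)"
      by (simp add: sum_distrib_left mult_ac)
  qed
  also have "\<dots> = (\<Sum>i\<in>U. \<Sum>l<n. \<Sum>j\<in>U. ?R l i * Q i j * ?R l j / ?t)"
    by (intro sum.cong refl sum.swap)
  also have "\<dots> = (\<Sum>l<n. \<Sum>i\<in>U. \<Sum>j\<in>U. ?R l i * Q i j * ?R l j / ?t)" by (rule sum.swap)
  also have "\<dots> = (\<Sum>l<n. (\<Sum>i\<in>U. \<Sum>j\<in>U. ?R l i * Q i j * ?R l j) / ?t)" by (simp add: sum_divide_distrib)
  finally show ?thesis using assms(2) trace_pos by (auto intro!: sum_nonneg)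
qed

lemma N_diag: "i < n \<Longrightarrow> 0 \<le> N i i"
  unfolding N_def using trace_pos by (simp add: mat_pow_inner inner_on_self_nonneg)

lemma N_abs: "i < n \<Longrightarrow> j < n \<Longrightarrow> \<bar>N i j\<bar> \<le> 1"
proof -
  assume ij: "i < n" "j < n"
  have le1: "N l l \<le> 1" if "l < n" for l
  proof -
    have "N l l \<le> (\<Sum>l<n. N l l)" using that N_diag by (intro member_le_sum) auto
    then show ?thesis using N_trace by simp
  qed
  let ?R = "mat_pow n PR s" and ?t = "pow_trace {..<n} PR (2 * s)"
  have "(N i j)\<^sup>2 \<le> N i i * N j j"
    using cauchy_schwarz_on[of "{..<n}" "\<lambda>l. ?R l i" "\<lambda>l. ?R l j"] ij trace_pos
    by (simp add: N_def mat_pow_inner power_divide power2_eq_square divide_right_mono)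
  also have "\<dots> \<le> 1 * 1" using le1 N_diag ij by (intro mult_mono) auto
  finally show ?thesis by (simp add: abs_square_le_1)
qed

lemma dot_N:
  "(\<Sum>i<n. \<Sum>j<n. y i * real_of_int (M i j) * y j) - 1 \<le> dot n (\<lambda>i j. real_of_int (M i j)) N"
proof -
  let ?b = "pow_trace {..<n} PR" and ?q = "\<Sum>i<n. \<Sum>j<n. y i * real_of_int (M i j) * y j"
  have yy: "inner_on {..<n} y y = 1" using y1 by (simp add: inner_on_def power2_eq_square)
  have cn: "int n \<le> c * int n" using c n by (simp add: mult_le_cancel_right1)
  then have s0: "n \<le> s" using s by linarith
  have "(?q + c) * (1 - card {..<n} / (2 * s)) \<le> ?b (2 * s + 1) / ?b (2 * s)"
    using power_oracle[OF finite_lessThan PR_sym PR_psd yy _ trace_pos] s0 n unfolding quad_PR y1 by (simp add: lessThan_empty_iff)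
  moreover have "?b (2 * s + 1) / ?b (2 * s) = dot n PR N"
  proof -
    have "?b (2 * s + 1) = (\<Sum>i<n. \<Sum>j<n. PR i j * mat_pow n PR (2 * s) j i)"
      unfolding pow_trace_diag[OF finite_lessThan] mat_pow_def by (simp only: mat_app_funpow_Suc Suc_eq_plus1[symmetric])
    also have "\<dots> = (\<Sum>i<n. \<Sum>j<n. PR i j * mat_pow n PR (2 * s) i j)"
      by (intro sum.cong refl) (auto simp: mat_pow_inner inner_on_commute)
    finally show ?thesis by (simp add: dot_def N_def sum_divide_distrib)
  qed
  moreover have "dot n PR N = dot n (\<lambda>i j. real_of_int (M i j)) N + c"
  proof -
    have "dot n PR N = dot n (\<lambda>i j. real_of_int (M i j)) N + (\<Sum>i<n. \<Sum>j<n. (if i = j then real_of_int c else 0) * N i j)"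
      unfolding dot_def PR_alt by (simp add: algebra_simps sum.distrib)
    then show ?thesis unfolding sum_diagonal using N_trace by (simp flip: sum_distrib_left)
  qed
  moreover have "?q \<le> c"
  proof -
    have "0 \<le> inner_on {..<n} y (mat_app {..<n} (\<lambda>i j. - real_of_int (M i j) + (if i = j then real_of_int c else 0)) y)"
      using psd_on_diagonally_dominant[of "{..<n}" "\<lambda>i j. - real_of_int (M i j)" "real_of_int c"] symM row
      unfolding psd_on_def sym_on_def
      by (simp flip: of_int_abs of_int_sum)
    moreover have "inner_on {..<n} y (mat_app {..<n} (\<lambda>i j. - real_of_int (M i j) + (if i = j then real_of_int c else 0)) y)
      = - ?q + real_of_int c * (\<Sum>i<n. (y i)\<^sup>2)"
    proof -
      have "(\<Sum>i<n. \<Sum>j<n. y i * (if i = j then real_of_int c else 0) * y j) = real_of_int c * (\<Sum>i<n. (y i)\<^sup>2)"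
        using quad_PR[of y] unfolding inner_on_mat_app PR_alt by (simp add: algebra_simps sum.distrib)
      moreover have "(\<Sum>i<n. \<Sum>j<n. y i * (- real_of_int (M i j) + (if i = j then real_of_int c else 0)) * y j)
        = (\<Sum>i<n. \<Sum>j<n. y i * (if i = j then real_of_int c else 0) * y j) - ?q"
        by (simp only: distrib_left distrib_right sum.distrib mult_minus_left mult_minus_right sum_negf)
      ultimately show ?thesis unfolding inner_on_mat_app by simp
    qed
    ultimately show ?thesis using y1 by simp
  qed
  \<comment> \<open>The loss is \<open>?q + c \<le> 2 * c\<close> times \<open>n / (2 * s)\<close>,
    at most 1 by \<open>c * n \<le> s\<close>.\<close>
  moreover have "(?q + c) * (1 - card {..<n} / (2 * s)) \<ge> ?q + c - 1"
  proof -
    have sp: "0 < real s" using s0 n by simp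
    have "(?q + c) * (real n / (2 * s)) \<le> (2 * c) * (real n / (2 * s))"
      using \<open>?q \<le> c\<close> by (intro mult_right_mono) auto
    also have "\<dots> = real_of_int (c * int n) / s" by simp
    also have "\<dots> \<le> 1"
    proof -
      have "real_of_int (c * int n) \<le> real_of_int (int s)" using s by (simp only: of_int_le_iff)
      then show ?thesis using sp by simp
    qed
    finally show ?thesis by (simp add: algebra_simps)
  qed
  ultimately show ?thesis by linarith
qed

abbreviation "V \<equiv> response n B P s"

lemma V_floor: "real_of_int (V i j) \<le> B * N i j" "B * N i j - 1 \<le> real_of_int (V i j)"
proof -
  have t: "real_of_int (\<Sum>l<n. mat_pow n P (2 * s) l l) = pow_trace {..<n} PR (2 * s)"
    unfolding pow_trace_diag[OF finite_lessThan] by (simp add: of_int_mat_pow PR_def[abs_def] mat_pow_def[symmetric])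
  have "real_of_int (V i j) = of_int \<lfloor>real_of_int (B * mat_pow n P (2 * s) i j) / real_of_int (\<Sum>l<n. mat_pow n P (2 * s) l l)\<rfloor>"
    unfolding response_def by (simp only: floor_divide_of_int_eq)
  also have "real_of_int (B * mat_pow n P (2 * s) i j) / real_of_int (\<Sum>l<n. mat_pow n P (2 * s) l l) = B * N i j"
    unfolding t N_def by (simp add: of_int_mat_pow PR_def[abs_def])
  finally show "real_of_int (V i j) \<le> B * N i j" "B * N i j - 1 \<le> real_of_int (V i j)" by linarith+
qed

lemma V_sym: "sym_on {..<n} V"
proof -
  have e: "real_of_int (mat_pow n P (2 * s) i j) = mat_pow n PR (2 * s) i j" for i j
    by (simp add: of_int_mat_pow PR_def[abs_def])
  have m: "mat_pow n P (2 * s) i j = mat_pow n P (2 * s) j i" if "i < n" "j < n" for i j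
  proof -
    have "mat_pow n PR (2 * s) i j = mat_pow n PR (2 * s) j i"
      unfolding mat_pow_inner[OF that(1)] mat_pow_inner[OF that(2)] by (rule inner_on_commute)
    then show ?thesis using e[of i j] e[of j i] by linarith
  qed
  show ?thesis unfolding sym_on_def response_def
    by (intro ballI arg_cong2[where f = "(div)"] arg_cong2[where f = "(*)"] refl m) auto
qed

lemma V_abs: "i < n \<Longrightarrow> j < n \<Longrightarrow> \<bar>V i j\<bar> \<le> B"
proof -
  assume ij: "i < n" "j < n"
  have "- 1 \<le> N i j" "N i j \<le> 1" using N_abs[OF ij] by (simp_all add: abs_le_iff)
  then have "real_of_int B * N i j \<le> real_of_int B * 1" "real_of_int B * (- 1) \<le> real_of_int B * N i j"
    using B by (intro mult_left_mono; simp)+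
  then have "real_of_int (V i j) \<le> B" "- real_of_int B - 1 \<le> real_of_int (V i j)" using V_floor[where i=i and j=j] by linarith+
  \<comment> \<open>The generic floor estimate would lose 1 here; as \<open>- B\<close> is an
    integer, flooring a number above it stays above it.\<close>
  moreover have "- B \<le> V i j"
  proof -
    have "V i j = \<lfloor>B * N i j\<rfloor>" using V_floor[where i=i and j=j]
    proof -
      have "real_of_int (V i j) = of_int \<lfloor>real_of_int (B * mat_pow n P (2 * s) i j) / real_of_int (\<Sum>l<n. mat_pow n P (2 * s) l l)\<rfloor>"
        unfolding response_def by (simp only: floor_divide_of_int_eq)
      moreover have "real_of_int (B * mat_pow n P (2 * s) i j) / real_of_int (\<Sum>l<n. mat_pow n P (2 * s) l l) = B * N i j"
        unfolding N_def pow_trace_diag[OF finite_lessThan] by (simp add: of_int_mat_pow PR_def[abs_def] mat_pow_def[symmetric])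
      ultimately show ?thesis by simp
    qed
    then show ?thesis using \<open>real_of_int B * (- 1) \<le> real_of_int B * N i j\<close> by (simp add: le_floor_iff)
  qed
  ultimately show ?thesis by (simp add: abs_le_iff)
qed

lemma V_trace: "(\<Sum>i<n. V i i) \<le> B"
proof -
  have "real_of_int (\<Sum>i<n. V i i) \<le> (\<Sum>i<n. B * N i i)" by (simp add: sum_mono V_floor(1))
  also have "\<dots> = B" using N_trace by (simp flip: sum_distrib_left)
  finally show ?thesis by linarith
qed

lemma V_trace_ge: "B - int n \<le> (\<Sum>i<n. V i i)"
proof -
  have "(\<Sum>i<n. B * N i i - 1) \<le> real_of_int (\<Sum>i<n. V i i)" by (simp add: sum_mono V_floor(2))
  moreover have "(\<Sum>i<n. B * N i i - 1) = B - real n"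
    using N_trace by (simp add: sum_subtractf flip: sum_distrib_left)
  ultimately show ?thesis by linarith
qed

lemma V_perturb: "- (\<Sum>i\<in>U. \<Sum>j\<in>U. \<bar>Q i j\<bar>) + (\<Sum>i\<in>U. \<Sum>j\<in>U. Q i j * (B * N i j)) \<le> (\<Sum>i\<in>U. \<Sum>j\<in>U. Q i j * real_of_int (V i j))"
proof -
  have "(\<Sum>i\<in>U. \<Sum>j\<in>U. - \<bar>Q i j\<bar> + Q i j * (B * N i j)) \<le> (\<Sum>i\<in>U. \<Sum>j\<in>U. Q i j * real_of_int (V i j))"
  proof (intro sum_mono)
    fix i j
    have "\<bar>B * N i j - real_of_int (V i j)\<bar> \<le> 1" using V_floor[where i=i and j=j] by linarith
    then have "\<bar>Q i j\<bar> * \<bar>B * N i j - real_of_int (V i j)\<bar> \<le> \<bar>Q i j\<bar>" by (simp add: mult_left_le)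
    then have "Q i j * (B * N i j - real_of_int (V i j)) \<le> \<bar>Q i j\<bar>" unfolding abs_mult[symmetric] by linarith
    then show "- \<bar>Q i j\<bar> + Q i j * (B * N i j) \<le> Q i j * real_of_int (V i j)" by (simp add: algebra_simps)
  qed
  then show ?thesis by (simp only: sum.distrib sum_negf)
qed

text \<open>Flooring can destroy positive semidefiniteness. It is therefore kept in dual form only,
  against each nonnegative form \<open>Q\<close>, with an error of at most 1 per entry.\<close>

lemma V_psd:
  assumes "U \<subseteq> {..<n}" "\<And>x. 0 \<le> (\<Sum>i\<in>U. \<Sum>j\<in>U. x i * Q i j * x j)"
  shows "- (\<Sum>i\<in>U. \<Sum>j\<in>U. \<bar>Q i j\<bar>) \<le> (\<Sum>i\<in>U. \<Sum>j\<in>U. Q i j * real_of_int (V i j))"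
proof -
  have "(\<Sum>i\<in>U. \<Sum>j\<in>U. Q i j * (B * N i j)) = B * (\<Sum>i\<in>U. \<Sum>j\<in>U. Q i j * N i j)"
    by (simp add: sum_distrib_left algebra_simps)
  moreover have "0 \<le> \<dots>" using N_psd[OF assms] B by simp
  ultimately show ?thesis using V_perturb[of Q U] by linarith
qed

lemma V_response:
  "B * (\<Sum>i<n. \<Sum>j<n. y i * real_of_int (M i j) * y j) - B - (\<Sum>i<n. \<Sum>j<n. \<bar>real_of_int (M i j)\<bar>)
    \<le> dot n (\<lambda>i j. real_of_int (M i j)) (\<lambda>i j. real_of_int (V i j))"
proof -
  have "(\<Sum>i<n. \<Sum>j<n. real_of_int (M i j) * (B * N i j)) = B * dot n (\<lambda>i j. real_of_int (M i j)) N"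
    by (simp add: dot_def sum_distrib_left algebra_simps)
  also have "\<dots> \<ge> B * ((\<Sum>i<n. \<Sum>j<n. y i * real_of_int (M i j) * y j) - 1)"
    using dot_N B by (intro mult_left_mono) auto
  finally show ?thesis using V_perturb[of "\<lambda>i j. real_of_int (M i j)" "{..<n}"]
    by (simp add: dot_def right_diff_distrib)
qed

end

text \<open>
  Objective entries have size up to \<open>n ^ 16\<close>, a step has size \<open>n ^ 60\<close> and \<open>n ^ 48\<close> steps are taken, so that drift
  entries stay below \<open>n ^ 115\<close>. The shift \<open>n ^ 116\<close> makes the drift diagonally dominant, hence
  positive semidefinite, and the power \<open>2 n ^ 117\<close> makes the relative error of the best response negligible.
\<close>

definition shifted :: "nat \<Rightarrow> nat \<Rightarrow> (nat \<Rightarrow> nat \<Rightarrow> int) \<Rightarrow> (nat \<Rightarrow> nat \<Rightarrow> int) \<Rightarrow> nat \<Rightarrow> nat \<Rightarrow> int" where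
  "shifted n k a Z i j = drift n (int k) (int n ^ 64) a Z i j + (if i = j then int n ^ 116 else 0)"

fun sol :: "nat \<Rightarrow> nat \<Rightarrow> (nat \<Rightarrow> nat \<Rightarrow> int) \<Rightarrow> nat \<Rightarrow> nat \<Rightarrow> nat \<Rightarrow> int" where
  "sol n k a 0 = (\<lambda>_ _. 0)"
| "sol n k a (Suc t) = (\<lambda>i j. sol n k a t i j +
     response n (int n ^ 60) (shifted n k a (sol n k a t)) (n ^ 117) i j)"

lemma drift_sym:
  assumes "sym_on {..<n} a" "sym_on {..<n} Z" shows "sym_on {..<n} (drift n k H a Z)"
  using assms unfolding sym_on_def drift_def by (auto simp: algebra_simps)

lemma drift_abs:
  fixes Z :: "nat \<Rightarrow> nat \<Rightarrow> int"
  assumes n: "0 < n" and k: "0 \<le> k" "k \<le> int n" and H: "0 \<le> H"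
    and a: "\<And>i j. i < n \<Longrightarrow> j < n \<Longrightarrow> \<bar>a i j\<bar> \<le> K" and Z: "\<And>i j. i < n \<Longrightarrow> j < n \<Longrightarrow> \<bar>Z i j\<bar> \<le> z"
    and ij: "i < n" "j < n"
  shows "\<bar>drift n k H a Z i j\<bar> \<le> 2 * (H * K) + 26 * (int n)\<^sup>2 * z"
proof -
  let ?n = "int n"
  have z0: "0 \<le> z" using Z[OF ij] by linarith
  have n1: "1 \<le> ?n" using n by simp
  have "1 * z \<le> ?n * z" using n1 z0 by (intro mult_right_mono) auto
  then have zn: "z \<le> ?n * z" by simp
  have "?n * z \<le> ?n * (?n * z)" using zn n1 by (intro mult_left_mono) auto
  then have nz: "?n * z \<le> ?n\<^sup>2 * z" by (simp add: power2_eq_square)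
  have kz: "\<bar>k * Z i i\<bar> \<le> ?n * z" if "i < n" for i
    using Z[OF that that] k unfolding abs_mult by (intro mult_mono) auto
  have s1: "\<bar>\<Sum>l<n. f l\<bar> \<le> ?n * b" if "\<And>l. l < n \<Longrightarrow> \<bar>f l\<bar> \<le> b" for f :: "nat \<Rightarrow> int" and b
  proof -
    have "\<bar>\<Sum>l<n. f l\<bar> \<le> (\<Sum>l<n. b)" using that by (intro order.trans[OF sum_abs] sum_mono) auto
    then show ?thesis by simp
  qed
  have t: "0 \<le> pos (Z i j - Z i i)" "pos (Z i j - Z i i) \<le> 2 * z" if "i < n" "j < n" for i j
    using Z[of i j] Z[of i i] that by (auto simp: pos_nonneg intro!: pos_le)
  have q: "0 \<le> row_excess n k Z i" "row_excess n k Z i \<le> 2 * (?n * z)" if "i < n" for i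
  proof -
    have "\<bar>(\<Sum>l<n. Z i l) - k * Z i i\<bar> \<le> 2 * (?n * z)"
      using s1[of "Z i" z] Z that kz[OF that] by fastforce
    then show "0 \<le> row_excess n k Z i" "row_excess n k Z i \<le> 2 * (?n * z)"
      by (auto simp: row_excess_def pos_nonneg intro: pos_le)
  qed
  have p: "0 \<le> diag_excess n k Z i" "diag_excess n k Z i \<le> 2 * (?n * z)" if "i < n" for i
  proof -
    have "\<bar>k * Z i i - (\<Sum>l<n. Z l l)\<bar> \<le> 2 * (?n * z)"
      using s1[of "\<lambda>l. Z l l" z] Z that kz[OF that] by fastforce
    then show "0 \<le> diag_excess n k Z i" "diag_excess n k Z i \<le> 2 * (?n * z)"
      by (auto simp: diag_excess_def pos_nonneg intro: pos_le)
  qed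
  have u: "0 \<le> pos (- Z i j)" "pos (- Z i j) \<le> z" using Z[OF ij] by (auto simp: pos_nonneg intro: pos_le)
  have Ha: "\<bar>2 * H * a i j\<bar> \<le> 2 * (H * K)" using a[OF ij] H by (simp add: abs_mult mult_left_mono)
  have kq: "0 \<le> k * row_excess n k Z i" "k * row_excess n k Z i \<le> 2 * (?n\<^sup>2 * z)"
    "0 \<le> k * diag_excess n k Z i" "k * diag_excess n k Z i \<le> 2 * (?n\<^sup>2 * z)"
  proof -
    have "k * row_excess n k Z i \<le> ?n * (2 * (?n * z))" "k * diag_excess n k Z i \<le> ?n * (2 * (?n * z))"
      using q[OF ij(1)] p[OF ij(1)] k by (auto intro!: mult_mono)
    then show "k * row_excess n k Z i \<le> 2 * (?n\<^sup>2 * z)" "k * diag_excess n k Z i \<le> 2 * (?n\<^sup>2 * z)"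
      by (simp_all add: power2_eq_square)
  qed (use q p ij k in auto)
  have st: "0 \<le> (\<Sum>l<n. pos (Z i l - Z i i))" "(\<Sum>l<n. pos (Z i l - Z i i)) \<le> 2 * (?n * z)"
    using s1[of "\<lambda>l. pos (Z i l - Z i i)" "2 * z"] t ij by (auto intro!: sum_nonneg)
  have sp: "0 \<le> (\<Sum>l<n. diag_excess n k Z l)" "(\<Sum>l<n. diag_excess n k Z l) \<le> 2 * (?n\<^sup>2 * z)"
    using s1[of "diag_excess n k Z" "2 * (?n * z)"] p by (auto intro!: sum_nonneg simp: power2_eq_square)
  define D where "D = (if i = j then 2 * (\<Sum>l<n. pos (Z i l - Z i i)) + 2 * k * row_excess n k Z i
          - 2 * k * diag_excess n k Z i + 2 * (\<Sum>l<n. diag_excess n k Z l) else 0)"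
  have D: "D \<le> 4 * (?n * z) + 8 * (?n\<^sup>2 * z)" "- (4 * (?n\<^sup>2 * z)) \<le> D"
    using kq st sp zn nz z0 unfolding D_def mult.assoc[of 2 k] by (auto split: if_splits)
  have "\<bar>2 * H * a i j + 2 * pos (- Z i j) - pos (Z i j - Z i i) - pos (Z j i - Z j j)
     - row_excess n k Z i - row_excess n k Z j + D\<bar> \<le> 2 * (H * K) + 26 * (?n\<^sup>2 * z)"
    using u t[OF ij] t[OF ij(2,1)] q[OF ij(1)] q[OF ij(2)] Ha zn nz z0 D by linarith
  then show ?thesis unfolding drift_def D_def by (simp only: mult.assoc)
qed

lemma spread_le:
  assumes n: "0 < n" and k: "0 \<le> k" "k \<le> real n" and B: "0 \<le> B"
    and V: "\<And>i j. i < n \<Longrightarrow> j < n \<Longrightarrow> \<bar>V i j\<bar> \<le> B"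
  shows "spread n k V \<le> 13 * real n ^ 3 * B\<^sup>2"
proof -
  let ?n = "real n"
  have sq: "x\<^sup>2 \<le> b\<^sup>2" if "\<bar>x\<bar> \<le> b" for x b :: real using that by (metis abs_le_square_iff abs_of_nonneg abs_ge_zero order.trans)
  have sb: "(\<Sum>l<n. f l) \<le> ?n * b" if "\<And>l. l < n \<Longrightarrow> f l \<le> b" for f :: "nat \<Rightarrow> real" and b
    using sum_bounded_above[of "{..<n}" f b] that by simp
  have s1: "\<bar>\<Sum>l<n. f l\<bar> \<le> ?n * B" if "\<And>l. l < n \<Longrightarrow> \<bar>f l\<bar> \<le> B" for f :: "nat \<Rightarrow> real"
    using sb[of "\<lambda>l. \<bar>f l\<bar>" B] that by (intro order.trans[OF sum_abs]) auto
  have kz: "\<bar>k * V i i\<bar> \<le> ?n * B" if "i < n" for i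
    using V[OF that that] k unfolding abs_mult by (intro mult_mono) auto
  have 1: "(\<Sum>i<n. \<Sum>j<n. (V i j)\<^sup>2) \<le> ?n * (?n * B\<^sup>2)" by (intro sb sq V)
  have 2: "(\<Sum>i<n. \<Sum>j<n. (V i i - V i j)\<^sup>2) \<le> ?n * (?n * (2 * B)\<^sup>2)"
  proof (intro sb sq)
    fix i j assume "i < n" "j < n"
    then show "\<bar>V i i - V i j\<bar> \<le> 2 * B" using V[of i i] V[of i j] by simp
  qed
  have 3: "(\<Sum>i<n. (k * V i i - (\<Sum>j<n. V i j))\<^sup>2) \<le> ?n * (2 * (?n * B))\<^sup>2"
  proof (intro sb sq)
    fix i assume "i < n"
    then show "\<bar>k * V i i - (\<Sum>j<n. V i j)\<bar> \<le> 2 * (?n * B)" using kz[of i] s1[of "V i"] V by fastforce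
  qed
  have 4: "(\<Sum>i<n. ((\<Sum>j<n. V j j) - k * V i i)\<^sup>2) \<le> ?n * (2 * (?n * B))\<^sup>2"
  proof (intro sb sq)
    fix i assume "i < n"
    then show "\<bar>(\<Sum>j<n. V j j) - k * V i i\<bar> \<le> 2 * (?n * B)" using kz[of i] s1[of "\<lambda>j. V j j"] V by fastforce
  qed
  \<comment> \<open>The four sums then contribute 1, 4, 4 and 4 to the constant 13.\<close>
  have "?n\<^sup>2 * B\<^sup>2 \<le> ?n ^ 3 * B\<^sup>2" using n by (intro mult_right_mono power_increasing) auto
  then show ?thesis using 1 2 3 4 unfolding spread_def
    by (simp add: power2_eq_square power3_eq_cube algebra_simps)
qed

text \<open>The indicator matrix of \<open>S\<close> satisfies all constraints, so in
  \<open>dot_drift\<close> every violation is multiplied by a nonnegative slack and only the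
  objective remains.\<close>

lemma dot_drift_planted:
  assumes S: "S \<subseteq> {..<n}" "card S = k" and H: "0 \<le> H"
  shows "2 * H * (\<Sum>i\<in>S. \<Sum>j\<in>S. a i j) \<le> (\<Sum>i\<in>S. \<Sum>j\<in>S. drift n (real k) H a Z i j)"
proof -
  define X :: "nat \<Rightarrow> nat \<Rightarrow> real" where "X i j = of_bool (i \<in> S \<and> j \<in> S)" for i j
  have fin: "finite S" using S finite_subset by blast
  have d: "dot n A X = (\<Sum>i\<in>S. \<Sum>j\<in>S. A i j)" for A
  proof -
    have "dot n A X = (\<Sum>i<n. if i \<in> S then \<Sum>j<n. (if j \<in> S then A i j else 0) else 0)"
    proof (unfold dot_def, intro sum.cong refl)
      fix i
      show "(\<Sum>j<n. A i j * X i j) = (if i \<in> S then \<Sum>j<n. (if j \<in> S then A i j else 0) else 0)"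
        by (cases "i \<in> S") (simp_all add: X_def of_bool_def if_distrib[of "\<lambda>z. _ * z"] cong: if_cong)
    qed
    also have "\<dots> = (\<Sum>i\<in>S. \<Sum>j\<in>S. A i j)"
      using S(1) by (simp flip: sum.inter_restrict add: Int_absorb1)
    finally show ?thesis .
  qed
  have row: "(\<Sum>j<n. X i j) = (if i \<in> S then real k else 0)" for i
  proof -
    have "(\<Sum>j<n. X i j) = (\<Sum>j<n. if j \<in> S then of_bool (i \<in> S) else 0)" by (intro sum.cong) (auto simp: X_def)
    also have "\<dots> = (\<Sum>j\<in>S. of_bool (i \<in> S))" using S(1) by (simp flip: sum.inter_restrict add: Int_absorb1)
    finally show ?thesis using S(2) by simp
  qed
  have tr: "(\<Sum>j<n. X j j) = real k"
  proof -
    have "(\<Sum>j<n. X j j) = (\<Sum>j<n. if j \<in> S then 1 else 0)" by (intro sum.cong) (auto simp: X_def)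
    also have "\<dots> = (\<Sum>j\<in>S. 1)" using S(1) by (simp flip: sum.inter_restrict add: Int_absorb1)
    finally show ?thesis using S(2) by simp
  qed
  have "sym_on {..<n} X" by (auto simp: sym_on_def X_def)
  note dd = dot_drift[OF this, of "real k" H a Z]
  have "2 * H * dot n a X \<le> dot n (drift n (real k) H a Z) X"
  proof -
    have "0 \<le> (\<Sum>i<n. \<Sum>j<n. pos (- Z i j) * X i j)" "0 \<le> (\<Sum>i<n. \<Sum>j<n. pos (Z i j - Z i i) * (X i i - X i j))"
      "0 \<le> (\<Sum>i<n. row_excess n (real k) Z i * (real k * X i i - (\<Sum>j<n. X i j)))"
      "0 \<le> (\<Sum>i<n. diag_excess n (real k) Z i * ((\<Sum>j<n. X j j) - real k * X i i))"
      unfolding row tr by (intro sum_nonneg mult_nonneg_nonneg; simp add: pos_nonneg row_excess_def diag_excess_def X_def)+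
    then show ?thesis unfolding dd by linarith
  qed
  then show ?thesis unfolding d .
qed


section \<open>Invariants of the iteration and the scaled solution\<close>

locale solver_input =
  fixes n k :: nat and a :: "nat \<Rightarrow> nat \<Rightarrow> int"
  assumes n: "2 \<le> n" and k: "0 < k" "k \<le> n" and a_sym: "sym_on {..<n} a"
    and a_nonneg: "\<And>i j. i < n \<Longrightarrow> j < n \<Longrightarrow> 0 \<le> a i j" and a_sum: "(\<Sum>i<n. \<Sum>j<n. a i j) \<le> int n ^ 16"
begin

abbreviation "Z \<equiv> sol n k a"
abbreviation "M t \<equiv> drift n (int k) (int n ^ 64) a (Z t)"
abbreviation "V t \<equiv> response n (int n ^ 60) (shifted n k a (Z t)) (n ^ 117)"
definition "y S i = (if i \<in> S then 1 / sqrt (real k) else 0)"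

lemma a_le: "i < n \<Longrightarrow> j < n \<Longrightarrow> \<bar>a i j\<bar> \<le> int n ^ 16"
proof -
  assume ij: "i < n" "j < n"
  have "a i j \<le> (\<Sum>j<n. a i j)" using ij a_nonneg by (intro member_le_sum) auto
  also have "\<dots> \<le> (\<Sum>i<n. \<Sum>j<n. a i j)"
    using ij a_nonneg by (intro member_le_sum[of i "{..<n}" "\<lambda>i. \<Sum>j<n. a i j"]) (auto intro: sum_nonneg)
  finally show ?thesis using a_sum a_nonneg[OF ij] by simp
qed

lemma real_M: "real_of_int (M t i j) = drift n (real k) (real n ^ 64) (\<lambda>i j. of_int (a i j)) (\<lambda>i j. of_int (Z t i j)) i j"
  by (simp add: of_int_drift)

lemma y_quad: "S \<subseteq> {..<n} \<Longrightarrow> (\<Sum>i<n. \<Sum>j<n. y S i * A i j * y S j) = (\<Sum>i\<in>S. \<Sum>j\<in>S. A i j) / k"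
proof -
  assume S: "S \<subseteq> {..<n}"
  have "(\<Sum>i<n. \<Sum>j<n. y S i * A i j * y S j) = (\<Sum>i<n. if i \<in> S then \<Sum>j<n. (if j \<in> S then A i j / k else 0) else 0)"
  proof (intro sum.cong refl)
    fix i
    show "(\<Sum>j<n. y S i * A i j * y S j) = (if i \<in> S then \<Sum>j<n. (if j \<in> S then A i j / k else 0) else 0)"
      using k by (cases "i \<in> S") (simp_all add: y_def if_distrib[of "\<lambda>z. _ * z"] cong: if_cong)
  qed
  also have "\<dots> = (\<Sum>i\<in>S. \<Sum>j\<in>S. A i j / k)"
    using S by (simp flip: sum.inter_restrict add: Int_absorb1)
  finally show ?thesis by (simp flip: sum_divide_distrib)
qed

lemma y_norm: "S \<subseteq> {..<n} \<Longrightarrow> card S = k \<Longrightarrow> (\<Sum>i<n. (y S i)\<^sup>2) = 1"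
proof -
  assume S: "S \<subseteq> {..<n}" "card S = k"
  have "(\<Sum>i<n. (y S i)\<^sup>2) = (\<Sum>i<n. if i \<in> S then 1 / real k else 0)"
    by (intro sum.cong) (auto simp: y_def power_divide)
  also have "\<dots> = (\<Sum>i\<in>S. 1 / real k)" using S(1) by (simp flip: sum.inter_restrict add: Int_absorb1)
  finally show ?thesis using S(2) k by simp
qed

lemma power_le: "28 * int n ^ b \<le> int n ^ (b + 5)"
proof -
  have "(2::int) ^ 5 \<le> int n ^ 5" using n by (intro power_mono) auto
  then have "28 * int n ^ b \<le> int n ^ 5 * int n ^ b" by (intro mult_right_mono) auto
  then show ?thesis by (simp add: power_add mult.commute)
qed

lemma M_abs:
  assumes Z: "\<And>i j. i < n \<Longrightarrow> j < n \<Longrightarrow> \<bar>Z t i j\<bar> \<le> int n ^ 108" and ij: "i < n" "j < n"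
  shows "\<bar>M t i j\<bar> \<le> 28 * int n ^ 110"
proof -
  have "\<bar>M t i j\<bar> \<le> 2 * (int n ^ 64 * int n ^ 16) + 26 * (int n)\<^sup>2 * int n ^ 108"
    using n k Z a_le ij by (intro drift_abs) auto
  also have "int n ^ 64 * int n ^ 16 = int n ^ 80" by (simp flip: power_add)
  also have "26 * (int n)\<^sup>2 * int n ^ 108 = 26 * int n ^ 110" by (simp flip: power_add)
  also have "2 * int n ^ 80 + 26 * int n ^ 110 \<le> 28 * int n ^ 110"
    using power_increasing[of 80 110 "int n"] n by simp
  finally show ?thesis .
qed

lemma best_response:
  assumes Z: "sym_on {..<n} (Z t)" "\<And>i j. i < n \<Longrightarrow> j < n \<Longrightarrow> \<bar>Z t i j\<bar> \<le> int n ^ 108"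
    and S: "S \<subseteq> {..<n}" "card S = k"
  shows "best_response n (n ^ 117) (M t) (int n ^ 116) (int n ^ 60) (y S)"
proof
  show "sym_on {..<n} (M t)" by (rule drift_sym[OF a_sym Z(1)])
  show "0 < n" "0 < int n ^ 116" "0 < int n ^ 60" using n by auto
  show "int n ^ 116 * int n \<le> int (n ^ 117)" by (simp flip: power_Suc2)
  show "(\<Sum>i<n. (y S i)\<^sup>2) = 1" by (rule y_norm[OF S])
  have "0 \<le> 2 * real n ^ 64 * (\<Sum>i\<in>S. \<Sum>j\<in>S. real_of_int (a i j))"
    using S(1) a_nonneg by (intro mult_nonneg_nonneg sum_nonneg) auto
  also have "\<dots> \<le> (\<Sum>i\<in>S. \<Sum>j\<in>S. real_of_int (M t i j))"
    unfolding real_M by (rule dot_drift_planted[OF S]) simp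
  finally show "0 \<le> (\<Sum>i<n. \<Sum>j<n. y S i * real_of_int (M t i j) * y S j)"
    unfolding y_quad[OF S(1)] by simp
  fix i assume i: "i < n"
  have "(\<Sum>j<n. \<bar>M t i j\<bar>) \<le> of_nat (card {..<n}) * (28 * int n ^ 110)"
    using M_abs[OF Z(2) i] by (intro sum_bounded_above) auto
  also have "\<dots> = 28 * int n ^ 111" using power_add[of "int n" 1 110] by simp
  also have "\<dots> \<le> int n ^ 116" using power_le[of 111] by simp
  finally show "(\<Sum>j<n. \<bar>M t i j\<bar>) \<le> int n ^ 116" .
qed

lemma shifted_P: "shifted n k a (Z t) = best_response.P (M t) (int n ^ 116)"
  if "best_response n (n ^ 117) (M t) (int n ^ 116) (int n ^ 60) (y S)"
  using best_response.P_def[OF that] by (auto simp: shifted_def fun_eq_iff)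

lemma sol_bounds: "t \<le> n ^ 48 \<Longrightarrow> sym_on {..<n} (Z t) \<and>
  (\<forall>i<n. \<forall>j<n. \<bar>Z t i j\<bar> \<le> int t * int n ^ 60) \<and> (\<Sum>i<n. Z t i i) \<le> int t * int n ^ 60"
proof (induction t)
  case 0
  then show ?case by (simp add: sym_on_def)
next
  case (Suc t)
  then have IH: "sym_on {..<n} (Z t)" "\<And>i j. i < n \<Longrightarrow> j < n \<Longrightarrow> \<bar>Z t i j\<bar> \<le> int t * int n ^ 60"
    "(\<Sum>i<n. Z t i i) \<le> int t * int n ^ 60" by auto
  have Z: "\<bar>Z t i j\<bar> \<le> int n ^ 108" if "i < n" "j < n" for i j
  proof -
    have "int t * int n ^ 60 \<le> int n ^ 48 * int n ^ 60"
      using Suc.prems by (intro mult_right_mono) (auto simp flip: of_nat_power)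
    then show ?thesis using IH(2)[OF that] by (simp flip: power_add)
  qed
  \<comment> \<open>The bounds do not mention a planted set; any set of size \<open>k\<close>
    supplies the comparison vector required by the locale.\<close>
  have S: "{..<k} \<subseteq> {..<n}" "card {..<k} = k" using k by auto
  interpret b: best_response n "n ^ 117" "M t" "int n ^ 116" "int n ^ 60" "y {..<k}"
    by (rule best_response[OF IH(1) Z S])
  have P: "b.V = V t" by (simp add: shifted_P[OF b.best_response_axioms])
  have "sym_on {..<n} (Z (Suc t))"
    using IH(1) b.V_sym unfolding P sym_on_def by simp
  moreover have "\<bar>Z (Suc t) i j\<bar> \<le> int (Suc t) * int n ^ 60" if "i < n" "j < n" for i j
    using IH(2)[OF that] b.V_abs[OF that] unfolding P by (simp add: algebra_simps)
  moreover have "(\<Sum>i<n. Z (Suc t) i i) \<le> int (Suc t) * int n ^ 60"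
    using IH(3) b.V_trace unfolding P by (simp add: algebra_simps sum.distrib)
  ultimately show ?case by blast
qed

lemma sol_abs: "t \<le> n ^ 48 \<Longrightarrow> i < n \<Longrightarrow> j < n \<Longrightarrow> \<bar>Z t i j\<bar> \<le> int n ^ 108"
proof -
  assume "t \<le> n ^ 48" "i < n" "j < n"
  then have "\<bar>Z t i j\<bar> \<le> int t * int n ^ 60" using sol_bounds by blast
  also have "\<dots> \<le> int n ^ 48 * int n ^ 60"
    using \<open>t \<le> n ^ 48\<close> by (intro mult_right_mono) (auto simp flip: of_nat_power)
  finally show ?thesis by (simp flip: power_add)
qed

lemma sol_response:
  assumes "t \<le> n ^ 48" "S \<subseteq> {..<n}" "card S = k"
  shows "best_response n (n ^ 117) (M t) (int n ^ 116) (int n ^ 60) (y S)"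
  using best_response[of t S] sol_bounds[OF assms(1)] sol_abs[OF assms(1)] assms(2,3) by blast

text \<open>Each response scores against the drift almost as well as the normalised indicator of
  \<open>S\<close>, so potential plus weighted regret grows by a bounded amount per step: 13 from
  the spread and 1 from rounding and the oracle error. Dropping the potential bounds the regret;
  bounding the objective instead controls the violations.\<close>

lemma sol_potential:
  assumes S: "S \<subseteq> {..<n}" "card S = k"
  defines "A \<equiv> (\<Sum>i\<in>S. \<Sum>j\<in>S. real_of_int (a i j))"
  shows "t \<le> n ^ 48 \<Longrightarrow> potential n (real k) (\<lambda>i j. of_int (Z t i j)) +
     2 * real n ^ 64 * (t * (real n ^ 60 / k * A) - dot n (\<lambda>i j. of_int (a i j)) (\<lambda>i j. of_int (Z t i j)))
     \<le> t * (14 * real n ^ 123)"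
proof (induction t)
  case 0
  have "potential n (real k) (\<lambda>i j. 0) = 0"
    by (simp add: potential_def pos_def row_excess_def diag_excess_def)
  then show ?case by (simp add: dot_def)
next
  case (Suc t)
  have t: "t \<le> n ^ 48" using Suc.prems by simp
  interpret b: best_response n "n ^ 117" "M t" "int n ^ 116" "int n ^ 60" "y S"
    by (rule sol_response[OF t S])
  have P: "b.V = V t" by (simp add: shifted_P[OF b.best_response_axioms])
  let ?a = "\<lambda>i j. real_of_int (a i j)" and ?Z = "\<lambda>i j. real_of_int (Z t i j)" and ?V = "\<lambda>i j. real_of_int (V t i j)"
  let ?M = "\<lambda>i j. real_of_int (M t i j)" and ?H = "real n ^ 64" and ?B = "real n ^ 60"
  have sV: "sym_on {..<n} ?V" using b.V_sym unfolding P sym_on_def by simp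
  have "potential n k (\<lambda>i j. ?Z i j + ?V i j) \<le> potential n k ?Z -
      (dot n (drift n k ?H ?a ?Z) ?V - 2 * ?H * dot n ?a ?V) + spread n k ?V"
    by (rule potential_add[OF sV])
  moreover have "spread n k ?V \<le> 13 * real n ^ 3 * ?B\<^sup>2"
  proof (rule spread_le)
    fix i j assume "i < n" "j < n"
    from b.V_abs[OF this] have "real_of_int \<bar>V t i j\<bar> \<le> real_of_int (int n ^ 60)" unfolding P by (simp only: of_int_le_iff)
    then show "\<bar>?V i j\<bar> \<le> ?B" by simp
  qed (use n k in auto)
  moreover have "13 * real n ^ 3 * ?B\<^sup>2 = 13 * real n ^ 123" by (simp flip: power_mult power_add)
  moreover have "drift n k ?H ?a ?Z = ?M" by (simp add: real_M fun_eq_iff)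
  moreover have "?B * (2 * ?H * A / k) - ?B - 28 * real n ^ 112 \<le> dot n ?M ?V"
  proof -
    have "2 * ?H * A \<le> (\<Sum>i\<in>S. \<Sum>j\<in>S. ?M i j)"
      unfolding A_def real_M by (rule dot_drift_planted[OF S]) simp
    then have "?B * (2 * ?H * A / k) \<le> ?B * ((\<Sum>i\<in>S. \<Sum>j\<in>S. ?M i j) / k)"
      by (intro mult_left_mono divide_right_mono) auto
    moreover have "(\<Sum>i<n. \<Sum>j<n. \<bar>?M i j\<bar>) \<le> 28 * real n ^ 112"
    proof -
      have "\<bar>?M i j\<bar> \<le> 28 * real n ^ 110" if "i < n" "j < n" for i j
      proof -
        have "real_of_int \<bar>M t i j\<bar> \<le> real_of_int (28 * int n ^ 110)"
          using M_abs[OF sol_abs[OF t] that] by (simp only: of_int_le_iff)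
        then show ?thesis by simp
      qed
      then have "(\<Sum>i<n. \<Sum>j<n. \<bar>?M i j\<bar>) \<le> (\<Sum>i<n. \<Sum>j<n. 28 * real n ^ 110)" by (intro sum_mono) auto
      also have "\<dots> = 28 * (real n * real n * real n ^ 110)" by simp
      also have "real n * real n * real n ^ 110 = real n ^ 112"
        using power_add[of "real n" 2 110] by (simp add: power2_eq_square)
      finally show ?thesis .
    qed
    ultimately show ?thesis using b.V_response unfolding P y_quad[OF S(1)] by simp
  qed
  moreover have "?B + 28 * real n ^ 112 \<le> real n ^ 123"
  proof -
    have "?B \<le> real n ^ 122" using n by (intro power_increasing) auto
    moreover have "28 * real n ^ 112 \<le> real n ^ 117"
    proof -
      have "real_of_int (28 * int n ^ 112) \<le> real_of_int (int n ^ (112 + 5))" using power_le[of 112] by (simp only: of_int_le_iff)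
      then show ?thesis by simp
    qed
    moreover have "real n ^ 117 \<le> real n ^ 122" using n by (intro power_increasing) auto
    moreover have "2 * real n ^ 122 \<le> real n * real n ^ 122" using n by (intro mult_right_mono) auto
    moreover have "real n * real n ^ 122 = real n ^ 123"
      using power_add[of "real n" 1 122] by simp
    ultimately show ?thesis by linarith
  qed
  moreover have "dot n ?a (\<lambda>i j. ?Z i j + ?V i j) = dot n ?a ?Z + dot n ?a ?V"
    by (simp add: dot_def distrib_left sum.distrib)
  ultimately have 1: "potential n k (\<lambda>i j. ?Z i j + ?V i j) + 2 * ?H * (?B / k * A) - 2 * ?H * dot n ?a (\<lambda>i j. ?Z i j + ?V i j)
     \<le> potential n k ?Z - 2 * ?H * dot n ?a ?Z + 14 * real n ^ 123"
    by (simp add: algebra_simps)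
  define g where "g = ?B / k * A"
  define c where "c = 14 * real n ^ 123"
  note IH = Suc.IH[OF t, folded g_def c_def] and 1 = 1[folded g_def c_def]
  have Z': "(\<lambda>i j. real_of_int (Z (Suc t) i j)) = (\<lambda>i j. ?Z i j + ?V i j)" by simp
  show ?case unfolding Z' g_def[symmetric] c_def[symmetric] using IH 1
    by (simp add: algebra_simps del: sol.simps)
qed

lemma sol_psd:
  assumes U: "U \<subseteq> {..<n}" and Q: "\<And>x. 0 \<le> (\<Sum>i\<in>U. \<Sum>j\<in>U. x i * Q i j * x j)"
  shows "t \<le> n ^ 48 \<Longrightarrow> - (t * (\<Sum>i\<in>U. \<Sum>j\<in>U. \<bar>Q i j\<bar>)) \<le> (\<Sum>i\<in>U. \<Sum>j\<in>U. Q i j * real_of_int (Z t i j))"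
proof (induction t)
  case (Suc t)
  have t: "t \<le> n ^ 48" using Suc.prems by simp
  have S: "{..<k} \<subseteq> {..<n}" "card {..<k} = k" using k by auto
  interpret b: best_response n "n ^ 117" "M t" "int n ^ 116" "int n ^ 60" "y {..<k}"
    by (rule sol_response[OF t S])
  have P: "b.V = V t" by (simp add: shifted_P[OF b.best_response_axioms])
  have "(\<Sum>i\<in>U. \<Sum>j\<in>U. Q i j * real_of_int (Z (Suc t) i j)) =
     (\<Sum>i\<in>U. \<Sum>j\<in>U. Q i j * real_of_int (Z t i j)) + (\<Sum>i\<in>U. \<Sum>j\<in>U. Q i j * real_of_int (V t i j))"
    by (simp add: distrib_left sum.distrib)
  then show ?case using Suc.IH[OF t] b.V_psd[OF U Q] unfolding P by (simp add: algebra_simps)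
qed simp

text \<open>\<open>Z\<close> sums \<open>n ^ 48\<close> responses of trace close to
  \<open>n ^ 60\<close>, so this factor brings the trace close to \<open>k\<close>.\<close>

definition "x i j = real_of_int (Z (n ^ 48) i j) * (k / real n ^ 108)"

lemma scale_pos: "0 < k / real n ^ 108" using k n by simp

lemma x_sym: "sym_on {..<n} x"
  using sol_bounds[of "n ^ 48"] by (simp add: sym_on_def x_def)

lemma x_trace: "(\<Sum>i<n. x i i) \<le> k"
proof -
  have "(\<Sum>i<n. Z (n ^ 48) i i) \<le> int n ^ 108" using sol_bounds[of "n ^ 48"] by (simp flip: power_add)
  then have "real_of_int (\<Sum>i<n. Z (n ^ 48) i i) \<le> real_of_int (int n ^ 108)" by (simp only: of_int_le_iff)
  then have "(\<Sum>i<n. real_of_int (Z (n ^ 48) i i)) * (k / real n ^ 108) \<le> real n ^ 108 * (k / real n ^ 108)"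
    by (intro mult_right_mono) auto
  then show ?thesis using n by (simp add: x_def sum_distrib_right sum_divide_distrib)
qed

lemma sol_trace_ge: "t \<le> n ^ 48 \<Longrightarrow> int t * (int n ^ 60 - int n) \<le> (\<Sum>i<n. Z t i i)"
proof (induction t)
  case (Suc t)
  have t: "t \<le> n ^ 48" using Suc.prems by simp
  have S: "{..<k} \<subseteq> {..<n}" "card {..<k} = k" using k by auto
  interpret b: best_response n "n ^ 117" "M t" "int n ^ 116" "int n ^ 60" "y {..<k}"
    by (rule sol_response[OF t S])
  have P: "b.V = V t" by (simp add: shifted_P[OF b.best_response_axioms])
  show ?case using Suc.IH[OF t] b.V_trace_ge unfolding P by (simp add: algebra_simps sum.distrib)
qed simp

lemma x_trace_ge: "k - 1 / real n ^ 12 \<le> (\<Sum>i<n. x i i)"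
proof -
  have "real_of_int (int (n ^ 48) * (int n ^ 60 - int n)) \<le> real_of_int (\<Sum>i<n. Z (n ^ 48) i i)"
    unfolding of_int_le_iff by (rule sol_trace_ge) simp
  then have "(real n ^ 48 * (real n ^ 60 - n)) * (k / real n ^ 108) \<le> (\<Sum>i<n. real_of_int (Z (n ^ 48) i i)) * (k / real n ^ 108)"
    using scale_pos by (intro mult_right_mono) auto
  moreover have "(real n ^ 48 * (real n ^ 60 - n)) * (k / real n ^ 108) = k - k * (n / real n ^ 60)"
    using n power_add[of "real n" 48 60] by (simp add: field_simps)
  moreover have "k * (n / real n ^ 60) \<le> 1 / real n ^ 12"
  proof -
    have "real k * n * real n ^ 12 \<le> n * n * real n ^ 12" using k by (intro mult_right_mono) auto
    also have "\<dots> = real n ^ 14" using power_add[of "real n" 2 12] by (simp add: power2_eq_square)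
    also have "\<dots> \<le> real n ^ 60" using n by (intro power_increasing) auto
    finally show ?thesis using n by (simp add: field_simps)
  qed
  moreover have "(\<Sum>i<n. real_of_int (Z (n ^ 48) i i)) * (k / real n ^ 108) = (\<Sum>i<n. x i i)"
    unfolding x_def sum_distrib_right ..
  ultimately show ?thesis by linarith
qed

text \<open>The potential is nonnegative, so the regret of \<open>Z\<close> is at most
  \<open>14 * n ^ 171 / (2 * n ^ 64) = 7 * n ^ 107\<close>, and scaling by
  \<open>k / n ^ 108\<close> leaves at most 7, little on the scale \<open>n ^ 16\<close> of the
  objective.\<close>

lemma x_objective:
  assumes S: "S \<subseteq> {..<n}" "card S = k"
  shows "(\<Sum>i\<in>S. \<Sum>j\<in>S. real_of_int (a i j)) - 7 \<le> dot n (\<lambda>i j. real_of_int (a i j)) x"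
proof -
  let ?A = "\<Sum>i\<in>S. \<Sum>j\<in>S. real_of_int (a i j)" let ?D = "dot n (\<lambda>i j. of_int (a i j)) (\<lambda>i j. of_int (Z (n ^ 48) i j))"
  have "2 * real n ^ 64 * (real (n ^ 48) * (real n ^ 60 / k * ?A) - ?D) \<le> real (n ^ 48) * (14 * real n ^ 123)"
    using sol_potential[OF S order_refl] potential_nonneg[of n "real k" "\<lambda>i j. of_int (Z (n ^ 48) i j)"] by linarith
  also have "real (n ^ 48) * (real n ^ 60 / k * ?A) = real n ^ 108 / k * ?A" by (simp flip: power_add)
  also have "real (n ^ 48) * (14 * real n ^ 123) = 2 * real n ^ 64 * (7 * real n ^ 107)" by (simp flip: power_add)
  finally have "real n ^ 108 / k * ?A - ?D \<le> 7 * real n ^ 107" using n by (subst (asm) mult_le_cancel_left_pos) auto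
  then have "(real n ^ 108 / k * ?A - ?D) * (k / real n ^ 108) \<le> 7 * real n ^ 107 * (k / real n ^ 108)"
    using scale_pos by (intro mult_right_mono) auto
  moreover have "(real n ^ 108 / k * ?A - ?D) * (k / real n ^ 108) = ?A - ?D * (k / real n ^ 108)"
    using k n by (simp add: field_simps)
  moreover have "?D * (k / real n ^ 108) = dot n (\<lambda>i j. of_int (a i j)) x"
    by (simp add: dot_def x_def sum_distrib_right sum_divide_distrib mult.assoc)
  moreover have "7 * real n ^ 107 * (k / real n ^ 108) \<le> 7"
  proof -
    have "real n ^ 107 * k \<le> real n ^ 107 * n" using k by (intro mult_left_mono) auto
    also have "real n ^ 107 * n = real n ^ 108" using power_add[of "real n" 107 1] by simp
    finally show ?thesis using n by (simp add: field_simps)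
  qed
  ultimately show ?thesis by linarith
qed

lemma x_psd:
  assumes U: "U \<subseteq> {..<n}" and Q: "\<And>x. 0 \<le> (\<Sum>i\<in>U. \<Sum>j\<in>U. x i * Q i j * x j)"
  shows "- (k / real n ^ 60 * (\<Sum>i\<in>U. \<Sum>j\<in>U. \<bar>Q i j\<bar>)) \<le> (\<Sum>i\<in>U. \<Sum>j\<in>U. Q i j * x i j)"
proof -
  have "- (real (n ^ 48) * (\<Sum>i\<in>U. \<Sum>j\<in>U. \<bar>Q i j\<bar>)) * (k / real n ^ 108)
    \<le> (\<Sum>i\<in>U. \<Sum>j\<in>U. Q i j * real_of_int (Z (n ^ 48) i j)) * (k / real n ^ 108)"
    using scale_pos sol_psd[OF U Q order_refl] by (intro mult_right_mono) auto
  moreover have "(\<Sum>i\<in>U. \<Sum>j\<in>U. Q i j * real_of_int (Z (n ^ 48) i j)) * (k / real n ^ 108) = (\<Sum>i\<in>U. \<Sum>j\<in>U. Q i j * x i j)"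
    by (simp add: x_def sum_distrib_right sum_divide_distrib mult.assoc)
  moreover have e: "real (n ^ 48) * (k / real n ^ 108) = k / real n ^ 60"
    using n power_add[of "real n" 48 60] by (simp add: field_simps)
  moreover have "- (real (n ^ 48) * q) * (k / real n ^ 108) = - (k / real n ^ 60 * q)" for q
    unfolding e[symmetric] by (simp only: mult_minus_left mult_ac)
  ultimately show ?thesis by metis
qed

text \<open>The accumulated objective is at most \<open>n ^ 16 * n ^ 108\<close>. Hence the
  potential is at most \<open>14 * n ^ 171 + 2 * n ^ 188\<close>, below the square of
  \<open>2 * n ^ 94\<close>, and scaling brings this violation under
  \<open>1 / n ^ 12\<close>.\<close>

lemma x_violations:
  assumes ij: "i < n" "j < n"
  shows "- (1 / real n ^ 12) \<le> x i j" "x i j \<le> x i i + 1 / real n ^ 12"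
    "(\<Sum>l<n. x i l) \<le> k * x i i + 1 / real n ^ 12" "k * x i i \<le> (\<Sum>l<n. x l l) + 1 / real n ^ 12"
proof -
  let ?Z = "\<lambda>i j. real_of_int (Z (n ^ 48) i j)" let ?s = "k / real n ^ 108" let ?e = "2 * real n ^ 94"
  have S: "{..<k} \<subseteq> {..<n}" "card {..<k} = k" using k by auto
  let ?A = "\<Sum>i\<in>{..<k}. \<Sum>j\<in>{..<k}. real_of_int (a i j)" let ?D = "dot n (\<lambda>i j. of_int (a i j)) ?Z"
  have A0: "0 \<le> ?A" using k a_nonneg by (intro sum_nonneg) auto
  have D: "?D \<le> real n ^ 124"
  proof -
    have "?D \<le> (\<Sum>i<n. \<Sum>j<n. real_of_int (a i j) * real n ^ 108)"
      unfolding dot_def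
    proof (intro sum_mono)
      fix i j assume "i \<in> {..<n}" "j \<in> {..<n}"
      then have "real_of_int (Z (n ^ 48) i j) \<le> real_of_int (int n ^ 108)" "0 \<le> a i j"
        using sol_abs[OF order_refl, of i j] a_nonneg unfolding of_int_le_iff by auto
      then show "real_of_int (a i j) * real_of_int (Z (n ^ 48) i j) \<le> real_of_int (a i j) * real n ^ 108"
        by (intro mult_left_mono) auto
    qed
    also have "\<dots> = real_of_int (\<Sum>i<n. \<Sum>j<n. a i j) * real n ^ 108" by (simp add: sum_distrib_right)
    also have "\<dots> \<le> real_of_int (int n ^ 16) * real n ^ 108"
      using a_sum by (intro mult_right_mono) (simp_all only: of_int_le_iff zero_le_power of_nat_0_le_iff)
    also have "\<dots> = real n ^ 124" by (simp flip: power_add)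
    finally show ?thesis .
  qed
  have "potential n (real k) ?Z \<le> real (n ^ 48) * (14 * real n ^ 123) + 2 * real n ^ 64 * (?D - real (n ^ 48) * (real n ^ 60 / k * ?A))"
    using sol_potential[OF S order_refl] by (simp add: algebra_simps)
  also have "\<dots> \<le> real (n ^ 48) * (14 * real n ^ 123) + 2 * real n ^ 64 * real n ^ 124"
    using D A0 by (intro add_left_mono mult_left_mono) (auto intro: order.trans[rotated])
  also have "\<dots> = 14 * real n ^ 171 + 2 * real n ^ 188"
  proof -
    have "real n ^ 48 * real n ^ 123 = real n ^ 171" "real n ^ 64 * real n ^ 124 = real n ^ 188"
      by (simp_all flip: power_add)
    then show ?thesis by (simp only: of_nat_power mult.left_commute[of _ 14] mult.assoc)
  qed
  also have "\<dots> \<le> ?e\<^sup>2"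
  proof -
    have "(7::real) \<le> 2 ^ 17" by simp
    also have "\<dots> \<le> real n ^ 17" using n by (intro power_mono) auto
    finally have "7 * real n ^ 171 \<le> real n ^ 17 * real n ^ 171" by (intro mult_right_mono) auto
    then show ?thesis by (simp add: power_mult_distrib flip: power_mult power_add)
  qed
  finally have pot: "potential n (real k) ?Z \<le> ?e\<^sup>2" .
  have e: "?e * ?s \<le> 1 / real n ^ 12"
  proof -
    have "2 * real k \<le> real n * real n" using n k by (intro mult_mono) auto
    then have "2 * real k * real n ^ 106 \<le> (real n * real n) * real n ^ 106" by (intro mult_right_mono) auto
    also have "\<dots> = real n ^ 108" using power_add[of "real n" 2 106] by (simp add: power2_eq_square)
    finally have "?e * ?s * real n ^ 12 \<le> 1"
      using n power_add[of "real n" 94 12] by (simp add: field_simps)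
    then show ?thesis using n by (simp add: field_simps)
  qed
  note v = violations_le_potential[OF ij pot]
  have sc: "u * ?s \<le> w * ?s + 1 / real n ^ 12" if "u \<le> w + ?e" for u w
  proof -
    have "u * ?s \<le> (w + ?e) * ?s" using that scale_pos by (intro mult_right_mono) auto
    then show ?thesis using e unfolding distrib_right by linarith
  qed
  have "0 \<le> ?Z i j + ?e" using v(1) by simp
  from sc[OF this] show "- (1 / real n ^ 12) \<le> x i j" by (simp add: x_def)
  have "?Z i j \<le> ?Z i i + ?e" using v(2) by simp
  from sc[OF this] show "x i j \<le> x i i + 1 / real n ^ 12" by (simp add: x_def)
  have "(\<Sum>l<n. ?Z i l) \<le> k * ?Z i i + ?e" using v(3) by simp
  from sc[OF this] show "(\<Sum>l<n. x i l) \<le> k * x i i + 1 / real n ^ 12"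
    unfolding x_def sum_distrib_right[symmetric] mult.assoc[symmetric] .
  have "k * ?Z i i \<le> (\<Sum>l<n. ?Z l l) + ?e" using v(4) by simp
  from sc[OF this] show "k * x i i \<le> (\<Sum>l<n. x l l) + 1 / real n ^ 12"
    unfolding x_def sum_distrib_right[symmetric] mult.assoc[symmetric] .
qed

end

section \<open>Recovery of the planted set\<close>

lemma expander_quadratic_form:
  assumes fin: "finite U" "U \<noteq> {}" and nn: "\<And>i j. i \<in> U \<Longrightarrow> j \<in> U \<Longrightarrow> 0 \<le> w {i, j}"
    and ex: "expander_on U w d lam" and v: "(\<Sum>i\<in>U. v i) = 0"
  shows "\<bar>\<Sum>i\<in>U. \<Sum>j\<in>U. v i * w {i, j} * v j\<bar> \<le> lam * (\<Sum>i\<in>U. (v i)\<^sup>2)"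
proof -
  define vs where "vs = sorted_list_of_set U"
  define m where "m = card U"
  have bij: "bij_betw (\<lambda>a. vs ! a) {..<m} U"
    unfolding vs_def m_def using fin(1) by (metis bij_betw_nth distinct_sorted_list_of_set length_sorted_list_of_set set_sorted_list_of_set)
  have re: "(\<Sum>a<m. f (vs ! a)) = (\<Sum>u\<in>U. f u)" for f :: "nat \<Rightarrow> real"
    by (rule sum.reindex_bij_betw[OF bij])
  have mem: "vs ! a \<in> U" if "a < m" for a using bij that by (auto simp: bij_betw_def)
  let ?A = "adjacency_mat_on U w"
  have A: "?A \<in> carrier_mat m m" by (simp add: adjacency_mat_on_def m_def Let_def)
  have Aij: "?A $$ (a, b) = w {vs ! a, vs ! b}" if "a < m" "b < m" for a b
    using that by (simp add: adjacency_mat_on_def vs_def m_def Let_def)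
  have m0: "0 < m" using fin by (simp add: m_def card_gt_0_iff)
  have reg: "(\<Sum>b<m. ?A $$ (a, b)) = d" if "a < m" for a
  proof -
    have "(\<Sum>b<m. ?A $$ (a, b)) = (\<Sum>b<m. w {vs ! a, vs ! b})" using Aij that by simp
    also have "\<dots> = (\<Sum>u\<in>U. w {vs ! a, u})" by (rule re)
    finally show ?thesis using ex mem[OF that] by (simp add: expander_on_def regular_on_def)
  qed
  have v0: "(\<Sum>a<m. v (vs ! a)) = 0" using re v by simp
  have "\<bar>\<Sum>a<m. \<Sum>b<m. v (vs ! a) * ?A $$ (a, b) * v (vs ! b)\<bar> \<le> lam * (\<Sum>a<m. (v (vs ! a))\<^sup>2)"
  proof (rule regular_quadratic_form_bound[OF A _ _ reg m0 _ _ v0])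
    show "?A $$ (i, j) = ?A $$ (j, i)" if "i < m" "j < m" for i j using that by (simp add: Aij insert_commute)
    show "0 \<le> ?A $$ (i, j)" if "i < m" "j < m" for i j using that by (simp add: Aij nn mem)
    show "0 \<le> lam" using ex by (simp add: expander_on_def)
    show "\<forall>x\<in>#proots (char_poly ?A) - {#Max (set_mset (proots (char_poly ?A)))#}. \<bar>x\<bar> \<le> lam"
      using ex by (simp add: expander_on_def spectrum_on_def)
  qed
  moreover have "(\<Sum>a<m. \<Sum>b<m. v (vs ! a) * ?A $$ (a, b) * v (vs ! b)) =
      (\<Sum>a<m. \<Sum>b<m. v (vs ! a) * w {vs ! a, vs ! b} * v (vs ! b))" by (simp add: Aij)
  moreover have "\<dots> = (\<Sum>a<m. \<Sum>u\<in>U. v (vs ! a) * w {vs ! a, u} * v u)"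
  proof (intro sum.cong[OF refl])
    fix a
    show "(\<Sum>b<m. v (vs ! a) * w {vs ! a, vs ! b} * v (vs ! b)) = (\<Sum>u\<in>U. v (vs ! a) * w {vs ! a, u} * v u)"
      by (rule re)
  qed
  moreover have "\<dots> = (\<Sum>u'\<in>U. \<Sum>u\<in>U. v u' * w {u', u} * v u)" by (rule re)
  ultimately show ?thesis using re[of "\<lambda>u. (v u)\<^sup>2"] by simp
qed

context
  fixes U :: "nat set" and w :: "nat set \<Rightarrow> real" and d lam :: real
  assumes fin: "finite U" "U \<noteq> {}" and nn: "\<And>i j. i \<in> U \<Longrightarrow> j \<in> U \<Longrightarrow> 0 \<le> w {i, j}"
    and loopfree: "\<And>i. i \<in> U \<Longrightarrow> w {i} = 0" and ex: "expander_on U w d lam"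
begin

lemma expander_row: "i \<in> U \<Longrightarrow> (\<Sum>j\<in>U. w {i, j}) = d"
  using ex by (simp add: expander_on_def regular_on_def)

lemma expander_degree_nonneg: "0 \<le> d"
  using expander_row nn fin(2) by (metis all_not_in_conv sum_nonneg)

lemma expander_form_split:
  assumes "(\<Sum>i\<in>U. v i) = 0"
  shows "(\<Sum>i\<in>U. \<Sum>j\<in>U. (v i + c) * w {i, j} * (v j + c)) =
    (\<Sum>i\<in>U. \<Sum>j\<in>U. v i * w {i, j} * v j) + d * card U * c\<^sup>2"
proof -
  have "(\<Sum>i\<in>U. \<Sum>j\<in>U. w {i, j} * v j) = (\<Sum>j\<in>U. \<Sum>i\<in>U. w {i, j} * v j)" by (rule sum.swap)
  also have "\<dots> = (\<Sum>j\<in>U. (\<Sum>i\<in>U. w {j, i}) * v j)" by (simp add: sum_distrib_right insert_commute)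
  also have "\<dots> = d * (\<Sum>j\<in>U. v j)" by (simp add: expander_row sum_distrib_left)
  finally have 1: "(\<Sum>i\<in>U. \<Sum>j\<in>U. w {i, j} * v j) = 0" using assms by simp
  have "(\<Sum>i\<in>U. \<Sum>j\<in>U. v i * w {i, j}) = (\<Sum>i\<in>U. v i * d)" by (simp add: expander_row flip: sum_distrib_left)
  then have 2: "(\<Sum>i\<in>U. \<Sum>j\<in>U. v i * w {i, j}) = 0" using assms by (simp flip: sum_distrib_right)
  have 3: "(\<Sum>i\<in>U. \<Sum>j\<in>U. w {i, j}) = d * card U" by (simp add: expander_row)
  have "(\<Sum>i\<in>U. \<Sum>j\<in>U. (v i + c) * w {i, j} * (v j + c)) =
    (\<Sum>i\<in>U. \<Sum>j\<in>U. v i * w {i, j} * v j + c * (v i * w {i, j}) + c * (w {i, j} * v j) + c\<^sup>2 * w {i, j})"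
    by (intro sum.cong refl) (simp add: power2_eq_square algebra_simps)
  also have "\<dots> = (\<Sum>i\<in>U. \<Sum>j\<in>U. v i * w {i, j} * v j) + c * (\<Sum>i\<in>U. \<Sum>j\<in>U. v i * w {i, j}) +
      c * (\<Sum>i\<in>U. \<Sum>j\<in>U. w {i, j} * v j) + c\<^sup>2 * (\<Sum>i\<in>U. \<Sum>j\<in>U. w {i, j})"
    by (simp only: sum.distrib sum_distrib_left)
  finally show ?thesis using 1 2 3 by simp
qed

text \<open>Test the spectral bound with a unit vector minus its mean: since there is no loop, the
  form takes the value \<open>- d / card U\<close>. The lower bound on \<open>lam\<close> obtained
  this way feeds the estimate of the margin.\<close>

lemma expander_degree_le: "d \<le> lam * card U"
proof -
  let ?m = "real (card U)"
  have m: "0 < ?m" using fin by (simp add: card_gt_0_iff)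
  have l0: "0 \<le> lam" using ex by (simp add: expander_on_def)
  obtain i where i: "i \<in> U" using fin(2) by blast
  define v where "v j = of_bool (j = i) - 1 / ?m" for j
  have v0: "(\<Sum>j\<in>U. v j) = 0" using i fin m by (simp add: v_def sum_subtractf)
  have sel: "(\<Sum>j\<in>U. of_bool (j = i) * f j) = f i" for f :: "nat \<Rightarrow> real"
  proof -
    have "(\<Sum>j\<in>U. of_bool (j = i) * f j) = (\<Sum>j\<in>U. if j = i then f j else 0)" by (intro sum.cong) auto
    then show ?thesis using i fin by simp
  qed
  have "(\<Sum>a\<in>U. \<Sum>b\<in>U. (v a + 1 / ?m) * w {a, b} * (v b + 1 / ?m)) = (\<Sum>a\<in>U. of_bool (a = i) * (\<Sum>b\<in>U. of_bool (b = i) * w {a, b}))"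
    by (simp add: v_def sum_distrib_left algebra_simps)
  also have "\<dots> = w {i}" by (simp only: sel) simp
  finally have "(\<Sum>a\<in>U. \<Sum>b\<in>U. v a * w {a, b} * v b) = - (d / ?m)"
    using expander_form_split[OF v0, of "1 / ?m"] loopfree[OF i] m by (simp add: power2_eq_square field_simps)
  then have "d / ?m \<le> lam * (\<Sum>a\<in>U. (v a)\<^sup>2)"
    using expander_quadratic_form[OF fin nn ex v0] by linarith
  also have "(\<Sum>a\<in>U. (v a)\<^sup>2) \<le> 1"
  proof -
    have "(\<Sum>a\<in>U. (v a)\<^sup>2) = (\<Sum>a\<in>U. of_bool (a = i) * (1 - 2 / ?m) + 1 / ?m\<^sup>2)"
      using m by (intro sum.cong refl) (simp add: v_def power2_eq_square field_simps)
    also have "\<dots> = 1 - 2 / ?m + ?m * (1 / ?m\<^sup>2)" using sel[of "\<lambda>_. 1 - 2 / ?m"] by (simp add: sum.distrib)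
    also have "\<dots> = 1 - 1 / ?m" using m by (simp add: power2_eq_square field_simps)
    finally show ?thesis using m by simp
  qed
  then have "lam * (\<Sum>a\<in>U. (v a)\<^sup>2) \<le> lam" using l0 by (simp add: mult_left_le)
  finally show ?thesis using m by (simp add: field_simps)
qed

text \<open>The dual certificate for the outer block. For \<open>lam \<le> d\<close>, split off the
  mean of \<open>x\<close> and use the spectral bound on the rest; otherwise the degree already
  bounds the form. The minimum keeps the coefficient \<open>d - l\<close> nonnegative, as is needed
  to insert the row constraints.\<close>

lemma expander_psd:
  defines "l \<equiv> min lam d"
  shows "0 \<le> (\<Sum>i\<in>U. \<Sum>j\<in>U. x i * ((if i = j then l else 0) + (d - l) / card U - w {i, j}) * x j)"
proof -
  let ?m = "real (card U)"
  have m: "0 < ?m" using fin by (simp add: card_gt_0_iff)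
  let ?q = "\<Sum>i\<in>U. \<Sum>j\<in>U. x i * w {i, j} * x j" let ?s = "\<Sum>i\<in>U. x i" let ?n = "\<Sum>i\<in>U. (x i)\<^sup>2"
  have "(\<Sum>i\<in>U. \<Sum>j\<in>U. x i * (if i = j then l else 0) * x j) = (\<Sum>i\<in>U. l * (x i)\<^sup>2)"
  proof (intro sum.cong refl)
    fix i assume "i \<in> U"
    have "(\<Sum>j\<in>U. x i * (if i = j then l else 0) * x j) = (\<Sum>j\<in>U. if i = j then l * (x i)\<^sup>2 else 0)"
      by (intro sum.cong) (auto simp: power2_eq_square)
    then show "(\<Sum>j\<in>U. x i * (if i = j then l else 0) * x j) = l * (x i)\<^sup>2" using fin \<open>i \<in> U\<close> by simp
  qed
  moreover have "(\<Sum>i\<in>U. \<Sum>j\<in>U. x i * ((d - l) / ?m) * x j) = (d - l) / ?m * ?s\<^sup>2"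
  proof -
    have "(\<Sum>i\<in>U. \<Sum>j\<in>U. x i * ((d - l) / ?m) * x j) = (\<Sum>i\<in>U. x i * ((d - l) / ?m)) * ?s"
      by (rule sum_product[symmetric])
    then show ?thesis by (simp only: sum_distrib_right[symmetric] power2_eq_square mult_ac)
  qed
  ultimately have e: "(\<Sum>i\<in>U. \<Sum>j\<in>U. x i * ((if i = j then l else 0) + (d - l) / ?m - w {i, j}) * x j) =
      l * ?n + (d - l) / ?m * ?s\<^sup>2 - ?q"
    by (simp only: distrib_left right_diff_distrib distrib_right left_diff_distrib sum.distrib sum_subtractf sum_distrib_left)
  have "?q \<le> l * ?n + (d - l) / ?m * ?s\<^sup>2"
  proof (cases "lam \<le> d")
    case True
    then have l: "l = lam" by (simp add: l_def)
    define c where "c = ?s / ?m"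
    define v where "v i = x i - c" for i
    have v0: "(\<Sum>i\<in>U. v i) = 0" using m by (simp add: v_def c_def sum_subtractf)
    have "?q = (\<Sum>i\<in>U. \<Sum>j\<in>U. (v i + c) * w {i, j} * (v j + c))" by (simp add: v_def)
    also have "\<dots> = (\<Sum>i\<in>U. \<Sum>j\<in>U. v i * w {i, j} * v j) + d * ?m * c\<^sup>2" by (rule expander_form_split[OF v0])
    also have "\<dots> \<le> lam * (\<Sum>i\<in>U. (v i)\<^sup>2) + d * ?m * c\<^sup>2"
      using expander_quadratic_form[OF fin nn ex v0] by linarith
    also have "(\<Sum>i\<in>U. (v i)\<^sup>2) = ?n - ?m * c\<^sup>2"
    proof -
      have "(\<Sum>i\<in>U. (v i)\<^sup>2) = (\<Sum>i\<in>U. (x i)\<^sup>2 - 2 * c * x i + c\<^sup>2)"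
        by (intro sum.cong refl) (simp add: v_def power2_eq_square algebra_simps)
      also have "\<dots> = ?n - 2 * c * ?s + ?m * c\<^sup>2" by (simp add: sum.distrib sum_subtractf sum_distrib_left)
      also have "?s = c * ?m" using m by (simp add: c_def)
      finally show ?thesis by (simp add: power2_eq_square algebra_simps)
    qed
    also have "lam * (?n - ?m * c\<^sup>2) + d * ?m * c\<^sup>2 = lam * ?n + (d - lam) * (?m * c\<^sup>2)" by (simp add: algebra_simps)
    also have "?m * c\<^sup>2 = ?s\<^sup>2 / ?m" using m by (simp add: c_def power2_eq_square)
    finally show ?thesis using l by simp
  next
    case False
    then have l: "l = d" by (simp add: l_def)
    have "?q \<le> (\<Sum>i\<in>U. \<Sum>j\<in>U. w {i, j} * ((x i)\<^sup>2 / 2) + w {i, j} * ((x j)\<^sup>2 / 2))"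
    proof (intro sum_mono)
      fix i j assume "i \<in> U" "j \<in> U"
      then have "w {i, j} * (x i * x j) \<le> w {i, j} * (((x i)\<^sup>2 + (x j)\<^sup>2) / 2)"
        using nn sum_squares_bound[of "x i" "x j"] by (intro mult_left_mono) auto
      then show "x i * w {i, j} * x j \<le> w {i, j} * ((x i)\<^sup>2 / 2) + w {i, j} * ((x j)\<^sup>2 / 2)"
        by (simp add: algebra_simps add_divide_distrib)
    qed
    also have "\<dots> = (\<Sum>i\<in>U. \<Sum>j\<in>U. w {i, j} * ((x i)\<^sup>2 / 2)) + (\<Sum>i\<in>U. \<Sum>j\<in>U. w {i, j} * ((x j)\<^sup>2 / 2))"
      by (simp add: sum.distrib)
    also have "(\<Sum>i\<in>U. \<Sum>j\<in>U. w {i, j} * ((x j)\<^sup>2 / 2)) = (\<Sum>j\<in>U. \<Sum>i\<in>U. w {j, i} * ((x j)\<^sup>2 / 2))"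
      by (subst sum.swap) (simp add: insert_commute)
    also have "(\<Sum>i\<in>U. \<Sum>j\<in>U. w {i, j} * ((x i)\<^sup>2 / 2)) = d * ?n / 2"
    proof -
      have "(\<Sum>i\<in>U. \<Sum>j\<in>U. w {i, j} * ((x i)\<^sup>2 / 2)) = (\<Sum>i\<in>U. d * ((x i)\<^sup>2 / 2))"
        by (intro sum.cong refl) (simp only: sum_distrib_right[symmetric] expander_row)
      then show ?thesis by (simp add: sum_distrib_left sum_divide_distrib)
    qed
    finally show ?thesis using l by simp
  qed
  then show ?thesis using e by simp
qed

end

section \<open>The planted graph once the coins are fixed\<close>

locale planted_graph =
  fixes n k :: nat and d \<delta> d' lam :: real and S :: "nat set" and om :: "nat \<times> nat \<Rightarrow> bool"
    and w0 w :: "nat set \<Rightarrow> real"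
  assumes n: "100 \<le> n" and k: "0 < k" "k < n" and d: "0 < d" and \<delta>: "0 < \<delta>" "\<delta> < 1"
    and S: "S \<subseteq> {..<n}" "card S = k" and compl: "completion n d d' lam S om w0"
    and del: "monotone_deletion n S w0 w"
    and gap: "0 < spectral_gap n k d \<delta> d' lam" and density: "1 / n \<le> \<delta> * d / k"
    and dev: "sq_dev (\<delta> * d / k) ({..<n} - S) (S \<times> ({..<n} - S)) om \<le> 2 * n * (\<delta> * d / k) * k"
begin

definition "U = {..<n} - S"
definition "p = \<delta> * d / k"
definition "m = real n - real k"
definition "wtotal = (\<Sum>i<n. \<Sum>j<n. w {i, j})"
definition "lam' = min lam d'"
definition "gp = spectral_gap n k d \<delta> d' lam * d"

lemma finS: "finite S" "finite U" using S(1) finite_subset by (auto simp: U_def)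

lemma cardU: "real (card U) = m"
  using S k by (simp add: U_def m_def card_Diff_subset finS)

lemma m_pos: "0 < m" "1 \<le> m" "m \<le> n" using k by (auto simp: m_def)

lemma U_ne: "U \<noteq> {}" using cardU m_pos by auto

lemma in_S: "i \<in> S \<Longrightarrow> i < n" and in_U: "i \<in> U \<Longrightarrow> i < n" using S(1) by (auto simp: U_def)

lemma split_sum: "(\<Sum>i<n. f i) = (\<Sum>i\<in>S. f i) + (\<Sum>i\<in>U. f i)" for f :: "nat \<Rightarrow> real"
  unfolding U_def using S(1) by (simp add: sum.subset_diff add.commute)

lemma w0_nonneg: "i < n \<Longrightarrow> j < n \<Longrightarrow> 0 \<le> w0 {i, j}" and w0_loop: "i < n \<Longrightarrow> w0 {i} = 0"
  using compl by (simp_all add: completion_def weighted_graph_def)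

lemma w_cases: "i < n \<Longrightarrow> j < n \<Longrightarrow> w {i, j} = 0 \<or> w {i, j} = w0 {i, j}"
  using del by (auto simp: monotone_deletion_def split: if_splits)

lemma w_nonneg: "i < n \<Longrightarrow> j < n \<Longrightarrow> 0 \<le> w {i, j}"
  using w_cases[of i j] w0_nonneg[of i j] by auto

lemma w_le: "i < n \<Longrightarrow> j < n \<Longrightarrow> w {i, j} \<le> w0 {i, j}"
  using w_cases[of i j] w0_nonneg[of i j] by auto

lemma w_S: "i \<in> S \<Longrightarrow> j \<in> S \<Longrightarrow> w {i, j} = w0 {i, j}"
  using del in_S by (auto simp: monotone_deletion_def)

lemma row_S: "i \<in> S \<Longrightarrow> (\<Sum>j\<in>S. w {i, j}) = d"
  using compl by (simp add: w_S completion_def regular_on_def)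

lemma w_cross: "i \<in> S \<Longrightarrow> j \<in> U \<Longrightarrow> w {i, j} \<le> of_bool (om (i, j))"
proof -
  assume "i \<in> S" "j \<in> U"
  then have "w0 {i, j} = of_bool (om (i, j))" using compl by (simp add: completion_def U_def)
  then show ?thesis using w_le[OF in_S in_U] \<open>i \<in> S\<close> \<open>j \<in> U\<close> by metis
qed

lemma expander: "expander_on U w0 d' lam" using compl by (simp add: completion_def U_def)

lemma lam_nonneg: "0 \<le> lam" using expander by (simp add: expander_on_def)

lemma d'_nonneg: "0 \<le> d'"
  by (rule expander_degree_nonneg[OF finS(2) U_ne _ _ expander]) (auto intro: w0_nonneg w0_loop in_U)

lemma d'_le_lam: "d' \<le> lam * m"
  unfolding cardU[symmetric]
  by (rule expander_degree_le[OF finS(2) U_ne _ _ expander]) (auto intro: w0_nonneg w0_loop in_U)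

lemma row_U: "i \<in> U \<Longrightarrow> (\<Sum>j\<in>U. w0 {i, j}) = d'"
  using expander by (simp add: expander_on_def regular_on_def)

lemma gp_eq: "gp = d - lam - d' * k / m - 6 * \<delta> * d"
proof -
  have "lam / d * d = lam" "d' * k / (m * d) * d = d' * k / m" using d by simp_all
  then show ?thesis unfolding gp_def spectral_gap_def m_def[symmetric] left_diff_distrib by simp
qed

lemma gp_pos: "0 < gp" using gap d by (simp add: gp_def)

text \<open>The positive gap forces \<open>d' * k / m \<le> d\<close>. This expresses errors coming
  from the outer block as multiples of \<open>d\<close>.\<close>

lemma d'_le: "d' \<le> n * d"
proof -
  have "0 \<le> \<delta> * d" using \<delta> d by simp
  then have "d' * k / m \<le> d" using gp_pos lam_nonneg by (simp add: gp_eq)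
  then have "d' * k \<le> d * m" using m_pos by (simp add: field_simps)
  also have "\<dots> \<le> d * n" using d m_pos by (intro mult_left_mono) auto
  finally have "d' * k \<le> n * d" by (simp add: mult.commute)
  moreover have "d' * 1 \<le> d' * k" using d'_nonneg k by (intro mult_left_mono) auto
  ultimately show ?thesis by simp
qed

lemma lam'_bounds: "0 \<le> lam'" "lam' \<le> d'" "lam' \<le> lam"
  using lam_nonneg d'_nonneg by (auto simp: lam'_def)

lemma d_ge: "1 \<le> n * d"
proof -
  have "\<delta> * d / k \<le> \<delta> * d / 1" using k \<delta> d by (intro divide_left_mono) auto
  then have "1 / n \<le> \<delta> * d" using density by simp
  also have "\<dots> \<le> 1 * d" using \<delta> d by (intro mult_right_mono) auto
  finally show ?thesis using n by (simp add: field_simps)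
qed

lemma sum_S: "(\<Sum>i\<in>S. \<Sum>j\<in>S. w {i, j}) = k * d"
  using row_S S(2) by simp

lemma sum_swap_w: "(\<Sum>i\<in>U. \<Sum>j\<in>S. w {i, j} * x i j) = (\<Sum>i\<in>S. \<Sum>j\<in>U. w {i, j} * x i j)"
  if "sym_on {..<n} x" for x
proof -
  have "(\<Sum>i\<in>U. \<Sum>j\<in>S. w {i, j} * x i j) = (\<Sum>j\<in>S. \<Sum>i\<in>U. w {i, j} * x i j)" by (rule sum.swap)
  also have "\<dots> = (\<Sum>j\<in>S. \<Sum>i\<in>U. w {j, i} * x j i)"
    using that by (intro sum.cong refl) (auto simp: insert_commute sym_on_def dest: in_S in_U)
  finally show ?thesis .
qed

lemma split_dot: "(\<Sum>i<n. \<Sum>j<n. w {i, j} * x i j) = (\<Sum>i\<in>S. \<Sum>j\<in>S. w {i, j} * x i j)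
  + 2 * (\<Sum>i\<in>S. \<Sum>j\<in>U. w {i, j} * x i j) + (\<Sum>i\<in>U. \<Sum>j\<in>U. w {i, j} * x i j)"
  if "sym_on {..<n} x" for x
  using sum_swap_w[OF that] by (simp add: split_sum sum.distrib)

lemma wtotal_bounds: "0 < wtotal" "wtotal \<le> 4 * real n ^ 3 * d"
proof -
  have "k * d \<le> wtotal"
  proof -
    have "(\<Sum>i\<in>S. \<Sum>j\<in>S. w {i, j}) \<le> (\<Sum>i\<in>S. \<Sum>j<n. w {i, j})"
      using S(1) w_nonneg by (intro sum_mono sum_mono2) (auto dest: in_S)
    also have "\<dots> \<le> wtotal" unfolding wtotal_def
      using S(1) w_nonneg by (intro sum_mono2) (auto intro: sum_nonneg)
    finally show ?thesis by (simp add: sum_S)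
  qed
  moreover have "0 < k * d" using k d by simp
  ultimately show "0 < wtotal" by linarith
  have "wtotal = k * d + 2 * (\<Sum>i\<in>S. \<Sum>j\<in>U. w {i, j}) + (\<Sum>i\<in>U. \<Sum>j\<in>U. w {i, j})"
    using split_dot[of "\<lambda>_ _. 1"] by (simp add: wtotal_def sum_S sym_on_def)
  also have "(\<Sum>i\<in>S. \<Sum>j\<in>U. w {i, j}) \<le> (\<Sum>i\<in>S. \<Sum>j\<in>U. 1)"
    by (intro sum_mono order.trans[OF w_cross]) auto
  also have "(\<Sum>i\<in>S. \<Sum>j\<in>U. 1 :: real) \<le> real n * n"
    using S(2) cardU k m_pos by (auto intro!: mult_mono)
  also have "(\<Sum>i\<in>U. \<Sum>j\<in>U. w {i, j}) \<le> (\<Sum>i\<in>U. \<Sum>j\<in>U. w0 {i, j})" using w_le by (intro sum_mono) (auto dest: in_U)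
  also have "\<dots> = m * d'" using row_U cardU by simp
  also have "m * d' \<le> n * (n * d)" using m_pos d'_le d'_nonneg by (intro mult_mono) auto
  finally have 1: "wtotal \<le> k * d + 2 * (real n * n) + n * (n * d)" by simp
  \<comment> \<open>Cross edges have weight 1, unrelated to the scale of the other weights;
    \<open>1 \<le> n * d\<close>, a consequence of the density, makes them comparable to
    \<open>d\<close>.\<close>
  have "real n * n * 1 \<le> real n * n * (n * d)" using d_ge by (intro mult_left_mono) auto
  then have 2: "real n * n \<le> real n ^ 3 * d" by (simp add: power3_eq_cube mult_ac)
  have "real n * n \<le> real n * n * n" using n by (auto simp: mult_le_cancel_left1)
  then have "real n * n * d \<le> real n * n * n * d" using d by (rule mult_right_mono[OF _ less_imp_le])
  then have 3: "n * (n * d) \<le> real n ^ 3 * d" by (simp add: power3_eq_cube mult_ac)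
  have "real n * 1 \<le> real n * n" using n by (intro mult_left_mono) auto
  then have "real k \<le> real n * n" using k by linarith
  then have "k * d \<le> real n * n * d" using d by (intro mult_right_mono) auto
  then have 4: "k * d \<le> real n ^ 3 * d" using 3 by (simp add: mult.assoc)
  show "wtotal \<le> 4 * real n ^ 3 * d" using 1 2 3 4 by linarith
qed

end


section \<open>From an approximate solution of the relaxation to the planted set\<close>

locale recovery = planted_graph +
  fixes x :: "nat \<Rightarrow> nat \<Rightarrow> real"
  assumes x_sym: "sym_on {..<n} x"
    and x_lower: "\<And>i j. i < n \<Longrightarrow> j < n \<Longrightarrow> - (1 / real n ^ 12) \<le> x i j"
    and x_upper: "\<And>i j. i < n \<Longrightarrow> j < n \<Longrightarrow> x i j \<le> x i i + 1 / real n ^ 12"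
    and x_row: "\<And>i. i < n \<Longrightarrow> (\<Sum>l<n. x i l) \<le> k * x i i + 1 / real n ^ 12"
    and x_diag: "\<And>i. i < n \<Longrightarrow> k * x i i \<le> (\<Sum>l<n. x l l) + 1 / real n ^ 12"
    and x_trace: "(\<Sum>i<n. x i i) \<le> k" "k - 1 / real n ^ 12 \<le> (\<Sum>i<n. x i i)"
    and x_objective: "(\<Sum>i\<in>S. \<Sum>j\<in>S. real_of_int \<lfloor>real n ^ 16 * w {i, j} / wtotal\<rfloor>) - 7
        \<le> (\<Sum>i<n. \<Sum>j<n. real_of_int \<lfloor>real n ^ 16 * w {i, j} / wtotal\<rfloor> * x i j)"
    and x_psd: "\<And>Q. (\<And>v. 0 \<le> (\<Sum>i\<in>U. \<Sum>j\<in>U. v i * Q i j * v j)) \<Longrightarrow>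
        - (k / real n ^ 60 * (\<Sum>i\<in>U. \<Sum>j\<in>U. \<bar>Q i j\<bar>)) \<le> (\<Sum>i\<in>U. \<Sum>j\<in>U. Q i j * x i j)"
begin

definition "eps = 1 / real n ^ 12"

lemmas lower = x_lower[folded eps_def] and upper = x_upper[folded eps_def] and row = x_row[folded eps_def]
  and diag = x_diag[folded eps_def] and trace_ge = x_trace(2)[folded eps_def]

text \<open>The diagonal mass outside \<open>S\<close>, shifted so that each summand is nonnegative
  in spite of the violations and dominates the entries of its column.\<close>

definition "z = (\<Sum>j\<in>U. x j j + 2 * eps)"

lemma n_pow_le: "a \<le> b \<Longrightarrow> real n ^ a \<le> real n ^ b" using n by (intro power_increasing) auto

lemma eps_pos: "0 < eps" using n by (simp add: eps_def)

lemma eps_small: "c * eps \<le> 1 / real n ^ (12 - b)" if "c \<le> real n ^ b" "b \<le> 12"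
proof -
  have "c * eps \<le> real n ^ b * eps" using that eps_pos by (intro mult_right_mono) auto
  also have "real n ^ b * eps = 1 / real n ^ (12 - b)"
    using that n by (simp add: eps_def power_diff)
  finally show ?thesis .
qed

lemma n_eps: "real n * eps \<le> 1 / 8"
proof -
  have "real n * eps \<le> 1 / real n ^ 11" using eps_small[of "real n" 1] by simp
  also have "\<dots> \<le> 1 / real n ^ 1" using n n_pow_le[of 1 11] by (intro divide_left_mono) auto
  also have "\<dots> \<le> 1 / 8" using n by (simp add: field_simps)
  finally show ?thesis .
qed

lemma diag_le: "i < n \<Longrightarrow> x i i \<le> 1 + eps"
proof -
  assume "i < n"
  then have "k * x i i \<le> k + eps" using diag[of i] x_trace(1) by simp
  also have "\<dots> \<le> k * (1 + eps)" using k eps_pos by (simp add: distrib_left)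
  finally show ?thesis using k by simp
qed

lemma y_bounds: "j < n \<Longrightarrow> 0 \<le> x j j + 2 * eps" "j < n \<Longrightarrow> x j j + 2 * eps \<le> 2"
proof -
  show "0 \<le> x j j + 2 * eps" if "j < n" using lower[OF that that] eps_pos by simp
  have "real n * eps \<ge> 100 * eps" using n eps_pos by (intro mult_right_mono) auto
  then show "x j j + 2 * eps \<le> 2" if "j < n" using diag_le[OF that] n_eps by linarith
qed

lemma z_eq: "z = (\<Sum>j\<in>U. x j j) + 2 * m * eps"
  by (simp add: z_def sum.distrib cardU)

lemma z_nonneg: "0 \<le> z"
  unfolding z_def by (intro sum_nonneg y_bounds(1) in_U)

lemma inner_part: "(\<Sum>i\<in>S. \<Sum>j\<in>S. w {i, j} * x i j) \<le> d * (\<Sum>i\<in>S. x i i) + n * eps * d"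
proof -
  have "(\<Sum>i\<in>S. \<Sum>j\<in>S. w {i, j} * x i j) \<le> (\<Sum>i\<in>S. \<Sum>j\<in>S. w {i, j} * (x i i + eps))"
    by (intro sum_mono mult_left_mono upper w_nonneg in_S)
  also have "\<dots> = (\<Sum>i\<in>S. d * (x i i + eps))" by (simp add: row_S flip: sum_distrib_right)
  also have "\<dots> = d * (\<Sum>i\<in>S. x i i) + k * eps * d"
    using S(2) by (simp add: sum_distrib_left sum.distrib distrib_left)
  also have "k * eps * d \<le> n * eps * d" using k eps_pos d by (intro mult_right_mono) auto
  finally show ?thesis by simp
qed

lemma col_dev_eq: "j \<in> U \<Longrightarrow> col_dev p (S \<times> U) om j = (\<Sum>i\<in>S. of_bool (om (i, j))) - p * k"
proof -
  assume j: "j \<in> U"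
  have "{e \<in> S \<times> U. snd e = j} = (\<lambda>i. (i, j)) ` S" using j by auto
  then have "col_dev p (S \<times> U) om j = (\<Sum>i\<in>S. of_bool (om (i, j)) - p)"
    unfolding col_dev_def by (simp add: sum.reindex inj_on_def)
  then show ?thesis using S(2) by (simp add: sum_subtractf)
qed

text \<open>Only \<open>x\<^sub>i\<^sub>j \<le> x\<^sub>j\<^sub>j\<close> is used for the random part, so the noise enters through the column degrees alone.\<close>

lemma cross_part: "(\<Sum>i\<in>S. \<Sum>j\<in>U. w {i, j} * x i j) \<le> \<delta> * d * z + sqrt (4 * n * p * k * z)"
proof -
  let ?y = "\<lambda>j. x j j + 2 * eps" let ?c = "col_dev p (S \<times> U) om"
  have "(\<Sum>i\<in>S. \<Sum>j\<in>U. w {i, j} * x i j) \<le> (\<Sum>i\<in>S. \<Sum>j\<in>U. of_bool (om (i, j)) * ?y j)"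
  proof (intro sum_mono)
    fix i j assume i: "i \<in> S" and j: "j \<in> U"
    have "x i j = x j i" using x_sym in_S[OF i] in_U[OF j] by (simp add: sym_on_def)
    then have "x i j \<le> ?y j" using upper[OF in_U[OF j] in_S[OF i]] eps_pos by simp
    then have "w {i, j} * x i j \<le> w {i, j} * ?y j" using w_nonneg in_S[OF i] in_U[OF j] by (intro mult_left_mono) auto
    also have "\<dots> \<le> of_bool (om (i, j)) * ?y j" using w_cross[OF i j] y_bounds(1)[OF in_U[OF j]] by (intro mult_right_mono)
    finally show "w {i, j} * x i j \<le> of_bool (om (i, j)) * ?y j" .
  qed
  also have "\<dots> = (\<Sum>j\<in>U. (\<Sum>i\<in>S. of_bool (om (i, j))) * ?y j)" by (subst sum.swap) (simp add: sum_distrib_right)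
  also have "\<dots> = (\<Sum>j\<in>U. p * k * ?y j + ?c j * ?y j)" by (intro sum.cong refl) (simp add: col_dev_eq algebra_simps)
  also have "\<dots> = p * k * z + (\<Sum>j\<in>U. ?c j * ?y j)" by (simp only: sum.distrib[of "\<lambda>j. p * k * ?y j"] z_def sum_distrib_left)
  also have "p * k = \<delta> * d" using k by (simp add: p_def)
  also have "(\<Sum>j\<in>U. ?c j * ?y j) \<le> sqrt (4 * n * p * k * z)"
  proof (rule real_le_rsqrt)
    have "(\<Sum>j\<in>U. ?c j * ?y j)\<^sup>2 \<le> (\<Sum>j\<in>U. (?c j)\<^sup>2) * (\<Sum>j\<in>U. (?y j)\<^sup>2)" by (rule Cauchy_Schwarz_ineq_sum)
    also have "\<dots> \<le> (2 * n * p * k) * (2 * z)"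
    proof (rule mult_mono)
      show "(\<Sum>j\<in>U. (?c j)\<^sup>2) \<le> 2 * n * p * k" using dev by (simp add: sq_dev_def p_def U_def)
      \<comment> \<open>Shifted diagonal entries lie between 0 and 2, so their squares add up to a
        multiple of \<open>z\<close> and the noise grows only like \<open>sqrt z\<close>.\<close>
      have "(?y j)\<^sup>2 \<le> 2 * ?y j" if "j \<in> U" for j
        unfolding power2_eq_square using y_bounds[OF in_U[OF that]] by (rule mult_right_mono[rotated])
      then have "(\<Sum>j\<in>U. (?y j)\<^sup>2) \<le> (\<Sum>j\<in>U. 2 * ?y j)" by (rule sum_mono)
      then show "(\<Sum>j\<in>U. (?y j)\<^sup>2) \<le> 2 * z" by (simp only: z_def sum_distrib_left)
      show "0 \<le> 2 * n * p * k" using \<delta> d by (simp add: p_def)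
    qed (intro sum_nonneg, simp)
    finally show "(\<Sum>j\<in>U. ?c j * ?y j)\<^sup>2 \<le> 4 * n * p * k * z" by simp
  qed
  finally show ?thesis by simp
qed

definition "mu = (d' - lam') / m"

lemma mu_bounds: "0 \<le> mu" "mu * m \<le> d'" using lam'_bounds m_pos by (simp_all add: mu_def)

text \<open>Pair \<open>x\<close> with the positive semidefinite matrix
  \<open>lam' * I + mu * J - w0\<close>, where \<open>I\<close> is the identity and \<open>J\<close>
  the all-ones matrix. The \<open>I\<close> part gives \<open>lam'\<close> times the trace, and the
  row constraint bounds the \<open>J\<close> part by \<open>mu * k\<close> times the trace.\<close>

lemma outer_part: "(\<Sum>i\<in>U. \<Sum>j\<in>U. w {i, j} * x i j) \<le> (lam' + mu * k) * (\<Sum>j\<in>U. x j j) + 5 * (real n ^ 2 * eps * d)"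
proof -
  define Q where "Q i j = (if i = j then lam' else 0) + mu - w0 {i, j}" for i j
  let ?z = "\<Sum>j\<in>U. x j j"
  have sel: "(\<Sum>i\<in>U. \<Sum>j\<in>U. (if i = j then lam' else 0) * f i j) = (\<Sum>i\<in>U. lam' * f i i)" for f
  proof (intro sum.cong refl)
    fix i assume "i \<in> U"
    have "(\<Sum>j\<in>U. (if i = j then lam' else 0) * f i j) = (\<Sum>j\<in>U. if i = j then lam' * f i j else 0)" by (intro sum.cong) auto
    then show "(\<Sum>j\<in>U. (if i = j then lam' else 0) * f i j) = lam' * f i i" using finS \<open>i \<in> U\<close> by simp
  qed
  have "0 \<le> (\<Sum>i\<in>U. \<Sum>j\<in>U. v i * Q i j * v j)" for v
    unfolding Q_def mu_def lam'_def cardU[symmetric]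
    by (rule expander_psd[OF finS(2) U_ne _ _ expander]) (auto intro: w0_nonneg w0_loop in_U)
  from x_psd[OF this] have 1: "- (k / real n ^ 60 * (\<Sum>i\<in>U. \<Sum>j\<in>U. \<bar>Q i j\<bar>)) \<le> (\<Sum>i\<in>U. \<Sum>j\<in>U. Q i j * x i j)" .
  have 2: "(\<Sum>i\<in>U. \<Sum>j\<in>U. Q i j * x i j) = lam' * ?z + mu * (\<Sum>i\<in>U. \<Sum>j\<in>U. x i j) - (\<Sum>i\<in>U. \<Sum>j\<in>U. w0 {i, j} * x i j)"
    using sel[of x] by (simp add: Q_def left_diff_distrib distrib_right sum.distrib sum_subtractf sum_distrib_left)
  have 3: "(\<Sum>i\<in>U. \<Sum>j\<in>U. \<bar>Q i j\<bar>) \<le> 3 * (real n * (n * d))"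
  proof -
    have "(\<Sum>i\<in>U. \<Sum>j\<in>U. \<bar>Q i j\<bar>) \<le> (\<Sum>i\<in>U. \<Sum>j\<in>U. (if i = j then lam' else 0) * 1 + mu + w0 {i, j})"
    proof (intro sum_mono)
      fix i j assume "i \<in> U" "j \<in> U"
      then show "\<bar>Q i j\<bar> \<le> (if i = j then lam' else 0) * 1 + mu + w0 {i, j}"
        using w0_nonneg[OF in_U in_U, of i j] mu_bounds(1) lam'_bounds(1) by (auto simp: Q_def)
    qed
    also have "\<dots> = m * lam' + m * (m * mu) + m * d'"
      using sel[of "\<lambda>_ _. 1"] by (simp add: sum.distrib row_U cardU)
    also have "\<dots> \<le> m * d' + m * d' + m * d'"
      using mu_bounds(2) lam'_bounds m_pos by (intro add_mono mult_left_mono) (auto simp: mult.commute)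
    finally have "(\<Sum>i\<in>U. \<Sum>j\<in>U. \<bar>Q i j\<bar>) \<le> 3 * (m * d')" by linarith
    moreover have "m * d' \<le> n * (n * d)" using m_pos d'_le d'_nonneg by (intro mult_mono) auto
    ultimately show ?thesis by linarith
  qed
  have 4: "k / real n ^ 60 * (\<Sum>i\<in>U. \<Sum>j\<in>U. \<bar>Q i j\<bar>) \<le> real n ^ 2 * eps * d"
  proof -
    have "k / real n ^ 60 * (\<Sum>i\<in>U. \<Sum>j\<in>U. \<bar>Q i j\<bar>) \<le> n / real n ^ 60 * (3 * (real n * (n * d)))"
      using k 3 by (intro mult_mono divide_right_mono) (auto intro: sum_nonneg)
    also have "\<dots> = 3 * real n / real n ^ 60 * (real n ^ 2 * d)" by (simp add: power2_eq_square)
    also have "\<dots> \<le> eps * (real n ^ 2 * d)"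
    proof (rule mult_right_mono)
      have "3 * real n * real n ^ 12 \<le> n * real n * real n ^ 12" using n by (intro mult_right_mono) auto
      also have "\<dots> = real n ^ 14" using power_add[of "real n" 2 12] by (simp add: power2_eq_square)
      also have "\<dots> \<le> real n ^ 60" by (rule n_pow_le) simp
      finally show "3 * real n / real n ^ 60 \<le> eps" using n by (simp add: eps_def field_simps)
    qed (use d in simp)
    finally show ?thesis by (simp add: mult_ac)
  qed
  have 5: "mu * (\<Sum>i\<in>U. \<Sum>j\<in>U. x i j) \<le> mu * k * ?z + real n ^ 2 * eps * d"
  proof -
    have "(\<Sum>j\<in>U. x i j) \<le> k * x i i + eps + k * eps" if i: "i \<in> U" for i
    proof -
      have "(\<Sum>j\<in>S. - eps) \<le> (\<Sum>j\<in>S. x i j)" by (intro sum_mono lower in_U[OF i] in_S)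
      then have "- (k * eps) \<le> (\<Sum>j\<in>S. x i j)" using S(2) by simp
      then show ?thesis using row[OF in_U[OF i]] split_sum[of "x i"] by linarith
    qed
    then have "(\<Sum>i\<in>U. \<Sum>j\<in>U. x i j) \<le> (\<Sum>i\<in>U. k * x i i + eps + k * eps)" by (rule sum_mono)
    also have "\<dots> = k * ?z + m * (real (1 + k) * eps)" by (simp add: sum.distrib sum_distrib_left cardU algebra_simps)
    finally have "mu * (\<Sum>i\<in>U. \<Sum>j\<in>U. x i j) \<le> mu * (k * ?z + m * (real (1 + k) * eps))"
      using mu_bounds(1) by (rule mult_left_mono)
    also have "\<dots> = mu * k * ?z + (mu * m) * (real (1 + k) * eps)" by (simp add: algebra_simps)
    also have "(mu * m) * (real (1 + k) * eps) \<le> (n * d) * (n * eps)"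
    proof (rule mult_mono)
      show "mu * m \<le> n * d" using mu_bounds d'_le by linarith
      show "real (1 + k) * eps \<le> n * eps" using k eps_pos by (intro mult_right_mono) auto
    qed (use d eps_pos in auto)
    finally show ?thesis by (simp add: power2_eq_square mult_ac)
  qed
  have "(\<Sum>i\<in>U. \<Sum>j\<in>U. w {i, j} * x i j) \<le> (\<Sum>i\<in>U. \<Sum>j\<in>U. w0 {i, j} * (x i j + eps))"
  proof (intro sum_mono)
    fix i j assume "i \<in> U" "j \<in> U"
    then have ij: "i < n" "j < n" using in_U by auto
    \<comment> \<open>The entry may be slightly negative, so it is shifted before the deleted edges
      are put back.\<close>
    have "w {i, j} * x i j \<le> w {i, j} * (x i j + eps)" using w_nonneg[OF ij] eps_pos by (intro mult_left_mono) auto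
    also have "\<dots> \<le> w0 {i, j} * (x i j + eps)" using w_le[OF ij] lower[OF ij] by (intro mult_right_mono) auto
    finally show "w {i, j} * x i j \<le> w0 {i, j} * (x i j + eps)" .
  qed
  also have "\<dots> = (\<Sum>i\<in>U. \<Sum>j\<in>U. w0 {i, j} * x i j) + m * d' * eps"
    by (simp add: distrib_left sum.distrib row_U cardU flip: sum_distrib_right)
  also have "m * d' * eps \<le> n * (n * d) * eps"
    using m_pos d'_le d'_nonneg eps_pos by (intro mult_right_mono mult_mono) auto
  finally have "(\<Sum>i\<in>U. \<Sum>j\<in>U. w {i, j} * x i j) \<le> (\<Sum>i\<in>U. \<Sum>j\<in>U. w0 {i, j} * x i j) + real n ^ 2 * eps * d"
    by (simp add: power2_eq_square mult_ac)
  moreover have "0 \<le> real n ^ 2 * eps * d" using eps_pos d by simp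
  ultimately show ?thesis using 1 2 4 5 by (simp add: distrib_right)
qed

text \<open>Flooring loses at most 1 for each of the \<open>k * k\<close> planted entries and the
  solver at most 7; in units of \<open>c = n ^ 16 / wtotal\<close> this is at most
  \<open>eps * wtotal\<close>. Passing back from the floors, where \<open>x\<close> may be negative,
  costs another \<open>eps * wtotal\<close>.\<close>

lemma objective_ge: "k * d - 8 * (real n ^ 3 * eps * d) \<le> (\<Sum>i<n. \<Sum>j<n. w {i, j} * x i j)"
proof -
  define f where "f i j = real_of_int \<lfloor>real n ^ 16 * w {i, j} / wtotal\<rfloor>" for i j
  define c where "c = real n ^ 16 / wtotal"
  have c: "0 < c" using wtotal_bounds(1) n by (simp add: c_def)
  have f: "f i j \<le> c * w {i, j}" "c * w {i, j} - 1 \<le> f i j" for i j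
    unfolding f_def c_def by (simp_all add: field_simps) linarith+
  have f0: "0 \<le> f i j" if "i < n" "j < n" for i j
    using w_nonneg[OF that] wtotal_bounds(1) by (simp add: f_def)
  have "c * (k * d) - real k * k \<le> (\<Sum>i\<in>S. \<Sum>j\<in>S. f i j)"
  proof -
    have "(\<Sum>i\<in>S. \<Sum>j\<in>S. c * w {i, j} - 1) \<le> (\<Sum>i\<in>S. \<Sum>j\<in>S. f i j)" by (intro sum_mono f)
    moreover have "(\<Sum>i\<in>S. \<Sum>j\<in>S. c * w {i, j} - 1) = c * (\<Sum>i\<in>S. \<Sum>j\<in>S. w {i, j}) - real k * k"
      using S(2) by (simp add: sum_subtractf sum_distrib_left)
    ultimately show ?thesis by (simp add: sum_S)
  qed
  moreover have "(\<Sum>i<n. \<Sum>j<n. f i j * x i j) \<le> c * ((\<Sum>i<n. \<Sum>j<n. w {i, j} * x i j) + eps * wtotal)"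
  proof -
    have "(\<Sum>i<n. \<Sum>j<n. f i j * x i j) \<le> (\<Sum>i<n. \<Sum>j<n. c * w {i, j} * (x i j + eps))"
    proof (intro sum_mono)
      fix i j assume "i \<in> {..<n}" "j \<in> {..<n}"
      then have ij: "i < n" "j < n" by auto
      have "f i j * x i j \<le> f i j * (x i j + eps)" using f0[OF ij] eps_pos by (intro mult_left_mono) auto
      also have "\<dots> \<le> c * w {i, j} * (x i j + eps)" using f(1) lower[OF ij] by (intro mult_right_mono) auto
      finally show "f i j * x i j \<le> c * w {i, j} * (x i j + eps)" .
    qed
    also have "\<dots> = c * ((\<Sum>i<n. \<Sum>j<n. w {i, j} * x i j) + eps * wtotal)"
    proof -
      have "c * w {i, j} * (x i j + eps) = c * (w {i, j} * x i j) + c * (eps * w {i, j})" for i j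
        by (simp add: algebra_simps)
      then show ?thesis by (simp only: wtotal_def distrib_left sum.distrib sum_distrib_left)
    qed
    finally show ?thesis .
  qed
  ultimately have "c * (k * d) - (real k * k + 7) \<le> c * ((\<Sum>i<n. \<Sum>j<n. w {i, j} * x i j) + eps * wtotal)"
    using x_objective unfolding f_def by linarith
  then have "c * (k * d - (real k * k + 7) / c) \<le> c * ((\<Sum>i<n. \<Sum>j<n. w {i, j} * x i j) + eps * wtotal)"
    using c by (simp add: right_diff_distrib)
  then have 1: "k * d - (real k * k + 7) / c - eps * wtotal \<le> (\<Sum>i<n. \<Sum>j<n. w {i, j} * x i j)" using c by simp
  have "(real k * k + 7) / c = (real k * k + 7) / real n ^ 16 * wtotal" by (simp add: c_def)
  also have "\<dots> \<le> eps * wtotal"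
  proof (rule mult_right_mono)
    have "real k * k + 7 \<le> real n * n + real n * n"
    proof (rule add_mono)
      show "real k * k \<le> real n * n" using k by (intro mult_mono) auto
      have "7 * 1 \<le> real n * n" using n by (intro mult_mono) auto
      then show "7 \<le> real n * n" by simp
    qed
    also have "\<dots> \<le> (real n * n) * (real n * n)"
    proof -
      have "2 * 1 \<le> real n * n" using n by (intro mult_mono) auto
      then have "(real n * n) * 2 \<le> (real n * n) * (real n * n)" by (intro mult_left_mono) auto
      then show ?thesis by simp
    qed
    finally have "(real k * k + 7) * real n ^ 12 \<le> (real n * n) * (real n * n) * real n ^ 12" by (intro mult_right_mono) auto
    also have "\<dots> = real n ^ 16" using power_add[of "real n" 4 12] by (simp add: power4_eq_xxxx mult.assoc)
    finally show "(real k * k + 7) / real n ^ 16 \<le> eps" using n by (simp add: eps_def field_simps)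
  qed (use wtotal_bounds in simp)
  finally have "k * d - 2 * (eps * wtotal) \<le> (\<Sum>i<n. \<Sum>j<n. w {i, j} * x i j)" using 1 by linarith
  moreover have "eps * wtotal \<le> eps * (4 * real n ^ 3 * d)" using wtotal_bounds(2) eps_pos by (intro mult_left_mono) auto
  ultimately show ?thesis by (simp add: mult_ac)
qed

definition "margin = d - 2 * \<delta> * d - lam' - mu * k"

text \<open>The margin exceeds the gap by
  \<open>4 * \<delta> * d + (lam - lam') + lam' * k / m\<close>, hence by at least
  \<open>4 * \<delta> * d + lam / n\<close>. If the gap is below \<open>d / 2\<close>, then
  \<open>d' * k / m \<le> lam * k\<close> forces \<open>lam * (1 + k)\<close> or
  \<open>6 * \<delta> * d\<close> to be at least \<open>d / 4\<close>, and the excess alone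
  suffices.\<close>

lemma margin_ge: "gp \<le> margin" "d / (8 * real n ^ 2) \<le> margin"
proof -
  have e: "margin - gp = 4 * \<delta> * d + (lam - lam') + lam' * (k / m)"
    unfolding margin_def gp_eq mu_def by (simp add: field_simps diff_divide_distrib)
  have km: "1 / n \<le> k / m"
  proof -
    have "1 / real n \<le> k / real n" using k by (intro divide_right_mono) auto
    also have "\<dots> \<le> k / m" using m_pos k by (intro divide_left_mono) auto
    finally show ?thesis .
  qed
  have "lam * (1 / n) \<le> (lam - lam') + lam' * (k / m)"
  proof -
    have "(lam - lam') * (1 / n) \<le> (lam - lam') * 1" using lam'_bounds n by (intro mult_left_mono) auto
    moreover have "lam' * (1 / n) \<le> lam' * (k / m)" using km lam'_bounds by (intro mult_left_mono) auto
    ultimately show ?thesis by (simp add: left_diff_distrib diff_divide_distrib)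
  qed
  then have ge: "gp + 4 * \<delta> * d + lam * (1 / n) \<le> margin" using e by linarith
  have \<delta>d: "0 \<le> \<delta> * d" using \<delta> d by simp
  have ln: "0 \<le> lam * (1 / n)" using lam_nonneg by simp
  show "gp \<le> margin" using ge \<delta>d ln by linarith
  have n2: "(8::real) \<le> 8 * real n ^ 2" using n by simp
  have small: "d / (8 * real n ^ 2) \<le> d / c" if "0 < c" "c \<le> 8 * real n ^ 2" for c
    using that d n by (intro divide_left_mono) auto
  show "d / (8 * real n ^ 2) \<le> margin"
  proof (cases "d / 2 \<le> gp")
    case True
    then show ?thesis using small[of 2] n2 ge \<delta>d ln by linarith
  next
    case False
    have "d' * k / m \<le> lam * k"
    proof -
      have "d' * k \<le> lam * m * k" using d'_le_lam by (intro mult_right_mono) auto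
      then show ?thesis using m_pos by (simp add: field_simps)
    qed
    then have "d / 2 \<le> lam * (1 + k) + 6 * (\<delta> * d)" using False by (simp add: gp_eq distrib_left)
    then consider "d / 4 \<le> lam * (1 + k)" | "d / 4 \<le> 6 * (\<delta> * d)" by linarith
    then show ?thesis
    proof cases
      case 1
      have "lam * (1 + k) \<le> lam * n" using lam_nonneg k by (intro mult_left_mono) auto
      then have "d / 4 \<le> lam * n" using 1 by linarith
      then have "d / (4 * real n ^ 2) \<le> lam * (1 / n)" using n by (simp add: field_simps power2_eq_square)
      moreover have "d / (8 * real n ^ 2) \<le> d / (4 * real n ^ 2)" using n by (intro small) auto
      ultimately show ?thesis using ge \<delta>d gp_pos by linarith
    next
      case 2
      have "d / (8 * real n ^ 2) \<le> d / 8" using n2 by (intro small) auto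
      then show ?thesis using 2 ge ln gp_pos d by linarith
    qed
  qed
qed

lemma margin_z: "margin * z \<le> 2 * sqrt (4 * n * p * k * z) + 18 * (real n ^ 3 * eps * d)"
proof -
  \<comment> \<open>All products are abstracted to variables, which leaves a problem of linear
    arithmetic.\<close>
  have arith: "mz \<le> 2 * r + 18 * q"
    if "kd - 8 * q \<le> ds + A + 2 * ddz + 2 * r + (Czz + 5 * B)" "ds \<le> dk" "Czz \<le> Cz" "dz = dzz + 2 * E"
      "mz = dz - 2 * ddz - Cz" "dk = kd - dzz" "0 \<le> q" "A \<le> q" "B \<le> q" "E \<le> A"
    for mz r q kd ds A ddz Czz B dk Cz dz dzz E :: real using that by linarith
  let ?z = "\<Sum>j\<in>U. x j j" let ?s = "\<Sum>i\<in>S. x i i"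
  have n3: "n * eps * d \<le> real n ^ 3 * eps * d" "real n ^ 2 * eps * d \<le> real n ^ 3 * eps * d"
    using n_pow_le[of 1 3] n_pow_le[of 2 3] eps_pos d by (auto intro!: mult_right_mono)
  have me: "m * eps * d \<le> n * eps * d" using m_pos eps_pos d by (intro mult_right_mono) auto
  have "k * d - 8 * (real n ^ 3 * eps * d) \<le> d * ?s + n * eps * d + 2 * (\<delta> * d * z) + 2 * sqrt (4 * n * p * k * z)
      + ((lam' + mu * k) * ?z + 5 * (real n ^ 2 * eps * d))"
  proof -
    have add3: "a \<le> s' + 2 * c' + 2 * c'' + u'" if "a \<le> t" "t = s + 2 * c + u" "s \<le> s'" "c \<le> c' + c''" "u \<le> u'"
      for a t s c u s' c' c'' u' :: real using that by linarith
    show ?thesis by (rule add3[OF objective_ge split_dot[OF x_sym] inner_part cross_part outer_part])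
  qed
  moreover have "d * ?s \<le> d * (k - ?z)" using x_trace(1) d split_sum[of "\<lambda>i. x i i"] by (intro mult_left_mono) auto
  moreover have "(lam' + mu * k) * ?z \<le> (lam' + mu * k) * z"
    using lam'_bounds mu_bounds eps_pos m_pos by (intro mult_left_mono) (auto simp: z_eq)
  moreover have "d * z = d * ?z + 2 * (m * eps * d)" by (simp add: z_eq algebra_simps)
  moreover have "margin * z = d * z - 2 * (\<delta> * d * z) - (lam' + mu * k) * z"
    by (simp add: margin_def left_diff_distrib distrib_right)
  moreover have "d * (k - ?z) = k * d - d * ?z" by (simp add: right_diff_distrib)
  moreover have "0 \<le> real n ^ 3 * eps * d" using eps_pos d by simp
  ultimately show ?thesis using n3 me by (rule arith)
qed

text \<open>Compare the two terms of \<open>margin_z\<close>; the threshold 36 is twice 18. If the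
  numerical error dominates, the polynomial lower bound on the margin makes \<open>z\<close> tiny.
  If the noise dominates, squaring and cancelling one factor \<open>z\<close> gives the second
  alternative.\<close>

lemma z_cases: "z \<le> 1 / 8 \<or> gp\<^sup>2 * z \<le> 64 * n * p * k"
proof -
  have mp: "0 < margin" using margin_ge gp_pos by linarith
  show ?thesis
  proof (cases "margin * z \<le> 36 * (real n ^ 3 * eps * d)")
    case True
    have "d / (8 * real n ^ 2) * z \<le> 36 * (real n ^ 3 * eps * d)"
      using True mult_right_mono[OF margin_ge(2) z_nonneg] by linarith
    then have "z \<le> 36 * real n ^ 3 * eps * (8 * real n ^ 2)"
      using d n by (simp add: field_simps)
    also have "\<dots> = 288 * real n ^ 5 * eps" using power_add[of "real n" 3 2] by simp
    also have "\<dots> \<le> 1 / real n ^ (12 - 10)"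
    proof (rule eps_small)
      have "(288::real) \<le> 100 ^ 5" by simp
      also have "\<dots> \<le> real n ^ 5" using n by (intro power_mono) auto
      finally have "288 * real n ^ 5 \<le> real n ^ 5 * real n ^ 5" by (intro mult_right_mono) auto
      then show "288 * real n ^ 5 \<le> real n ^ 10" by (simp flip: power_add)
    qed simp
    also have "\<dots> \<le> 1 / real n ^ 1" using n n_pow_le[of 1 2] by (intro divide_left_mono) auto
    also have "\<dots> \<le> 1 / 8" using n by (simp add: field_simps)
    finally show ?thesis by simp
  next
    case False
    then have lt: "margin * z \<le> 4 * sqrt (4 * n * p * k * z)" using margin_z by linarith
    have p0: "0 \<le> 4 * n * p * k * z" using \<delta> d z_nonneg by (simp add: p_def)
    have zp: "0 < z"
    proof (rule ccontr)
      assume "\<not> 0 < z"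
      then have "z = 0" using z_nonneg by simp
      then show False using False eps_pos d by simp
    qed
    have "(margin * z)\<^sup>2 \<le> (4 * sqrt (4 * n * p * k * z))\<^sup>2"
      using lt mp zp by (intro power_mono) auto
    also have "\<dots> = 64 * n * p * k * z" using p0 by (simp add: power_mult_distrib)
    finally have "(margin\<^sup>2 * z) * z \<le> (64 * n * p * k) * z" by (simp add: power2_eq_square mult_ac)
    then have "margin\<^sup>2 * z \<le> 64 * n * p * k" using zp by simp
    moreover have "gp\<^sup>2 * z \<le> margin\<^sup>2 * z" using margin_ge(1) gp_pos zp by (intro mult_right_mono power_mono) auto
    ultimately show ?thesis by linarith
  qed
qed

text \<open>Let \<open>t\<close> be the largest diagonal entry of a missed vertex. The equally many
  selected vertices outside \<open>S\<close> have entries at least \<open>t\<close>, so the missed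
  ones carry mass at most \<open>card (S - Q) * t \<le> z\<close>. The other vertices of
  \<open>S\<close> carry about 1 each at most, while \<open>S\<close> as a whole carries almost
  \<open>k - z\<close>.\<close>

lemma rounding:
  assumes Q: "Q \<subseteq> {..<n}" "card Q = k" and top: "\<And>i j. i \<in> {..<n} - Q \<Longrightarrow> j \<in> Q \<Longrightarrow> x i i \<le> x j j"
  shows "real (card (S - Q)) \<le> 2 * z + 2 * n * eps"
proof (cases "S - Q = {}")
  case True
  have "0 \<le> 2 * z + 2 * n * eps" using z_nonneg eps_pos by simp
  then show ?thesis using True by (metis card.empty of_nat_0)
next
  case False
  have finQ: "finite Q" using Q(1) finite_subset by blast
  define t where "t = Max ((\<lambda>i. x i i) ` (S - Q))"
  let ?r = "real (card (S - Q))"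
  have t1: "x i i \<le> t" if "i \<in> S - Q" for i unfolding t_def using that finS by (intro Max_ge) auto
  have "t \<in> (\<lambda>i. x i i) ` (S - Q)" unfolding t_def using False finS by (intro Max_in) auto
  then have t2: "t \<le> x j j" if "j \<in> Q" for j using that top S(1) by auto
  have cQ: "card (Q - S) = card (S - Q)"
    using S(2) Q(2) finQ finS by (metis Int_commute card_Diff_subset_Int finite_Int)
  have QU: "Q - S \<subseteq> U" using Q(1) by (auto simp: U_def)
  have "?r * t = (\<Sum>j\<in>Q - S. t)" using cQ by simp
  also have "\<dots> \<le> (\<Sum>j\<in>Q - S. x j j + 2 * eps)" using t2 eps_pos by (intro sum_mono) (smt (verit) DiffD1)
  also have "\<dots> \<le> z" unfolding z_def using QU finS by (intro sum_mono2) (auto intro: y_bounds(1) in_U)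
  finally have rt: "?r * t \<le> z" .
  have "(\<Sum>i\<in>S. x i i) = (\<Sum>i\<in>S - Q. x i i) + (\<Sum>i\<in>S \<inter> Q. x i i)"
    using sum.Int_Diff[OF finS(1), of "\<lambda>i. x i i" Q] by simp
  also have "(\<Sum>i\<in>S - Q. x i i) \<le> (\<Sum>i\<in>S - Q. t)" by (intro sum_mono t1)
  also have "(\<Sum>i\<in>S \<inter> Q. x i i) \<le> (\<Sum>i\<in>S \<inter> Q. 1 + eps)" by (intro sum_mono diag_le in_S) auto
  finally have s: "(\<Sum>i\<in>S. x i i) \<le> z + real (card (S \<inter> Q)) * (1 + eps)" using rt by simp
  have cSQ: "real (card (S \<inter> Q)) = k - ?r"
  proof -
    have "card S = card (S - Q) + card (S \<inter> Q)" using finS by (metis card_Diff_subset_Int card_mono finite_Int inf_le1 le_add_diff_inverse2 add.commute)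
    then show ?thesis using S(2) by simp
  qed
  have "real (card (S \<inter> Q)) * eps \<le> k * eps" using cSQ eps_pos by (intro mult_right_mono) auto
  then have "(\<Sum>i\<in>S. x i i) \<le> z + k - ?r + k * eps" using s cSQ by (simp add: distrib_left)
  moreover have "k - eps - z \<le> (\<Sum>i\<in>S. x i i)"
  proof -
    have "0 \<le> m * eps" using m_pos eps_pos by simp
    then show ?thesis using trace_ge split_sum[of "\<lambda>i. x i i"] z_eq by linarith
  qed
  ultimately have "?r \<le> 2 * z + (1 + real k) * eps" by (simp add: algebra_simps)
  also have "(1 + real k) * eps \<le> 2 * n * eps" using k eps_pos by (intro mult_right_mono) auto
  finally show ?thesis by simp
qed

text \<open>With \<open>gp\<^sup>2 = 256 * n * p * X\<close> the noise bound reads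
  \<open>4 * X * z \<le> k\<close>. Here \<open>nu' < 1\<close> means \<open>X > 24\<close>, so
  \<open>sqrt (1 + X) \<le> X\<close>, and \<open>3 * z\<close> is at most
  \<open>3 / 4 * k / sqrt (1 + X)\<close>, below the permitted
  \<open>5 / 6 * k / sqrt (1 + X)\<close>.\<close>

lemma overlap:
  assumes Q: "Q \<subseteq> {..<n}" "card Q = k" and top: "\<And>i j. i \<in> {..<n} - Q \<Longrightarrow> j \<in> Q \<Longrightarrow> x i i \<le> x j j"
    and nu: "nu' 8 n k d \<delta> d' lam < 1"
  shows "real (card (S - Q)) \<le> nu' 8 n k d \<delta> d' lam / 6 * k"
proof -
  let ?r = "real (card (S - Q))"
  define X where "X = d * real k / (4 * 8\<^sup>2 * \<delta> * real n) * (spectral_gap n k d \<delta> d' lam)\<^sup>2"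
  have nu_eq: "nu' 8 n k d \<delta> d' lam = 5 / sqrt (1 + X)" by (simp add: nu'_def X_def)
  have X0: "0 \<le> X" using d \<delta> by (simp add: X_def)
  have sq: "0 < sqrt (1 + X)" using X0 by simp
  have "5 < sqrt (1 + X)" using nu sq unfolding nu_eq by (simp add: field_simps)
  then have "5\<^sup>2 < (sqrt (1 + X))\<^sup>2" by (intro power_strict_mono) auto
  then have X24: "24 < X" using X0 by simp
  have gX: "gp\<^sup>2 = 256 * n * p * X"
    using d \<delta> k n by (simp add: X_def gp_def p_def power2_eq_square field_simps)
  have nup: "0 \<le> nu' 8 n k d \<delta> d' lam / 6 * k" using nu_eq sq by simp
  show ?thesis
  proof (cases "card (S - Q) = 0")
    case True
    then show ?thesis using nup by simp
  next
    case False
    then have r1: "1 \<le> ?r" by simp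
    \<comment> \<open>Integrality enters here: \<open>1 \<le> ?r\<close> forces
      \<open>z \<ge> 3 / 8\<close>, which rules out the first alternative of \<open>z_cases\<close>
      and absorbs the \<open>1 / 4\<close> into \<open>?r \<le> 3 * z\<close>.\<close>
    have r2: "?r \<le> 2 * z + 1 / 4" using rounding[OF Q top] n_eps by linarith
    then have "\<not> z \<le> 1 / 8" using r1 by linarith
    then have "gp\<^sup>2 * z \<le> 64 * n * p * k" using z_cases by blast
    then have "(64 * n * p) * (4 * X * z) \<le> (64 * n * p) * k" unfolding gX by (simp add: mult_ac)
    moreover have "0 < 64 * n * p" using n d \<delta> k by (simp add: p_def)
    ultimately have zX: "4 * X * z \<le> k" by (simp only: mult_le_cancel_left_pos)
    have "?r \<le> 3 * z" using r1 r2 by linarith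
    then have "4 * X * ?r \<le> 3 * (4 * X * z)" using X0 mult_left_mono[of "?r" "3 * z" "4 * X"] by simp
    then have rX: "4 * X * ?r \<le> 3 * k" using zX by linarith
    have "sqrt (1 + X) \<le> X"
    proof (rule real_le_lsqrt)
      have "1 + X \<le> 2 * X" using X24 by simp
      also have "\<dots> \<le> X * X" using X24 by (intro mult_right_mono) auto
      finally show "1 + X \<le> X\<^sup>2" by (simp add: power2_eq_square)
    qed (use X0 in auto)
    then have "?r * sqrt (1 + X) \<le> ?r * X" by (intro mult_left_mono) auto
    also have "\<dots> \<le> 3 / 4 * k" using rX by (simp add: mult_ac)
    also have "\<dots> \<le> 5 / 6 * k" by simp
    finally show ?thesis using sq unfolding nu_eq by (simp add: field_simps)
  qed
qed

end

text \<open>Each missed vertex removes weight at most \<open>2 * d\<close> from the double sum over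
  \<open>S\<close>: its own row and its column. What \<open>Q\<close> contains outside
  \<open>S\<close> can only add weight.\<close>

lemma (in planted_graph) density_of_overlap:
  assumes Q: "Q \<subseteq> {..<n}" "card Q = k" and r: "real (card (S - Q)) \<le> c / 6 * k"
  shows "(1 - c) * (k * d / 2) \<le> rho w Q" "(1 - c / 6) * k \<le> real (card (Q \<inter> S))"
proof -
  have c: "0 \<le> c" using r k by (smt (verit) divide_nonneg_pos of_nat_0_le_iff of_nat_0_less_iff zero_le_mult_iff divide_neg_pos mult_neg_pos)
  have finQ: "finite Q" using Q(1) finite_subset by blast
  have "card S = card (S - Q) + card (Q \<inter> S)"
    using finS by (metis Int_commute card_Diff_subset_Int card_mono finite_Int inf_le1 le_add_diff_inverse2 add.commute)
  then have cQ: "real (card (Q \<inter> S)) = k - real (card (S - Q))" using S(2) by simp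
  then show "(1 - c / 6) * k \<le> real (card (Q \<inter> S))" using r by (simp add: algebra_simps)
  have row: "(\<Sum>j\<in>Q \<inter> S. w {i, j}) = d - (\<Sum>j\<in>S - Q. w {i, j})" if "i \<in> S" for i
    using row_S[OF that] sum.Int_Diff[OF finS(1), of "\<lambda>j. w {i, j}" Q] by (simp add: Int_commute)
  have "(\<Sum>i\<in>Q \<inter> S. \<Sum>j\<in>S - Q. w {i, j}) \<le> (\<Sum>i\<in>S. \<Sum>j\<in>S - Q. w {i, j})"
    using finS w_nonneg by (intro sum_mono2) (auto intro!: sum_nonneg dest: in_S)
  also have "\<dots> = (\<Sum>j\<in>S - Q. \<Sum>i\<in>S. w {j, i})" by (subst sum.swap) (simp add: insert_commute)
  also have "\<dots> = d * card (S - Q)" by (simp add: row_S)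
  finally have "(\<Sum>i\<in>Q \<inter> S. \<Sum>j\<in>S - Q. w {i, j}) \<le> d * card (S - Q)" .
  moreover have "(\<Sum>i\<in>Q \<inter> S. \<Sum>j\<in>Q \<inter> S. w {i, j}) = d * card (Q \<inter> S) - (\<Sum>i\<in>Q \<inter> S. \<Sum>j\<in>S - Q. w {i, j})"
    by (simp add: row sum_subtractf mult.commute)
  moreover have "(\<Sum>i\<in>Q \<inter> S. \<Sum>j\<in>Q \<inter> S. w {i, j}) \<le> (\<Sum>i\<in>Q. \<Sum>j\<in>Q. w {i, j})"
  proof -
    have "(\<Sum>i\<in>Q \<inter> S. \<Sum>j\<in>Q \<inter> S. w {i, j}) \<le> (\<Sum>i\<in>Q \<inter> S. \<Sum>j\<in>Q. w {i, j})"
      using finQ Q(1) w_nonneg by (intro sum_mono sum_mono2) auto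
    also have "\<dots> \<le> (\<Sum>i\<in>Q. \<Sum>j\<in>Q. w {i, j})"
      using finQ Q(1) w_nonneg by (intro sum_mono2) (auto intro!: sum_nonneg)
    finally show ?thesis .
  qed
  ultimately have "d * (k - 2 * real (card (S - Q))) \<le> 2 * rho w Q"
    unfolding rho_def cQ by (simp add: algebra_simps)
  moreover have "d * (k - 2 * (c / 2 * k)) \<le> d * (k - 2 * real (card (S - Q)))"
  proof (intro mult_left_mono diff_left_mono)
    have "c / 6 * k \<le> c / 2 * k" using c by (intro mult_right_mono) auto
    then show "real (card (S - Q)) \<le> c / 2 * k" using r by linarith
  qed (use d in auto)
  ultimately show "(1 - c) * (k * d / 2) \<le> rho w Q" by (simp add: algebra_simps)
qed

section \<open>The program\<close>

definition "v_n = VIn (VC 0)"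
definition "v_row = VDiv VI v_n"
definition "v_col = VSub VI (VMul v_n v_row)"
definition "v_at A e f = VA A (VAdd (VMul e v_n) f)"
fun v_npow :: "nat \<Rightarrow> vexp" where
  "v_npow 0 = VC 1"
| "v_npow (Suc a) = VMul v_n (v_npow a)"

text \<open>The machine has no comparison operators: \<open>x div (x\<^sup>2 + 1)\<close> is \<open>-1\<close> for negative and \<open>0\<close> for
  nonnegative \<open>x\<close>.\<close>

definition "v_neg e = VDiv e (VAdd (VMul e e) (VC 1))"
definition "v_pos e = VMul e (VAdd (VC 1) (v_neg e))"
definition "v_gt0 e = VSub (VC 0) (v_neg (VSub (VC 0) e))"
definition "v_eq e f = VAdd (VC 1) (v_neg (VSub (VC 0) (VMul (VSub e f) (VSub e f))))"
text \<open>The running time is also claimed for \<open>k = 0\<close>; replacing it by 1 keeps the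
  hypotheses of the solver true on every input.\<close>

definition "v_k = VAdd (VIn (VC 1)) (v_eq (VIn (VC 1)) (VC 0))"

lemma div_square_succ: "x div (x * x + 1) = (if x < 0 then - 1 else 0)" for x :: int
proof (cases "x < 0")
  case True
  have "- x * 1 \<le> - x * - x" using True by (intro mult_left_mono) auto
  then have "x div (x * x + 1) = - 1"
    using True by (intro int_div_pos_eq[where r = "x + (x * x + 1)"]) auto
  then show ?thesis using True by simp
next
  case False
  have "x < x * x + 1"
  proof (cases "x = 0")
    case f: False
    then have "x * 1 \<le> x * x" using False by (intro mult_left_mono) auto
    then show ?thesis by simp
  qed simp
  then show ?thesis using False by (simp add: div_pos_pos_trivial)
qed

lemma vev_neg: "vev n inp \<sigma> i l (v_neg e) = (if vev n inp \<sigma> i l e < 0 then - 1 else 0)"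
  by (simp add: v_neg_def div_square_succ)

lemma vev_pos [simp]: "vev n inp \<sigma> i l (v_pos e) = pos (vev n inp \<sigma> i l e)"
  by (simp add: v_pos_def vev_neg pos_def max_def)

lemma vev_gt0 [simp]: "vev n inp \<sigma> i l (v_gt0 e) = of_bool (0 < vev n inp \<sigma> i l e)"
  by (simp add: v_gt0_def vev_neg)

lemma vev_eq [simp]: "vev n inp \<sigma> i l (v_eq e f) = of_bool (vev n inp \<sigma> i l e = vev n inp \<sigma> i l f)"
proof -
  have "(0 < (x - y) * (x - y)) \<longleftrightarrow> x \<noteq> y" for x y :: int by (auto simp: zero_less_mult_iff)
  then show ?thesis by (auto simp: v_eq_def vev_neg)
qed

lemma reads_v [simp]:
  "reads v_n = {}" "reads v_row = {}" "reads v_col = {}" "reads (v_at A e f) = insert A (reads e \<union> reads f)"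
  "reads (v_npow a) = {}" "reads (v_pos e) = reads e" "reads (v_gt0 e) = reads e"
  "reads (v_eq e f) = reads e \<union> reads f" "reads v_k = {}"
proof -
  show "reads (v_npow a) = {}" by (induction a) (simp_all add: v_n_def)
qed (simp_all add: v_n_def v_row_def v_col_def v_at_def v_pos_def v_neg_def v_gt0_def v_eq_def v_k_def)

text \<open>
  Array 9 holds the rounded objective, 10 the current iterate, 12 to 15 its trace, row sums and
  violations, 16 the shifted drift, 17 its power and 21 the indicator of the selected vertices; arrays 2
  to 4 are loop counters. The selection ranks the diagonal entries, breaking ties by the index.
\<close>

definition "prep =
  PSeq (Tab 5 0 0 (VC 1))
  (PSeq (Loop 2 2 (PSeq (Tab 6 0 0 (VMul (VA 5 (VC 0)) (VIn (VAdd (VC 3) (VMul (VC 2) (VA 2 (VC 0)))))))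
                        (Tab 5 0 0 (VA 6 (VC 0)))))
  (PSeq (Tab 7 2 0 (VMul (VIn (VAdd (VC 2) (VMul (VC 2) VI))) (VDiv (VA 5 (VC 0)) (VIn (VAdd (VC 3) (VMul (VC 2) VI))))))
  (PSeq (Tab 8 0 2 (VA 7 VS))
        (Tab 9 2 0 (VDiv (VMul (v_npow 16) (VA 7 VI)) (VA 8 (VC 0)))))))"

definition "v_Z = v_at 10"
definition "v_row_excess e = v_pos (VSub (VA 13 e) (VMul v_k (v_Z e e)))"
definition "v_diag_excess e = v_pos (VSub (VMul v_k (v_Z e e)) (VA 12 (VC 0)))"

definition "v_drift =
  VSub (VSub (VSub (VSub (VAdd (VMul (VMul (VC 2) (v_npow 64)) (VA 9 VI)) (VMul (VC 2) (v_pos (VSub (VC 0) (v_Z v_row v_col)))))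
    (v_pos (VSub (v_Z v_row v_col) (v_Z v_row v_row)))) (v_pos (VSub (v_Z v_col v_row) (v_Z v_col v_col))))
    (v_row_excess v_row)) (v_row_excess v_col)"

definition "v_drift_diag =
  VAdd (VAdd (VSub (VAdd (VMul (VC 2) (VA 15 v_row)) (VMul (VMul (VC 2) v_k) (v_row_excess v_row)))
    (VMul (VMul (VC 2) v_k) (v_diag_excess v_row))) (VMul (VC 2) (VA 14 (VC 0)))) (v_npow 116)"

definition "drift_prog =
  PSeq (Tab 12 0 1 (v_Z VS VS))
  (PSeq (Tab 13 1 1 (v_Z VI VS))
  (PSeq (Tab 14 0 1 (v_diag_excess VS))
  (PSeq (Tab 15 1 1 (v_pos (VSub (v_Z VI VS) (v_Z VI VI))))
        (Tab 16 2 0 (VAdd v_drift (VMul (v_eq v_row v_col) v_drift_diag))))))"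

text \<open>Two multiplications by the shifted drift, through the auxiliary array 18 because a
  \<open>Tab\<close> may not read the array it writes. So \<open>n ^ 117\<close> rounds produce the
  power \<open>2 * n ^ 117\<close>.\<close>

definition "square_prog =
  PSeq (Tab 18 2 1 (VMul (v_at 16 v_row VS) (v_at 17 VS v_col))) (Tab 17 2 1 (VMul (v_at 16 v_row VS) (v_at 18 VS v_col)))"

definition "power_prog = PSeq (Tab 17 2 0 (v_eq v_row v_col)) (Loop 4 117 square_prog)"

definition "update_prog =
  PSeq (Tab 19 0 1 (v_at 17 VS VS))
  (PSeq (Tab 11 2 0 (VAdd (VA 10 VI) (VDiv (VMul (v_npow 60) (VA 17 VI)) (VA 19 (VC 0)))))
        (Tab 10 2 0 (VA 11 VI)))"

definition "select_prog =
  PSeq (Tab 20 1 1 (v_gt0 (VSub (VSub (VMul (v_Z VS VS) v_n) VS) (VSub (VMul (v_Z VI VI) v_n) VI))))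
       (Tab 21 1 0 (v_gt0 (VSub v_k (VA 20 VI))))"

definition "solver_prog = PSeq prep (PSeq (Loop 3 48 (PSeq drift_prog (PSeq power_prog update_prog))) select_prog)"

lemma wf_solver_prog: "wf_prog solver_prog"
  by (simp add: solver_prog_def prep_def drift_prog_def power_prog_def square_prog_def update_prog_def select_prog_def
      v_Z_def v_row_excess_def v_diag_excess_def v_drift_def v_drift_diag_def)

lemma mat_pow_abs_le:
  fixes P :: "nat \<Rightarrow> nat \<Rightarrow> int"
  assumes "\<And>i j. i < n \<Longrightarrow> j < n \<Longrightarrow> \<bar>P i j\<bar> \<le> c" "0 \<le> c" and "i < n"
  shows "\<bar>mat_pow n P r i j\<bar> \<le> (int n * c) ^ r"
  using assms(3)
proof (induction r arbitrary: i)
  case 0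
  then show ?case by (simp add: mat_pow_def unit_at_def)
next
  case (Suc r)
  have "\<bar>mat_pow n P (Suc r) i j\<bar> \<le> (\<Sum>l<n. \<bar>P i l * mat_pow n P r l j\<bar>)"
    unfolding mat_pow_def mat_app_funpow_Suc by (rule sum_abs)
  also have "\<dots> \<le> (\<Sum>l<n. c * (int n * c) ^ r)"
    using Suc assms by (intro sum_mono) (auto simp: abs_mult intro!: mult_mono)
  finally show ?case by simp
qed

lemma two_power_bound: "(int n) ^ a \<le> 2 ^ (a * n)"
proof -
  have "int n \<le> 2 ^ n" using of_nat_less_two_power[of n, where 'a = int] by simp
  then have "(int n) ^ a \<le> (2 ^ n) ^ a" by (intro power_mono) auto
  then show ?thesis by (simp add: mult.commute flip: power_mult)
qed

section \<open>Correctness and bit bounds of the program\<close>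

locale machine =
  fixes n k :: nat and inp :: store and \<gamma> :: nat
  assumes n: "2 \<le> n" and kn: "k \<le> n" and inp0: "inp 0 = int n" and inp1: "inp 1 = int k" and \<gamma>: "n ^ 127 \<le> \<gamma>"
begin

definition "k' = max 1 k"

abbreviation "ev \<equiv> vev n inp"
abbreviation "rn \<equiv> run n inp"
abbreviation "ok \<equiv> bounded_run (Suc \<gamma>) n inp"
abbreviation M :: "arrays \<Rightarrow> nat \<Rightarrow> nat \<Rightarrow> nat \<Rightarrow> int" where "M \<sigma> A i j \<equiv> \<sigma> A (i * n + j)"

lemma base_gt: "2 < base n" "n < base n" "n * n < base n"
proof -
  have "n * 1 \<le> n * n" using n by (intro mult_le_mono2) simp
  then show "2 < base n" "n < base n" "n * n < base n" using n unfolding base_def by linarith+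
qed

lemma ev_n [simp]: "ev \<sigma> i l v_n = int n" by (simp add: v_n_def inp0)

lemma ev_k [simp]: "ev \<sigma> i l v_k = int k'"
proof -
  have "nat (1 mod int (base n)) = 1" using base_gt by simp
  then show ?thesis using inp1 by (simp add: v_k_def k'_def)
qed

lemma ev_npow [simp]: "ev \<sigma> i l (v_npow a) = int n ^ a"
  by (induction a) simp_all

lemma ev_VA: "ev \<sigma> i l e = int x \<Longrightarrow> x < base n \<Longrightarrow> ev \<sigma> i l (VA A e) = \<sigma> A x" by simp

lemma ev_VA0 [simp]: "ev \<sigma> i l (VA A (VC 0)) = \<sigma> A 0" by simp

lemma ij_less: "i < n \<Longrightarrow> j < n \<Longrightarrow> i * n + j < n * n"
proof -
  assume "i < n" "j < n"
  then have "i * n + j < (i + 1) * n" by simp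
  also have "\<dots> \<le> n * n" using \<open>i < n\<close> by (intro mult_le_mono1) simp
  finally show ?thesis .
qed

lemma ev_at [simp]: "ev \<sigma> x l e = int i \<Longrightarrow> ev \<sigma> x l f = int j \<Longrightarrow> i < n \<Longrightarrow> j < n \<Longrightarrow>
  ev \<sigma> x l (v_at A e f) = M \<sigma> A i j"
  using ij_less[of i j] base_gt
  by (simp add: v_at_def flip: of_nat_mult of_nat_add)

lemma ev_row_col [simp]: "i < n \<Longrightarrow> j < n \<Longrightarrow> ev \<sigma> (i * n + j) l v_row = int i"
  "i < n \<Longrightarrow> j < n \<Longrightarrow> ev \<sigma> (i * n + j) l v_col = int j"
proof -
  assume ij: "i < n" "j < n"
  have d: "(i * n + j) div n = i" using ij by simp
  have "int (i * n + j) div int n = int i" unfolding zdiv_int[symmetric] d ..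
  then show r: "ev \<sigma> (i * n + j) l v_row = int i" by (simp add: v_row_def)
  show "ev \<sigma> (i * n + j) l v_col = int j" unfolding v_col_def vev.simps r ev_n by (simp add: algebra_simps)
qed

lemma ev_VI [simp]: "x < n * n \<Longrightarrow> ev \<sigma> x l (VA A VI) = \<sigma> A x" "l < n * n \<Longrightarrow> ev \<sigma> x l (VA A VS) = \<sigma> A l"
  using base_gt by simp_all

lemma index_split: "x < n ^ 2 \<Longrightarrow> \<exists>i j. i < n \<and> j < n \<and> x = i * n + j"
  using n by (intro exI[of _ "x div n"] exI[of _ "x mod n"]) (auto simp: power2_eq_square less_mult_imp_div_less)

text \<open>Entries of the drift are at most \<open>n ^ 117\<close>, so those of its power
  \<open>2 * n ^ 117\<close> are at most \<open>n ^ 118\<close> to that power, that is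
  \<open>n ^ (236 * n ^ 117)\<close>. Since \<open>n \<le> 2 ^ n\<close> and
  \<open>436 < 2 ^ 9 \<le> n ^ 9\<close>, \<open>n ^ 127\<close> bits suffice.\<close>

lemma power_less: "c \<le> 200 \<Longrightarrow> int n ^ (c + 236 * n ^ 117) < 2 ^ \<gamma>"
proof -
  assume c: "c \<le> 200"
  have "(c + 236 * n ^ 117) * n \<le> (200 * n ^ 117 + 236 * n ^ 117) * n"
    using c n by (intro mult_le_mono1 add_le_mono1) (simp add: order.trans[OF c])
  also have "\<dots> = 436 * n ^ 118" using power_add[of n 117 1] by simp
  also have "\<dots> < 2 ^ 9 * n ^ 118" using n by simp
  also have "\<dots> \<le> n ^ 9 * n ^ 118" using n by (intro mult_le_mono1 power_mono) auto
  also have "\<dots> = n ^ 127" by (simp flip: power_add)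
  finally have "(c + 236 * n ^ 117) * n < \<gamma>" using \<gamma> by linarith
  then have "(2::int) ^ ((c + 236 * n ^ 117) * n) < 2 ^ \<gamma>" by simp
  then show ?thesis using two_power_bound[of n "c + 236 * n ^ 117"] by linarith
qed

lemma small_power_less: "c \<le> 200 \<Longrightarrow> int n ^ c < 2 ^ \<gamma>"
  using order.strict_trans1[OF power_increasing[of c "c + 236 * n ^ 117" "int n"] power_less[of c]] n by simp

lemma tab_ok:
  assumes "\<And>i l. i < n ^ a \<Longrightarrow> l < n ^ b \<Longrightarrow> \<bar>ev \<sigma> i l e\<bar> \<le> G" and "int n ^ b * G < 2 ^ \<gamma>"
    and "a \<le> 200" "b \<le> 200" and "0 \<le> G"
  shows "ok (Tab A a b e) \<sigma>"
proof -
  have "\<bar>\<Sum>l<m. ev \<sigma> i l e\<bar> < 2 ^ \<gamma>" if "i < n ^ a" "m \<le> n ^ b" for i m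
  proof -
    have "\<bar>\<Sum>l<m. ev \<sigma> i l e\<bar> \<le> (\<Sum>l<m. G)"
      using assms(1) that by (intro order.trans[OF sum_abs] sum_mono) auto
    also have "\<dots> = int m * G" by simp
    also have "\<dots> \<le> int n ^ b * G" using that assms(5) by (intro mult_right_mono) (auto simp flip: of_nat_power)
    finally show ?thesis using assms(2) by linarith
  qed
  then show ?thesis using small_power_less[OF assms(3)] small_power_less[OF assms(4)] by (simp add: bit_length_le_iff)
qed

lemma tab_ok_small:
  assumes "\<And>i l. i < n ^ a \<Longrightarrow> l < n ^ b \<Longrightarrow> \<bar>ev \<sigma> i l e\<bar> \<le> int n ^ 120" and "a \<le> 2" "b \<le> 2"
  shows "ok (Tab A a b e) \<sigma>"
proof (rule tab_ok[OF assms(1)])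
  show "int n ^ b * int n ^ 120 < 2 ^ \<gamma>" using small_power_less[of "b + 120"] assms(3) by (simp add: power_add)
qed (use assms in auto)

lemma npow_le: "a \<le> b \<Longrightarrow> int n ^ a \<le> int n ^ b" using n by (intro power_increasing) auto

lemma two_npow: "2 * int n ^ a \<le> int n ^ Suc a" using n by (simp add: mult_right_mono)

lemma k'_bounds: "0 < k'" "k' \<le> n" using kn n by (auto simp: k'_def)

lemma drift_abs_bound:
  assumes "\<And>i j. i < n \<Longrightarrow> j < n \<Longrightarrow> \<bar>a i j\<bar> \<le> int n ^ 16" "\<And>i j. i < n \<Longrightarrow> j < n \<Longrightarrow> \<bar>Z i j\<bar> \<le> int n ^ 108"
    and "i < n" "j < n"
  shows "\<bar>shifted n k' a Z i j\<bar> \<le> int n ^ 117"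
proof -
  have "\<bar>drift n (int k') (int n ^ 64) a Z i j\<bar> \<le> 2 * (int n ^ 64 * int n ^ 16) + 26 * (int n)\<^sup>2 * int n ^ 108"
    using n k'_bounds assms by (intro drift_abs) auto
  also have "int n ^ 64 * int n ^ 16 = int n ^ 80" by (simp flip: power_add)
  also have "26 * (int n)\<^sup>2 * int n ^ 108 = 26 * int n ^ 110" by (simp flip: power_add)
  also have "2 * int n ^ 80 + 26 * int n ^ 110 \<le> 28 * int n ^ 110" using npow_le[of 80 110] by simp
  also have "\<dots> \<le> int n ^ 6 * int n ^ 110"
  proof (rule mult_right_mono)
    have "(2::int) ^ 6 \<le> int n ^ 6" using n by (intro power_mono) auto
    then show "28 \<le> int n ^ 6" by simp
  qed simp
  also have "\<dots> = int n ^ 116" by (simp flip: power_add)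
  finally have d: "\<bar>drift n (int k') (int n ^ 64) a Z i j\<bar> \<le> int n ^ 116" .
  have "0 \<le> int n ^ 116" by simp
  then have "\<bar>shifted n k' a Z i j\<bar> \<le> 2 * int n ^ 116" unfolding shifted_def using d
    by (smt (verit) abs_triangle_ineq)
  also have "\<dots> \<le> int n ^ Suc 116" by (rule two_npow)
  finally show ?thesis by simp
qed

lemma drift_prog_correct:
  assumes a: "\<And>i j. i < n \<Longrightarrow> j < n \<Longrightarrow> \<bar>M \<sigma> 9 i j\<bar> \<le> int n ^ 16" and Z: "\<And>i j. i < n \<Longrightarrow> j < n \<Longrightarrow> \<bar>M \<sigma> 10 i j\<bar> \<le> int n ^ 108"
  shows "ok drift_prog \<sigma>" "i < n \<Longrightarrow> j < n \<Longrightarrow> M (rn drift_prog \<sigma>) 16 i j = shifted n k' (M \<sigma> 9) (M \<sigma> 10) i j"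
proof -
  let ?Z = "M \<sigma> 10"
  define s1 where "s1 = rn (Tab 12 0 1 (v_Z VS VS)) \<sigma>"
  define s2 where "s2 = rn (Tab 13 1 1 (v_Z VI VS)) s1"
  define s3 where "s3 = rn (Tab 14 0 1 (v_diag_excess VS)) s2"
  define s4 where "s4 = rn (Tab 15 1 1 (v_pos (VSub (v_Z VI VS) (v_Z VI VI)))) s3"
  let ?e = "VAdd v_drift (VMul (v_eq v_row v_col) v_drift_diag)"
  have u1: "s1 A = \<sigma> A" if "A \<noteq> 12" for A using that by (simp add: s1_def)
  have u2: "s2 A = s1 A" if "A \<noteq> 13" for A using that by (simp add: s2_def)
  have u3: "s3 A = s2 A" if "A \<noteq> 14" for A using that by (simp add: s3_def)
  have u4: "s4 A = s3 A" if "A \<noteq> 15" for A using that by (simp add: s4_def)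
  note u = u1 u2 u3 u4
  have s1v: "s1 12 0 = (\<Sum>l<n. ?Z l l)" by (simp add: s1_def v_Z_def)
  have s2v: "s2 13 i = (\<Sum>l<n. ?Z i l)" if "i < n" for i using that by (simp add: s2_def v_Z_def u)
  have dx: "ev s2 0 l (v_diag_excess VS) = diag_excess n (int k') ?Z l" if "l < n" for l
    using that s1v by (simp add: v_diag_excess_def diag_excess_def v_Z_def u)
  have s3v: "s3 14 0 = (\<Sum>l<n. diag_excess n (int k') ?Z l)" using dx by (simp add: s3_def)
  have s4v: "s4 15 i = (\<Sum>l<n. pos (?Z i l - ?Z i i))" if "i < n" for i using that by (simp add: s4_def v_Z_def u)
  have VA1: "ev s4 x l (VA A e) = s4 A i" if "ev s4 x l e = int i" "i < n" for x l A e i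
    using ev_VA[OF that(1)] that(2) base_gt by simp
  have qe: "ev s4 x l (v_row_excess e) = row_excess n (int k') ?Z i" if "ev s4 x l e = int i" "i < n" for x l e i
    using that s2v[OF that(2)] VA1[OF that] by (simp add: v_row_excess_def row_excess_def v_Z_def u del: vev.simps(5))
  have pe: "ev s4 x l (v_diag_excess e) = diag_excess n (int k') ?Z i" if "ev s4 x l e = int i" "i < n" for x l e i
    using that s1v by (simp add: v_diag_excess_def diag_excess_def v_Z_def u del: vev.simps(5))
  have fin: "ev s4 (i * n + j) l ?e = shifted n k' (M \<sigma> 9) ?Z i j" if "i < n" "j < n" for i j l
  proof -
    have "ev s4 (i * n + j) l (VA 9 VI) = M \<sigma> 9 i j" using ij_less[OF that] by (simp add: u del: vev.simps(5))
    moreover have "ev s4 (i * n + j) l (VA 15 v_row) = (\<Sum>l<n. pos (?Z i l - ?Z i i))"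
      using VA1[of "i * n + j" l v_row i 15] that s4v by simp
    moreover have "ev s4 (i * n + j) l (VA 14 (VC 0)) = (\<Sum>l<n. diag_excess n (int k') ?Z l)"
      using s3v by (simp add: u)
    ultimately show ?thesis
      using that by (simp add: v_drift_def v_drift_diag_def shifted_def drift_def qe pe v_Z_def u del: vev.simps(5))
  qed
  have r: "rn drift_prog \<sigma> = rn (Tab 16 2 0 ?e) s4"
    by (simp only: drift_prog_def run.simps(2) s1_def[symmetric] s2_def[symmetric] s3_def[symmetric] s4_def[symmetric])
  show "M (rn drift_prog \<sigma>) 16 i j = shifted n k' (M \<sigma> 9) (M \<sigma> 10) i j" if "i < n" "j < n"
    using ij_less[OF that] fin[OF that] by (simp add: r power2_eq_square)
  have b108: "int n ^ 108 \<le> int n ^ 120" by (rule npow_le) simp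
  have "ok (Tab 12 0 1 (v_Z VS VS)) \<sigma>"
    by (rule tab_ok_small) (use Z b108 in \<open>auto simp: v_Z_def intro: order.trans\<close>)
  moreover have "ok (Tab 13 1 1 (v_Z VI VS)) s1"
    by (rule tab_ok_small) (use Z b108 in \<open>auto simp: v_Z_def u intro: order.trans\<close>)
  moreover have "ok (Tab 14 0 1 (v_diag_excess VS)) s2"
  proof (rule tab_ok_small)
    fix i l assume "i < n ^ 0" "l < n ^ 1"
    then have "i = 0" "l < n" by auto
    have "\<bar>int k' * ?Z l l\<bar> \<le> int n * int n ^ 108"
      using Z[OF \<open>l < n\<close> \<open>l < n\<close>] k'_bounds unfolding abs_mult by (intro mult_mono) auto
    moreover have "\<bar>\<Sum>l<n. ?Z l l\<bar> \<le> int n * int n ^ 108"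
    proof -
      have "\<bar>\<Sum>l<n. ?Z l l\<bar> \<le> (\<Sum>l<n. int n ^ 108)" using Z by (intro order.trans[OF sum_abs] sum_mono) auto
      then show ?thesis by simp
    qed
    ultimately have "\<bar>int k' * ?Z l l - (\<Sum>l<n. ?Z l l)\<bar> \<le> 2 * int n ^ 109"
      using power_add[of "int n" 1 108] by simp
    also have "\<dots> \<le> int n ^ 110" using two_npow[of 109] by simp
    also have "\<dots> \<le> int n ^ 120" by (rule npow_le) simp
    finally have "pos (int k' * ?Z l l - (\<Sum>l<n. ?Z l l)) \<le> int n ^ 120" by (rule pos_le)
    then show "\<bar>ev s2 i l (v_diag_excess VS)\<bar> \<le> int n ^ 120"
      using dx[OF \<open>l < n\<close>] \<open>i = 0\<close> by (simp add: diag_excess_def abs_of_nonneg[OF pos_nonneg])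
  qed auto
  moreover have "ok (Tab 15 1 1 (v_pos (VSub (v_Z VI VS) (v_Z VI VI)))) s3"
  proof (rule tab_ok_small)
    fix i l assume "i < n ^ 1" "l < n ^ 1"
    then have il: "i < n" "l < n" by auto
    have "\<bar>?Z i l - ?Z i i\<bar> \<le> 2 * int n ^ 108" using Z[of i l] Z[of i i] il by simp
    also have "\<dots> \<le> int n ^ 109" using two_npow[of 108] by simp
    also have "\<dots> \<le> int n ^ 120" by (rule npow_le) simp
    finally have "pos (?Z i l - ?Z i i) \<le> int n ^ 120" by (rule pos_le)
    then show "\<bar>ev s3 i l (v_pos (VSub (v_Z VI VS) (v_Z VI VI)))\<bar> \<le> int n ^ 120"
      using il by (simp add: v_Z_def u abs_of_nonneg[OF pos_nonneg])
  qed auto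
  moreover have "ok (Tab 16 2 0 ?e) s4"
  proof (rule tab_ok_small)
    fix x l assume "x < n ^ 2" "l < n ^ 0"
    then obtain i j where ij: "i < n" "j < n" "x = i * n + j" using index_split by blast
    have "\<bar>shifted n k' (M \<sigma> 9) ?Z i j\<bar> \<le> int n ^ 117" by (rule drift_abs_bound[OF a Z ij(1,2)])
    also have "\<dots> \<le> int n ^ 120" by (rule npow_le) simp
    finally show "\<bar>ev s4 x l ?e\<bar> \<le> int n ^ 120" using fin[OF ij(1,2)] ij(3) by simp
  qed auto
  ultimately show "ok drift_prog \<sigma>"
    by (simp only: drift_prog_def bounded_run.simps(2) s1_def[symmetric] s2_def[symmetric] s3_def[symmetric] s4_def[symmetric] simp_thms)
qed

lemma power_prog_correct:
  assumes P: "\<And>i j. i < n \<Longrightarrow> j < n \<Longrightarrow> \<bar>M \<sigma> 16 i j\<bar> \<le> int n ^ 117"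
  shows "ok power_prog \<sigma>" "i < n \<Longrightarrow> j < n \<Longrightarrow> M (rn power_prog \<sigma>) 17 i j = mat_pow n (M \<sigma> 16) (2 * n ^ 117) i j"
proof -
  let ?P = "M \<sigma> 16"
  define s0 where "s0 = rn (Tab 17 2 0 (v_eq v_row v_col)) \<sigma>"
  define it where "it t = iterate 4 (rn square_prog) s0 t" for t
  have i16: "it t 16 = \<sigma> 16" for t
  proof (induction t)
    case (Suc t)
    have "rn square_prog \<tau> 16 = \<tau> 16" for \<tau> by (rule run_unchanged) (simp add: square_prog_def)
    then show ?case using Suc by (simp add: it_def Let_def)
  qed (simp add: it_def s0_def)
  have bound: "\<bar>mat_pow n ?P r i j\<bar> \<le> int n ^ (118 * r)" if "i < n" for r i j
  proof -
    have "\<bar>mat_pow n ?P r i j\<bar> \<le> (int n * int n ^ 117) ^ r" by (rule mat_pow_abs_le[OF P _ that]) auto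
    also have "int n * int n ^ 117 = int n ^ 118" using power_add[of "int n" 1 117] by simp
    finally show ?thesis by (simp add: power_mult)
  qed
  have Suc_pow: "(\<Sum>l<n. ?P i l * mat_pow n ?P r l j) = mat_pow n ?P (Suc r) i j" for i j r
    unfolding mat_pow_def mat_app_funpow_Suc ..
  have mult: "M (rn (Tab B 2 1 (VMul (v_at 16 v_row VS) (v_at A VS v_col))) \<tau>) B i j = mat_pow n ?P (Suc r) i j"
    if "\<tau> 16 = \<sigma> 16" "\<And>i j. i < n \<Longrightarrow> j < n \<Longrightarrow> M \<tau> A i j = mat_pow n ?P r i j" "i < n" "j < n" for \<tau> A B r i j
    using ij_less[OF that(3,4)] that by (simp add: power2_eq_square Suc_pow)
  have mult_ok: "ok (Tab B 2 1 (VMul (v_at 16 v_row VS) (v_at A VS v_col))) \<tau>"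
    if "\<tau> 16 = \<sigma> 16" "\<And>i j. i < n \<Longrightarrow> j < n \<Longrightarrow> M \<tau> A i j = mat_pow n ?P r i j" "r < 2 * n ^ 117" for \<tau> A B r
  proof (rule tab_ok)
    fix x l assume "x < n ^ 2" "l < n ^ 1"
    then obtain i j where ij: "i < n" "j < n" "x = i * n + j" "l < n" using index_split[of x] by auto
    have "\<bar>?P i l * mat_pow n ?P r l j\<bar> \<le> int n ^ 117 * int n ^ (118 * r)"
      unfolding abs_mult using P[OF ij(1,4)] bound[OF ij(4)] by (intro mult_mono) auto
    then show "\<bar>ev \<tau> x l (VMul (v_at 16 v_row VS) (v_at A VS v_col))\<bar> \<le> int n ^ (117 + 118 * r)"
      using ij that(1,2) by (simp add: power_add)
  next
    have "int n ^ 1 * int n ^ (117 + 118 * r) = int n ^ (118 * Suc r)"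
      using power_Suc[of "int n" "117 + 118 * r"] by simp
    also have "\<dots> \<le> int n ^ (0 + 236 * n ^ 117)" using that(3) by (intro npow_le) simp
    also have "\<dots> < 2 ^ \<gamma>" by (rule power_less) simp
    finally show "int n ^ 1 * int n ^ (117 + 118 * r) < 2 ^ \<gamma>" .
  qed auto
  have sq: "\<tau> 16 = \<sigma> 16 \<Longrightarrow> (\<And>i j. i < n \<Longrightarrow> j < n \<Longrightarrow> M \<tau> 17 i j = mat_pow n ?P r i j) \<Longrightarrow>
     (Suc r < 2 * n ^ 117 \<longrightarrow> ok square_prog \<tau>) \<and> (\<forall>i<n. \<forall>j<n. M (rn square_prog \<tau>) 17 i j = mat_pow n ?P (Suc (Suc r)) i j)" for \<tau> r
  proof -
    assume t: "\<tau> 16 = \<sigma> 16" "\<And>i j. i < n \<Longrightarrow> j < n \<Longrightarrow> M \<tau> 17 i j = mat_pow n ?P r i j"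
    let ?t1 = "Tab 18 2 1 (VMul (v_at 16 v_row VS) (v_at 17 VS v_col))"
    have t16: "rn ?t1 \<tau> 16 = \<sigma> 16" using t(1) by simp
    have t18: "M (rn ?t1 \<tau>) 18 i j = mat_pow n ?P (Suc r) i j" if "i < n" "j < n" for i j
      using mult[OF t that] .
    show ?thesis
      unfolding square_prog_def run.simps(2) bounded_run.simps(2)
    proof (intro conjI impI allI)
      assume r: "Suc r < 2 * n ^ 117"
      then have "r < 2 * n ^ 117" by simp
      then show "ok ?t1 \<tau>" by (intro mult_ok[OF t])
      show "ok (Tab 17 2 1 (VMul (v_at 16 v_row VS) (v_at 18 VS v_col))) (rn ?t1 \<tau>)"
        by (rule mult_ok[OF t16 t18 r])
    qed (rule mult[OF t16 t18])
  qed
  have inv: "\<forall>i<n. \<forall>j<n. M (it t) 17 i j = mat_pow n ?P (2 * t) i j" for t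
  proof (induction t)
    case 0
    show ?case using ij_less by (auto simp: it_def s0_def mat_pow_def unit_at_def power2_eq_square)
  next
    case (Suc t)
    then show ?case using sq[of "it t" "2 * t", OF i16] by (simp add: it_def Let_def)
  qed
  have r: "rn power_prog \<sigma> = it (n ^ 117)" by (simp add: power_prog_def it_def s0_def)
  show "M (rn power_prog \<sigma>) 17 i j = mat_pow n (M \<sigma> 16) (2 * n ^ 117) i j" if "i < n" "j < n"
    using inv that unfolding r by blast
  have "ok (Tab 17 2 0 (v_eq v_row v_col)) \<sigma>"
    by (rule tab_ok_small) (use npow_le[of 0 120] in \<open>auto simp: of_bool_def\<close>)
  moreover have "ok (Loop 4 117 square_prog) s0"
  proof -
    have "ok square_prog (it t)" if "t < n ^ 117" for t
      using sq[of "it t" "2 * t", OF i16] inv that by simp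
    moreover have "bit_length (int (n ^ 117)) \<le> Suc \<gamma>" using small_power_less[of 117] by (simp add: bit_length_le_iff)
    ultimately show ?thesis by (simp add: it_def)
  qed
  ultimately show "ok power_prog \<sigma>" by (simp add: power_prog_def s0_def del: bounded_run.simps(1,3) run.simps(1,3))
qed

lemma update_prog_correct:
  assumes P: "\<And>i j. i < n \<Longrightarrow> j < n \<Longrightarrow> \<bar>P i j\<bar> \<le> int n ^ 117"
    and Q: "\<And>i j. i < n \<Longrightarrow> j < n \<Longrightarrow> M \<sigma> 17 i j = mat_pow n P (2 * n ^ 117) i j"
    and Z: "\<And>i j. i < n \<Longrightarrow> j < n \<Longrightarrow> \<bar>M \<sigma> 10 i j + response n (int n ^ 60) P (n ^ 117) i j\<bar> \<le> int n ^ 108"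
  shows "ok update_prog \<sigma>" "i < n \<Longrightarrow> j < n \<Longrightarrow> M (rn update_prog \<sigma>) 10 i j =
    M \<sigma> 10 i j + response n (int n ^ 60) P (n ^ 117) i j"
proof -
  define s1 where "s1 = rn (Tab 19 0 1 (v_at 17 VS VS)) \<sigma>"
  let ?e = "VAdd (VA 10 VI) (VDiv (VMul (v_npow 60) (VA 17 VI)) (VA 19 (VC 0)))"
  define s2 where "s2 = rn (Tab 11 2 0 ?e) s1"
  have u1: "s1 A = \<sigma> A" if "A \<noteq> 19" for A using that by (simp add: s1_def)
  have s1v: "s1 19 0 = (\<Sum>l<n. mat_pow n P (2 * n ^ 117) l l)" using Q by (simp add: s1_def)
  have e: "ev s1 (i * n + j) l ?e = M \<sigma> 10 i j + response n (int n ^ 60) P (n ^ 117) i j" if "i < n" "j < n" for i j l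
    using ij_less[OF that] Q[OF that] s1v by (simp add: u1 response_def del: vev.simps(5))
  have s2v: "M s2 11 i j = M \<sigma> 10 i j + response n (int n ^ 60) P (n ^ 117) i j" if "i < n" "j < n" for i j
    using ij_less[OF that] e[OF that] unfolding s2_def by (simp add: power2_eq_square del: vev.simps)
  have r: "rn update_prog \<sigma> = rn (Tab 10 2 0 (VA 11 VI)) s2"
    by (simp only: update_prog_def run.simps(2) s1_def[symmetric] s2_def[symmetric])
  show "M (rn update_prog \<sigma>) 10 i j = M \<sigma> 10 i j + response n (int n ^ 60) P (n ^ 117) i j" if "i < n" "j < n"
    using ij_less[OF that] s2v[OF that] by (simp add: r power2_eq_square del: vev.simps)
  have b: "\<bar>M \<sigma> 17 i j\<bar> \<le> int n ^ (236 * n ^ 117)" if "i < n" "j < n" for i j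
  proof -
    have "\<bar>mat_pow n P (2 * n ^ 117) i j\<bar> \<le> (int n * int n ^ 117) ^ (2 * n ^ 117)" by (rule mat_pow_abs_le[OF P _ that(1)]) auto
    also have "int n * int n ^ 117 = int n ^ 118" using power_add[of "int n" 1 117] by simp
    also have "(int n ^ 118) ^ (2 * n ^ 117) = int n ^ (236 * n ^ 117)" by (simp flip: power_mult)
    finally show ?thesis using Q[OF that] by simp
  qed
  have "ok (Tab 19 0 1 (v_at 17 VS VS)) \<sigma>"
  proof (rule tab_ok)
    show "int n ^ 1 * int n ^ (236 * n ^ 117) < 2 ^ \<gamma>" using power_less[of 1] by (simp add: power_add)
  qed (use b in auto)
  moreover have "ok (Tab 11 2 0 ?e) s1"
  proof (rule tab_ok_small)
    fix x l assume "x < n ^ 2"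
    then obtain i j where ij: "i < n" "j < n" "x = i * n + j" using index_split by blast
    show "\<bar>ev s1 x l ?e\<bar> \<le> int n ^ 120"
      unfolding ij(3) e[OF ij(1,2)] using Z[OF ij(1,2)] npow_le[of 108 120] by linarith
  qed auto
  moreover have "ok (Tab 10 2 0 (VA 11 VI)) s2"
  proof (rule tab_ok_small)
    fix x l assume "x < n ^ 2"
    then obtain i j where ij: "i < n" "j < n" "x = i * n + j" using index_split by blast
    have "ev s2 x l (VA 11 VI) = M s2 11 i j" using ij_less[OF ij(1,2)] ij(3) by (simp del: vev.simps)
    then show "\<bar>ev s2 x l (VA 11 VI)\<bar> \<le> int n ^ 120"
      using s2v[OF ij(1,2)] Z[OF ij(1,2)] npow_le[of 108 120] by linarith
  qed auto
  ultimately show "ok update_prog \<sigma>"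
    by (simp only: update_prog_def bounded_run.simps(2) s1_def[symmetric] s2_def[symmetric] simp_thms)
qed

text \<open>Arrays agree with the abstract matrices only at indices below \<open>n\<close>, so each
  constituent of \<open>sol\<close> has to be shown insensitive to all other arguments.\<close>

lemma mat_pow_cong:
  fixes P P' :: "nat \<Rightarrow> nat \<Rightarrow> int"
  assumes "\<And>i j. i < n \<Longrightarrow> j < n \<Longrightarrow> P i j = P' i j" "i < n"
  shows "mat_pow n P r i j = mat_pow n P' r i j"
  using assms(2)
proof (induction r arbitrary: i)
  case (Suc r)
  then show ?case using assms(1) unfolding mat_pow_def mat_app_funpow_Suc by (intro sum.cong refl) auto
qed (simp add: mat_pow_def)

lemma response_cong:
  assumes "\<And>i j. i < n \<Longrightarrow> j < n \<Longrightarrow> P i j = P' i j" "i < n"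
  shows "response n B P s i j = response n B P' s i j"
  unfolding response_def using mat_pow_cong[OF assms(1)] assms(2) by simp

lemma shifted_cong:
  assumes "\<And>i j. i < n \<Longrightarrow> j < n \<Longrightarrow> a i j = a' i j" "\<And>i j. i < n \<Longrightarrow> j < n \<Longrightarrow> Z i j = Z' i j" "i < n" "j < n"
  shows "shifted n k' a Z i j = shifted n k' a' Z' i j"
  unfolding shifted_def drift_def row_excess_def diag_excess_def using assms by simp

definition "body = PSeq drift_prog (PSeq power_prog update_prog)"

lemma iteration_correct:
  assumes a: "solver_input n k' (M \<sigma> 9)" and Z0: "\<And>i j. i < n \<Longrightarrow> j < n \<Longrightarrow> M \<sigma> 10 i j = 0"
  shows "ok (Loop 3 48 body) \<sigma>" "i < n \<Longrightarrow> j < n \<Longrightarrow> M (rn (Loop 3 48 body) \<sigma>) 10 i j = sol n k' (M \<sigma> 9) (n ^ 48) i j"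
proof -
  interpret si: solver_input n k' "M \<sigma> 9" by (rule a)
  let ?a = "M \<sigma> 9"
  define it where "it t = iterate 3 (rn body) \<sigma> t" for t
  have i9: "it t 9 = \<sigma> 9" for t
  proof (induction t)
    case (Suc t)
    have "rn body \<tau> 9 = \<tau> 9" for \<tau>
      by (rule run_unchanged) (simp add: body_def drift_prog_def power_prog_def square_prog_def update_prog_def)
    then show ?case using Suc by (simp add: it_def Let_def)
  qed (simp add: it_def)
  have step: "ok body \<tau> \<and> (\<forall>i<n. \<forall>j<n. M (rn body \<tau>) 10 i j = sol n k' ?a (Suc t) i j)"
    if t: "t < n ^ 48" and \<tau>: "\<tau> 9 = \<sigma> 9" "\<And>i j. i < n \<Longrightarrow> j < n \<Longrightarrow> M \<tau> 10 i j = sol n k' ?a t i j" for t \<tau>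
  proof -
    have ba: "\<bar>M \<tau> 9 i j\<bar> \<le> int n ^ 16" and bZ: "\<bar>M \<tau> 10 i j\<bar> \<le> int n ^ 108" if "i < n" "j < n" for i j
      using si.a_le[OF that] si.sol_abs[OF less_imp_le[OF t] that] \<tau> that by auto
    let ?P = "shifted n k' ?a (sol n k' ?a t)"
    define s1 where "s1 = rn drift_prog \<tau>"
    define s2 where "s2 = rn power_prog s1"
    note d = drift_prog_correct[of \<tau>, OF ba bZ]
    have s1v: "M s1 16 i j = ?P i j" if "i < n" "j < n" for i j
    proof -
      have "M s1 16 i j = shifted n k' (M \<tau> 9) (M \<tau> 10) i j" using d(2) that by (simp add: s1_def)
      also have "\<dots> = ?P i j" by (rule shifted_cong) (use \<tau> that in auto)
      finally show ?thesis .
    qed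
    have s1u: "s1 10 = \<tau> 10" unfolding s1_def by (rule run_unchanged) (simp add: drift_prog_def)
    have s2u: "s2 10 = \<tau> 10" unfolding s2_def s1u[symmetric] by (rule run_unchanged) (simp add: power_prog_def square_prog_def)
    have bP: "\<bar>?P i j\<bar> \<le> int n ^ 117" if "i < n" "j < n" for i j
      by (rule drift_abs_bound) (use si.a_le si.sol_abs[OF less_imp_le[OF t]] that in auto)
    have bP': "\<bar>M s1 16 i j\<bar> \<le> int n ^ 117" if "i < n" "j < n" for i j using bP[OF that] s1v[OF that] by simp
    note p = power_prog_correct[of s1, OF bP']
    have s2v: "M s2 17 i j = mat_pow n ?P (2 * n ^ 117) i j" if "i < n" "j < n" for i j
      using p(2) that mat_pow_cong[of "M s1 16" ?P, OF s1v that(1)] by (simp add: s2_def)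
    have next_eq: "M s2 10 i j + response n (int n ^ 60) ?P (n ^ 117) i j = sol n k' ?a (Suc t) i j" if "i < n" "j < n" for i j
      using s2u \<tau>(2)[OF that] by simp
    have bn: "\<bar>M s2 10 i j + response n (int n ^ 60) ?P (n ^ 117) i j\<bar> \<le> int n ^ 108" if "i < n" "j < n" for i j
      unfolding next_eq[OF that] by (rule si.sol_abs) (use t that in auto)
    note u = update_prog_correct[of ?P s2, OF bP s2v bn]
    have "ok body \<tau>" using d(1) p(1) u(1) by (simp only: body_def bounded_run.simps(2) s1_def s2_def simp_thms)
    moreover have "M (rn body \<tau>) 10 i j = sol n k' ?a (Suc t) i j" if "i < n" "j < n" for i j
      using u(2)[of i j] that next_eq[OF that] unfolding body_def run.simps(2) s1_def[symmetric] s2_def[symmetric] by simp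
    ultimately show ?thesis by blast
  qed
  have inv: "t \<le> n ^ 48 \<Longrightarrow> \<forall>i<n. \<forall>j<n. M (it t) 10 i j = sol n k' ?a t i j" for t
  proof (induction t)
    case 0
    then show ?case using Z0 by (simp add: it_def)
  next
    case (Suc t)
    then show ?case using step[of t "it t"] i9[of t] by (simp add: it_def Let_def del: sol.simps)
  qed
  show "M (rn (Loop 3 48 body) \<sigma>) 10 i j = sol n k' ?a (n ^ 48) i j" if "i < n" "j < n"
    using inv[OF order_refl] that by (simp add: it_def)
  have "ok body (it t)" if "t < n ^ 48" for t
    using step[of t "it t"] i9[of t] inv[of t] that by simp
  moreover have "bit_length (int (n ^ 48)) \<le> Suc \<gamma>" using small_power_less[of 48] by (simp add: bit_length_le_iff)
  ultimately show "ok (Loop 3 48 body) \<sigma>" by (simp add: it_def)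
qed

lemma select_prog_correct:
  assumes Z: "\<And>i j. i < n \<Longrightarrow> j < n \<Longrightarrow> \<bar>M \<sigma> 10 i j\<bar> \<le> int n ^ 108"
  defines "key \<equiv> \<lambda>i. M \<sigma> 10 i i * int n - int i"
  shows "ok select_prog \<sigma>" "i < n \<Longrightarrow> rn select_prog \<sigma> 21 i = of_bool (card {j \<in> {..<n}. key i < key j} < k')"
proof -
  let ?e = "v_gt0 (VSub (VSub (VMul (v_Z VS VS) v_n) VS) (VSub (VMul (v_Z VI VI) v_n) VI))"
  define s1 where "s1 = rn (Tab 20 1 1 ?e) \<sigma>"
  have e: "ev \<sigma> i l ?e = of_bool (key i < key l)" if "i < n" "l < n" for i l
    using that by (simp add: v_Z_def key_def)
  have s1v: "s1 20 i = int (card {j \<in> {..<n}. key i < key j})" if "i < n" for i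
  proof -
    have "s1 20 i = (\<Sum>l<n. of_bool (key i < key l))" using that e by (simp add: s1_def)
    also have "\<dots> = int (card {j \<in> {..<n}. key i < key j})" by (simp add: of_bool_def flip: sum.inter_filter)
    finally show ?thesis .
  qed
  have VA1: "ev s1 i l (VA 20 VI) = s1 20 i" if "i < n" for i l using that base_gt by simp
  show "rn select_prog \<sigma> 21 i = of_bool (card {j \<in> {..<n}. key i < key j} < k')" if "i < n"
    using that s1v[OF that] VA1[OF that] unfolding select_prog_def run.simps(2) s1_def[symmetric]
    by (simp del: vev.simps(5))
  have one: "(1::int) \<le> int n ^ 120" using npow_le[of 0 120] by simp
  have "ok (Tab 20 1 1 ?e) \<sigma>" by (rule tab_ok_small) (use one in \<open>auto simp: of_bool_def\<close>)
  moreover have "ok (Tab 21 1 0 (v_gt0 (VSub v_k (VA 20 VI)))) s1"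
    by (rule tab_ok_small) (use one in \<open>auto simp: of_bool_def\<close>)
  ultimately show "ok select_prog \<sigma>" by (simp only: select_prog_def bounded_run.simps(2) s1_def[symmetric] simp_thms)
qed

end

text \<open>Denominators are cleared by multiplying all of them. The product stays below
  \<open>2 ^ sz\<close> because bit lengths add up over the input, and the common factor cancels
  when the weights are divided by their total.\<close>

locale machine_input = machine +
  fixes sz :: nat
  assumes den_pos: "\<And>x. x < n * n \<Longrightarrow> 0 < inp (3 + 2 * x)" and num_nonneg: "\<And>x. x < n * n \<Longrightarrow> 0 \<le> inp (2 + 2 * x)"
    and den_prod: "\<And>t. t \<le> n * n \<Longrightarrow> (\<Prod>x<t. inp (3 + 2 * x)) \<le> 2 ^ sz"
    and num_le: "\<And>x. x < n * n \<Longrightarrow> inp (2 + 2 * x) \<le> 2 ^ sz" and \<gamma>_sz: "4 * sz + n ^ 127 \<le> \<gamma>"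
begin

definition "den x = inp (3 + 2 * x)"
definition "num x = inp (2 + 2 * x)"
definition "den_all = (\<Prod>x<n * n. den x)"
definition "scaled x = num x * (den_all div den x)"
definition "weight i j = int n ^ 16 * scaled (i * n + j) div (\<Sum>x<n * n. scaled x)"

lemma size_less: "c \<le> 200 \<Longrightarrow> int n ^ c * 2 ^ (4 * sz) < 2 ^ \<gamma>"
proof -
  assume c: "c \<le> 200"
  have "c * n \<le> 200 * n" using c by (rule mult_le_mono1)
  also have "\<dots> < 2 ^ 8 * n" using n by simp
  also have "\<dots> \<le> n ^ 8 * n" using n by (intro mult_le_mono1 power_mono) auto
  also have "\<dots> = n ^ 9" using power_add[of n 8 1] by simp
  also have "\<dots> \<le> n ^ 127" using n by (intro power_increasing) auto
  finally have "c * n + 4 * sz < \<gamma>" using \<gamma>_sz by linarith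
  then have "(2::int) ^ (c * n + 4 * sz) < 2 ^ \<gamma>" by simp
  moreover have "int n ^ c * 2 ^ (4 * sz) \<le> 2 ^ (c * n) * 2 ^ (4 * sz)" by (intro mult_right_mono two_power_bound) simp
  ultimately show ?thesis unfolding power_add by linarith
qed

lemma run_scalar: "rn (Tab A 0 0 e) \<sigma> = \<sigma>(A := (\<sigma> A)(0 := ev \<sigma> 0 0 e))"
  by (simp add: fun_eq_iff)

lemma scalar_ok: "\<bar>ev \<sigma> 0 0 e\<bar> \<le> 2 ^ sz \<Longrightarrow> ok (Tab A 0 0 e) \<sigma>"
proof (rule tab_ok[where G = "2 ^ sz"])
  have "(2::int) ^ sz \<le> 2 ^ (4 * sz)" by (intro power_increasing) auto
  then show "int n ^ 0 * 2 ^ sz < 2 ^ \<gamma>" using size_less[of 0] by simp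
qed auto

lemma address_den: "x < n * n \<Longrightarrow> nat ((3 + 2 * int x) mod int (base n)) = 3 + 2 * x"
proof -
  assume "x < n * n"
  then have "3 + 2 * x < base n" by (simp add: base_def)
  then have "int (3 + 2 * x) mod int (base n) = int (3 + 2 * x)" by simp
  then show ?thesis by simp
qed

lemma address_num: "x < n * n \<Longrightarrow> nat ((2 + 2 * int x) mod int (base n)) = 2 + 2 * x"
proof -
  assume "x < n * n"
  then have "2 + 2 * x < base n" by (simp add: base_def)
  then have "int (2 + 2 * x) mod int (base n) = int (2 + 2 * x)" by simp
  then show ?thesis by simp
qed

lemma den_prod_bounds: "t \<le> n * n \<Longrightarrow> \<bar>\<Prod>x<t. den x\<bar> \<le> 2 ^ sz"
proof -
  assume t: "t \<le> n * n"
  have "0 \<le> (\<Prod>x<t. den x)" using den_pos t by (intro prod_nonneg) (auto simp: den_def intro: less_imp_le)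
  then show ?thesis using den_prod[OF t] by (simp add: den_def)
qed

lemma scaled_bounds: "x < n * n \<Longrightarrow> 0 \<le> scaled x" "x < n * n \<Longrightarrow> scaled x \<le> 2 ^ (2 * sz)"
proof -
  assume x: "x < n * n"
  have d: "0 < den x" "0 \<le> num x" "num x \<le> 2 ^ sz" using den_pos num_nonneg num_le x by (auto simp: den_def num_def)
  have D: "0 \<le> den_all" unfolding den_all_def using den_pos by (intro prod_nonneg) (auto simp: den_def intro: less_imp_le)
  have q: "0 \<le> den_all div den x" using D d by (simp add: pos_imp_zdiv_nonneg_iff)
  then show "0 \<le> scaled x" using d by (simp add: scaled_def)
  have "den_all div den x \<le> 2 ^ sz"
    using abs_div_le[of den_all "den x"] den_prod_bounds[of "n * n"] by (simp add: den_all_def)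
  then have "scaled x \<le> 2 ^ sz * 2 ^ sz" unfolding scaled_def using d q by (intro mult_mono) auto
  then show "scaled x \<le> 2 ^ (2 * sz)" by (simp add: mult_2 power_add)
qed

lemma prep_correct:
  shows "ok prep \<sigma>" "i < n \<Longrightarrow> j < n \<Longrightarrow> M (rn prep \<sigma>) 9 i j = weight i j"
proof -
  let ?in = "PSeq (Tab 6 0 0 (VMul (VA 5 (VC 0)) (VIn (VAdd (VC 3) (VMul (VC 2) (VA 2 (VC 0))))))) (Tab 5 0 0 (VA 6 (VC 0)))"
  let ?e7 = "VMul (VIn (VAdd (VC 2) (VMul (VC 2) VI))) (VDiv (VA 5 (VC 0)) (VIn (VAdd (VC 3) (VMul (VC 2) VI))))"
  let ?e9 = "VDiv (VMul (v_npow 16) (VA 7 VI)) (VA 8 (VC 0))"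
  define s1 where "s1 = rn (Tab 5 0 0 (VC 1)) \<sigma>"
  define it where "it t = iterate 2 (rn ?in) s1 t" for t
  define s2 where "s2 = it (n * n)"
  define s3 where "s3 = rn (Tab 7 2 0 ?e7) s2"
  define s4 where "s4 = rn (Tab 8 0 2 (VA 7 VS)) s3"
  have b1: "(2::int) ^ sz \<le> 2 ^ (4 * sz)" "(2::int) ^ (2 * sz) \<le> 2 ^ (4 * sz)" "(1::int) \<le> 2 ^ (4 * sz)"
    by (auto intro: power_increasing)
  have lt: "int n ^ c * 2 ^ (2 * sz) < 2 ^ \<gamma>" if "c \<le> 200" for c
    using order.strict_trans1[OF mult_left_mono[OF b1(2), of "int n ^ c"] size_less[OF that]] by simp
  have step: "rn ?in \<tau> 5 0 = \<tau> 5 0 * den t \<and> (\<bar>\<tau> 5 0 * den t\<bar> \<le> 2 ^ sz \<longrightarrow> ok ?in \<tau>)"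
    if "\<tau> 2 0 = int t" "t < n * n" for \<tau> t
  proof -
    have e: "ev \<tau> x l (VMul (VA 5 (VC 0)) (VIn (VAdd (VC 3) (VMul (VC 2) (VA 2 (VC 0)))))) = \<tau> 5 0 * den t" for x l
      using that address_den[OF that(2)] by (simp add: den_def)
    let ?t6 = "Tab 6 0 0 (VMul (VA 5 (VC 0)) (VIn (VAdd (VC 3) (VMul (VC 2) (VA 2 (VC 0))))))"
    have t6: "rn ?t6 \<tau> = \<tau>(6 := (\<tau> 6)(0 := \<tau> 5 0 * den t))" unfolding run_scalar e ..
    have t5: "rn (Tab 5 0 0 (VA 6 (VC 0))) \<tau>' = \<tau>'(5 := (\<tau>' 5)(0 := \<tau>' 6 0))" for \<tau>'
      unfolding run_scalar ev_VA0 ..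
    have "ok ?in \<tau>" if b: "\<bar>\<tau> 5 0 * den t\<bar> \<le> 2 ^ sz"
      unfolding bounded_run.simps(2) t6
    proof
      show "ok ?t6 \<tau>" by (rule scalar_ok) (use b e in \<open>simp del: vev.simps\<close>)
      show "ok (Tab 5 0 0 (VA 6 (VC 0))) (\<tau>(6 := (\<tau> 6)(0 := \<tau> 5 0 * den t)))"
        by (rule scalar_ok) (use b in \<open>simp only: ev_VA0 fun_upd_same\<close>)
    qed
    moreover have "rn ?in \<tau> 5 0 = \<tau> 5 0 * den t" unfolding run.simps(2) t6 t5 by simp
    ultimately show ?thesis by blast
  qed
  have it2: "it t 2 0 = int t" for t unfolding it_def by (rule iterate_counter)
  have it5: "t \<le> n * n \<Longrightarrow> it t 5 0 = (\<Prod>x<t. den x)" for t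
  proof (induction t)
    case 0
    show ?case by (simp add: it_def s1_def)
  next
    case (Suc t)
    have "it (Suc t) 5 0 = rn ?in (it t) 5 0" by (simp add: it_def Let_def del: run.simps)
    then show ?case using step[of "it t" t, OF it2[of t]] Suc by simp
  qed
  have s2v: "s2 5 0 = den_all" unfolding s2_def den_all_def by (rule it5) simp
  have e7: "ev s2 x l ?e7 = scaled x" if "x < n * n" for x l
    using that address_den[OF that] address_num[OF that] s2v by (simp add: scaled_def num_def den_def)
  have s3v: "s3 7 x = scaled x" if "x < n * n" for x
    using that e7 unfolding s3_def by (simp add: power2_eq_square del: vev.simps)
  have s4v: "s4 8 0 = (\<Sum>x<n * n. scaled x)" "s4 7 = s3 7"
    using s3v by (simp_all add: s4_def power2_eq_square del: vev.simps)
  have e9: "ev s4 (i * n + j) l ?e9 = weight i j" if "i < n" "j < n" for i j l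
    using ij_less[OF that] s4v s3v by (simp add: weight_def del: vev.simps(5))
  have r: "rn prep \<sigma> = rn (Tab 9 2 0 ?e9) s4"
    unfolding prep_def run.simps(2,3) s1_def[symmetric] power2_eq_square it_def[symmetric] s2_def[symmetric]
      s3_def[symmetric] s4_def[symmetric] ..
  show "M (rn prep \<sigma>) 9 i j = weight i j" if "i < n" "j < n"
    unfolding r using ij_less[OF that] e9[OF that] by (simp add: power2_eq_square del: vev.simps)
  have "ok (Tab 5 0 0 (VC 1)) \<sigma>"
    by (rule tab_ok_small) (use npow_le[of 0 120] in auto)
  moreover have "ok (Loop 2 2 ?in) s1"
  proof -
    have "ok ?in (it t)" if "t < n * n" for t
    proof -
      have "it t 5 0 * den t = (\<Prod>x<Suc t. den x)" using it5[of t] that by simp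
      then have "\<bar>it t 5 0 * den t\<bar> \<le> 2 ^ sz" using den_prod_bounds[of "Suc t"] that by (simp only: Suc_leI)
      then show ?thesis using step[of "it t" t, OF it2[of t] that] by blast
    qed
    moreover have "bit_length (int (n ^ 2)) \<le> Suc \<gamma>" using small_power_less[of 2] by (simp add: bit_length_le_iff)
    ultimately show ?thesis unfolding bounded_run.simps(3) power2_eq_square it_def by blast
  qed
  moreover have "ok (Tab 7 2 0 ?e7) s2"
  proof (rule tab_ok[where G = "2 ^ (2 * sz)"])
    fix x l assume "x < n ^ 2"
    then have "x < n * n" by (simp add: power2_eq_square)
    then show "\<bar>ev s2 x l ?e7\<bar> \<le> 2 ^ (2 * sz)" using e7 scaled_bounds by (simp del: vev.simps)
  qed (use lt[of 0] in auto)
  moreover have "ok (Tab 8 0 2 (VA 7 VS)) s3"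
  proof (rule tab_ok[where G = "2 ^ (2 * sz)"])
    fix x l assume "l < n ^ 2"
    then have "l < n * n" by (simp add: power2_eq_square)
    then show "\<bar>ev s3 x l (VA 7 VS)\<bar> \<le> 2 ^ (2 * sz)" using s3v scaled_bounds by (simp del: vev.simps)
  qed (use lt[of 2] in auto)
  moreover have "ok (Tab 9 2 0 ?e9) s4"
  proof (rule tab_ok[where G = "int n ^ 16 * 2 ^ (2 * sz)"])
    fix x l assume "x < n ^ 2"
    then obtain i j where ij: "i < n" "j < n" "x = i * n + j" using index_split by blast
    have "\<bar>weight i j\<bar> \<le> \<bar>int n ^ 16 * scaled (i * n + j)\<bar>" unfolding weight_def by (rule abs_div_le)
    also have "\<dots> \<le> int n ^ 16 * 2 ^ (2 * sz)"
      using scaled_bounds[OF ij_less[OF ij(1,2)]] by (simp add: abs_mult mult_left_mono)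
    finally show "\<bar>ev s4 x l ?e9\<bar> \<le> int n ^ 16 * 2 ^ (2 * sz)" using e9[OF ij(1,2)] ij(3) by (simp del: vev.simps)
  qed (use lt[of 16] in auto)
  moreover have "rn (Loop 2 2 ?in) s1 = s2" unfolding run.simps(3) power2_eq_square s2_def it_def ..
  ultimately show "ok prep \<sigma>"
    by (simp only: prep_def bounded_run.simps(2) run.simps(2) s1_def[symmetric] s3_def[symmetric] s4_def[symmetric] simp_thms)
qed

lemma weight_input:
  assumes sym: "\<And>i j. i < n \<Longrightarrow> j < n \<Longrightarrow> scaled (i * n + j) = scaled (j * n + i)"
  shows "solver_input n k' weight"
proof
  show "2 \<le> n" "0 < k'" "k' \<le> n" using n k'_bounds by auto
  show "sym_on {..<n} weight" using sym by (auto simp: sym_on_def weight_def)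
  have T0: "0 \<le> (\<Sum>x<n * n. scaled x)" using scaled_bounds by (intro sum_nonneg) auto
  show nn: "0 \<le> weight i j" if "i < n" "j < n" for i j
  proof -
    have "0 \<le> int n ^ 16 * scaled (i * n + j)" using scaled_bounds(1)[OF ij_less[OF that]] by simp
    then show ?thesis unfolding weight_def using T0
      by (cases "(\<Sum>x<n * n. scaled x) = 0") (auto simp: pos_imp_zdiv_nonneg_iff)
  qed
  have flat: "(\<Sum>i<n. \<Sum>j<n. f (i * n + j)) = (\<Sum>x<n * n. f x)" for f :: "nat \<Rightarrow> int"
  proof -
    have "(\<Sum>j<n. f (i * n + j)) = sum f {i * n..<i * n + n}" for i
      using sum.shift_bounds_nat_ivl[of f 0 "i * n" n] by (simp add: lessThan_atLeast0 add.commute)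
    then show ?thesis using sum.nat_group[of f n n] by simp
  qed
  let ?T = "\<Sum>x<n * n. scaled x"
  show "(\<Sum>i<n. \<Sum>j<n. weight i j) \<le> int n ^ 16"
  proof (cases "?T = 0")
    case True
    then show ?thesis by (simp add: weight_def)
  next
    case False
    then have T: "0 < ?T" using T0 by simp
    have "(\<Sum>i<n. \<Sum>j<n. weight i j) * ?T = (\<Sum>i<n. \<Sum>j<n. weight i j * ?T)" by (simp add: sum_distrib_right)
    also have "\<dots> \<le> (\<Sum>i<n. \<Sum>j<n. int n ^ 16 * scaled (i * n + j))"
      using T by (intro sum_mono) (simp add: weight_def flip: minus_mod_eq_div_mult)
    also have "\<dots> = int n ^ 16 * ?T" using flat[of scaled] by (simp flip: sum_distrib_left)
    finally show ?thesis using T by simp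
  qed
qed

lemma solver_prog_correct:
  assumes sym: "\<And>i j. i < n \<Longrightarrow> j < n \<Longrightarrow> scaled (i * n + j) = scaled (j * n + i)"
    and Z0: "\<And>x. \<sigma> 10 x = 0"
  defines "key \<equiv> \<lambda>i. sol n k' weight (n ^ 48) i i * int n - int i"
  shows "ok solver_prog \<sigma>" "i < n \<Longrightarrow> rn solver_prog \<sigma> 21 i = of_bool (card {j \<in> {..<n}. key i < key j} < k')"
proof -
  define s1 where "s1 = rn prep \<sigma>"
  define s2 where "s2 = rn (Loop 3 48 body) s1"
  have s1v: "M s1 9 i j = weight i j" if "i < n" "j < n" for i j unfolding s1_def by (rule prep_correct(2)[OF that])
  have "s1 10 = \<sigma> 10" unfolding s1_def by (rule run_unchanged) (simp add: prep_def)
  then have Z1: "M s1 10 i j = 0" for i j using Z0 by simp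
  interpret w: solver_input n k' weight by (rule weight_input[OF sym])
  have si: "solver_input n k' (M s1 9)"
    using w.solver_input_axioms s1v by (simp add: solver_input_def sym_on_def)
  have sc: "t \<le> n ^ 48 \<Longrightarrow> i < n \<Longrightarrow> j < n \<Longrightarrow> sol n k' (M s1 9) t i j = sol n k' weight t i j" for t i j
  proof (induction t arbitrary: i j)
    case (Suc t)
    have "response n (int n ^ 60) (shifted n k' (M s1 9) (sol n k' (M s1 9) t)) (n ^ 117) i j =
       response n (int n ^ 60) (shifted n k' weight (sol n k' weight t)) (n ^ 117) i j"
      by (rule response_cong[OF shifted_cong]) (use Suc s1v in auto)
    then show ?case using Suc by simp
  qed simp
  note it = iteration_correct[OF si Z1]
  have s2v: "M s2 10 i j = sol n k' weight (n ^ 48) i j" if "i < n" "j < n" for i j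
    using it(2)[OF that] sc[OF order_refl that] by (simp add: s2_def)
  have b: "\<bar>M s2 10 i j\<bar> \<le> int n ^ 108" if "i < n" "j < n" for i j
    unfolding s2v[OF that] by (rule w.sol_abs[OF order_refl that])
  note sel = select_prog_correct[of s2, OF b]
  have r: "rn solver_prog \<sigma> = rn select_prog s2"
    unfolding solver_prog_def body_def[symmetric] run.simps(2) s1_def[symmetric] s2_def[symmetric] ..
  show "ok solver_prog \<sigma>"
    unfolding solver_prog_def body_def[symmetric] bounded_run.simps(2)
    using prep_correct(1) it(1) sel(1) by (simp only: s1_def[symmetric] s2_def[symmetric] simp_thms)
  show "rn solver_prog \<sigma> 21 i = of_bool (card {j \<in> {..<n}. key i < key j} < k')" if i: "i < n"
  proof -
    have "{j \<in> {..<n}. M s2 10 i i * int n - int i < M s2 10 j j * int n - int j} = {j \<in> {..<n}. key i < key j}"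
      using s2v i by (auto simp: key_def)
    then show ?thesis using sel(2)[OF _ _ i] r by simp
  qed
qed

end


text \<open>Cells 0 and 1 hold the parameters, from which all addresses are computed, and are overwritten last.\<close>

definition "copy_cell a = Store a (Cell (aexp_addr 21 a))"

definition "copy_loop = Seq (Store (reg_addr 0) (Const 2))
  (While (Minus aexp_n (reg 0)) (Seq (copy_cell (reg 0)) (Store (reg_addr 0) (Plus (reg 0) (Const 1)))))"

definition "copy_out = Seq copy_loop (Seq (copy_cell (Const 1)) (copy_cell (Const 0)))"

definition "copy_weight = 100 + 100 * aexp_weight (aexp_addr 21 (reg 0)) + 100 * aexp_weight (reg_addr 0) +
  100 * aexp_weight aexp_n + 100 * aexp_weight (aexp_addr 21 (Const 1)) + 100 * aexp_weight (aexp_addr 21 (Const 0))"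

lemma bit_length_01: "bit_length 0 = 1" "bit_length 1 = 2" "bit_length 2 = 3"
proof -
  show "bit_length 0 = 1" "bit_length 1 = 2" by (simp_all add: bit_length_def floorlog_def)
  have "bit_length 2 \<le> Suc 2" by (simp only: bit_length_le_iff) simp
  moreover have "\<not> bit_length 2 \<le> Suc 1" by (simp only: bit_length_le_iff) simp
  ultimately show "bit_length 2 = 3" by simp
qed

text \<open>Copying overwrites the input area, so the current store itself takes the place of the
  input in \<open>represents\<close>: the condition on the input becomes trivial, and the arrays and
  the bit bound remain.\<close>

lemma exec_copy_cell:
  assumes r: "represents n s \<beta> \<sigma> s" and s0: "s 0 = int n" and \<beta>: "1 \<le> \<beta>" and a: "aval a s = int x" "x < n"
  shows "\<exists>t. exec (copy_cell a) s t (s(x := \<sigma> 21 x)) \<and> t \<le> (3 + 2 * aexp_weight a + 4 * aexp_weight (aexp_addr 21 a)) * \<beta>"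
    "represents n (s(x := \<sigma> 21 x)) \<beta> \<sigma> (s(x := \<sigma> 21 x))"
proof -
  have "s (base n + (21 + 32 * x)) = \<sigma> 21 x" using r by (simp add: represents_def)
  then have v: "aval (Cell (aexp_addr 21 a)) s = \<sigma> 21 x" using aval_addr[OF s0 r a(1)] by simp
  have x: "nat (aval a s) = x" using a by simp
  from exec_store_bounded[OF represents_bit_length[OF r] \<beta> v x]
  show "\<exists>t. exec (copy_cell a) s t (s(x := \<sigma> 21 x)) \<and> t \<le> (3 + 2 * aexp_weight a + 4 * aexp_weight (aexp_addr 21 a)) * \<beta>"
    unfolding copy_cell_def by (simp add: algebra_simps)
  have "bit_length (\<sigma> 21 x) \<le> \<beta>" using r \<open>s (base n + (21 + 32 * x)) = \<sigma> 21 x\<close> unfolding represents_def by metis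
  moreover have "n \<le> base n" by (simp add: base_def) (metis le_square mult_2 trans_le_add1 le_SucI)
  ultimately show "represents n (s(x := \<sigma> 21 x)) \<beta> \<sigma> (s(x := \<sigma> 21 x))"
    using r a(2) unfolding represents_def by auto
qed

lemma exec_copy_out:
  assumes r: "represents n s \<beta> \<sigma> s" and s0: "s 0 = int n" and \<beta>: "3 \<le> \<beta>" "bit_length (int n) \<le> \<beta>" and n: "2 \<le> n"
  shows "\<exists>t s'. exec copy_out s t s' \<and> (\<forall>x<n. s' x = \<sigma> 21 x) \<and> t \<le> copy_weight * (n + 1) * \<beta>"
proof -
  have \<beta>1: "1 \<le> \<beta>" using \<beta> by simp
  have nb: "n < base n"
  proof -
    have "n * 1 \<le> n * n" using n by (intro mult_le_mono2) simp
    then show ?thesis unfolding base_def by linarith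
  qed
  let ?R = "\<lambda>s. represents n s \<beta> \<sigma> s \<and> s 0 = int n"
  have reg: "?R (s(base n := v))" if "?R s" "bit_length v \<le> \<beta>" for s v
  proof -
    have "base n + (A + 32 * x) \<noteq> base n" if "A \<in> {2..<32}" for A x using that by auto
    then show ?thesis using that nb unfolding represents_def by auto
  qed
  let ?w0 = "aexp_weight (reg_addr 0)" let ?wa = "aexp_weight (aexp_addr 21 (reg 0))" let ?wn = "aexp_weight aexp_n"
  let ?c = "Seq (copy_cell (reg 0)) (Store (reg_addr 0) (Plus (reg 0) (Const 1)))"
  let ?b = "Minus aexp_n (reg 0)"
  define I where "I m s \<longleftrightarrow> ?R s \<and> s (base n) = int (2 + m) \<and> (\<forall>x. 2 \<le> x \<and> x < 2 + m \<longrightarrow> s x = \<sigma> 21 x)" for m s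
  have "aval (Const 2) s = 2" by simp
  from exec_store_bounded[OF represents_bit_length[OF r] \<beta>1 this aval_reg_addr[OF s0 r, of 0]]
  obtain t0 where t0: "exec (Store (reg_addr 0) (Const 2)) s t0 (s(base n := 2))" "t0 \<le> (1 + 2 * ?w0 + 2 * 3) * \<beta>"
    by (auto simp: bit_length_01)
  have "\<exists>t s'. exec (While ?b ?c) (s(base n := 2)) t s' \<and> I (n - 2) s' \<and>
     t \<le> (n - 2 + 1) * (1 + aexp_weight ?b * \<beta> + (20 + 20 * ?w0 + 4 * ?wa) * \<beta>)"
  proof (rule exec_while_count)
    show "I 0 (s(base n := 2))" unfolding I_def using reg[of s 2] r s0 \<beta> by (simp add: bit_length_01)
  next
    fix m s assume m: "m < n - 2" and I: "I m s"
    have R: "represents n s \<beta> \<sigma> s" "s 0 = int n" "s (base n) = int (2 + m)" using I by (auto simp: I_def)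
    have a: "aval (reg 0) s = int (2 + m)" "2 + m < n" using aval_reg[OF R(2,1), of 0] R(3) m by auto
    let ?s1 = "s(2 + m := \<sigma> 21 (2 + m))"
    obtain t1 where t1: "exec (copy_cell (reg 0)) s t1 ?s1" "t1 \<le> (3 + 2 * aexp_weight (reg 0) + 4 * ?wa) * \<beta>"
      using exec_copy_cell(1)[OF R(1,2) \<beta>1 a] by blast
    have R1: "represents n ?s1 \<beta> \<sigma> ?s1" by (rule exec_copy_cell(2)[OF R(1,2) \<beta>1 a])
    have R1': "?s1 0 = int n" "?s1 (base n) = int (2 + m)" using R a nb by auto
    have v: "aval (Plus (reg 0) (Const 1)) ?s1 = int (2 + Suc m)" using aval_reg[OF R1'(1) R1, of 0] R1'(2) by simp
    let ?s2 = "?s1(base n := int (2 + Suc m))"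
    from exec_store_bounded[OF represents_bit_length[OF R1] \<beta>1 v aval_reg_addr[OF R1'(1) R1, of 0]]
    obtain t2 where t2: "exec (Store (reg_addr 0) (Plus (reg 0) (Const 1))) ?s1 t2 ?s2"
      "t2 \<le> (1 + 2 * ?w0 + 2 * aexp_weight (Plus (reg 0) (Const 1))) * \<beta>" by auto
    have "exec ?c s (1 + t1 + t2) ?s2" using t1(1) t2(1) by (rule exec.Seq)
    moreover have "1 + t1 + t2 \<le> (20 + 20 * ?w0 + 4 * ?wa) * \<beta>"
      using t1(2) t2(2) \<beta>1 by (simp add: reg_def bit_length_01 algebra_simps)
    moreover have "I (Suc m) ?s2"
    proof -
      have "bit_length (int (2 + Suc m)) \<le> \<beta>"
        by (rule order.trans[OF bit_length_mono \<beta>(2)]) (use m in auto)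
      then have "?R ?s2" using reg[of ?s1] R1 R1'(1) by blast
      moreover have "?s2 x = \<sigma> 21 x" if "2 \<le> x" "x < 2 + Suc m" for x
      proof -
        have "x \<noteq> base n" using that m nb by linarith
        then show ?thesis using that I by (cases "x = 2 + m") (auto simp: I_def)
      qed
      ultimately show ?thesis by (simp add: I_def)
    qed
    ultimately show "\<exists>t s'. exec ?c s t s' \<and> t \<le> (20 + 20 * ?w0 + 4 * ?wa) * \<beta> \<and> I (Suc m) s'" by blast
  next
    fix m s assume m: "m \<le> n - 2" and I: "I m s"
    have R: "represents n s \<beta> \<sigma> s" "s 0 = int n" "s (base n) = int (2 + m)" using I by (auto simp: I_def)
    show "(0 < aval ?b s) = (m < n - 2) \<and> acost ?b s \<le> aexp_weight ?b * \<beta>"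
      using aexp_weight_bounds[OF represents_bit_length[OF R(1)] \<beta>1, of ?b] aval_n[OF R(2,1)] aval_reg[OF R(2,1), of 0] R(3) m n
      by auto
  qed
  then obtain t1 s1 where t1: "exec (While ?b ?c) (s(base n := 2)) t1 s1" "I (n - 2) s1"
    "t1 \<le> (n - 2 + 1) * (1 + aexp_weight ?b * \<beta> + (20 + 20 * ?w0 + 4 * ?wa) * \<beta>)" by blast
  have e1: "exec copy_loop s (1 + t0 + t1) s1" unfolding copy_loop_def using t0(1) t1(1) by (rule exec.Seq)
  have R1: "represents n s1 \<beta> \<sigma> s1" "s1 0 = int n" and v1: "\<And>x. 2 \<le> x \<Longrightarrow> x < n \<Longrightarrow> s1 x = \<sigma> 21 x"
    using t1(2) n by (auto simp: I_def)
  have a1: "aval (Const 1) s1 = int 1" "1 < n" using n by auto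
  let ?s2 = "s1(1 := \<sigma> 21 1)"
  obtain t2 where t2: "exec (copy_cell (Const 1)) s1 t2 ?s2" "t2 \<le> (3 + 2 * 2 + 4 * aexp_weight (aexp_addr 21 (Const 1))) * \<beta>"
    using exec_copy_cell(1)[OF R1 \<beta>1 a1] by (auto simp: bit_length_01)
  have R2: "represents n ?s2 \<beta> \<sigma> ?s2" "?s2 0 = int n" using exec_copy_cell(2)[OF R1 \<beta>1 a1] R1(2) by auto
  have a2: "aval (Const 0) ?s2 = int 0" "0 < n" using n by auto
  let ?s3 = "?s2(0 := \<sigma> 21 0)"
  obtain t3 where t3: "exec (copy_cell (Const 0)) ?s2 t3 ?s3" "t3 \<le> (3 + 2 * 1 + 4 * aexp_weight (aexp_addr 21 (Const 0))) * \<beta>"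
    using exec_copy_cell(1)[OF R2 \<beta>1 a2] by (auto simp: bit_length_01)
  have ex: "exec copy_out s (1 + (1 + t0 + t1) + (1 + t2 + t3)) ?s3"
    unfolding copy_out_def by (intro exec.Seq[OF e1] exec.Seq[OF t2(1) t3(1)])
  have vals: "?s3 x = \<sigma> 21 x" if "x < n" for x
    using v1[of x] that by (cases "x = 0"; cases "x = 1") auto
  have "1 + (1 + t0 + t1) + (1 + t2 + t3) \<le> copy_weight * (n + 1) * \<beta>"
  proof -
    define u where "u = (24 + 24 * ?w0 + 4 * ?wa + 2 * ?wn) * \<beta>"
    have "1 + aexp_weight ?b * \<beta> + (20 + 20 * ?w0 + 4 * ?wa) * \<beta> \<le> u"
      using \<beta>1 by (simp add: u_def reg_def algebra_simps)
    then have "t1 \<le> (n - 2 + 1) * u" using t1(3) by (meson le_trans mult_le_mono2)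
    also have "\<dots> \<le> n * u" using n by (intro mult_le_mono1) simp
    finally have "t1 \<le> n * u" .
    moreover have "3 + t0 + t2 + t3 \<le> (30 + 2 * ?w0 + 4 * aexp_weight (aexp_addr 21 (Const 1)) + 4 * aexp_weight (aexp_addr 21 (Const 0))) * \<beta>"
      using t0(2) t2(2) t3(2) \<beta>1 by (simp add: algebra_simps)
    moreover have "u \<le> copy_weight * \<beta>"
      unfolding u_def copy_weight_def by (intro mult_le_mono1) simp
    moreover have "(30 + 2 * ?w0 + 4 * aexp_weight (aexp_addr 21 (Const 1)) + 4 * aexp_weight (aexp_addr 21 (Const 0))) * \<beta> \<le> copy_weight * \<beta>"
      unfolding copy_weight_def by (intro mult_le_mono1) simp
    moreover have "n * u \<le> n * (copy_weight * \<beta>)" using \<open>u \<le> copy_weight * \<beta>\<close> by (rule mult_le_mono2)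
    ultimately have "3 + t0 + t1 + t2 + t3 \<le> n * (copy_weight * \<beta>) + copy_weight * \<beta>" by linarith
    then show ?thesis by (simp add: algebra_simps)
  qed
  then show ?thesis using ex vals by blast
qed

section \<open>The algorithm on graph inputs\<close>

lemma nth_concat_pairs:
  assumes "x < length ps"
  shows "concat (map (\<lambda>p. [f p, g p]) ps) ! (2 * x) = f (ps ! x) \<and>
    concat (map (\<lambda>p. [f p, g p]) ps) ! (2 * x + 1) = g (ps ! x)"
  using assms
proof (induction ps arbitrary: x)
  case (Cons p ps)
  then show ?case by (cases x) auto
qed simp

lemma length_concat_pairs: "length (concat (map (\<lambda>p. [f p, g p]) ps)) = 2 * length ps"
  by (induction ps) auto

lemma length_dks_input: "length (dks_input n k q) = 2 + 2 * (n * n)"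
  unfolding dks_input_def by (simp add: case_prod_beta' length_concat_pairs)

lemma nth_dks_input:
  "dks_input n k q ! 0 = int n" "dks_input n k q ! 1 = int k"
  "i < n \<Longrightarrow> j < n \<Longrightarrow> dks_input n k q ! (2 + 2 * (i * n + j)) = fst (quotient_of (q {i, j}))"
  "i < n \<Longrightarrow> j < n \<Longrightarrow> dks_input n k q ! (3 + 2 * (i * n + j)) = snd (quotient_of (q {i, j}))"
proof -
  show "dks_input n k q ! 0 = int n" "dks_input n k q ! 1 = int k" by (simp_all add: dks_input_def)
  assume ij: "i < n" "j < n"
  let ?ps = "List.product [0..<n] [0..<n]"
  let ?l = "concat (map (\<lambda>p. [fst (quotient_of (q {fst p, snd p})), snd (quotient_of (q {fst p, snd p}))]) ?ps)"
  have e: "dks_input n k q = int n # int k # ?l" by (simp add: dks_input_def case_prod_beta')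
  have x: "i * n + j < n * n"
  proof -
    have "i * n + j < (i + 1) * n" using ij by simp
    also have "\<dots> \<le> n * n" using ij by (intro mult_le_mono1) simp
    finally show ?thesis .
  qed
  have "(i * n + j) div n = i" "(i * n + j) mod n = j" using ij by auto
  then have p: "?ps ! (i * n + j) = (i, j)" using product_nth[of "i * n + j" "[0..<n]" "[0..<n]"] x ij by simp
  have "i * n + j < length ?ps" using x by simp
  from nth_concat_pairs[OF this, of "\<lambda>p. fst (quotient_of (q {fst p, snd p}))" "\<lambda>p. snd (quotient_of (q {fst p, snd p}))"] p
  have l: "?l ! (2 * (i * n + j)) = fst (quotient_of (q {i, j}))" "?l ! (2 * (i * n + j) + 1) = snd (quotient_of (q {i, j}))"
    by auto
  have "2 + 2 * (i * n + j) = Suc (Suc (2 * (i * n + j)))" "3 + 2 * (i * n + j) = Suc (Suc (2 * (i * n + j) + 1))" by simp_all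
  then show "dks_input n k q ! (2 + 2 * (i * n + j)) = fst (quotient_of (q {i, j}))"
    "dks_input n k q ! (3 + 2 * (i * n + j)) = snd (quotient_of (q {i, j}))"
    unfolding e using l by (simp_all only: nth_Cons_Suc)
qed

lemma bit_length_le_input_size: "x \<in> set xs \<Longrightarrow> bit_length x \<le> input_size xs"
  unfolding input_size_def by (induction xs) auto

lemma length_le_input_size: "length xs \<le> input_size xs"
proof (induction xs)
  case (Cons x xs)
  then show ?case using bit_length_pos[of x] by (simp add: input_size_def)
qed (simp add: input_size_def)

lemma input_size_nth: "input_size xs = (\<Sum>a<length xs. bit_length (xs ! a))"
  unfolding input_size_def by (simp add: sum_list_sum_nth lessThan_atLeast0)

lemma prod_le_two_power:
  fixes t :: nat and f :: "nat \<Rightarrow> int"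
  assumes "\<forall>x<t. 0 < f x"
  shows "(\<Prod>x<t. f x) \<le> 2 ^ (\<Sum>x<t. bit_length (f x))"
  using assms
proof (induction t)
  case (Suc t)
  have "f t \<le> 2 ^ bit_length (f t)"
  proof -
    have "(2::int) ^ (bit_length (f t) - 1) \<le> 2 ^ bit_length (f t)" by (intro power_increasing) auto
    then show ?thesis using abs_less_two_power_bit_length[of "f t"] by linarith
  qed
  moreover have "(\<Prod>x<t. f x) \<le> 2 ^ (\<Sum>x<t. bit_length (f x))" using Suc by simp
  ultimately have "(\<Prod>x<t. f x) * f t \<le> 2 ^ (\<Sum>x<t. bit_length (f x)) * 2 ^ bit_length (f t)"
    using Suc.prems by (intro mult_mono) auto
  then show ?case by (simp add: power_add)
qed simp

text \<open>The estimates by powers of \<open>n\<close> require \<open>2 \<le> n\<close>. Smaller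
  graphs admit no \<open>k\<close> with \<open>0 < k < n\<close>, and on them the program only has
  to halt.\<close>

definition alg :: com where
  "alg = If (Minus aexp_n (Const 1)) (Seq (compile solver_prog) copy_out) Skip"

locale graph_input =
  fixes n k :: nat and q :: "nat set \<Rightarrow> rat"
  assumes kn: "k \<le> n" and graph: "weighted_graph n (real_weights q)"
begin

definition "inp = init_store (dks_input n k q)"
definition "sz = input_size (dks_input n k q)"
definition "gam = 4 * sz + n ^ 127"

lemma inp_nth: "a < 2 + 2 * (n * n) \<Longrightarrow> inp a = dks_input n k q ! a"
  by (simp add: inp_def init_store_def length_dks_input)

lemma inp_01: "inp 0 = int n" "inp 1 = int k"
  using inp_nth[of 0] inp_nth[of 1] nth_dks_input(1,2)[of n k q] by auto

lemma sz_ge: "2 + 2 * (n * n) \<le> sz" "n + 1 \<le> sz" "1 \<le> sz"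
proof -
  show 1: "2 + 2 * (n * n) \<le> sz" using length_le_input_size[of "dks_input n k q"] by (simp add: length_dks_input sz_def)
  have "n \<le> n * n" by simp
  then show "n + 1 \<le> sz" "1 \<le> sz" using 1 by linarith+
qed

lemma inp_bits: "bit_length (inp a) \<le> sz"
proof (cases "a < length (dks_input n k q)")
  case True
  then show ?thesis using bit_length_le_input_size[OF nth_mem[OF True]] by (simp add: inp_def init_store_def sz_def)
next
  case False
  then show ?thesis using sz_ge by (simp add: inp_def init_store_def bit_length_01)
qed

lemma index_cases: "x < n * n \<Longrightarrow> \<exists>i j. i < n \<and> j < n \<and> x = i * n + j"
  by (intro exI[of _ "x div n"] exI[of _ "x mod n"])
    (cases "n = 0"; simp add: less_mult_imp_div_less)

lemma index_less: "i < n \<Longrightarrow> j < n \<Longrightarrow> i * n + j < n * n"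
proof -
  assume ij: "i < n" "j < n"
  then have "i * n + j < (i + 1) * n" by simp
  also have "\<dots> \<le> n * n" using ij by (intro mult_le_mono1) simp
  finally show ?thesis .
qed

lemma inp_num_den:
  assumes "i < n" "j < n"
  shows "inp (2 + 2 * (i * n + j)) = fst (quotient_of (q {i, j}))" "inp (3 + 2 * (i * n + j)) = snd (quotient_of (q {i, j}))"
  using nth_dks_input(3,4)[OF assms] index_less[OF assms] inp_nth by auto

lemma q_nonneg: "i < n \<Longrightarrow> j < n \<Longrightarrow> 0 \<le> q {i, j}"
  using graph by (simp add: weighted_graph_def real_weights_def)

lemma num_nonneg: "i < n \<Longrightarrow> j < n \<Longrightarrow> 0 \<le> fst (quotient_of (q {i, j}))"
  using q_nonneg[of i j] quotient_of_div[of "q {i, j}"] quotient_of_denom_pos'[of "q {i, j}"]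
  by (cases "quotient_of (q {i, j})") (auto simp: zero_le_divide_iff)

lemma machine_input:
  assumes n: "2 \<le> n"
  shows "machine_input n k inp gam sz"
proof
  show "2 \<le> n" "k \<le> n" "inp 0 = int n" "inp 1 = int k" by (rule n kn inp_01)+
  show "n ^ 127 \<le> gam" "4 * sz + n ^ 127 \<le> gam" by (simp_all add: gam_def)
  show den: "0 < inp (3 + 2 * x)" if "x < n * n" for x
    using index_cases[OF that] inp_num_den quotient_of_denom_pos' by auto
  show "0 \<le> inp (2 + 2 * x)" if "x < n * n" for x
    using index_cases[OF that] inp_num_den num_nonneg by auto
  show "inp (2 + 2 * x) \<le> 2 ^ sz" for x
  proof -
    have "\<bar>inp (2 + 2 * x)\<bar> < 2 ^ sz" using inp_bits[of "2 + 2 * x"] bit_length_le_iff[of "inp (2 + 2 * x)" sz] by simp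
    then show ?thesis by simp
  qed
  show "(\<Prod>x<t. inp (3 + 2 * x)) \<le> 2 ^ sz" if "t \<le> n * n" for t
  proof -
    have "(\<Prod>x<t. inp (3 + 2 * x)) \<le> 2 ^ (\<Sum>x<t. bit_length (inp (3 + 2 * x)))"
      using den that by (intro prod_le_two_power) auto
    also have "\<dots> \<le> 2 ^ sz"
    proof (rule power_increasing)
      have "(\<Sum>x<t. bit_length (inp (3 + 2 * x))) = (\<Sum>a\<in>(\<lambda>x. 3 + 2 * x) ` {..<t}. bit_length (inp a))"
        by (subst sum.reindex) (auto simp: inj_on_def)
      also have "\<dots> \<le> (\<Sum>a<2 + 2 * (n * n). bit_length (inp a))"
        using that by (intro sum_mono2) auto
      also have "\<dots> = sz" unfolding sz_def input_size_nth length_dks_input by (intro sum.cong) (auto simp: inp_nth)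
      finally show "(\<Sum>x<t. bit_length (inp (3 + 2 * x))) \<le> sz" .
    qed simp
    finally show ?thesis .
  qed
qed

end

locale big_graph_input = graph_input +
  assumes n: "2 \<le> n"
begin

sublocale mi: machine_input n k inp gam sz by (rule machine_input[OF n])

definition "key i = sol n mi.k' mi.weight (n ^ 48) i i * int n - int i"

lemma scaled_sym: "i < n \<Longrightarrow> j < n \<Longrightarrow> mi.scaled (i * n + j) = mi.scaled (j * n + i)"
  unfolding mi.scaled_def mi.num_def mi.den_def
  using inp_num_den[of i j] inp_num_den[of j i] by (simp add: insert_commute)

lemma exec_alg:
  "\<exists>t s. exec alg inp t s \<and> (\<forall>i<n. s i = of_bool (card {j \<in> {..<n}. key i < key j} < mi.k')) \<and>
    t \<le> (10 + aexp_weight (Minus aexp_n (Const 1)) + prog_const solver_prog * (n + 1) ^ prog_degree solver_prog + copy_weight * (n + 1)) * Suc gam"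
proof -
  define \<sigma> :: arrays where "\<sigma> A x = inp (base n + (A + 32 * x))" for A x
  have b2: "base n = length (dks_input n k q)" by (simp add: base_def length_dks_input)
  \<comment> \<open>The arrays begin exactly where the input ends, and memory is zero there, so the
    iteration starts at \<open>Z = 0\<close> without initialisation.\<close>
  have s10: "\<sigma> 10 x = 0" for x by (simp add: \<sigma>_def inp_def init_store_def b2)
  have bits: "bit_length (inp a) \<le> Suc gam" for a using inp_bits[of a] by (simp add: gam_def)
  have rep: "represents n inp (Suc gam) \<sigma> inp" using bits by (simp add: represents_def \<sigma>_def)
  have g1: "1 \<le> Suc gam" "3 \<le> Suc gam" using sz_ge(3) by (simp_all add: gam_def)
  have okp: "bounded_run (Suc gam) n inp solver_prog \<sigma>" using mi.solver_prog_correct(1)[of \<sigma>] scaled_sym s10 by blast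
  obtain t1 s1 where 1: "exec (compile solver_prog) inp t1 s1" "represents n inp (Suc gam) (run n inp solver_prog \<sigma>) s1"
    "t1 \<le> prog_const solver_prog * (n + 1) ^ prog_degree solver_prog * Suc gam"
    using exec_compile[OF inp_01(1) g1(1) rep okp wf_solver_prog] by blast
  let ?\<tau> = "run n inp solver_prog \<sigma>"
  have r1: "represents n s1 (Suc gam) ?\<tau> s1" using 1(2) by (simp add: represents_def)
  have s10': "s1 0 = int n" using 1(2) inp_01 by (simp add: represents_def base_def)
  have "bit_length (int n) \<le> Suc gam" using bits[of 0] inp_01 by simp
  from exec_copy_out[OF r1 s10' g1(2) this n] obtain t2 s2 where 2: "exec copy_out s1 t2 s2" "\<forall>x<n. s2 x = ?\<tau> 21 x"
    "t2 \<le> copy_weight * (n + 1) * Suc gam" by blast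
  have pos: "aval (Minus aexp_n (Const 1)) inp > 0" using aval_n[OF inp_01(1) rep] n by simp
  have "exec alg inp (1 + acost (Minus aexp_n (Const 1)) inp + (1 + t1 + t2)) s2"
    unfolding alg_def by (rule exec.IfTrue[OF pos exec.Seq[OF 1(1) 2(1)]])
  moreover have "1 + acost (Minus aexp_n (Const 1)) inp + (1 + t1 + t2) \<le>
    (10 + aexp_weight (Minus aexp_n (Const 1)) + prog_const solver_prog * (n + 1) ^ prog_degree solver_prog + copy_weight * (n + 1)) * Suc gam"
  proof -
    define A where "A = prog_const solver_prog * (n + 1) ^ prog_degree solver_prog"
    define C where "C = copy_weight * (n + 1)"
    define W where "W = aexp_weight (Minus aexp_n (Const 1))"
    have "acost (Minus aexp_n (Const 1)) inp \<le> W * Suc gam"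
      unfolding W_def using aexp_weight_bounds[of inp "Suc gam" "Minus aexp_n (Const 1)"] bits g1(1) by blast
    moreover have "t1 \<le> A * Suc gam" "t2 \<le> C * Suc gam" using 1(3) 2(3) by (simp_all add: A_def C_def)
    moreover have "1 + c + (1 + t1 + t2) \<le> (10 + W + A + C) * G"
      if "c \<le> W * G" "t1 \<le> A * G" "t2 \<le> C * G" "1 \<le> G" for c G
      using that by (simp add: distrib_right)
    ultimately show ?thesis unfolding A_def[symmetric] C_def[symmetric] W_def[symmetric] using g1(1) by blast
  qed
  moreover have "s2 i = of_bool (card {j \<in> {..<n}. key i < key j} < mi.k')" if "i < n" for i
    using 2(2) that mi.solver_prog_correct(2)[of \<sigma> i] scaled_sym s10 by (simp add: key_def)
  ultimately show ?thesis by blast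
qed

end

lemma poly_time_alg: "dks_poly_time alg"
proof -
  define C where "C = 10 + aexp_weight (Minus aexp_n (Const 1)) + prog_const solver_prog + copy_weight"
  define D where "D = prog_degree solver_prog + 1"
  show ?thesis unfolding dks_poly_time_def
  proof (rule exI[of _ "monom (6 * C) (D + 127)"], intro allI impI)
    fix n k q assume "k \<le> n" "weighted_graph n (real_weights q)"
    then interpret g: graph_input n k q by unfold_locales
    let ?sz = "input_size (dks_input n k q)"
    have szg: "?sz = g.sz" by (simp add: g.sz_def)
    have s1: "1 \<le> g.sz" "n + 1 \<le> g.sz" using g.sz_ge by auto
    have poly: "poly (monom (6 * C) (D + 127)) ?sz = 6 * C * g.sz ^ (D + 127)" by (simp add: poly_monom szg)
    \<comment> \<open>The 6 is made up of 4 for \<open>4 * sz\<close>, 1 for \<open>n ^ 127\<close>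
      and 1 for the successor.\<close>
    have gam: "Suc g.gam \<le> 6 * g.sz ^ 127"
    proof -
      have "g.sz ^ 1 \<le> g.sz ^ 127" using s1 by (intro power_increasing) auto
      then have "g.sz \<le> g.sz ^ 127" by simp
      moreover have "n ^ 127 \<le> g.sz ^ 127" using s1 by (intro power_mono) auto
      ultimately show ?thesis using s1(1) unfolding g.gam_def by linarith
    qed
    have p1: "1 \<le> g.sz ^ D" using s1 by simp
    show "\<exists>t s. exec alg (init_store (dks_input n k q)) t s \<and> t \<le> poly (monom (6 * C) (D + 127)) ?sz"
    proof (cases "2 \<le> n")
      case True
      then interpret b: big_graph_input n k q by unfold_locales
      obtain t s where t: "exec alg g.inp t s"
        "t \<le> (10 + aexp_weight (Minus aexp_n (Const 1)) + prog_const solver_prog * (n + 1) ^ prog_degree solver_prog + copy_weight * (n + 1)) * Suc g.gam"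
        using b.exec_alg by blast
      have "(n + 1) ^ prog_degree solver_prog \<le> g.sz ^ D"
      proof -
        have "(n + 1) ^ prog_degree solver_prog \<le> g.sz ^ prog_degree solver_prog" using s1 by (intro power_mono) auto
        also have "\<dots> \<le> g.sz ^ D" using s1 by (intro power_increasing) (auto simp: D_def)
        finally show ?thesis .
      qed
      moreover have "n + 1 \<le> g.sz ^ D"
      proof -
        have "g.sz ^ 1 \<le> g.sz ^ D" using s1 by (intro power_increasing) (auto simp: D_def)
        then show ?thesis using s1 by simp
      qed
      ultimately have "10 + aexp_weight (Minus aexp_n (Const 1)) + prog_const solver_prog * (n + 1) ^ prog_degree solver_prog + copy_weight * (n + 1)
         \<le> 10 * g.sz ^ D + aexp_weight (Minus aexp_n (Const 1)) * g.sz ^ D + prog_const solver_prog * g.sz ^ D + copy_weight * g.sz ^ D"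
        using p1 by (intro add_mono mult_le_mono2) auto
      also have "\<dots> = C * g.sz ^ D" by (simp only: C_def distrib_right)
      finally have "t \<le> (C * g.sz ^ D) * (6 * g.sz ^ 127)" using t(2) gam by (meson le_trans mult_le_mono)
      also have "\<dots> = 6 * C * g.sz ^ (D + 127)" by (simp add: power_add)
      finally show ?thesis using t(1) unfolding poly g.inp_def by blast
    next
      case False
      have n0: "aval aexp_n g.inp = int n" using g.inp_01 by (simp add: aexp_n_def)
      then have "\<not> 0 < aval (Minus aexp_n (Const 1)) g.inp" using False by simp
      then have e: "exec alg g.inp (1 + acost (Minus aexp_n (Const 1)) g.inp + 1) g.inp"
        unfolding alg_def by (rule exec.IfFalse) (rule exec.Skip)
      have "\<forall>a. bit_length (g.inp a) \<le> Suc g.gam" by (auto simp: g.gam_def intro: le_trans[OF g.inp_bits])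
      then have "acost (Minus aexp_n (Const 1)) g.inp \<le> aexp_weight (Minus aexp_n (Const 1)) * Suc g.gam"
        by (intro conjunct2[OF aexp_weight_bounds]) simp_all
      then have "1 + acost (Minus aexp_n (Const 1)) g.inp + 1 \<le> 10 * Suc g.gam + aexp_weight (Minus aexp_n (Const 1)) * Suc g.gam" by simp
      also have "\<dots> = (10 + aexp_weight (Minus aexp_n (Const 1))) * Suc g.gam" by (simp only: distrib_right)
      also have "\<dots> \<le> (C * g.sz ^ D) * (6 * g.sz ^ 127)"
      proof (intro mult_le_mono gam)
        have "10 + aexp_weight (Minus aexp_n (Const 1)) \<le> C * 1" by (simp add: C_def)
        also have "\<dots> \<le> C * g.sz ^ D" using p1 by (rule mult_le_mono2)
        finally show "10 + aexp_weight (Minus aexp_n (Const 1)) \<le> C * g.sz ^ D" .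
      qed
      also have "\<dots> = 6 * C * g.sz ^ (D + 127)" by (simp add: power_add)
      finally show ?thesis using e unfolding poly g.inp_def by blast
    qed
  qed
qed


text \<open>Distinct keys have distinct ranks, and ranks are below \<open>n\<close>; so the rank
  permutes the vertices and exactly \<open>k\<close> of them have rank below
  \<open>k\<close>.\<close>

lemma top_ranked:
  fixes key :: "nat \<Rightarrow> int"
  assumes inj: "inj_on key {..<n}" and k: "k \<le> n"
  defines "Q \<equiv> {i \<in> {..<n}. card {j \<in> {..<n}. key i < key j} < k}"
  shows "card Q = k" "i \<in> {..<n} - Q \<Longrightarrow> j \<in> Q \<Longrightarrow> key i < key j"
proof -
  define r where "r i = card {j \<in> {..<n}. key i < key j}" for i
  have mono: "r j < r i" if "key i < key j" "j < n" for i j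
    unfolding r_def using that by (intro psubset_card_mono) auto
  have rn: "r i < n" if "i < n" for i
  proof -
    have "{j \<in> {..<n}. key i < key j} \<subset> {..<n}" using that by auto
    then have "r i < card {..<n}" unfolding r_def by (intro psubset_card_mono) auto
    then show ?thesis by simp
  qed
  have rinj: "inj_on r {..<n}"
  proof (rule inj_onI)
    fix i j assume ij: "i \<in> {..<n}" "j \<in> {..<n}" "r i = r j"
    then have "key i = key j" using mono[of i j] mono[of j i] by (metis less_irrefl lessThan_iff linorder_neqE)
    then show "i = j" using inj ij by (auto dest: inj_onD)
  qed
  have "r ` {..<n} \<subseteq> {..<n}" using rn by auto
  then have img: "r ` {..<n} = {..<n}" using card_image[OF rinj] by (intro card_subset_eq) auto
  have Q: "Q = {i \<in> {..<n}. r i < k}" by (simp add: Q_def r_def)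
  have "r ` Q = {..<k}"
  proof
    show "{..<k} \<subseteq> r ` Q"
    proof
      fix t assume t: "t \<in> {..<k}"
      then have "t \<in> r ` {..<n}" unfolding img using k by auto
      then show "t \<in> r ` Q" using t unfolding Q by auto
    qed
  qed (auto simp: Q)
  moreover have "inj_on r Q" using rinj by (rule inj_on_subset) (auto simp: Q)
  ultimately show "card Q = k" by (metis card_image card_lessThan)
  assume "i \<in> {..<n} - Q" "j \<in> Q"
  then have ij: "i < n" "j < n" "r j < r i" by (auto simp: Q)
  show "key i < key j"
  proof (rule ccontr)
    assume "\<not> key i < key j"
    then have "r i \<le> r j" unfolding r_def by (intro card_mono) auto
    then show False using ij by simp
  qed
qed

lemma planted_recovery:
  assumes pl: "planted_graph n k d \<delta> d' lam S om w0 (real_weights q)" and nu: "nu' 8 n k d \<delta> d' lam < 1"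
  shows "\<exists>Q. dks_outputs alg n k q Q \<and> card Q = k \<and>
     rho (real_weights q) Q \<ge> (1 - nu' 8 n k d \<delta> d' lam) * (real k * d / 2) \<and>
     real (card (Q \<inter> S)) \<ge> (1 - nu' 8 n k d \<delta> d' lam / 6) * real k"
proof -
  interpret p: planted_graph n k d \<delta> d' lam S om w0 "real_weights q" by (rule pl)
  let ?w = "real_weights q"
  have "weighted_graph n ?w"
    unfolding weighted_graph_def
  proof (intro conjI allI impI)
    fix i assume i: "i < n"
    show "?w {i} = 0" using p.w_cases[OF i i] p.w0_loop[OF i] by simp
  qed (rule p.w_nonneg)
  then interpret b: big_graph_input n k q using p.k p.n by unfold_locales auto
  have k': "b.mi.k' = k" using p.k by (simp add: b.mi.k'_def)
  interpret s: solver_input n k b.mi.weight using b.mi.weight_input[OF b.scaled_sym] by (simp add: k')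
  have scaled: "real_of_int (b.mi.scaled (i * n + j)) = real_of_int b.mi.den_all * ?w {i, j}" if "i < n" "j < n" for i j
  proof -
    obtain u v where uv: "quotient_of (q {i, j}) = (u, v)" by (cases "quotient_of (q {i, j})")
    have v: "0 < v" using quotient_of_denom_pos[OF uv] .
    have "b.mi.den (i * n + j) dvd b.mi.den_all"
      unfolding b.mi.den_all_def using b.index_less[OF that] by (intro dvd_prodI) auto
    then have dv: "v dvd b.mi.den_all" using b.inp_num_den[OF that] uv by (simp add: b.mi.den_def)
    then have "real_of_int (b.mi.den_all div v) = real_of_int b.mi.den_all / real_of_int v" by (rule real_of_int_div)
    moreover have "?w {i, j} = real_of_int u / real_of_int v"
      unfolding real_weights_def quotient_of_div[OF uv] by (simp add: of_rat_divide)
    ultimately show ?thesis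
      using b.inp_num_den[OF that] uv by (simp add: b.mi.scaled_def b.mi.num_def b.mi.den_def)
  qed
  have D: "0 < real_of_int b.mi.den_all"
  proof -
    have "0 < b.mi.den_all" unfolding b.mi.den_all_def using b.mi.den_pos by (intro prod_pos) (auto simp: b.mi.den_def)
    then show ?thesis by simp
  qed
  have tot: "real_of_int (\<Sum>x<n * n. b.mi.scaled x) = real_of_int b.mi.den_all * p.wtotal"
  proof -
    have "(\<Sum>j<n. f (i * n + j)) = sum f {i * n..<i * n + n}" for i and f :: "nat \<Rightarrow> real"
      using sum.shift_bounds_nat_ivl[of f 0 "i * n" n] by (simp add: lessThan_atLeast0 add.commute)
    then have "(\<Sum>i<n. \<Sum>j<n. f (i * n + j)) = (\<Sum>x<n * n. f x)" for f :: "nat \<Rightarrow> real"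
      using sum.nat_group[of f n n] by simp
    from this[of "\<lambda>x. real_of_int (b.mi.scaled x)"] scaled
    have "(\<Sum>x<n * n. real_of_int (b.mi.scaled x)) = (\<Sum>i<n. \<Sum>j<n. real_of_int b.mi.den_all * ?w {i, j})" by simp
    then show ?thesis by (simp add: p.wtotal_def sum_distrib_left)
  qed
  \<comment> \<open>The product of the denominators cancels between entry and total, so the integers
    on the machine are exactly the floors used in the analysis.\<close>
  have wt: "real_of_int (b.mi.weight i j) = real_of_int \<lfloor>real n ^ 16 * ?w {i, j} / p.wtotal\<rfloor>" if "i < n" "j < n" for i j
  proof -
    have "b.mi.weight i j = \<lfloor>real_of_int (int n ^ 16 * b.mi.scaled (i * n + j)) / real_of_int (\<Sum>x<n * n. b.mi.scaled x)\<rfloor>"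
      unfolding b.mi.weight_def by (rule floor_divide_of_int_eq[symmetric])
    also have "real_of_int (int n ^ 16 * b.mi.scaled (i * n + j)) / real_of_int (\<Sum>x<n * n. b.mi.scaled x) =
       real n ^ 16 * ?w {i, j} / p.wtotal"
      unfolding tot using D scaled[OF that] by simp
    finally show ?thesis by simp
  qed
  interpret r: recovery n k d \<delta> d' lam S om w0 ?w s.x
  proof
    show "sym_on {..<n} s.x" by (rule s.x_sym)
    show "- (1 / real n ^ 12) \<le> s.x i j" "s.x i j \<le> s.x i i + 1 / real n ^ 12" if "i < n" "j < n" for i j
      using s.x_violations[OF that] by auto
    show "(\<Sum>l<n. s.x i l) \<le> k * s.x i i + 1 / real n ^ 12" "k * s.x i i \<le> (\<Sum>l<n. s.x l l) + 1 / real n ^ 12" if "i < n" for i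
      using s.x_violations[OF that that] by auto
    show "(\<Sum>i<n. s.x i i) \<le> k" "k - 1 / real n ^ 12 \<le> (\<Sum>i<n. s.x i i)" by (rule s.x_trace s.x_trace_ge)+
    have "(\<Sum>i\<in>S. \<Sum>j\<in>S. real_of_int (b.mi.weight i j)) - 7 \<le> dot n (\<lambda>i j. real_of_int (b.mi.weight i j)) s.x"
      by (rule s.x_objective[OF p.S])
    moreover have "(\<Sum>i\<in>S. \<Sum>j\<in>S. real_of_int (b.mi.weight i j)) =
        (\<Sum>i\<in>S. \<Sum>j\<in>S. real_of_int \<lfloor>real n ^ 16 * ?w {i, j} / p.wtotal\<rfloor>)"
      by (intro sum.cong refl wt p.in_S)
    moreover have "dot n (\<lambda>i j. real_of_int (b.mi.weight i j)) s.x =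
        (\<Sum>i<n. \<Sum>j<n. real_of_int \<lfloor>real n ^ 16 * ?w {i, j} / p.wtotal\<rfloor> * s.x i j)"
      unfolding dot_def by (intro sum.cong refl) (simp add: wt)
    ultimately show "(\<Sum>i\<in>S. \<Sum>j\<in>S. real_of_int \<lfloor>real n ^ 16 * ?w {i, j} / p.wtotal\<rfloor>) - 7
        \<le> (\<Sum>i<n. \<Sum>j<n. real_of_int \<lfloor>real n ^ 16 * ?w {i, j} / p.wtotal\<rfloor> * s.x i j)" by simp
    show "- (k / real n ^ 60 * (\<Sum>i\<in>p.U. \<Sum>j\<in>p.U. \<bar>Q i j\<bar>)) \<le> (\<Sum>i\<in>p.U. \<Sum>j\<in>p.U. Q i j * s.x i j)"
      if "\<And>v. 0 \<le> (\<Sum>i\<in>p.U. \<Sum>j\<in>p.U. v i * Q i j * v j)" for Q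
      by (rule s.x_psd[OF _ that]) (auto simp: p.U_def)
  qed
  obtain t st where st: "exec alg b.inp t st" "\<forall>i<n. st i = of_bool (card {j \<in> {..<n}. b.key i < b.key j} < k)"
    using b.exec_alg unfolding k' by blast
  define Q where "Q = {i \<in> {..<n}. card {j \<in> {..<n}. b.key i < b.key j} < k}"
  have "Q = {i. i < n \<and> st i \<noteq> 0}" using st(2) by (auto simp: Q_def)
  then have out: "dks_outputs alg n k q Q" unfolding dks_outputs_def b.inp_def[symmetric] using st(1) by blast
  let ?z = "\<lambda>i. sol n k b.mi.weight (n ^ 48) i i"
  have key: "b.key i = ?z i * int n - int i" for i by (simp add: b.key_def k')
  have key_le: "?z i \<le> ?z j" if "b.key i \<le> b.key j" "i < n" "j < n" for i j
  proof (rule ccontr)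
    assume "\<not> ?z i \<le> ?z j"
    then have "(?z j + 1) * int n \<le> ?z i * int n" by (intro mult_right_mono) auto
    then show False using that unfolding key by (simp add: distrib_right)
  qed
  have inj: "inj_on b.key {..<n}"
  proof (rule inj_onI)
    fix i j assume ij: "i \<in> {..<n}" "j \<in> {..<n}" "b.key i = b.key j"
    then have "?z i = ?z j" using key_le[of i j] key_le[of j i] by auto
    then show "i = j" using ij(3) by (simp add: key)
  qed
  have kn: "k \<le> n" using p.k by simp
  have cQ: "card Q = k" using top_ranked(1)[OF inj kn] by (simp add: Q_def)
  have Qn: "Q \<subseteq> {..<n}" by (auto simp: Q_def)
  have top: "s.x i i \<le> s.x j j" if "i \<in> {..<n} - Q" "j \<in> Q" for i j
  proof -
    have "b.key i < b.key j" using top_ranked(2)[OF inj kn, of i j] that by (simp add: Q_def)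
    then have "?z i \<le> ?z j" using key_le[of i j] that Qn by auto
    then show ?thesis unfolding s.x_def using s.scale_pos by (intro mult_right_mono) auto
  qed
  have "real (card (S - Q)) \<le> nu' 8 n k d \<delta> d' lam / 6 * k" by (rule r.overlap[OF Qn cQ top nu])
  then show ?thesis using p.density_of_overlap[OF Qn cQ] out cQ by blast
qed

theorem theorem3p1:
  shows "\<exists>\<kappa>::real. \<exists>\<xi>::real. \<exists>alg :: com. \<exists>err :: nat \<Rightarrow> real.
    0 < \<kappa> \<and> 0 < \<xi> \<and> dks_poly_time alg \<and> err \<longlonglongrightarrow> 0 \<and>
    (\<forall>(n::nat) (k::nat) (d::real) (\<delta>::real) (d'::real) (lam::real) (S::nat set)
       (G :: (nat \<times> nat \<Rightarrow> bool) \<Rightarrow> (nat set \<Rightarrow> rat)).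
      0 < k \<longrightarrow> k < n \<longrightarrow> 0 < d \<longrightarrow> 0 < \<delta> \<longrightarrow> \<delta> < 1 \<longrightarrow>
      S \<subseteq> {..<n} \<longrightarrow> card S = k \<longrightarrow>
      (\<forall>\<omega> \<in> set_pmf (cross_edges_pmf n k d \<delta> S).
         dks_exp_reg_instance n d d' lam S \<omega> (real_weights (G \<omega>))) \<longrightarrow>
      0 < spectral_gap n k d \<delta> d' lam \<longrightarrow>
      nu' \<xi> n k d \<delta> d' lam \<in> {0<..<1} \<longrightarrow>
      \<delta> * d / real k \<in> {\<kappa> * (ln (real n) / real n)..<1} \<longrightarrow>
      measure_pmf.prob (cross_edges_pmf n k d \<delta> S)
        {\<omega>. \<exists>Q. dks_outputs alg n k (G \<omega>) Q \<and> card Q = k \<and>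
             rho (real_weights (G \<omega>)) Q \<ge> (1 - nu' \<xi> n k d \<delta> d' lam) * (real k * d / 2) \<and>
             real (card (Q \<inter> S)) \<ge> (1 - nu' \<xi> n k d \<delta> d' lam / 6) * real k}
        \<ge> 1 - err n)"
proof -
  define err where "err n = (if n < 100 then 1 else 4 / real n + 1 / ln (real n))" for n :: nat
  have "(\<lambda>n. 4 / real n + 1 / ln (real n)) \<longlonglongrightarrow> 0" by real_asymp
  moreover have "eventually (\<lambda>n. 4 / real n + 1 / ln (real n) = err n) sequentially"
    using eventually_ge_at_top[of 100] by eventually_elim (simp add: err_def)
  ultimately have lim: "err \<longlonglongrightarrow> 0" by (rule Lim_transform_eventually)
  show ?thesis
  \<comment> \<open>\<open>\<xi> = 8\<close> turns \<open>4 * \<xi>\<^sup>2\<close> into 256, four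
    times the 64 of the noise bound. \<open>\<kappa> = 1\<close> gives
    \<open>ln n \<le> n * p\<close>, hence a vanishing failure probability and, for
    \<open>n \<ge> 100\<close>, \<open>1 / n \<le> p\<close>.\<close>
  proof (rule exI[of _ 1], rule exI[of _ 8], rule exI[of _ alg], rule exI[of _ err], intro conjI allI impI)
    fix n k :: nat and d \<delta> d' lam :: real and S :: "nat set" and G :: "(nat \<times> nat \<Rightarrow> bool) \<Rightarrow> (nat set \<Rightarrow> rat)"
    assume k: "0 < k" "k < n" and d: "0 < d" and \<delta>: "0 < \<delta>" "\<delta> < 1" and S: "S \<subseteq> {..<n}" "card S = k"
      and inst: "\<forall>\<omega> \<in> set_pmf (cross_edges_pmf n k d \<delta> S). dks_exp_reg_instance n d d' lam S \<omega> (real_weights (G \<omega>))"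
      and gap: "0 < spectral_gap n k d \<delta> d' lam" and nu: "nu' 8 n k d \<delta> d' lam \<in> {0<..<1}"
      and dens: "\<delta> * d / real k \<in> {1 * (ln (real n) / real n)..<1}"
    let ?P = "cross_edges_pmf n k d \<delta> S" let ?p = "\<delta> * d / real k"
    let ?U = "{..<n} - S"
    let ?good = "{\<omega>. \<exists>Q. dks_outputs alg n k (G \<omega>) Q \<and> card Q = k \<and>
             rho (real_weights (G \<omega>)) Q \<ge> (1 - nu' 8 n k d \<delta> d' lam) * (real k * d / 2) \<and>
             real (card (Q \<inter> S)) \<ge> (1 - nu' 8 n k d \<delta> d' lam / 6) * real k}"
    show "1 - err n \<le> measure_pmf.prob ?P ?good"
    proof (cases "n < 100")
      case True
      then show ?thesis by (simp add: err_def)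
    next
      case False
      let ?bad = "{\<omega>. sq_dev ?p ?U (S \<times> ?U) \<omega> > 2 * n * ?p * k}"
      have P: "?P = coins ?p (S \<times> ?U)" by (simp add: cross_edges_pmf_def coins_def)
      have p: "0 < ?p" "?p < 1" using \<delta> d k dens by auto
      have ln1: "1 \<le> ln (real n)"
      proof -
        have "exp 1 \<le> (3::real)" by (rule exp_le)
        also have "\<dots> \<le> real n" using False by simp
        finally show ?thesis using False by (subst ln_ge_iff) auto
      qed
      have lnp: "ln (real n) \<le> n * ?p" using dens k by (simp add: field_simps)
      have "1 / (n * ?p * k) \<le> 1 / ln (real n)"
      proof (rule divide_left_mono)
        have "n * ?p * 1 \<le> n * ?p * k" using \<delta> d k by (intro mult_left_mono) auto
        then show "ln (real n) \<le> n * ?p * k" using lnp by linarith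
      qed (use ln1 \<delta> d k in auto)
      then have bad: "measure_pmf.prob ?P ?bad \<le> err n"
        unfolding P using sq_dev_concentration[OF S k p] False by (simp add: err_def)
      \<comment> \<open>\<open>G\<close> is known to be an instance only for outcomes in the
        support, so the inclusion is restricted to it; this does not change the probability.\<close>
      have "set_pmf ?P - ?bad \<subseteq> ?good"
      proof
        fix om assume om: "om \<in> set_pmf ?P - ?bad"
        then obtain w0 where w0: "completion n d d' lam S om w0" "monotone_deletion n S w0 (real_weights (G om))"
          using inst by (auto simp: dks_exp_reg_instance_def)
        have "planted_graph n k d \<delta> d' lam S om w0 (real_weights (G om))"
        proof
          have "1 / real n \<le> ln (real n) / real n" using ln1 by (intro divide_right_mono) auto
          then show "1 / real n \<le> \<delta> * d / real k" using dens by simp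
        qed (use False k d \<delta> S w0 gap om in auto)
        from planted_recovery[OF this] nu show "om \<in> ?good" by simp
      qed
      then have sub: "set_pmf ?P \<inter> - ?bad \<subseteq> ?good" by auto
      have "1 - err n \<le> 1 - measure_pmf.prob ?P ?bad" using bad by simp
      also have "\<dots> = measure_pmf.prob ?P (- ?bad)"
        using measure_pmf.prob_compl[of ?bad ?P] by (simp add: Compl_eq_Diff_UNIV)
      also have "\<dots> = measure_pmf.prob ?P (set_pmf ?P \<inter> - ?bad)"
        using measure_Int_set_pmf[of ?P "- ?bad"] by (simp add: Int_commute)
      also have "\<dots> \<le> measure_pmf.prob ?P ?good"
        using sub by (intro measure_pmf.finite_measure_mono) auto
      finally show ?thesis .
    qed
  qed (use poly_time_alg lim in auto)
qed

end
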